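(* Fix a natural number $g$. The moduli space of pure tropical curves $M_g^{tr,p}$ (resp. the moduli space of tropical curves $M_g^{tr}$) is the stratified quotient, hence global quotient, of the pure tropical Teichmüller space $\mathcal T_g^{tr,p}$ (resp. of the tropical Teichmüller space $\mathcal T_g^{tr}$) modulo the action of $\operatorname{Out}(F_g)$.
   Context: Graphs are finite and connected, loops and multiple edges allowed; $g(\Gamma)=|E(\Gamma)|-|V(\Gamma)|+1$; a loop counts twice in the valence. A weighted graph $(\Gamma,w)$ has $w:V(\Gamma)\to\mathbb Z_{\ge0}$; $|w|=\sum_vw(v)$; its genus is $g(\Gamma)+|w|$; it is stable if every vertex of weight $0$ has valence $\ge3$. A tropical curve of genus $g$ is $(\Gamma,w,l)$ with $(\Gamma,w)$ stable of genus $g$ and $l:E(\Gamma)\to\mathbb R_{>0}$; it is pure if $w=0$. $\Gamma^w$ is obtained from $\Gamma$ by attaching $w(v)$ "virtual" loops at each vertex $v$. $R_g$ is the rose with one vertex $v$ and $g$ loops $\gamma_1,\dots,\gamma_g$, and $\pi_1(R_g,v)=F_g$ is the free group of rank $g$. A marking of $(\Gamma,w)$ is a homotopy equivalence $h:R_g\to\Gamma^w$. Two markings $h,h'$ of $(\Gamma,w)$ are equivalent if, after homotoping $h$ and $h'$: (a) $h(v)=h'(v)$ is a point of $\Gamma$ which is not a vertex; (b) $h$ and $h'$ are immersions on the interior of each $\gamma_i$; (c) for each $i=1,\dots,g$, the directed loop $h'(\gamma_i)$ is obtained, up to homotopy fixing the basepoint, from the directed loop $h(\gamma_i)$ by repeatedly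 replacing sequences of virtual loops at a vertex with other sequences of virtual loops at that vertex (the sequences may be empty, i.e. virtual loops at a vertex may be added or removed). Marked weighted graphs $(\Gamma,w,h),(\Gamma',w',h')$ are equivalent if there is an isomorphism $\gamma:\Gamma^w\to\Gamma'^{w'}$ of 1-complexes taking virtual loops to virtual loops with $\gamma\circ h$ equivalent to $h'$; for marked tropical curves one also requires $\gamma$ to respect the lengths of the edges of $\Gamma$. In the pure case $w=0$ this means: an isomorphism (resp. isometry) $\gamma:\Gamma\to\Gamma'$ with $\gamma\circ h$ homotopic to $h'$. Specialization: $(\Gamma,w)\rightsquigarrow(\Gamma',w')$ if $\Gamma'$ arises by contracting a set $S$ of edges, where contracting a loop at a vertex increases the weight of that vertex by $1$ and contracting an edge between distinct $v_1,v_2$ gives a vertex of weight $w(v_1)+w(v_2)$. A marking $h$ of $(\Gamma,w)$ induces a marking $h'$ of $(\Gamma',w')$, well defined up to equivalence, by contracting a spanning forest of $S$ (the remaining edges of $S$ becoming virtual loops); then $(\Gamma,w,h)\rightsquigarrow(\Gamma',w',h')$. The inclusion $E(\Gamma')\hookrightarrow E(\Gamma)$ induces $L_\iota:\mathbb R_{\ge0}^{E(\Gamma')}\hookrightarrow\mathbb R_{\ge0}^{E(\Gamma)}$. $\mathcal T_g^{tr}$ is the stacky fan obtained as the quotient of $\coprod\mathbb R_{\ge0}^{E(\Gamma)}$ (lattice $\mathbb Z^{E(\Gamma)}$), over equivalence classes of stable marked weighted graphs $(\Gamma,w,h)$ of genus $g$, by the relation generated by the $L_\iota$ of all specializations of marked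 weighted graphs. $\mathcal T_g^{tr,p}$ is the ideal stacky fan defined in the same way using only $w=0$, the ideal cones $\{l\in\mathbb R_{\ge0}^{E(\Gamma)}:l^{-1}(0)\text{ contains no cycle}\}$, and specializations contracting acyclic subgraphs. Their points are the equivalence classes of marked (pure) tropical curves of genus $g$. $M_g^{tr}$ is the stacky fan obtained as the quotient of $\coprod\mathbb R_{\ge0}^{E(\Gamma)}$, over stable weighted graphs $(\Gamma,w)$ of genus $g$, by the relation generated by the $L_\iota$ of all specializations of weighted graphs and the coordinate permutations induced by the elements of $\operatorname{Aut}(\Gamma,w)$. $M_g^{tr,p}$ is the ideal stacky fan defined in the same way with $w=0$, the ideal cones $\{l\in\mathbb R_{\ge0}^{E(\Gamma)}:l^{-1}(0)\text{ contains no cycle}\}$, and specializations for which the weight function remains zero. The class of $\alpha\in\operatorname{Aut}(F_g)$ in $\operatorname{Out}(F_g)$ acts by $(\Gamma,w,l,h)\cdot\alpha=(\Gamma,w,l,h\circ\alpha_R)$, where $\alpha_R:R_g\to R_g$ is the homotopy equivalence, unique up to homotopy, fixing the vertex and inducing $\alpha$ on $\pi_1$. This action is admissible: for each $\alpha$ and each cone $\sigma_i$ there are a cone $\sigma_i\cdot\alpha$ and a lattice-preserving linear isomorphism $\sigma_i\to\sigma_i\cdot\alpha$ compatible with the action of $\alpha$ on the space. Stratified quotient: for an ideal stacky fan $X=(\coprod\sigma_i)/\!\sim$ glued along a collection of inclusions of faces $L_\beta$ with an admissible action of $G$, choose one cone in each $G$-orbit of cones; $X/\!/G$ is the quotient of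 the disjoint union of the chosen cones by all identifications given by composites $\sigma_i\to\sigma_i\cdot\gamma\xrightarrow{L_\beta}\sigma_j$ of the isomorphism induced by $\gamma\in G$ and an inclusion of faces. The global quotient is the orbit space $X/G$ with the quotient topology. The identification with the stratified quotient is as ideal stacky fans, where a morphism of ideal stacky fans is a continuous map which on each cone is given by an integral linear map to some cone of the target. *)

theory Defs
  imports
    "HOL-Analysis.Analysis"
    "HOL-Algebra.Coset"
    "HOL-Algebra.Bij"
    "Graph_Theory.Digraph_Component"
begin

section \<open>Homotopy\<close>

definition homotopy_equivalence :: "'a topology \<Rightarrow> 'b topology \<Rightarrow> ('a \<Rightarrow> 'b) \<Rightarrow> bool" where
  "homotopy_equivalence X Y f \<longleftrightarrow>
     continuous_map X Y f \<and>
     (\<exists>k. continuous_map Y X k \<and>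
          homotopic_with (\<lambda>_. True) X X (k \<circ> f) id \<and>
          homotopic_with (\<lambda>_. True) Y Y (f \<circ> k) id)"

text \<open>Paths in an abstract topology are functions on the reals of which only the restriction
  to the unit interval matters (\<^const>\<open>pathin\<close>).\<close>

definition path_homotopic :: "'a topology \<Rightarrow> (real \<Rightarrow> 'a) \<Rightarrow> (real \<Rightarrow> 'a) \<Rightarrow> bool" where
  "path_homotopic X p q \<longleftrightarrow>
     homotopic_with (\<lambda>r. r 0 = p 0 \<and> r 1 = p 1) (top_of_set {0..1}) X p q"

definition path_join :: "(real \<Rightarrow> 'a) \<Rightarrow> (real \<Rightarrow> 'a) \<Rightarrow> real \<Rightarrow> 'a" where
  "path_join p q t = (if t \<le> 1/2 then p (2 * t) else q (2 * t - 1))"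

definition path_reverse :: "(real \<Rightarrow> 'a) \<Rightarrow> real \<Rightarrow> 'a" where
  "path_reverse p t = p (1 - t)"

definition path_class :: "'a topology \<Rightarrow> (real \<Rightarrow> 'a) \<Rightarrow> (real \<Rightarrow> 'a) set" where
  "path_class X p = {q. path_homotopic X p q}"

definition loops_at :: "'a topology \<Rightarrow> 'a \<Rightarrow> (real \<Rightarrow> 'a) set" where
  "loops_at X x = {p. pathin X p \<and> p 0 = x \<and> p 1 = x}"

definition fundamental_group :: "'a topology \<Rightarrow> 'a \<Rightarrow> (real \<Rightarrow> 'a) set monoid" where
  "fundamental_group X x =
     \<lparr>carrier = path_class X ` loops_at X x,
      monoid.mult = (\<lambda>A B. \<Union>p\<in>A. \<Union>q\<in>B. path_class X (path_join p q)),
      one = path_class X (\<lambda>_. x)\<rparr>"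

definition Inn :: "('a, 'b) monoid_scheme \<Rightarrow> ('a \<Rightarrow> 'a) set" where
  "Inn G = (\<lambda>a. \<lambda>x\<in>carrier G. a \<otimes>\<^bsub>G\<^esub> x \<otimes>\<^bsub>G\<^esub> inv\<^bsub>G\<^esub> a) ` carrier G"

definition Out :: "('a, 'b) monoid_scheme \<Rightarrow> ('a \<Rightarrow> 'a) set monoid" where
  "Out G = AutoGroup G Mod Inn G"


section \<open>Graphs as 1-complexes\<close>

text \<open>An undirected multigraph is a \<^typ>\<open>('v, 'e) pre_digraph\<close> in which the orientation
  of an edge only serves to parametrise it by the unit interval. A loop
  is counted once by \<^const>\<open>in_degree\<close> and once by \<^const>\<open>out_degree\<close>.\<close>

definition valence :: "('v, 'e) pre_digraph \<Rightarrow> 'v \<Rightarrow> nat" where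
  "valence G v = in_degree G v + out_degree G v"

definition graph_genus :: "('v, 'e) pre_digraph \<Rightarrow> int" where
  "graph_genus G = int (card (arcs G)) - int (card (verts G)) + 1"

text \<open>A dart is an edge with a direction of traversal. Loops and pairs of parallel edges
  are cycles.\<close>

definition dart_start :: "('v, 'e) pre_digraph \<Rightarrow> 'e \<times> bool \<Rightarrow> 'v" where
  "dart_start G d = (if snd d then tail G (fst d) else head G (fst d))"

definition dart_end :: "('v, 'e) pre_digraph \<Rightarrow> 'e \<times> bool \<Rightarrow> 'v" where
  "dart_end G d = (if snd d then head G (fst d) else tail G (fst d))"

definition contains_cycle :: "('v, 'e) pre_digraph \<Rightarrow> 'e set \<Rightarrow> bool" where
  "contains_cycle G F \<longleftrightarrow>
     (\<exists>ds. ds \<noteq> [] \<and> fst ` set ds \<subseteq> F \<and> distinct (map fst ds) \<and> distinct (map (dart_start G) ds) \<and>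
        (\<forall>i<length ds. dart_end G (ds ! i) = dart_start G (ds ! (Suc i mod length ds))))"

definition graph_iso ::
  "('v, 'e) pre_digraph \<Rightarrow> ('v2, 'e2) pre_digraph \<Rightarrow> ('v \<Rightarrow> 'v2) \<Rightarrow> ('e \<Rightarrow> 'e2) \<Rightarrow> bool" where
  "graph_iso G G' fV fE \<longleftrightarrow>
     bij_betw fV (verts G) (verts G') \<and> bij_betw fE (arcs G) (arcs G') \<and>
     (\<forall>e\<in>arcs G. {tail G' (fE e), head G' (fE e)} = fV ` {tail G e, head G e})"

text \<open>\<^term>\<open>Inner e t\<close> for \<^term>\<open>0 < t\<close> and \<^term>\<open>t < (1::real)\<close> is an interior point of the edge \<^term>\<open>e\<close>.\<close>

datatype ('v, 'e) gpoint = Vertex 'v | Inner 'e real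

definition edge_path :: "('v, 'e) pre_digraph \<Rightarrow> 'e \<Rightarrow> real \<Rightarrow> ('v, 'e) gpoint" where
  "edge_path G e t =
     (if t \<le> 0 then Vertex (tail G e) else if t \<ge> 1 then Vertex (head G e) else Inner e t)"

definition open_edge :: "'e \<Rightarrow> ('v, 'e) gpoint set" where
  "open_edge e = Inner e ` {0<..<1}"

definition gpoints :: "('v, 'e) pre_digraph \<Rightarrow> ('v, 'e) gpoint set" where
  "gpoints G = Vertex ` verts G \<union> (\<Union>e\<in>arcs G. open_edge e)"

text \<open>The quotient topology obtained by gluing one unit interval per edge to the
  discrete set of vertices.\<close>

definition realization :: "('v, 'e) pre_digraph \<Rightarrow> ('v, 'e) gpoint topology" where
  "realization G = topology (\<lambda>U. U \<subseteq> gpoints G \<and>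
     (\<forall>e\<in>arcs G. openin (top_of_set {0..1}) {t\<in>{0..1}. edge_path G e t \<in> U}))"

lemma openin_realization:
  "openin (realization G) U \<longleftrightarrow> U \<subseteq> gpoints G \<and>
     (\<forall>e\<in>arcs G. openin (top_of_set {0..1}) {t\<in>{0..1}. edge_path G e t \<in> U})"
proof -
  have 1: "{t\<in>{0..1::real}. edge_path G e t \<in> S \<inter> T} =
      {t\<in>{0..1}. edge_path G e t \<in> S} \<inter> {t\<in>{0..1}. edge_path G e t \<in> T}" for e S T
    by auto
  have 2: "{t\<in>{0..1::real}. edge_path G e t \<in> \<Union>K} =
      \<Union>((\<lambda>S. {t\<in>{0..1}. edge_path G e t \<in> S}) ` K)" for e K
    by auto
  have "istopology (\<lambda>U. U \<subseteq> gpoints G \<and>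
     (\<forall>e\<in>arcs G. openin (top_of_set {0..1}) {t\<in>{0..1}. edge_path G e t \<in> U}))"
    unfolding istopology_def 1 2 by (blast intro: openin_Int openin_Union)
  then show ?thesis
    by (simp add: realization_def)
qed

text \<open>Isomorphisms of 1-complexes: homeomorphisms of the realizations which map vertices to
  vertices and open edges to open edges.\<close>

definition complex_iso ::
  "('v, 'e) pre_digraph \<Rightarrow> ('v2, 'e2) pre_digraph \<Rightarrow> ('v \<Rightarrow> 'v2) \<Rightarrow> ('e \<Rightarrow> 'e2) \<Rightarrow>
   (('v, 'e) gpoint \<Rightarrow> ('v2, 'e2) gpoint) \<Rightarrow> bool" where
  "complex_iso G G' fV fE \<gamma> \<longleftrightarrow>
     graph_iso G G' fV fE \<and>
     homeomorphic_map (realization G) (realization G') \<gamma> \<and>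
     (\<forall>v\<in>verts G. \<gamma> (Vertex v) = Vertex (fV v)) \<and>
     (\<forall>e\<in>arcs G. \<gamma> ` open_edge e = open_edge (fE e))"


section \<open>Weighted graphs\<close>

text \<open>Every finite graph is isomorphic to one with vertices and edges in \<^typ>\<open>nat\<close>.\<close>

type_synonym wgraph = "(nat, nat) pre_digraph \<times> (nat \<Rightarrow> nat)"

definition stable_wgraphs :: "nat \<Rightarrow> wgraph set" where
  "stable_wgraphs g = {(G, w). fin_digraph G \<and> Digraph_Component.connected G \<and>
     graph_genus G + int (\<Sum>v\<in>verts G. w v) = int g \<and>
     (\<forall>v\<in>verts G. w v = 0 \<longrightarrow> valence G v \<ge> 3)}"

definition pure_wgraph :: "wgraph \<Rightarrow> bool" where
  "pure_wgraph Y \<longleftrightarrow> (\<forall>v\<in>verts (fst Y). snd Y v = 0)"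

definition wgraph_iso :: "wgraph \<Rightarrow> wgraph \<Rightarrow> (nat \<Rightarrow> nat) \<Rightarrow> (nat \<Rightarrow> nat) \<Rightarrow> bool" where
  "wgraph_iso Y Y' fV fE \<longleftrightarrow>
     graph_iso (fst Y) (fst Y') fV fE \<and> (\<forall>v\<in>verts (fst Y). snd Y' (fV v) = snd Y v)"

text \<open>The graph obtained by attaching the virtual loops \<^term>\<open>Inr (v, i)\<close> with
  \<^term>\<open>i < w v\<close> to the vertex \<^term>\<open>v\<close>; the original edges are the \<^term>\<open>Inl e\<close>.\<close>

definition with_virtual_loops :: "wgraph \<Rightarrow> (nat, nat + nat \<times> nat) pre_digraph" where
  "with_virtual_loops Y =
     \<lparr>verts = verts (fst Y),
      arcs = Inl ` arcs (fst Y) \<union> Inr ` {(v, i). v \<in> verts (fst Y) \<and> i < snd Y v},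
      tail = case_sum (tail (fst Y)) fst,
      head = case_sum (head (fst Y)) fst\<rparr>"

abbreviation vrealization :: "wgraph \<Rightarrow> (nat, nat + nat \<times> nat) gpoint topology" where
  "vrealization Y \<equiv> realization (with_virtual_loops Y)"

text \<open>Contraction of an edge. The names of the remaining edges are kept; an edge that is not
  a loop is contracted to its tail.\<close>

definition contract_edge :: "nat \<Rightarrow> wgraph \<Rightarrow> wgraph" where
  "contract_edge e Y = (let G = fst Y; w = snd Y; a = tail G e; b = head G e in
     if a = b then (G\<lparr>arcs := arcs G - {e}\<rparr>, w(a := w a + 1))
     else (\<lparr>verts = verts G - {b}, arcs = arcs G - {e},
            tail = (id(b := a)) \<circ> tail G, head = (id(b := a)) \<circ> head G\<rparr>,
           w(a := w a + w b)))"

text \<open>The induced map from the graph with virtual loops attached. A contracted loop becomes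
  the new virtual loop at its vertex; otherwise the edge is collapsed to a point, and the
  virtual loops at the two ends are put together.\<close>

fun contract_map ::
  "nat \<Rightarrow> wgraph \<Rightarrow> (nat, nat + nat \<times> nat) gpoint \<Rightarrow> (nat, nat + nat \<times> nat) gpoint" where
  "contract_map e Y (Vertex v) =
     Vertex (if v = head (fst Y) e then tail (fst Y) e else v)"
| "contract_map e Y (Inner (Inl d) t) =
     (let a = tail (fst Y) e; b = head (fst Y) e in
      if d \<noteq> e then Inner (Inl d) t
      else if a = b then Inner (Inr (a, snd Y a)) t
      else Vertex a)"
| "contract_map e Y (Inner (Inr (v, i)) t) =
     (let a = tail (fst Y) e; b = head (fst Y) e in
      if a \<noteq> b \<and> v = b then Inner (Inr (a, snd Y a + i)) t
      else Inner (Inr (v, i)) t)"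


section \<open>Markings\<close>

definition rose :: "nat \<Rightarrow> (unit, nat) pre_digraph" where
  "rose g = \<lparr>verts = {()}, arcs = {..<g}, tail = (\<lambda>_. ()), head = (\<lambda>_. ())\<rparr>"

text \<open>The free group of rank \<^term>\<open>g\<close> is taken to be the fundamental group of the rose at
  its vertex.\<close>

definition Fg :: "nat \<Rightarrow> (real \<Rightarrow> (unit, nat) gpoint) set monoid" where
  "Fg g = fundamental_group (realization (rose g)) (Vertex ())"

type_synonym marking = "(unit, nat) gpoint \<Rightarrow> (nat, nat + nat \<times> nat) gpoint"
type_synonym marked = "wgraph \<times> marking"

definition is_marking :: "nat \<Rightarrow> wgraph \<Rightarrow> marking \<Rightarrow> bool" where
  "is_marking g Y h \<longleftrightarrow> homotopy_equivalence (realization (rose g)) (vrealization Y) h"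

inductive virtual_sequence ::
  "wgraph \<Rightarrow> nat \<Rightarrow> (real \<Rightarrow> (nat, nat + nat \<times> nat) gpoint) \<Rightarrow> bool"
  for Y :: wgraph and u :: nat where
  empty: "virtual_sequence Y u (\<lambda>_. Vertex u)"
| forward: "\<lbrakk>i < snd Y u; virtual_sequence Y u s\<rbrakk> \<Longrightarrow>
     virtual_sequence Y u (path_join (edge_path (with_virtual_loops Y) (Inr (u, i))) s)"
| backward: "\<lbrakk>i < snd Y u; virtual_sequence Y u s\<rbrakk> \<Longrightarrow>
     virtual_sequence Y u (path_join (path_reverse (edge_path (with_virtual_loops Y) (Inr (u, i)))) s)"

text \<open>Equivalence of paths generated by homotopy relative to the end points and by the
  replacement of sequences of virtual loops at a vertex.\<close>

inductive virtual_equiv ::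
  "wgraph \<Rightarrow> (real \<Rightarrow> (nat, nat + nat \<times> nat) gpoint) \<Rightarrow>
   (real \<Rightarrow> (nat, nat + nat \<times> nat) gpoint) \<Rightarrow> bool"
  for Y :: wgraph where
  homotopy: "path_homotopic (vrealization Y) p q \<Longrightarrow> virtual_equiv Y p q"
| replace: "\<lbrakk>u \<in> verts (fst Y); virtual_sequence Y u s; virtual_sequence Y u s';
     pathin (vrealization Y) a; a 1 = Vertex u; pathin (vrealization Y) b; b 0 = Vertex u\<rbrakk> \<Longrightarrow>
     virtual_equiv Y (path_join a (path_join s b)) (path_join a (path_join s' b))"
| trans: "\<lbrakk>virtual_equiv Y p q; virtual_equiv Y q r\<rbrakk> \<Longrightarrow> virtual_equiv Y p r"

text \<open>The common base point is an interior point of a non-virtual edge. If there is no such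
  edge, then the graph is a single vertex, which is the only point available.\<close>

definition base_points :: "wgraph \<Rightarrow> (nat, nat + nat \<times> nat) gpoint set" where
  "base_points Y = (if arcs (fst Y) = {} then Vertex ` verts (fst Y)
     else (\<Union>e\<in>arcs (fst Y). open_edge (Inl e)))"

text \<open>Immersions of the interior of a loop are the locally injective maps.\<close>

definition immersed_on_loops :: "nat \<Rightarrow> marking \<Rightarrow> bool" where
  "immersed_on_loops g k \<longleftrightarrow> (\<forall>i<g. \<forall>t\<in>{0<..<1::real}. \<exists>\<epsilon>>0.
     inj_on (\<lambda>s. k (Inner i s)) ({t - \<epsilon><..<t + \<epsilon>} \<inter> {0<..<1}))"

definition marking_equiv :: "nat \<Rightarrow> wgraph \<Rightarrow> marking \<Rightarrow> marking \<Rightarrow> bool" where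
  "marking_equiv g Y h h' \<longleftrightarrow> (\<exists>k k'.
     homotopic_with (\<lambda>_. True) (realization (rose g)) (vrealization Y) h k \<and>
     homotopic_with (\<lambda>_. True) (realization (rose g)) (vrealization Y) h' k' \<and>
     k (Vertex ()) = k' (Vertex ()) \<and> k (Vertex ()) \<in> base_points Y \<and>
     immersed_on_loops g k \<and> immersed_on_loops g k' \<and>
     (\<forall>i<g. virtual_equiv Y (k \<circ> edge_path (rose g) i) (k' \<circ> edge_path (rose g) i)))"

definition marked_graphs :: "nat \<Rightarrow> marked set" where
  "marked_graphs g = {(Y, h). Y \<in> stable_wgraphs g \<and> is_marking g Y h}"

text \<open>Here \<^term>\<open>fE\<close> is the bijection induced on the non-virtual edges.\<close>

definition marked_iso :: "nat \<Rightarrow> marked \<Rightarrow> marked \<Rightarrow> (nat \<Rightarrow> nat) \<Rightarrow> bool" where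
  "marked_iso g X X' fE \<longleftrightarrow> (\<exists>fV fA \<gamma>.
     complex_iso (with_virtual_loops (fst X)) (with_virtual_loops (fst X')) fV fA \<gamma> \<and>
     (\<forall>e\<in>arcs (fst (fst X)). fA (Inl e) = Inl (fE e)) \<and>
     (\<forall>l. Inr l \<in> arcs (with_virtual_loops (fst X)) \<longrightarrow> fA (Inr l) \<in> range Inr) \<and>
     marking_equiv g (fst X') (\<gamma> \<circ> snd X) (snd X'))"

definition marked_rel :: "nat \<Rightarrow> (marked \<times> marked) set" where
  "marked_rel g = {(X, X'). X \<in> marked_graphs g \<and> X' \<in> marked_graphs g \<and> (\<exists>fE. marked_iso g X X' fE)}"

definition wgraph_rel :: "nat \<Rightarrow> (wgraph \<times> wgraph) set" where
  "wgraph_rel g = {(Y, Y'). Y \<in> stable_wgraphs g \<and> Y' \<in> stable_wgraphs g \<and>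
     (\<exists>fV fE. wgraph_iso Y Y' fV fE)}"


section \<open>Specializations\<close>

text \<open>The inclusion \<^term>\<open>\<iota>\<close> of the edges of the specialization into those of the original
  graph. Contracting no edge is allowed, so isomorphisms are specializations.\<close>

definition wgraph_specializes :: "wgraph \<Rightarrow> wgraph \<Rightarrow> (nat \<Rightarrow> nat) \<Rightarrow> bool" where
  "wgraph_specializes Y Y' \<iota> \<longleftrightarrow> (\<exists>es fV. distinct es \<and> set es \<subseteq> arcs (fst Y) \<and>
     wgraph_iso Y' (fold contract_edge es Y) fV \<iota>)"

definition contract_marked :: "nat \<Rightarrow> marked \<Rightarrow> marked" where
  "contract_marked e X = (contract_edge e (fst X), contract_map e (fst X) \<circ> snd X)"

text \<open>When the edges of a set are contracted one after the other, the edges which are not loops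
  at their turn form a spanning forest of that set, and the others become virtual loops.\<close>

definition marked_specializes_along ::
  "nat \<Rightarrow> nat set \<Rightarrow> marked \<Rightarrow> marked \<Rightarrow> (nat \<Rightarrow> nat) \<Rightarrow> bool" where
  "marked_specializes_along g S X X' \<iota> \<longleftrightarrow> S \<subseteq> arcs (fst (fst X)) \<and>
     (\<exists>es. distinct es \<and> set es = S \<and> marked_iso g X' (fold contract_marked es X) \<iota>)"

definition face_inclusion ::
  "nat set \<Rightarrow> nat set \<Rightarrow> (nat \<Rightarrow> nat) \<Rightarrow> (nat \<Rightarrow> real) \<Rightarrow> nat \<Rightarrow> real" where
  "face_inclusion A B \<iota> x = (\<lambda>b\<in>B. if b \<in> \<iota> ` A then x (inv_into A \<iota> b) else 0)"


section \<open>Ideal stacky fans\<close>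

text \<open>The cone of index \<^term>\<open>i\<close> is a subset of the space of functions
  \<^term>\<open>coords X i \<rightarrow>\<^sub>E (UNIV :: real set)\<close>, whose lattice consists of the integer-valued
  functions, and \<^term>\<open>face_maps X i j\<close> contains the maps from the cone \<^term>\<open>i\<close> to
  the cone \<^term>\<open>j\<close> which are used for the gluing.\<close>

record 'i stacky_fan =
  cells :: "'i set"
  coords :: "'i \<Rightarrow> nat set"
  cell_cone :: "'i \<Rightarrow> (nat \<Rightarrow> real) set"
  face_maps :: "'i \<Rightarrow> 'i \<Rightarrow> ((nat \<Rightarrow> real) \<Rightarrow> nat \<Rightarrow> real) set"

definition cone_points :: "'i stacky_fan \<Rightarrow> ('i \<times> (nat \<Rightarrow> real)) set" where
  "cone_points X = Sigma (cells X) (cell_cone X)"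

definition glue_step :: "'i stacky_fan \<Rightarrow> ('i \<times> (nat \<Rightarrow> real)) rel" where
  "glue_step X = {((i, x), (j, y)). (i, x) \<in> cone_points X \<and> (j, y) \<in> cone_points X \<and>
     (\<exists>L\<in>face_maps X i j. y = L x)}"

definition glue :: "'i stacky_fan \<Rightarrow> ('i \<times> (nat \<Rightarrow> real)) rel" where
  "glue X = Restr ((glue_step X \<union> (glue_step X)\<inverse>)\<^sup>*) (cone_points X)"

definition quotient_space :: "'a topology \<Rightarrow> 'a rel \<Rightarrow> 'a set topology" where
  "quotient_space T r = topology (\<lambda>U. U \<subseteq> topspace T // r \<and>
     openin T {x \<in> topspace T. r `` {x} \<in> U})"

lemma openin_quotient_space:
  "openin (quotient_space T r) U \<longleftrightarrow>
     U \<subseteq> topspace T // r \<and> openin T {x \<in> topspace T. r `` {x} \<in> U}"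
proof -
  have 1: "{x \<in> topspace T. r `` {x} \<in> A \<inter> B} =
      {x \<in> topspace T. r `` {x} \<in> A} \<inter> {x \<in> topspace T. r `` {x} \<in> B}" for A B
    by auto
  have 2: "{x \<in> topspace T. r `` {x} \<in> \<Union>K} =
      \<Union>((\<lambda>A. {x \<in> topspace T. r `` {x} \<in> A}) ` K)" for K
    by auto
  have "istopology (\<lambda>U. U \<subseteq> topspace T // r \<and> openin T {x \<in> topspace T. r `` {x} \<in> U})"
    unfolding istopology_def 1 2 by (blast intro: openin_Int openin_Union)
  then show ?thesis
    by (simp add: quotient_space_def)
qed

definition fan_space :: "'i stacky_fan \<Rightarrow> ('i \<times> (nat \<Rightarrow> real)) set topology" where
  "fan_space X = quotient_space
     (sum_topology (\<lambda>i. subtopology (powertop_real (coords X i)) (cell_cone X i)) (cells X)) (glue X)"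

definition integral_linear ::
  "nat set \<Rightarrow> nat set \<Rightarrow> ((nat \<Rightarrow> real) \<Rightarrow> nat \<Rightarrow> real) \<Rightarrow> bool" where
  "integral_linear A B L \<longleftrightarrow> (\<exists>M :: nat \<Rightarrow> nat \<Rightarrow> int.
     \<forall>x \<in> A \<rightarrow>\<^sub>E UNIV. L x = (\<lambda>b\<in>B. \<Sum>a\<in>A. of_int (M b a) * x a))"

definition lattice_iso ::
  "nat set \<Rightarrow> nat set \<Rightarrow> ((nat \<Rightarrow> real) \<Rightarrow> nat \<Rightarrow> real) \<Rightarrow> bool" where
  "lattice_iso A B L \<longleftrightarrow> integral_linear A B L \<and> (\<exists>L'. integral_linear B A L' \<and>
     (\<forall>x \<in> A \<rightarrow>\<^sub>E UNIV. L' (L x) = x) \<and> (\<forall>y \<in> B \<rightarrow>\<^sub>E UNIV. L (L' y) = y))"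

definition fan_morphism ::
  "'i stacky_fan \<Rightarrow> 'j stacky_fan \<Rightarrow>
   (('i \<times> (nat \<Rightarrow> real)) set \<Rightarrow> ('j \<times> (nat \<Rightarrow> real)) set) \<Rightarrow> bool" where
  "fan_morphism X Y f \<longleftrightarrow> continuous_map (fan_space X) (fan_space Y) f \<and>
     (\<forall>i\<in>cells X. \<exists>j\<in>cells Y. \<exists>L. integral_linear (coords X i) (coords Y j) L \<and>
        L ` cell_cone X i \<subseteq> cell_cone Y j \<and>
        (\<forall>x\<in>cell_cone X i. f (glue X `` {(i, x)}) = glue Y `` {(j, L x)}))"

definition fan_isomorphism ::
  "'i stacky_fan \<Rightarrow> 'j stacky_fan \<Rightarrow>
   (('i \<times> (nat \<Rightarrow> real)) set \<Rightarrow> ('j \<times> (nat \<Rightarrow> real)) set) \<Rightarrow> bool" where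
  "fan_isomorphism X Y f \<longleftrightarrow> fan_morphism X Y f \<and> (\<exists>f'. fan_morphism Y X f' \<and>
     (\<forall>p\<in>topspace (fan_space X). f' (f p) = p) \<and> (\<forall>q\<in>topspace (fan_space Y). f (f' q) = q))"


section \<open>Admissible actions and quotients\<close>

text \<open>A right action of the group \<^term>\<open>G\<close> is given by its effect \<^term>\<open>ca i \<gamma>\<close> on the
  cones and by maps \<^term>\<open>\<theta> i \<gamma>\<close> from the cone \<^term>\<open>i\<close> to the cone \<^term>\<open>ca i \<gamma>\<close>.\<close>

definition point_action ::
  "'i stacky_fan \<Rightarrow> ('i \<Rightarrow> 'g \<Rightarrow> 'i) \<Rightarrow> ('i \<Rightarrow> 'g \<Rightarrow> (nat \<Rightarrow> real) \<Rightarrow> nat \<Rightarrow> real) \<Rightarrow>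
   ('i \<times> (nat \<Rightarrow> real)) set \<Rightarrow> 'g \<Rightarrow> ('i \<times> (nat \<Rightarrow> real)) set" where
  "point_action X ca \<theta> p \<gamma> = (\<Union>(i, x)\<in>p. glue X `` {(ca i \<gamma>, \<theta> i \<gamma> x)})"

definition admissible_action ::
  "'i stacky_fan \<Rightarrow> ('g, 'm) monoid_scheme \<Rightarrow> ('i \<Rightarrow> 'g \<Rightarrow> 'i) \<Rightarrow>
   ('i \<Rightarrow> 'g \<Rightarrow> (nat \<Rightarrow> real) \<Rightarrow> nat \<Rightarrow> real) \<Rightarrow> bool" where
  "admissible_action X G ca \<theta> \<longleftrightarrow>
     group G \<and>
     (\<forall>\<gamma>\<in>carrier G. continuous_map (fan_space X) (fan_space X) (\<lambda>p. point_action X ca \<theta> p \<gamma>)) \<and>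
     (\<forall>p\<in>topspace (fan_space X). point_action X ca \<theta> p \<one>\<^bsub>G\<^esub> = p) \<and>
     (\<forall>p\<in>topspace (fan_space X). \<forall>\<gamma>\<in>carrier G. \<forall>\<delta>\<in>carrier G.
        point_action X ca \<theta> (point_action X ca \<theta> p \<gamma>) \<delta> = point_action X ca \<theta> p (\<gamma> \<otimes>\<^bsub>G\<^esub> \<delta>)) \<and>
     (\<forall>i\<in>cells X. ca i \<one>\<^bsub>G\<^esub> = i) \<and>
     (\<forall>i\<in>cells X. \<forall>\<gamma>\<in>carrier G. \<forall>\<delta>\<in>carrier G. ca (ca i \<gamma>) \<delta> = ca i (\<gamma> \<otimes>\<^bsub>G\<^esub> \<delta>)) \<and>
     (\<forall>i\<in>cells X. \<forall>\<gamma>\<in>carrier G.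
        ca i \<gamma> \<in> cells X \<and>
        lattice_iso (coords X i) (coords X (ca i \<gamma>)) (\<theta> i \<gamma>) \<and>
        bij_betw (\<theta> i \<gamma>) (cell_cone X i) (cell_cone X (ca i \<gamma>)) \<and>
        (\<forall>x\<in>cell_cone X i. point_action X ca \<theta> (glue X `` {(i, x)}) \<gamma> =
           glue X `` {(ca i \<gamma>, \<theta> i \<gamma> x)}))"

definition orbit_representatives ::
  "'i stacky_fan \<Rightarrow> ('g, 'm) monoid_scheme \<Rightarrow> ('i \<Rightarrow> 'g \<Rightarrow> 'i) \<Rightarrow> 'i set \<Rightarrow> bool" where
  "orbit_representatives X G ca R \<longleftrightarrow>
     R \<subseteq> cells X \<and> (\<forall>i\<in>cells X. \<exists>!r. r \<in> R \<and> r \<in> ca i ` carrier G)"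

definition stratified_quotient ::
  "'i stacky_fan \<Rightarrow> ('g, 'm) monoid_scheme \<Rightarrow> ('i \<Rightarrow> 'g \<Rightarrow> 'i) \<Rightarrow>
   ('i \<Rightarrow> 'g \<Rightarrow> (nat \<Rightarrow> real) \<Rightarrow> nat \<Rightarrow> real) \<Rightarrow> 'i set \<Rightarrow> 'i stacky_fan" where
  "stratified_quotient X G ca \<theta> R =
     \<lparr>cells = R, coords = coords X, cell_cone = cell_cone X,
      face_maps = (\<lambda>i j. {L \<circ> \<theta> i \<gamma> |L \<gamma>. \<gamma> \<in> carrier G \<and> L \<in> face_maps X (ca i \<gamma>) j})\<rparr>"

definition global_quotient ::
  "'i stacky_fan \<Rightarrow> ('g, 'm) monoid_scheme \<Rightarrow> ('i \<Rightarrow> 'g \<Rightarrow> 'i) \<Rightarrow>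
   ('i \<Rightarrow> 'g \<Rightarrow> (nat \<Rightarrow> real) \<Rightarrow> nat \<Rightarrow> real) \<Rightarrow> ('i \<times> (nat \<Rightarrow> real)) set set topology" where
  "global_quotient X G ca \<theta> = quotient_space (fan_space X)
     {(p, q). p \<in> topspace (fan_space X) \<and> (\<exists>\<gamma>\<in>carrier G. q = point_action X ca \<theta> p \<gamma>)}"

text \<open>The identification of \<^term>\<open>M\<close> with the quotient of \<^term>\<open>X\<close> is the one induced by a
  projection, given as a relation \<^term>\<open>proj\<close> between points of the cones of \<^term>\<open>X\<close> and
  of \<^term>\<open>M\<close> (a relation, since a point of \<^term>\<open>M\<close> may be represented in several ways).\<close>

definition is_stratified_quotient ::
  "'j stacky_fan \<Rightarrow> 'i stacky_fan \<Rightarrow> ('g, 'm) monoid_scheme \<Rightarrow> ('i \<Rightarrow> 'g \<Rightarrow> 'i) \<Rightarrow>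
   ('i \<Rightarrow> 'g \<Rightarrow> (nat \<Rightarrow> real) \<Rightarrow> nat \<Rightarrow> real) \<Rightarrow>
   ('i \<times> (nat \<Rightarrow> real) \<Rightarrow> 'j \<times> (nat \<Rightarrow> real) \<Rightarrow> bool) \<Rightarrow> bool" where
  "is_stratified_quotient M X G ca \<theta> proj \<longleftrightarrow>
     admissible_action X G ca \<theta> \<and>
     (\<forall>R. orbit_representatives X G ca R \<longrightarrow>
        (\<exists>\<phi>. fan_isomorphism (stratified_quotient X G ca \<theta> R) M \<phi> \<and>
           (\<forall>i\<in>R. \<forall>x\<in>cell_cone X i. \<forall>q. proj (i, x) q \<longrightarrow>
              \<phi> (glue (stratified_quotient X G ca \<theta> R) `` {(i, x)}) = glue M `` {q})))"

definition is_global_quotient ::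
  "'j stacky_fan \<Rightarrow> 'i stacky_fan \<Rightarrow> ('g, 'm) monoid_scheme \<Rightarrow> ('i \<Rightarrow> 'g \<Rightarrow> 'i) \<Rightarrow>
   ('i \<Rightarrow> 'g \<Rightarrow> (nat \<Rightarrow> real) \<Rightarrow> nat \<Rightarrow> real) \<Rightarrow>
   ('i \<times> (nat \<Rightarrow> real) \<Rightarrow> 'j \<times> (nat \<Rightarrow> real) \<Rightarrow> bool) \<Rightarrow> bool" where
  "is_global_quotient M X G ca \<theta> proj \<longleftrightarrow>
     admissible_action X G ca \<theta> \<and>
     (\<exists>\<psi>. homeomorphic_map (global_quotient X G ca \<theta>) (fan_space M) \<psi> \<and>
        (\<forall>i\<in>cells X. \<forall>x\<in>cell_cone X i. \<forall>q. proj (i, x) q \<longrightarrow>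
           \<psi> ((\<lambda>\<gamma>. point_action X ca \<theta> (glue X `` {(i, x)}) \<gamma>) ` carrier G) = glue M `` {q}))"


section \<open>Teichmueller and moduli spaces of tropical curves\<close>

text \<open>Cones are indexed by equivalence classes; the coordinates of a cone are the
  edges of a chosen representative of the class.\<close>

definition representative :: "'a set \<Rightarrow> 'a" where
  "representative c = (SOME X. X \<in> c)"

definition full_cone :: "(nat, nat) pre_digraph \<Rightarrow> (nat \<Rightarrow> real) set" where
  "full_cone G = arcs G \<rightarrow>\<^sub>E {0..}"

definition pure_cone :: "(nat, nat) pre_digraph \<Rightarrow> (nat \<Rightarrow> real) set" where
  "pure_cone G = {l \<in> arcs G \<rightarrow>\<^sub>E {0..}. \<not> contains_cycle G {e \<in> arcs G. l e = 0}}"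

abbreviation mgraph :: "marked set \<Rightarrow> (nat, nat) pre_digraph" where
  "mgraph c \<equiv> fst (fst (representative c))"

abbreviation wgraph_of :: "wgraph set \<Rightarrow> (nat, nat) pre_digraph" where
  "wgraph_of C \<equiv> fst (representative C)"

definition teichmueller :: "nat \<Rightarrow> marked set stacky_fan" where
  "teichmueller g =
     \<lparr>cells = marked_graphs g // marked_rel g,
      coords = (\<lambda>c. arcs (mgraph c)),
      cell_cone = (\<lambda>c. full_cone (mgraph c)),
      face_maps = (\<lambda>c d. {face_inclusion (arcs (mgraph c)) (arcs (mgraph d)) \<iota> |\<iota> S.
         marked_specializes_along g S (representative d) (representative c) \<iota>})\<rparr>"

definition pure_teichmueller :: "nat \<Rightarrow> marked set stacky_fan" where
  "pure_teichmueller g =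
     \<lparr>cells = {X \<in> marked_graphs g. pure_wgraph (fst X)} // marked_rel g,
      coords = (\<lambda>c. arcs (mgraph c)),
      cell_cone = (\<lambda>c. pure_cone (mgraph c)),
      face_maps = (\<lambda>c d. {face_inclusion (arcs (mgraph c)) (arcs (mgraph d)) \<iota> |\<iota> S.
         \<not> contains_cycle (mgraph d) S \<and>
         marked_specializes_along g S (representative d) (representative c) \<iota>})\<rparr>"

definition moduli_face_maps ::
  "wgraph set \<Rightarrow> wgraph set \<Rightarrow> ((nat \<Rightarrow> real) \<Rightarrow> nat \<Rightarrow> real) set" where
  "moduli_face_maps C D =
     {face_inclusion (arcs (wgraph_of C)) (arcs (wgraph_of D)) \<iota> |\<iota>.
        wgraph_specializes (representative D) (representative C) \<iota>} \<union>
     {face_inclusion (arcs (wgraph_of C)) (arcs (wgraph_of C)) fE |fV fE.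
        C = D \<and> wgraph_iso (representative C) (representative C) fV fE}"

definition moduli :: "nat \<Rightarrow> wgraph set stacky_fan" where
  "moduli g =
     \<lparr>cells = stable_wgraphs g // wgraph_rel g,
      coords = (\<lambda>C. arcs (wgraph_of C)),
      cell_cone = (\<lambda>C. full_cone (wgraph_of C)),
      face_maps = moduli_face_maps\<rparr>"

text \<open>A specialization between two cells of this fan is one for which the weight
  remains zero.\<close>

definition pure_moduli :: "nat \<Rightarrow> wgraph set stacky_fan" where
  "pure_moduli g =
     \<lparr>cells = {Y \<in> stable_wgraphs g. pure_wgraph Y} // wgraph_rel g,
      coords = (\<lambda>C. arcs (wgraph_of C)),
      cell_cone = (\<lambda>C. pure_cone (wgraph_of C)),
      face_maps = moduli_face_maps\<rparr>"

definition rose_map :: "nat \<Rightarrow> ((real \<Rightarrow> (unit, nat) gpoint) set \<Rightarrow> (real \<Rightarrow> (unit, nat) gpoint) set) \<Rightarrow>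
   (unit, nat) gpoint \<Rightarrow> (unit, nat) gpoint" where
  "rose_map g \<alpha> = (SOME f.
     homotopy_equivalence (realization (rose g)) (realization (rose g)) f \<and>
     f (Vertex ()) = Vertex () \<and>
     (\<forall>p\<in>loops_at (realization (rose g)) (Vertex ()).
        path_class (realization (rose g)) (f \<circ> p) = \<alpha> (path_class (realization (rose g)) p)))"

definition marked_action :: "nat \<Rightarrow> marked \<Rightarrow>
   ((real \<Rightarrow> (unit, nat) gpoint) set \<Rightarrow> (real \<Rightarrow> (unit, nat) gpoint) set) \<Rightarrow> marked" where
  "marked_action g X \<alpha> = (fst X, snd X \<circ> rose_map g \<alpha>)"

definition out_cell :: "nat \<Rightarrow> marked set \<Rightarrow>
   ((real \<Rightarrow> (unit, nat) gpoint) set \<Rightarrow> (real \<Rightarrow> (unit, nat) gpoint) set) set \<Rightarrow> marked set" where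
  "out_cell g c A = (\<Union>X\<in>c. \<Union>\<alpha>\<in>A. marked_rel g `` {marked_action g X \<alpha>})"

text \<open>The action does not change the lengths of the edges; the map between the cones is the
  relabelling of the edges by an isomorphism to the chosen representative.\<close>

definition out_map :: "nat \<Rightarrow> marked set \<Rightarrow>
   ((real \<Rightarrow> (unit, nat) gpoint) set \<Rightarrow> (real \<Rightarrow> (unit, nat) gpoint) set) set \<Rightarrow>
   (nat \<Rightarrow> real) \<Rightarrow> nat \<Rightarrow> real" where
  "out_map g c A = face_inclusion (arcs (mgraph c)) (arcs (mgraph (out_cell g c A)))
     (SOME fE. \<exists>\<alpha>\<in>A. marked_iso g (marked_action g (representative c) \<alpha>)
        (representative (out_cell g c A)) fE)"

definition forget_marking ::
  "nat \<Rightarrow> marked set \<times> (nat \<Rightarrow> real) \<Rightarrow> wgraph set \<times> (nat \<Rightarrow> real) \<Rightarrow> bool" where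
  "forget_marking g p q \<longleftrightarrow>
     fst q = wgraph_rel g `` {fst (representative (fst p))} \<and>
     (\<exists>fV fE. wgraph_iso (fst (representative (fst p))) (representative (fst q)) fV fE \<and>
        snd q = face_inclusion (arcs (mgraph (fst p))) (arcs (wgraph_of (fst q))) fE (snd p))"

end

theory Submission
  imports Defs "HOL-Complex_Analysis.Winding_Numbers" "HOL-Number_Theory.Cong"
begin

text \<open>The proof rests on two facts. Two markings of the same weighted graph differ, up to homotopy, by a
  self-equivalence of the rose, hence by an element of \<^term>\<open>Out (Fg g)\<close>; so the orbits of cones are the
  isomorphism classes of weighted graphs. And an isomorphism of marked graphs descends along the
  contraction of an edge; so a specialization of unmarked graphs lifts, after acting by some outer
  automorphism, to a specialization of the chosen marked representatives, and the generating
  relations of the two quotients correspond to each other.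

  To handle the equivalence of markings, it is replaced by a coarser looking relation without base
  point and immersion conditions. The two agree because every path in a finite graph is homotopic to
  a walk without backtracking, which is locally injective. The same walks show that every
  self-equivalence of the rose is homotopic to some \<^term>\<open>rose_map g \<alpha>\<close>.\<close>

section \<open>Path homotopy in abstract topological spaces\<close>

text \<open>Three obstacles shape the details. Paths are arbitrary continuous maps into an abstract
  quotient space, so nothing combinatorial is available until bisection of the parameter interval
  has cut a path into pieces lying in the star of a vertex or in an open edge. A constant path is
  not an immersion, so the immersion condition on markings can be met only because no petal of the
  rose dies under a homotopy equivalence; that a petal is not null-homotopic in the rose itself is
  shown by a winding number. Finally, cones are indexed by classes with arbitrarily chosen
  representatives, and the maps between cones come from arbitrarily chosen isomorphisms. Hence these
  maps satisfy the laws of an action, and commute with the projection, only up to automorphisms of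
  cells. Such automorphisms are absorbed because contracting no edge is an admissible
  specialization, so that they belong to the gluing. In the pure case the acyclicity of a contracted
  set is recovered from the vanishing of the weights after the contraction.\<close>

abbreviation unit_square :: "(real \<times> real) set" where
  "unit_square \<equiv> {0..1} \<times> {0..1}"

lemma continuous_map_top_of_set_compose:
  assumes "continuous_map (top_of_set T) X F" "continuous_on S f" "\<And>x. x \<in> S \<Longrightarrow> f x \<in> T"
  shows "continuous_map (top_of_set S) X (\<lambda>x. F (f x))"
proof -
  have "continuous_map (top_of_set S) (top_of_set T) f"
    using assms by (auto simp: continuous_map_in_subtopology)
  from continuous_map_compose[OF this assms(1)] show ?thesis
    by (simp add: o_def)
qed

lemma continuous_map_unit_prod:
  assumes "continuous_map (prod_topology (top_of_set {0..1::real}) Z) X F"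
    and "continuous_map Y (top_of_set {0..1::real}) f" "continuous_map Y Z h"
  shows "continuous_map Y X (\<lambda>y. F (f y, h y))"
proof -
  have "continuous_map Y (prod_topology (top_of_set {0..1::real}) Z) (\<lambda>y. (f y, h y))"
    using assms by (simp add: continuous_map_pairedI)
  from continuous_map_compose[OF this assms(1)] show ?thesis
    by (simp add: o_def)
qed

lemma path_homotopic_iff:
  "path_homotopic X p q \<longleftrightarrow>
     (\<exists>H. continuous_map (top_of_set unit_square) X H \<and>
       (\<forall>t\<in>{0..1}. H (0, t) = p t) \<and> (\<forall>t\<in>{0..1}. H (1, t) = q t) \<and>
       (\<forall>s\<in>{0..1}. H (s, 0) = p 0 \<and> H (s, 1) = p 1))"
proof -
  \<comment> \<open>\<open>homotopic_with\<close> unfolds to a map on the square only for a side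
    condition that depends on nothing but the values on \<open>{0..1}\<close>.\<close>
  have *: "(h 0 = p 0 \<and> h 1 = p 1) = (k 0 = p 0 \<and> k 1 = p 1)"
    if "\<And>x. x \<in> topspace (top_of_set {0..1}) \<Longrightarrow> h x = k x" for h k :: "real \<Rightarrow> 'a"
  proof -
    have "h 0 = k 0" "h 1 = k 1" using that by auto
    then show ?thesis by simp
  qed
  show ?thesis
    unfolding path_homotopic_def
    by (subst homotopic_with, rule *, blast) auto
qed

lemma path_homotopic_imp_pathin:
  assumes "path_homotopic X p q"
  shows "pathin X p" "pathin X q"
  using homotopic_with_imp_continuous_maps[OF assms[unfolded path_homotopic_def]]
  by (auto simp: pathin_def)

lemma path_homotopic_imp_endpoints:
  assumes "path_homotopic X p q"
  shows "q 0 = p 0" "q 1 = p 1"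
  using homotopic_with_imp_property[OF assms[unfolded path_homotopic_def]] by auto

lemma path_homotopic_sym:
  assumes "path_homotopic X p q"
  shows "path_homotopic X q p"
  using homotopic_with_symD[OF assms[unfolded path_homotopic_def]] path_homotopic_imp_endpoints[OF assms]
  by (simp add: path_homotopic_def)

lemma path_homotopic_trans [trans]:
  assumes "path_homotopic X p q" "path_homotopic X q r"
  shows "path_homotopic X p r"
  using homotopic_with_trans assms path_homotopic_imp_endpoints[OF assms(1)]
  unfolding path_homotopic_def by fastforce

lemma path_homotopic_eq:
  assumes "pathin X p" "\<And>t. 0 \<le> t \<Longrightarrow> t \<le> 1 \<Longrightarrow> q t = p t"
  shows "path_homotopic X p q"
  using assms unfolding path_homotopic_def pathin_def
  by (intro homotopic_with_equal) auto

lemma path_homotopic_refl [simp]: "path_homotopic X p p \<longleftrightarrow> pathin X p"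
  using path_homotopic_eq path_homotopic_imp_pathin by metis

text \<open>The straight-line homotopy takes place in the parameter domain \<open>C\<close>, where
  convexity makes it available, and is pushed forward by \<open>F\<close>. With \<open>C\<close> an
  interval it gives the reparametrizations, with \<open>C\<close> the square the comparison of the
  two ways around its boundary.\<close>

lemma path_homotopic_convex:
  fixes \<phi> \<psi> :: "real \<Rightarrow> 'a::real_normed_vector"
  assumes F: "continuous_map (top_of_set C) X F" and "convex C"
    and "continuous_on {0..1} \<phi>" "continuous_on {0..1} \<psi>"
    and C: "\<And>t. 0 \<le> t \<Longrightarrow> t \<le> 1 \<Longrightarrow> \<phi> t \<in> C" "\<And>t. 0 \<le> t \<Longrightarrow> t \<le> 1 \<Longrightarrow> \<psi> t \<in> C"
    and "\<phi> 0 = \<psi> 0" "\<phi> 1 = \<psi> 1"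
  shows "path_homotopic X (\<lambda>t. F (\<phi> t)) (\<lambda>t. F (\<psi> t))"
proof -
  let ?H = "\<lambda>(s, t). F ((1 - s) *\<^sub>R \<phi> t + s *\<^sub>R \<psi> t)"
  have "continuous_on unit_square (\<lambda>x. \<phi> (snd x))" "continuous_on unit_square (\<lambda>x. \<psi> (snd x))"
    using assms by (auto intro!: continuous_on_compose2[OF _ continuous_on_snd] continuous_intros)
  then have "continuous_map (top_of_set unit_square) X
      (\<lambda>x. F ((1 - fst x) *\<^sub>R \<phi> (snd x) + fst x *\<^sub>R \<psi> (snd x)))"
    using C \<open>convex C\<close>
    by (intro continuous_map_top_of_set_compose[OF F] continuous_intros)
       (auto intro!: convexD_alt)
  then have "continuous_map (top_of_set unit_square) X ?H"
    by (simp add: case_prod_unfold)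
  moreover have "?H (s, 0) = F (\<phi> 0)" "?H (s, 1) = F (\<phi> 1)" for s
    using assms by (auto simp: algebra_simps)
  ultimately show ?thesis
    unfolding path_homotopic_iff by (intro exI[of _ ?H]) auto
qed

text \<open>Associativity, the unit laws and the inverse laws each compare two parametrizations of a
  single path, so they reduce to two real functions with the same end values.\<close>

lemma path_homotopic_reparam:
  assumes p: "pathin X p" and "continuous_on {0..1} \<phi>" "continuous_on {0..1} \<psi>"
    and "\<And>t. 0 \<le> t \<Longrightarrow> t \<le> 1 \<Longrightarrow> \<phi> t \<in> {0..1}" "\<And>t. 0 \<le> t \<Longrightarrow> t \<le> 1 \<Longrightarrow> \<psi> t \<in> {0..1}"
    and "\<phi> 0 = \<psi> 0" "\<phi> 1 = \<psi> (1::real)"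
    and "\<And>t. 0 \<le> t \<Longrightarrow> t \<le> 1 \<Longrightarrow> q t = p (\<phi> t)" "\<And>t. 0 \<le> t \<Longrightarrow> t \<le> 1 \<Longrightarrow> r t = p (\<psi> t)"
  shows "path_homotopic X q r"
proof -
  have *: "path_homotopic X (\<lambda>t. p (\<phi> t)) (\<lambda>t. p (\<psi> t))"
    using assms by (intro path_homotopic_convex[of "{0..1}"]) (auto simp: pathin_def)
  have "path_homotopic X (\<lambda>t. p (\<phi> t)) q" "path_homotopic X (\<lambda>t. p (\<psi> t)) r"
    using path_homotopic_imp_pathin[OF *] assms by (auto intro!: path_homotopic_eq)
  then show ?thesis
    using * path_homotopic_sym path_homotopic_trans by meson
qed

section \<open>Joins, reversals and the groupoid laws of paths\<close>

lemma path_join_ends [simp]: "path_join p q 0 = p 0" "path_join p q 1 = q 1"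
  by (auto simp: path_join_def)

lemma path_reverse_ends [simp]: "path_reverse p 0 = p 1" "path_reverse p 1 = p 0"
  by (auto simp: path_reverse_def)

lemma path_reverse_reverse [simp]: "path_reverse (path_reverse p) = p"
  by (auto simp: path_reverse_def)

lemma path_reverse_const [simp]: "path_reverse (\<lambda>_. x) = (\<lambda>_. x)"
  by (auto simp: path_reverse_def)

lemma comp_path_join: "f \<circ> path_join p q = path_join (f \<circ> p) (f \<circ> q)"
  by (auto simp: path_join_def)

lemma comp_path_reverse: "f \<circ> path_reverse p = path_reverse (f \<circ> p)"
  by (auto simp: path_reverse_def)

text \<open>The pasting at parameter 1/2 is carried out here once: homotopies that are constant in
  the first coordinate give the continuity of joined paths.\<close>

lemma continuous_map_square_join:
  assumes H: "continuous_map (top_of_set unit_square) X H"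
    and K: "continuous_map (top_of_set unit_square) X K"
    and "\<And>s. s \<in> {0..1} \<Longrightarrow> H (s, 1) = K (s, 0)"
  shows "continuous_map (top_of_set unit_square) X
           (\<lambda>x. if snd x \<le> 1/2 then H (fst x, 2 * snd x) else K (fst x, 2 * snd x - 1))"
proof (rule continuous_map_cases_le)
  show "continuous_map (subtopology (top_of_set unit_square)
      {x \<in> topspace (top_of_set unit_square). snd x \<le> 1/2}) X (\<lambda>x. H (fst x, 2 * snd x))"
    unfolding subtopology_subtopology
    by (intro continuous_map_top_of_set_compose[OF H] continuous_intros) auto
  show "continuous_map (subtopology (top_of_set unit_square)
      {x \<in> topspace (top_of_set unit_square). 1/2 \<le> snd x}) X (\<lambda>x. K (fst x, 2 * snd x - 1))"
    unfolding subtopology_subtopology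
    by (intro continuous_map_top_of_set_compose[OF K] continuous_intros) auto
  show "H (fst x, 2 * snd x) = K (fst x, 2 * snd x - 1)"
    if "x \<in> topspace (top_of_set unit_square)" "snd x = 1/2" for x
  proof -
    have "x = (fst x, 1/2)" "fst x \<in> {0..1}" using that by (auto simp: prod_eq_iff)
    then obtain a where "x = (a, 1/2)" "a \<in> {0..1}" by metis
    then show ?thesis using assms(3)[of a] by simp
  qed
qed (auto intro!: continuous_intros)

lemma pathin_join [simp]:
  assumes p: "pathin X p" and q: "pathin X q" and "p 1 = q 0"
  shows "pathin X (path_join p q)"
proof -
  have "continuous_map (top_of_set unit_square) X (\<lambda>x. p (snd x))"
    "continuous_map (top_of_set unit_square) X (\<lambda>x. q (snd x))"
    using p q unfolding pathin_def
    by (auto intro!: continuous_map_top_of_set_compose[where f = snd] continuous_intros)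
  from continuous_map_square_join[OF this] assms
  have "continuous_map (top_of_set unit_square) X
      (\<lambda>x. if snd x \<le> 1/2 then p (2 * snd x) else q (2 * snd x - 1))"
    by (simp only: fst_conv snd_conv)
  from continuous_map_top_of_set_compose[OF this, of "{0..1}" "\<lambda>t. (0, t)"]
  show ?thesis
    unfolding pathin_def path_join_def by (simp only: fst_conv snd_conv) (simp add: continuous_on_Pair)
qed

lemma pathin_reparam:
  assumes "pathin X p" "continuous_on {0..1} \<phi>" "\<And>t. 0 \<le> t \<Longrightarrow> t \<le> 1 \<Longrightarrow> \<phi> t \<in> {0..1}"
  shows "pathin X (\<lambda>t. p (\<phi> t))"
  using assms unfolding pathin_def by (rule continuous_map_top_of_set_compose) auto

lemma pathin_reverse [simp]: "pathin X (path_reverse p) \<longleftrightarrow> pathin X p"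
proof -
  have "pathin X p \<Longrightarrow> pathin X (path_reverse p)" for p
    unfolding path_reverse_def by (rule pathin_reparam) (auto intro!: continuous_intros)
  from this[of p] this[of "path_reverse p"] show ?thesis by auto
qed

lemma path_homotopic_join:
  assumes pp: "path_homotopic X p p'" and qq: "path_homotopic X q q'" and eq: "p 1 = q 0"
  shows "path_homotopic X (path_join p q) (path_join p' q')"
proof -
  obtain H where H: "continuous_map (top_of_set unit_square) X H"
    "\<And>t. t\<in>{0..1} \<Longrightarrow> H (0, t) = p t" "\<And>t. t\<in>{0..1} \<Longrightarrow> H (1, t) = p' t"
    "\<And>s. s\<in>{0..1} \<Longrightarrow> H (s, 0) = p 0 \<and> H (s, 1) = p 1"
    using pp unfolding path_homotopic_iff by blast
  obtain K where K: "continuous_map (top_of_set unit_square) X K"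
    "\<And>t. t\<in>{0..1} \<Longrightarrow> K (0, t) = q t" "\<And>t. t\<in>{0..1} \<Longrightarrow> K (1, t) = q' t"
    "\<And>s. s\<in>{0..1} \<Longrightarrow> K (s, 0) = q 0 \<and> K (s, 1) = q 1"
    using qq unfolding path_homotopic_iff by blast
  show ?thesis
    unfolding path_homotopic_iff
    by (rule exI, rule conjI, rule continuous_map_square_join[OF H(1) K(1)])
       (use H K eq in \<open>auto simp: path_join_def\<close>)
qed

lemma path_homotopic_reverse:
  assumes pp: "path_homotopic X p p'"
  shows "path_homotopic X (path_reverse p) (path_reverse p')"
proof -
  obtain H where H: "continuous_map (top_of_set unit_square) X H"
    "\<And>t. t\<in>{0..1} \<Longrightarrow> H (0, t) = p t" "\<And>t. t\<in>{0..1} \<Longrightarrow> H (1, t) = p' t"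
    "\<And>s. s\<in>{0..1} \<Longrightarrow> H (s, 0) = p 0 \<and> H (s, 1) = p 1"
    using pp unfolding path_homotopic_iff by blast
  have "continuous_map (top_of_set unit_square) X (\<lambda>x. H (fst x, 1 - snd x))"
    by (intro continuous_map_top_of_set_compose[OF H(1)] continuous_intros) auto
  then show ?thesis
    unfolding path_homotopic_iff
    by (intro exI[of _ "\<lambda>x. H (fst x, 1 - snd x)"]) (use H in \<open>auto simp: path_reverse_def\<close>)
qed

lemma path_homotopic_compose:
  assumes "path_homotopic X p q" "continuous_map X Y f"
  shows "path_homotopic Y (f \<circ> p) (f \<circ> q)"
  using assms unfolding path_homotopic_def
  by (auto intro!: homotopic_with_compose_continuous_map_left[where p = "\<lambda>r. r 0 = p 0 \<and> r 1 = p 1"])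

lemma path_homotopic_assoc:
  assumes "pathin X p" "pathin X q" "pathin X r" "p 1 = q 0" "q 1 = r 0"
  shows "path_homotopic X (path_join (path_join p q) r) (path_join p (path_join q r))"
proof (rule path_homotopic_reparam)
  show "pathin X (path_join p (path_join q r))"
    using assms by auto
  \<comment> \<open>The break points 1/4 and 1/2 of the left bracketing are carried to the break
    points 1/2 and 3/4 of the right one. This piecewise linear map has slopes 2, 1 and 1/2, hence is
    concave and equals the minimum of its three affine pieces.\<close>
  show "continuous_on {0..1} (\<lambda>t::real. min (2 * t) (min (t + 1/4) (t/2 + 1/2)))"
    by (auto intro!: continuous_intros)
  show "continuous_on {0..1} (\<lambda>t::real. t)"
    by (intro continuous_intros)
  fix t :: real assume "0 \<le> t" "t \<le> 1"
  consider "t \<le> 1/4" | "1/4 < t" "t \<le> 1/2" | "1/2 < t" by linarith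
  then show "path_join (path_join p q) r t =
      path_join p (path_join q r) (min (2 * t) (min (t + 1/4) (t/2 + 1/2)))"
  proof cases
    case 1
    then have "min (2 * t) (min (t + 1/4) (t/2 + 1/2)) = 2 * t" by auto
    with 1 show ?thesis by (simp add: path_join_def)
  next
    case 2
    then have *: "min (2 * t) (min (t + 1/4) (t/2 + 1/2)) = t + 1/4" by auto
    show ?thesis unfolding * using 2 by (auto simp: path_join_def algebra_simps)
  next
    case 3
    then have *: "min (2 * t) (min (t + 1/4) (t/2 + 1/2)) = t/2 + 1/2" by auto
    show ?thesis unfolding * using 3 by (auto simp: path_join_def algebra_simps)
  qed
qed auto

lemma path_homotopic_lid:
  assumes "pathin X p"
  shows "path_homotopic X (path_join (\<lambda>_. p 0) p) p"
proof -
  have "continuous_on {0..1} (\<lambda>t::real. max 0 (2 * t - 1))" by (intro continuous_intros)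
  then show ?thesis
    by (rule path_homotopic_reparam[OF assms, of _ "\<lambda>t. t"])
       (auto simp: path_join_def max_def min_def intro!: arg_cong[of _ _ p])
qed

lemma path_homotopic_rid:
  assumes "pathin X p"
  shows "path_homotopic X (path_join p (\<lambda>_. p 1)) p"
proof -
  have "continuous_on {0..1} (\<lambda>t::real. min 1 (2 * t))" by (intro continuous_intros)
  then show ?thesis
    by (rule path_homotopic_reparam[OF assms, of _ "\<lambda>t. t"])
       (auto simp: path_join_def max_def min_def intro!: arg_cong[of _ _ p])
qed

lemma path_homotopic_rinv:
  assumes "pathin X p"
  shows "path_homotopic X (path_join p (path_reverse p)) (\<lambda>_. p 0)"
proof -
  \<comment> \<open>The parameter runs to 1 and back to 0, so it contracts to the constant 0 inside
    the interval.\<close>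
  have "continuous_on {0..1} (\<lambda>t::real. min (2 * t) (2 - 2 * t))" by (intro continuous_intros)
  then show ?thesis
    by (rule path_homotopic_reparam[OF assms, of _ "\<lambda>t. 0"])
       (auto simp: path_join_def max_def min_def path_reverse_def intro!: arg_cong[of _ _ p])
qed

lemma path_homotopic_linv:
  assumes "pathin X p"
  shows "path_homotopic X (path_join (path_reverse p) p) (\<lambda>_. p 1)"
  using path_homotopic_rinv[of X "path_reverse p"] assms by simp

text \<open>Both ways around the boundary are paths in the convex square with the same ends. Applied
  to \<open>H (s, p t)\<close> this gives the naturality of the traces of points under a
  homotopy.\<close>

lemma path_homotopic_square:
  assumes H: "continuous_map (top_of_set unit_square) X H"
  shows "path_homotopic X (path_join (\<lambda>t. H (0, t)) (\<lambda>s. H (s, 1)))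
           (path_join (\<lambda>s. H (s, 0)) (\<lambda>t. H (1, t)))"
proof -
  let ?\<phi> = "\<lambda>t::real. (max 0 (2 * t - 1), min 1 (2 * t))"
  let ?\<psi> = "\<lambda>t::real. (min 1 (2 * t), max 0 (2 * t - 1))"
  have *: "path_homotopic X (\<lambda>t. H (?\<phi> t)) (\<lambda>t. H (?\<psi> t))"
    by (rule path_homotopic_convex[OF H])
       ((intro continuous_intros convex_Times convex_real_interval) | (auto simp: max_def min_def))+
  have "path_homotopic X (\<lambda>t. H (?\<phi> t)) (path_join (\<lambda>t. H (0, t)) (\<lambda>s. H (s, 1)))"
    "path_homotopic X (\<lambda>t. H (?\<psi> t)) (path_join (\<lambda>s. H (s, 0)) (\<lambda>t. H (1, t)))"
    using path_homotopic_imp_pathin[OF *]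
    by (auto intro!: path_homotopic_eq arg_cong[of _ _ H] simp: path_join_def max_def min_def)
  then show ?thesis
    using * path_homotopic_sym path_homotopic_trans by meson
qed

text \<open>Appending the reverse of \<open>d\<close> to both sides isolates \<open>p\<close>. This
  turns the square relation of a homotopy, whose ends move, into a homotopy with fixed ends.\<close>

lemma path_homotopic_cancel_right:
  assumes h: "path_homotopic X (path_join p d) (path_join c q)"
    and P: "pathin X p" "pathin X q" "pathin X c" "pathin X d" and E: "p 1 = d 0" "c 1 = q 0"
  shows "path_homotopic X p (path_join c (path_join q (path_reverse d)))"
proof -
  have e: "d 1 = q 1" using path_homotopic_imp_endpoints[OF h] by simp
  have "path_homotopic X p (path_join p (\<lambda>_. p 1))"
    using path_homotopic_rid[OF P(1)] by (rule path_homotopic_sym)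
  also have "path_homotopic X \<dots> (path_join p (path_join d (path_reverse d)))"
    using path_homotopic_rinv[OF P(4)] P E
    by (intro path_homotopic_join) (auto intro: path_homotopic_sym)
  also have "path_homotopic X \<dots> (path_join (path_join p d) (path_reverse d))"
    using P E by (intro path_homotopic_sym[OF path_homotopic_assoc]) auto
  also have "path_homotopic X \<dots> (path_join (path_join c q) (path_reverse d))"
    using P E by (intro path_homotopic_join[OF h]) auto
  also have "path_homotopic X \<dots> (path_join c (path_join q (path_reverse d)))"
    using P E e by (intro path_homotopic_assoc) auto
  finally show ?thesis .
qed

text \<open>For \<open>c\<close> leading from the new base point to the old one this is the change
  of base point. It is bracketed to the right throughout.\<close>

definition path_conj :: "(real \<Rightarrow> 'a) \<Rightarrow> (real \<Rightarrow> 'a) \<Rightarrow> real \<Rightarrow> 'a" where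
  "path_conj c p = path_join c (path_join p (path_reverse c))"

lemma path_conj_ends [simp]: "path_conj c p 0 = c 0" "path_conj c p 1 = c 0"
  by (auto simp: path_conj_def)

lemma comp_path_conj: "f \<circ> path_conj c p = path_conj (f \<circ> c) (f \<circ> p)"
  by (simp add: path_conj_def comp_path_join comp_path_reverse)

lemma pathin_conj [simp]:
  "pathin X c \<Longrightarrow> pathin X p \<Longrightarrow> c 1 = p 0 \<Longrightarrow> c 1 = p 1 \<Longrightarrow> pathin X (path_conj c p)"
  by (auto simp: path_conj_def)

lemma path_homotopic_conj:
  assumes "path_homotopic X p q" "pathin X c" "c 1 = p 0" "c 1 = p 1"
  shows "path_homotopic X (path_conj c p) (path_conj c q)"
  unfolding path_conj_def using assms
  by (intro path_homotopic_join) auto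

lemma path_homotopic_conj_const:
  assumes "pathin X c"
  shows "path_homotopic X (path_conj c (\<lambda>_. c 1)) (\<lambda>_. c 0)"
proof -
  have "path_homotopic X (path_conj c (\<lambda>_. c 1)) (path_join c (path_reverse c))"
    unfolding path_conj_def using path_homotopic_lid[of X "path_reverse c"] assms
    by (intro path_homotopic_join) auto
  then show ?thesis
    using path_homotopic_rinv[OF assms] path_homotopic_trans by blast
qed

lemma path_homotopic_conj_conj:
  assumes P: "pathin X c" "pathin X d" "pathin X p" and E: "c 1 = d 0" "d 1 = p 0" "d 1 = p 1"
  shows "path_homotopic X (path_conj c (path_conj d p)) (path_conj (path_join c d) p)"
proof -
  let ?c = "path_reverse c" and ?d = "path_reverse d"
  have 1: "path_homotopic X (path_join (path_join d (path_join p ?d)) ?c)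
      (path_join d (path_join (path_join p ?d) ?c))"
    using P E by (intro path_homotopic_assoc) auto
  have 2: "path_homotopic X (path_join (path_join p ?d) ?c) (path_join p (path_join ?d ?c))"
    using P E by (intro path_homotopic_assoc) auto
  have rev: "path_homotopic X (path_reverse (path_join c d)) (path_join ?d ?c)"
  proof -
    have "pathin X (path_join ?d ?c)" using P E by auto
    \<comment> \<open>At the midpoint the two sides evaluate different halves, and these agree
      because \<open>c 1 = d 0\<close>.\<close>
    moreover have "path_reverse (path_join c d) t = path_join ?d ?c t" if "0 \<le> t" "t \<le> 1" for t
      using that E by (cases "t = 1/2") (auto simp: path_reverse_def path_join_def algebra_simps)
    ultimately show ?thesis using path_homotopic_eq path_homotopic_sym by metis
  qed
  have "path_homotopic X (path_conj c (path_conj d p)) (path_join c (path_join d (path_join (path_join p ?d) ?c)))"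
    unfolding path_conj_def using P E by (intro path_homotopic_join[OF _ 1]) auto
  also have "path_homotopic X \<dots> (path_join c (path_join d (path_join p (path_join ?d ?c))))"
    using P E by (intro path_homotopic_join[OF _ path_homotopic_join[OF _ 2]]) auto
  also have "path_homotopic X \<dots> (path_join (path_join c d) (path_join p (path_join ?d ?c)))"
    using P E by (intro path_homotopic_sym[OF path_homotopic_assoc]) auto
  also have "path_homotopic X \<dots> (path_conj (path_join c d) p)"
    unfolding path_conj_def using P E rev
    by (intro path_homotopic_join) (auto intro: path_homotopic_sym)
  finally show ?thesis .
qed

lemma path_homotopic_conj_const_left:
  assumes "pathin X p" "p 0 = x" "p 1 = x"
  shows "path_homotopic X (path_conj (\<lambda>_. x) p) p"
proof -
  have x: "x \<in> topspace X" using assms path_start_in_topspace by metis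
  have "path_homotopic X (path_conj (\<lambda>_. x) p) (path_join (\<lambda>_. x) p)"
    unfolding path_conj_def using path_homotopic_rid[of X p] assms x
    by (intro path_homotopic_join) auto
  then show ?thesis
    using path_homotopic_lid[of X p] assms path_homotopic_trans by blast
qed

lemma path_homotopic_conj_null:
  assumes "path_homotopic X c (\<lambda>_. x)" "pathin X p" "p 0 = x" "p 1 = x"
  shows "path_homotopic X (path_conj c p) p"
proof -
  have c: "c 0 = x" "c 1 = x" using path_homotopic_imp_endpoints[OF assms(1)] by auto
  have "path_homotopic X (path_conj c p) (path_conj (\<lambda>_. x) p)"
    unfolding path_conj_def using path_homotopic_reverse[OF assms(1)] assms c
    by (intro path_homotopic_join) auto
  then show ?thesis
    using path_homotopic_conj_const_left[of X p x] assms path_homotopic_trans by blast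
qed

text \<open>Conjugating both sides by the reverse of \<open>c\<close> and cancelling
  \<open>path_join (path_reverse c) c\<close> solves the relation for \<open>q\<close>.\<close>

lemma path_homotopic_conj_swap:
  assumes h: "path_homotopic X p (path_conj c q)"
    and P: "pathin X c" "pathin X q" and E: "c 1 = q 0" "c 1 = q 1"
  shows "path_homotopic X q (path_conj (path_reverse c) p)"
proof -
  have p: "pathin X p" "p 0 = c 0" "p 1 = c 0"
    using path_homotopic_imp_pathin[OF h] path_homotopic_imp_endpoints[OF h] by auto
  have "path_homotopic X (path_conj (path_reverse c) p) (path_conj (path_reverse c) (path_conj c q))"
    using h P p by (intro path_homotopic_conj) auto
  also have "path_homotopic X \<dots> (path_conj (path_join (path_reverse c) c) q)"
    using P E by (intro path_homotopic_conj_conj) auto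
  also have "path_homotopic X \<dots> q"
    using path_homotopic_linv[OF P(1)] P E by (intro path_homotopic_conj_null) auto
  finally show ?thesis by (rule path_homotopic_sym)
qed

text \<open>The path \<open>c x\<close> is the trace of the point \<open>x\<close> under the
  homotopy, and the last clause compares the two ways around the square
  \<open>H (s, p t)\<close>.\<close>

lemma homotopic_track:
  assumes "homotopic_with (\<lambda>_. True) X Y f k"
  obtains c where "\<And>x. x \<in> topspace X \<Longrightarrow> pathin Y (c x)"
    "\<And>x. c x 0 = f x" "\<And>x. c x 1 = k x"
    "\<And>p. pathin X p \<Longrightarrow> path_homotopic Y (path_join (f \<circ> p) (c (p 1))) (path_join (c (p 0)) (k \<circ> p))"
proof -
  obtain H where H: "continuous_map (prod_topology (top_of_set {0..1}) X) Y H"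
    "\<And>x. H (0, x) = f x" "\<And>x. H (1::real, x) = k x"
    using assms unfolding homotopic_with_def by blast
  show ?thesis
  proof
    fix x assume "x \<in> topspace X"
    then show "pathin Y (\<lambda>s. H (s, x))"
      unfolding pathin_def
      by (intro continuous_map_unit_prod[OF H(1)]) auto
  next
    fix p assume p: "pathin X p"
    have a: "continuous_map (top_of_set unit_square) X (\<lambda>y. p (snd y))"
      using p unfolding pathin_def
      by (rule continuous_map_top_of_set_compose) (auto intro!: continuous_intros)
    have "continuous_map (top_of_set unit_square) Y (\<lambda>y. H (fst y, p (snd y)))"
      by (rule continuous_map_unit_prod[OF H(1) _ a])
         (auto intro!: continuous_intros simp: continuous_map_in_subtopology)
    then have "continuous_map (top_of_set unit_square) Y (\<lambda>(s, t). H (s, p t))"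
      by (simp add: case_prod_unfold)
    from path_homotopic_square[OF this]
    show "path_homotopic Y (path_join (f \<circ> p) (\<lambda>s. H (s, p 1))) (path_join (\<lambda>s. H (s, p 0)) (k \<circ> p))"
      by (simp add: H o_def)
  qed (simp_all add: H)
qed

text \<open>For a loop the traces of the two ends are the same path, so homotopic maps agree on
  loops up to conjugation by it. This is how changes of base point enter the comparison of
  markings.\<close>

lemma homotopic_track_loops:
  assumes "homotopic_with (\<lambda>_. True) X Y f k" "x \<in> topspace X"
  obtains c where "pathin Y c" "c 0 = f x" "c 1 = k x"
    "\<And>p. pathin X p \<Longrightarrow> p 0 = x \<Longrightarrow> p 1 = x \<Longrightarrow> path_homotopic Y (f \<circ> p) (path_conj c (k \<circ> p))"
proof -
  obtain c where c: "\<And>x. x \<in> topspace X \<Longrightarrow> pathin Y (c x)"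
    "\<And>x. c x 0 = f x" "\<And>x. c x 1 = k x"
    "\<And>p. pathin X p \<Longrightarrow> path_homotopic Y (path_join (f \<circ> p) (c (p 1))) (path_join (c (p 0)) (k \<circ> p))"
    using homotopic_track[OF assms(1)] by blast
  have cont: "continuous_map X Y f" "continuous_map X Y k"
    using assms(1) homotopic_with_imp_continuous_maps by blast+
  show ?thesis
  proof
    show "pathin Y (c x)" "c x 0 = f x" "c x 1 = k x" using c assms by auto
    fix p assume p: "pathin X p" "p 0 = x" "p 1 = x"
    show "path_homotopic Y (f \<circ> p) (path_conj (c x) (k \<circ> p))"
      unfolding path_conj_def using c p assms(2) cont
      by (intro path_homotopic_cancel_right) (auto intro!: pathin_compose dest: c(4))
  qed
qed

section \<open>Restrictions of a path to subintervals\<close>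

lemma pathin_sub:
  assumes "pathin X p" "a \<in> {0..1}" "b \<in> {0..1}"
  shows "pathin X (\<lambda>t. p (a + (b - a) * t))"
proof (rule pathin_reparam[OF assms(1)])
  fix t :: real assume t: "0 \<le> t" "t \<le> 1"
  have "a + (b - a) * t = (1 - t) * a + t * b" by (simp add: algebra_simps)
  then show "a + (b - a) * t \<in> {0..1}"
    using convexD_alt[of "{0..1::real}" a b t] assms t by auto
qed (intro continuous_intros)

text \<open>The parameters \<open>a\<close>, \<open>b\<close>, \<open>c\<close> may come in any
  order, so a restriction may run backwards. Thus the segments of a walk that turns around on an
  edge can be merged.\<close>

lemma path_homotopic_sub_join:
  assumes p: "pathin X p" and "a \<in> {0..1}" "b \<in> {0..1}" "c \<in> {0..1}"
  shows "path_homotopic X (\<lambda>t. p (a + (c - a) * t))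
     (path_join (\<lambda>t. p (a + (b - a) * t)) (\<lambda>t. p (b + (c - b) * t)))"
proof (rule path_homotopic_reparam[OF p])
  \<comment> \<open>The first increment is frozen at \<open>b - a\<close> from time 1/2 on, and the
    second is 0 before it.\<close>
  let ?\<psi> = "\<lambda>t. (a + (b - a) * min 1 (2 * t)) + (c - b) * max 0 (2 * t - 1)"
  show "continuous_on {0..1} (\<lambda>t. a + (c - a) * t)" "continuous_on {0..1} ?\<psi>"
    by (auto intro!: continuous_intros)
  have conv: "x + (y - x) * t \<in> {0..1}" if "x \<in> {0..1}" "y \<in> {0..1}" "0 \<le> t" "t \<le> 1" for x y t :: real
    using convexD_alt[of "{0..1::real}" x y t] that by (simp add: algebra_simps)
  show "a + (c - a) * t \<in> {0..1}" if "0 \<le> t" "t \<le> 1" for t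
    using conv that assms by blast
  show "?\<psi> t \<in> {0..1}" if "0 \<le> t" "t \<le> 1" for t
    using conv[of a b "2 * t"] conv[of b c "2 * t - 1"] that assms by (cases "2 * t \<le> 1") auto
  show "path_join (\<lambda>t. p (a + (b - a) * t)) (\<lambda>t. p (b + (c - b) * t)) t = p (?\<psi> t)" for t
    by (auto simp: path_join_def)
qed auto

section \<open>The topology of the realization of a graph\<close>

lemma edge_path_ends [simp]:
  "edge_path G e 0 = Vertex (tail G e)" "edge_path G e 1 = Vertex (head G e)"
  by (auto simp: edge_path_def)

lemma edge_path_inner: "0 < t \<Longrightarrow> t < 1 \<Longrightarrow> edge_path G e t = Inner e t"
  by (auto simp: edge_path_def)

lemma edge_path_cases:
  obtains "t \<le> 0" "edge_path G e t = Vertex (tail G e)"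
  | "1 \<le> t" "edge_path G e t = Vertex (head G e)"
  | "0 < t" "t < 1" "edge_path G e t = Inner e t"
  by (cases "t \<le> 0"; cases "1 \<le> t") (auto simp: edge_path_def)

lemma edge_path_in_gpoints:
  assumes "wf_digraph G" "e \<in> arcs G"
  shows "edge_path G e t \<in> gpoints G"
  by (cases t G e rule: edge_path_cases)
     (use assms in \<open>auto simp: gpoints_def open_edge_def wf_digraph_def image_iff\<close>)

lemma gpoints_cases:
  assumes "x \<in> gpoints G"
  obtains (vertex) v where "v \<in> verts G" "x = Vertex v"
  | (inner) e t where "e \<in> arcs G" "0 < t" "t < 1" "x = Inner e t"
  using assms by (auto simp: gpoints_def open_edge_def)

lemma Vertex_in_gpoints [simp]: "Vertex v \<in> gpoints G \<longleftrightarrow> v \<in> verts G"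
  by (auto simp: gpoints_def open_edge_def image_iff)

lemma Inner_in_gpoints [simp]: "Inner e t \<in> gpoints G \<longleftrightarrow> e \<in> arcs G \<and> 0 < t \<and> t < 1"
  by (auto simp: gpoints_def open_edge_def image_iff)

lemma topspace_realization [simp]:
  assumes "wf_digraph G"
  shows "topspace (realization G) = gpoints G"
proof
  show "topspace (realization G) \<subseteq> gpoints G"
    using openin_topspace openin_realization by blast
  have "openin (realization G) (gpoints G)"
    unfolding openin_realization
  proof (intro conjI ballI)
    fix e assume "e \<in> arcs G"
    then have "{t \<in> {0..1}. edge_path G e t \<in> gpoints G} = topspace (top_of_set {0..1})"
      using edge_path_in_gpoints[OF assms] by auto
    then show "openin (top_of_set {0..1}) {t \<in> {0..1}. edge_path G e t \<in> gpoints G}"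
      by (simp only: openin_topspace)
  qed simp
  then show "gpoints G \<subseteq> topspace (realization G)"
    by (rule openin_subset)
qed

text \<open>This is the universal property of the gluing. The vertices are listed separately since
  an isolated vertex lies on no edge.\<close>

lemma continuous_map_realization:
  assumes "wf_digraph G"
  shows "continuous_map (realization G) Y f \<longleftrightarrow>
     (\<forall>v\<in>verts G. f (Vertex v) \<in> topspace Y) \<and> (\<forall>e\<in>arcs G. pathin Y (f \<circ> edge_path G e))"
proof safe
  assume f: "continuous_map (realization G) Y f"
  show "f (Vertex v) \<in> topspace Y" if "v \<in> verts G" for v
    using continuous_map_funspace[OF f] that assms by (auto simp: gpoints_def)
  fix e assume e: "e \<in> arcs G"
  show "pathin Y (f \<circ> edge_path G e)"
    unfolding pathin_def continuous_map_def
  proof safe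
    fix t :: real assume "t \<in> topspace (top_of_set {0..1})"
    then show "(f \<circ> edge_path G e) t \<in> topspace Y"
      using continuous_map_funspace[OF f] edge_path_in_gpoints[OF assms e] assms by auto
  next
    fix U assume "openin Y U"
    then have "openin (realization G) {x \<in> gpoints G. f x \<in> U}"
      using f assms by (auto simp: continuous_map_def)
    then have "openin (top_of_set {0..1}) {t \<in> {0..1}. edge_path G e t \<in> {x \<in> gpoints G. f x \<in> U}}"
      using e by (auto simp: openin_realization)
    moreover have "{t \<in> {0..1}. edge_path G e t \<in> {x \<in> gpoints G. f x \<in> U}} =
        {t \<in> topspace (top_of_set {0..1}). (f \<circ> edge_path G e) t \<in> U}"
      using edge_path_in_gpoints[OF assms e] by auto
    ultimately show "openin (top_of_set {0..1}) {t \<in> topspace (top_of_set {0..1}). (f \<circ> edge_path G e) t \<in> U}"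
      by simp
  qed
next
  assume v: "\<forall>v\<in>verts G. f (Vertex v) \<in> topspace Y" and e: "\<forall>e\<in>arcs G. pathin Y (f \<circ> edge_path G e)"
  have e': "f (edge_path G e t) \<in> topspace Y" if "e \<in> arcs G" "t \<in> {0..1}" for e t
    using e that path_image_subset_topspace by fastforce
  show "continuous_map (realization G) Y f"
    unfolding continuous_map_def
  proof safe
    fix x assume "x \<in> topspace (realization G)"
    then have "x \<in> gpoints G" using assms by simp
    then show "f x \<in> topspace Y"
    proof (cases rule: gpoints_cases)
      case (inner e t)
      then show ?thesis using e'[of e t] by (simp add: edge_path_inner)
    qed (use v in auto)
  next
    fix U assume U: "openin Y U"
    have "openin (top_of_set {0..1}) {t \<in> {0..1}. edge_path G e t \<in> {x \<in> gpoints G. f x \<in> U}}"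
      if "e \<in> arcs G" for e
    proof -
      have "openin (top_of_set {0..1}) {t \<in> topspace (top_of_set {0..1}). (f \<circ> edge_path G e) t \<in> U}"
        using e that U unfolding pathin_def continuous_map_def by blast
      moreover have "{t \<in> {0..1}. edge_path G e t \<in> {x \<in> gpoints G. f x \<in> U}} =
          {t \<in> topspace (top_of_set {0..1}). (f \<circ> edge_path G e) t \<in> U}"
        using edge_path_in_gpoints[OF assms that] by auto
      ultimately show ?thesis by simp
    qed
    then show "openin (realization G) {x \<in> topspace (realization G). f x \<in> U}"
      using assms by (auto simp: openin_realization)
  qed
qed

lemma pathin_edge_path [simp]:
  assumes "wf_digraph G" "e \<in> arcs G"
  shows "pathin (realization G) (edge_path G e)"
proof -
  have "continuous_map (realization G) (realization G) id" by simp
  then have "\<forall>e\<in>arcs G. pathin (realization G) (id \<circ> edge_path G e)"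
    using continuous_map_realization[OF assms(1)] by blast
  then show ?thesis using assms by simp
qed

text \<open>The product with \<open>Z\<close> distributes over disjoint unions. Together with the
  quotient map below it lets a homotopy on a realization be tested edge by edge.\<close>

lemma continuous_map_prod_sum_topology:
  assumes "\<And>i. i \<in> I \<Longrightarrow> continuous_map (prod_topology Z (X i)) Y (\<lambda>y. f (fst y, (i, snd y)))"
  shows "continuous_map (prod_topology Z (sum_topology X I)) Y f"
  unfolding continuous_map_def
proof safe
  fix z i x assume "(z, (i, x)) \<in> topspace (prod_topology Z (sum_topology X I))"
  then show "f (z, (i, x)) \<in> topspace Y"
    using continuous_map_funspace[OF assms[of i]] by (auto simp: Pi_iff)
next
  fix U assume U: "openin Y U"
  show "openin (prod_topology Z (sum_topology X I)) {x \<in> topspace (prod_topology Z (sum_topology X I)). f x \<in> U}"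
    unfolding openin_prod_topology_alt
  proof (intro allI impI)
    fix z w
    assume "(z, w) \<in> {x \<in> topspace (prod_topology Z (sum_topology X I)). f x \<in> U}"
    then obtain i x where w: "w = (i, x)" "i \<in> I" "x \<in> topspace (X i)" "z \<in> topspace Z" "f (z, (i, x)) \<in> U"
      by (cases w) auto
    have "openin (prod_topology Z (X i)) {y \<in> topspace (prod_topology Z (X i)). f (fst y, (i, snd y)) \<in> U}"
      using assms[OF w(2)] U by (auto simp: continuous_map_def)
    moreover have "(z, x) \<in> {y \<in> topspace (prod_topology Z (X i)). f (fst y, (i, snd y)) \<in> U}"
      using w by auto
    ultimately obtain A B where AB: "openin Z A" "openin (X i) B" "z \<in> A" "x \<in> B"
      "A \<times> B \<subseteq> {y \<in> topspace (prod_topology Z (X i)). f (fst y, (i, snd y)) \<in> U}"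
      unfolding openin_prod_topology_alt by meson
    have "openin (sum_topology X I) (Pair i ` B)"
      using open_map_component_injection[OF w(2), of X] AB(2) by (auto simp: open_map_def)
    moreover have "A \<times> (Pair i ` B) \<subseteq> {x \<in> topspace (prod_topology Z (sum_topology X I)). f x \<in> U}"
      using AB(5) w(2) by auto
    ultimately show "\<exists>U' V. openin Z U' \<and> openin (sum_topology X I) V \<and> z \<in> U' \<and> w \<in> V \<and>
        U' \<times> V \<subseteq> {x \<in> topspace (prod_topology Z (sum_topology X I)). f x \<in> U}"
      using AB w by blast
  qed
qed

text \<open>Each vertex receives an interval of its own, mapped constantly. This keeps all summands
  of one type and reaches isolated vertices.\<close>

lemma quotient_map_realization:
  assumes "wf_digraph G"
  shows "quotient_map (sum_topology (\<lambda>_. top_of_set {0..1::real}) (Inl ` verts G \<union> Inr ` arcs G))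
     (realization G) (\<lambda>(i, t). case i of Inl v \<Rightarrow> Vertex v | Inr e \<Rightarrow> edge_path G e t)"
    (is "quotient_map ?S _ ?Q")
  unfolding quotient_map_def
proof (intro conjI allI impI)
  show "?Q ` topspace ?S = topspace (realization G)"
  proof (intro Set.set_eqI iffI)
    fix x assume "x \<in> topspace (realization G)"
    then have "x \<in> gpoints G" using assms by simp
    then show "x \<in> ?Q ` topspace ?S"
    proof (cases rule: gpoints_cases)
      case (vertex v)
      then have "x = ?Q (Inl v, 0)" "(Inl v, 0) \<in> topspace ?S" by auto
      then show ?thesis by blast
    next
      case (inner e t)
      then have "x = ?Q (Inr e, t)" "(Inr e, t) \<in> topspace ?S" by (auto simp: edge_path_inner)
      then show ?thesis by blast
    qed
  qed (use assms edge_path_in_gpoints[OF assms] in auto)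
next
  fix U assume U: "U \<subseteq> topspace (realization G)"
  have 1: "{x. (Inl v, x) \<in> {x \<in> topspace ?S. ?Q x \<in> U}} = {t \<in> {0..1}. Vertex v \<in> U}" if "v \<in> verts G" for v
    using that by auto
  have 2: "{x. (Inr e, x) \<in> {x \<in> topspace ?S. ?Q x \<in> U}} = {t \<in> {0..1}. edge_path G e t \<in> U}" if "e \<in> arcs G" for e
    using that by auto
  have 3: "openin (top_of_set {0..1::real}) {t \<in> {0..1}. Vertex v \<in> U}" for v
  proof (cases "Vertex v \<in> U")
    case True
    then have "{t \<in> {0..1::real}. Vertex v \<in> U} = topspace (top_of_set {0..1})" by auto
    then show ?thesis by (simp only: openin_topspace)
  qed simp
  have "openin ?S {x \<in> topspace ?S. ?Q x \<in> U} \<longleftrightarrow>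
      (\<forall>i\<in>Inl ` verts G \<union> Inr ` arcs G. openin (top_of_set {0..1}) {x. (i, x) \<in> {x \<in> topspace ?S. ?Q x \<in> U}})"
    by (subst openin_sum_topology) auto
  also have "\<dots> \<longleftrightarrow> (\<forall>e\<in>arcs G. openin (top_of_set {0..1}) {t \<in> {0..1}. edge_path G e t \<in> U})"
    using 3 by (simp add: 1 2 ball_Un cong: ball_cong)
  finally show "openin ?S {x \<in> topspace ?S. ?Q x \<in> U} = openin (realization G) U"
    using U assms by (simp add: openin_realization)
qed

text \<open>The product of a quotient map with the identity of a locally compact Hausdorff space is
  again a quotient map. For the unit interval this allows homotopies to be glued from the
  edges.\<close>

lemma continuous_map_unit_prod_realization:
  assumes wf: "wf_digraph G"
    and v: "\<And>v. v \<in> verts G \<Longrightarrow> pathin Y (\<lambda>s. F (s, Vertex v))"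
    and e: "\<And>e. e \<in> arcs G \<Longrightarrow> continuous_map (top_of_set unit_square) Y (\<lambda>x. F (fst x, edge_path G e (snd x)))"
  shows "continuous_map (prod_topology (top_of_set {0..1::real}) (realization G)) Y F"
proof -
  let ?I = "top_of_set {0..1::real}"
  let ?S = "sum_topology (\<lambda>_. top_of_set {0..1::real}) (Inl ` verts G \<union> Inr ` arcs G)"
  let ?Q = "\<lambda>(i, t). case i of Inl v \<Rightarrow> Vertex v | Inr e \<Rightarrow> edge_path G e t"
  have "locally_compact_space ?I" "Hausdorff_space ?I"
    by (auto simp: compact_imp_locally_compact_space compact_space_subtopology compactin_euclidean_iff
        Hausdorff_space_subtopology)
  then have q: "quotient_map (prod_topology ?I ?S) (prod_topology ?I (realization G)) (\<lambda>(x, y). (x, ?Q y))"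
    using quotient_map_prod_right quotient_map_realization[OF wf] by blast
  have "continuous_map (prod_topology ?I ?S) Y (F \<circ> (\<lambda>(x, y). (x, ?Q y)))"
  proof (rule continuous_map_prod_sum_topology)
    fix i assume "i \<in> Inl ` verts G \<union> Inr ` arcs G"
    then show "continuous_map (prod_topology ?I ?I) Y (\<lambda>y. (F \<circ> (\<lambda>(x, y). (x, ?Q y))) (fst y, i, snd y))"
    proof
      assume "i \<in> Inl ` verts G"
      then obtain u where u: "u \<in> verts G" "i = Inl u" by auto
      have "continuous_map (prod_topology ?I ?I) Y ((\<lambda>s. F (s, Vertex u)) \<circ> fst)"
        using v[OF u(1)] unfolding pathin_def
        by (intro continuous_map_compose[OF continuous_map_fst])
      then show ?thesis using u by (simp add: o_def)
    next
      assume "i \<in> Inr ` arcs G"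
      then show ?thesis using e by (auto simp: o_def)
    qed
  qed
  from continuous_compose_quotient_map[OF q this] show ?thesis .
qed

lemma homotopic_realizationI:
  assumes wf: "wf_digraph G"
    and v: "\<And>v. v \<in> verts G \<Longrightarrow> pathin Y (\<lambda>s. F (s, Vertex v))"
    and e: "\<And>e. e \<in> arcs G \<Longrightarrow> continuous_map (top_of_set unit_square) Y (\<lambda>x. F (fst x, edge_path G e (snd x)))"
    and "\<And>x. x \<in> gpoints G \<Longrightarrow> F (0, x) = f x" "\<And>x. x \<in> gpoints G \<Longrightarrow> F (1, x) = k x"
  shows "homotopic_with (\<lambda>_. True) (realization G) Y f k"
proof -
  have "homotopic_with (\<lambda>_. True) (realization G) Y (\<lambda>x. F (0, x)) (\<lambda>x. F (1, x))"
    unfolding homotopic_with_def using continuous_map_unit_prod_realization[OF wf v e]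
    by (intro exI[of _ F]) auto
  then show ?thesis
    by (rule homotopic_with_eq) (use assms in auto)
qed

lemma homotopic_with_eq_on:
  assumes "homotopic_with (\<lambda>_. True) X Y f k" "\<And>x. x \<in> topspace X \<Longrightarrow> f' x = f x" "\<And>x. x \<in> topspace X \<Longrightarrow> k' x = k x"
  shows "homotopic_with (\<lambda>_. True) X Y f' k'"
  by (rule homotopic_with_eq[OF assms(1)]) (use assms in auto)

subsection \<open>Maps out of the rose\<close>

lemma wf_digraph_rose [simp]: "wf_digraph (rose g)"
  by unfold_locales (auto simp: rose_def)

lemma rose_simps [simp]: "arcs (rose g) = {..<g}" "verts (rose g) = UNIV"
  by (auto simp: rose_def)

fun rose_of :: "'a \<Rightarrow> (nat \<Rightarrow> real \<Rightarrow> 'a) \<Rightarrow> (unit, nat) gpoint \<Rightarrow> 'a" where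
  "rose_of x ps (Vertex _) = x"
| "rose_of x ps (Inner i t) = ps i t"

lemma rose_of_edge_path:
  assumes "ps i 0 = x" "ps i 1 = x" "0 \<le> t" "t \<le> 1"
  shows "rose_of x ps (edge_path (rose g) i t) = ps i t"
  using assms by (cases "t = 0"; cases "t = 1") (auto simp: edge_path_def)

lemma path_homotopic_rose_of:
  assumes "pathin Y (ps i)" "ps i 0 = x" "ps i 1 = x"
  shows "path_homotopic Y (rose_of x ps \<circ> edge_path (rose g) i) (ps i)"
  using assms by (intro path_homotopic_sym[OF path_homotopic_eq]) (auto simp: rose_of_edge_path)

lemma continuous_map_rose_of:
  assumes "x \<in> topspace Y" "\<And>i. i < g \<Longrightarrow> pathin Y (ps i) \<and> ps i 0 = x \<and> ps i 1 = x"
  shows "continuous_map (realization (rose g)) Y (rose_of x ps)"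
  unfolding continuous_map_realization[OF wf_digraph_rose]
proof safe
  fix i assume "i \<in> arcs (rose g)"
  then have i: "i < g" by simp
  show "pathin Y (rose_of x ps \<circ> edge_path (rose g) i)"
    by (rule path_homotopic_imp_pathin(1), rule path_homotopic_rose_of) (use assms(2)[OF i] in auto)
qed (use assms in simp)

lemma rose_loop:
  assumes "i < g" "continuous_map (realization (rose g)) Y k"
  shows "pathin Y (k \<circ> edge_path (rose g) i)" "(k \<circ> edge_path (rose g) i) 0 = k (Vertex ())"
    "(k \<circ> edge_path (rose g) i) 1 = k (Vertex ())"
  using assms by (auto intro!: pathin_compose)

text \<open>The homotopies of the single petals fix their ends, hence all of them stay at the image
  of the vertex and fit together there.\<close>

lemma homotopic_rose:
  assumes k: "continuous_map (realization (rose g)) Y k" and k': "continuous_map (realization (rose g)) Y k'"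
    and eq: "k (Vertex ()) = k' (Vertex ())"
    and h: "\<And>i. i < g \<Longrightarrow> path_homotopic Y (k \<circ> edge_path (rose g) i) (k' \<circ> edge_path (rose g) i)"
  shows "homotopic_with (\<lambda>_. True) (realization (rose g)) Y k k'"
proof -
  have "\<forall>i\<in>{..<g}. \<exists>H. continuous_map (top_of_set unit_square) Y H \<and>
       (\<forall>t\<in>{0..1}. H (0, t) = k (edge_path (rose g) i t)) \<and> (\<forall>t\<in>{0..1}. H (1, t) = k' (edge_path (rose g) i t)) \<and>
       (\<forall>s\<in>{0..1}. H (s, 0) = k (Vertex ()) \<and> H (s, 1) = k (Vertex ()))"
    using h unfolding path_homotopic_iff by (auto simp: o_def)
  then obtain H where H: "\<And>i. i < g \<Longrightarrow> continuous_map (top_of_set unit_square) Y (H i)"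
    "\<And>i t. i < g \<Longrightarrow> t\<in>{0..1} \<Longrightarrow> H i (0, t) = k (edge_path (rose g) i t)"
    "\<And>i t. i < g \<Longrightarrow> t\<in>{0..1} \<Longrightarrow> H i (1, t) = k' (edge_path (rose g) i t)"
    "\<And>i s. i < g \<Longrightarrow> s\<in>{0..1} \<Longrightarrow> H i (s, 0) = k (Vertex ()) \<and> H i (s, 1) = k (Vertex ())"
  proof -
    assume *: thesis if "\<And>i. i < g \<Longrightarrow> continuous_map (top_of_set unit_square) Y (H i)"
      "\<And>i t. i < g \<Longrightarrow> t\<in>{0..1} \<Longrightarrow> H i (0, t) = k (edge_path (rose g) i t)"
      "\<And>i t. i < g \<Longrightarrow> t\<in>{0..1} \<Longrightarrow> H i (1, t) = k' (edge_path (rose g) i t)"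
      "\<And>i s. i < g \<Longrightarrow> s\<in>{0..1} \<Longrightarrow> H i (s, 0) = k (Vertex ()) \<and> H i (s, 1) = k (Vertex ())" for H
    assume "\<forall>i\<in>{..<g}. \<exists>H. continuous_map (top_of_set unit_square) Y H \<and>
       (\<forall>t\<in>{0..1}. H (0, t) = k (edge_path (rose g) i t)) \<and> (\<forall>t\<in>{0..1}. H (1, t) = k' (edge_path (rose g) i t)) \<and>
       (\<forall>s\<in>{0..1}. H (s, 0) = k (Vertex ()) \<and> H (s, 1) = k (Vertex ()))"
    from bchoice[OF this] obtain H where "\<forall>i\<in>{..<g}. continuous_map (top_of_set unit_square) Y (H i) \<and>
       (\<forall>t\<in>{0..1}. H i (0, t) = k (edge_path (rose g) i t)) \<and> (\<forall>t\<in>{0..1}. H i (1, t) = k' (edge_path (rose g) i t)) \<and>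
       (\<forall>s\<in>{0..1}. H i (s, 0) = k (Vertex ()) \<and> H i (s, 1) = k (Vertex ()))" by blast
    then show thesis by (intro *[of H]) auto
  qed
  define F where "F = (\<lambda>(s, x). rose_of (k (Vertex ())) (\<lambda>i t. H i (s, t)) x)"
  have Fe: "F (s, edge_path (rose g) i t) = H i (s, t)" if "i < g" "s \<in> {0..1}" "t \<in> {0..1}" for s i t
    unfolding F_def using H(4)[OF that(1,2)] that by (simp add: rose_of_edge_path)
  have Fx: "F (0, x) = k x \<and> F (1, x) = k' x" if "x \<in> gpoints (rose g)" for x
    using that
  proof (cases rule: gpoints_cases)
    case (inner e t)
    then show ?thesis using Fe[of e 0 t] Fe[of e 1 t] H(2)[of e t] H(3)[of e t]
      by (auto simp: edge_path_inner)
  qed (auto simp: F_def eq)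
  show ?thesis
  proof (rule homotopic_realizationI[where F = F])
    show "pathin Y (\<lambda>s. F (s, Vertex v))" for v
      using continuous_map_funspace[OF k] by (auto simp: F_def Pi_iff)
    fix e assume "e \<in> arcs (rose g)"
    then show "continuous_map (top_of_set unit_square) Y (\<lambda>x. F (fst x, edge_path (rose g) e (snd x)))"
      using Fe by (intro continuous_map_eq[OF H(1)]) (auto simp: mem_Times_iff)
  qed (use Fx in auto)
qed

text \<open>The base point is dragged along \<open>c\<close>; the intermediate maps conjugate the
  petals by \<open>cs s\<close>, the part of \<open>c\<close> not yet run through. The conjugation
  by a constant path left over at the end is removed by a second homotopy.\<close>

lemma homotopic_rose_conj:
  assumes k: "continuous_map (realization (rose g)) Y k" and c: "pathin Y c" "c 1 = k (Vertex ())"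
  shows "homotopic_with (\<lambda>_. True) (realization (rose g)) Y
    (rose_of (c 0) (\<lambda>i. path_conj c (k \<circ> edge_path (rose g) i))) k"
proof -
  let ?p = "\<lambda>i. k \<circ> edge_path (rose g) i"
  define cs where "cs = (\<lambda>s u. c (s + (1 - s) * u))"
  let ?k1 = "rose_of (c 1) (\<lambda>i. path_conj (\<lambda>_. c 1) (?p i))"
  have p: "pathin Y (?p i)" "?p i 0 = c 1" "?p i 1 = c 1" if "i < g" for i
    using rose_loop[OF that k] c by auto
  have c1: "c 1 \<in> topspace Y" using path_finish_in_topspace[OF c(1)] .
  have L: "continuous_map (realization (rose g)) Y ?k1"
    using p c1 by (intro continuous_map_rose_of) auto
  have 1: "homotopic_with (\<lambda>_. True) (realization (rose g)) Y ?k1 k"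
  proof (rule homotopic_rose[OF L k])
    fix i assume i: "i < g"
    have "path_homotopic Y (?k1 \<circ> edge_path (rose g) i) (path_conj (\<lambda>_. c 1) (?p i))"
      using p[OF i] c1 by (intro path_homotopic_rose_of) auto
    also have "path_homotopic Y \<dots> (?p i)"
      using p[OF i] by (intro path_homotopic_conj_const_left) auto
    finally show "path_homotopic Y (?k1 \<circ> edge_path (rose g) i) (?p i)" .
  qed (simp add: c)
  define F where "F = (\<lambda>(s, x). rose_of (c s) (\<lambda>i. path_conj (cs s) (?p i)) x)"
  have bnd: "s + (1 - s) * u \<in> {0..1}" if "s \<in> {0..1}" "u \<in> {0..1}" for s u :: real
    using convexD_alt[of "{0..1::real}" s 1 u] that by (simp add: algebra_simps)
  have sq: "continuous_map (top_of_set unit_square) Y (\<lambda>x. path_conj (cs (fst x)) (?p i) (snd x))"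
    if i: "i < g" for i
  proof -
    let ?A = "\<lambda>x. cs (fst x) (snd x)" and ?B = "\<lambda>x. ?p i (snd x)" and ?C = "\<lambda>x. path_reverse (cs (fst x)) (snd x)"
    have A: "continuous_map (top_of_set unit_square) Y ?A"
      unfolding cs_def
      by (rule continuous_map_top_of_set_compose[OF c(1)[unfolded pathin_def]])
         (use bnd in \<open>auto intro!: continuous_intros simp del: atLeastAtMost_iff simp: mem_Times_iff\<close>)
    have B: "continuous_map (top_of_set unit_square) Y ?B"
      using p(1)[OF i] unfolding pathin_def
      by (rule continuous_map_top_of_set_compose) (auto intro!: continuous_intros)
    have C: "continuous_map (top_of_set unit_square) Y ?C"
      using continuous_map_top_of_set_compose[OF A, of unit_square "\<lambda>x. (fst x, 1 - snd x)"]
      by (simp add: path_reverse_def mem_Times_iff continuous_on_Pair continuous_on_diff continuous_on_fst continuous_on_snd)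
    have BC: "continuous_map (top_of_set unit_square) Y
       (\<lambda>x. if snd x \<le> 1/2 then ?B (fst x, 2 * snd x) else ?C (fst x, 2 * snd x - 1))"
      using p[OF i] by (intro continuous_map_square_join[OF B C]) (auto simp: cs_def)
    have "continuous_map (top_of_set unit_square) Y
       (\<lambda>x. if snd x \<le> 1/2 then ?A (fst x, 2 * snd x) else
         (\<lambda>x. if snd x \<le> 1/2 then ?B (fst x, 2 * snd x) else ?C (fst x, 2 * snd x - 1)) (fst x, 2 * snd x - 1))"
      using p[OF i] by (intro continuous_map_square_join[OF A BC]) (auto simp: cs_def)
    then show ?thesis
      by (simp only: path_conj_def path_join_def fst_conv snd_conv)
  qed
  have 2: "homotopic_with (\<lambda>_. True) (realization (rose g)) Y
     (rose_of (c 0) (\<lambda>i. path_conj c (?p i))) ?k1"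
  proof (rule homotopic_realizationI[where F = F])
    show "pathin Y (\<lambda>s. F (s, Vertex v))" for v
      using c by (auto simp: F_def)
    fix e assume "e \<in> arcs (rose g)"
    then have e: "e < g" by simp
    have "F (fst x, edge_path (rose g) e (snd x)) = path_conj (cs (fst x)) (?p e) (snd x)" if "x \<in> unit_square" for x
      unfolding F_def using that by (simp add: mem_Times_iff, intro rose_of_edge_path) (auto simp: cs_def)
    then show "continuous_map (top_of_set unit_square) Y (\<lambda>x. F (fst x, edge_path (rose g) e (snd x)))"
      by (intro continuous_map_eq[OF sq[OF e]]) auto
  next
    have "cs 0 = c" "cs 1 = (\<lambda>_. c 1)" by (auto simp: cs_def)
    then show "F (0, x) = rose_of (c 0) (\<lambda>i. path_conj c (?p i)) x" "F (1, x) = ?k1 x" for x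
      by (auto simp: F_def)
  qed simp
  from homotopic_with_trans[OF 2 1] show ?thesis .
qed

section \<open>Paths in the realization of a graph\<close>

lemma convex_comb_in_unit:
  fixes a b t :: real
  assumes "a \<in> {0..1}" "b \<in> {0..1}" "0 \<le> t" "t \<le> 1"
  shows "a + (b - a) * t \<in> {0..1}"
  using convexD_alt[of "{0..1::real}" a b t] assms by (simp add: algebra_simps)

lemma convex_comb_in_open_unit:
  fixes a b t :: real
  assumes "a \<in> {0..1}" "b \<in> {0..1}" "a \<noteq> b" "0 < t" "t < 1"
  shows "0 < a + (b - a) * t" "a + (b - a) * t < 1"
proof -
  have eq: "a + (b - a) * t = (1 - t) * a + t * b" by (simp add: algebra_simps)
  have "0 < (1 - t) * a + t * b"
  proof (cases "a = 0")
    case True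
    then show ?thesis using assms by (simp add: mult_pos_pos)
  next
    case False
    then have "0 < (1 - t) * a" "0 \<le> t * b" using assms by auto
    then show ?thesis by linarith
  qed
  then show "0 < a + (b - a) * t" using eq by simp
  have "0 < (1 - t) * (1 - a) + t * (1 - b)"
  proof (cases "a = 1")
    case True
    then show ?thesis using assms by (simp add: mult_pos_pos)
  next
    case False
    then have "0 < (1 - t) * (1 - a)" "0 \<le> t * (1 - b)" using assms by auto
    then show ?thesis by linarith
  qed
  then show "a + (b - a) * t < 1" by (simp add: algebra_simps)
qed

subsection \<open>Collapsing the ends of all edges\<close>

text \<open>At \<open>s = 1\<close> the outer thirds of an edge go to its ends and the middle third
  is stretched over the edge. The parameter \<open>3 * t - 1\<close> recurs at the end of the
  deformation that slides a vertex along an edge.\<close>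

definition collapse_param :: "real \<Rightarrow> real \<Rightarrow> real" where
  "collapse_param s t = (1 - s) * t + s * max 0 (min 1 (3 * t - 1))"

fun collapse_homotopy :: "('v, 'e) pre_digraph \<Rightarrow> real \<times> ('v, 'e) gpoint \<Rightarrow> ('v, 'e) gpoint" where
  "collapse_homotopy G (s, Vertex v) = Vertex v"
| "collapse_homotopy G (s, Inner e t) = edge_path G e (collapse_param s t)"

definition collapse :: "('v, 'e) pre_digraph \<Rightarrow> ('v, 'e) gpoint \<Rightarrow> ('v, 'e) gpoint" where
  "collapse G x = collapse_homotopy G (1, x)"

lemma collapse_param_in_unit:
  "s \<in> {0..1} \<Longrightarrow> t \<in> {0..1} \<Longrightarrow> collapse_param s t \<in> {0..1}"
  using convexD_alt[of "{0..1::real}" t "max 0 (min 1 (3 * t - 1))" s]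
  by (simp add: collapse_param_def)

lemma collapse_homotopy_edge_path:
  assumes "t \<in> {0..1}"
  shows "collapse_homotopy G (s, edge_path G e t) = edge_path G e (collapse_param s t)"
proof -
  consider "t = 0" | "t = 1" | "0 < t" "t < 1" using assms by fastforce
  then show ?thesis
    by cases (auto simp: edge_path_inner collapse_param_def)
qed

lemma collapse_edge_path:
  assumes "t \<in> {0..1}"
  shows "collapse G (edge_path G e t) = edge_path G e (3 * t - 1)"
  using collapse_homotopy_edge_path[OF assms, of G 1 e]
  by (auto simp: collapse_def collapse_param_def edge_path_def max_def min_def)

lemma continuous_map_collapse_homotopy:
  assumes wf: "wf_digraph G"
  shows "continuous_map (prod_topology (top_of_set {0..1::real}) (realization G)) (realization G) (collapse_homotopy G)"
proof (rule continuous_map_unit_prod_realization[OF wf])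
  fix e assume e: "e \<in> arcs G"
  have "continuous_map (top_of_set unit_square) (realization G) (\<lambda>x. edge_path G e (collapse_param (fst x) (snd x)))"
    by (rule continuous_map_top_of_set_compose[OF pathin_edge_path[OF wf e, unfolded pathin_def]])
       (auto simp: collapse_param_def[abs_def] mem_Times_iff simp del: atLeastAtMost_iff
         intro!: continuous_intros collapse_param_in_unit[unfolded collapse_param_def])
  then show "continuous_map (top_of_set unit_square) (realization G) (\<lambda>x. collapse_homotopy G (fst x, edge_path G e (snd x)))"
    by (rule continuous_map_eq) (auto simp: collapse_homotopy_edge_path)
qed (use wf in auto)

lemma homotopic_collapse:
  assumes wf: "wf_digraph G"
  shows "homotopic_with (\<lambda>_. True) (realization G) (realization G) id (collapse G)"
proof -
  have "homotopic_with (\<lambda>_. True) (realization G) (realization G)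
      (\<lambda>x. collapse_homotopy G (0, x)) (\<lambda>x. collapse_homotopy G (1, x))"
    unfolding homotopic_with_def using continuous_map_collapse_homotopy[OF wf] by auto
  then show ?thesis
  proof (rule homotopic_with_eq_on)
    fix x assume "x \<in> topspace (realization G)"
    then have "x \<in> gpoints G" using wf by simp
    then show "id x = collapse_homotopy G (0, x)"
      by (cases rule: gpoints_cases) (auto simp: collapse_param_def edge_path_inner)
  qed (simp add: collapse_def)
qed

subsection \<open>Walks\<close>

definition seg :: "('v, 'e) pre_digraph \<Rightarrow> 'e \<Rightarrow> real \<Rightarrow> real \<Rightarrow> real \<Rightarrow> ('v, 'e) gpoint" where
  "seg G e a b t = edge_path G e (a + (b - a) * t)"

text \<open>A triple \<open>(e, a, b)\<close> runs along \<open>e\<close> from parameter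
  \<open>a\<close> to \<open>b\<close>, in either direction and not necessarily over the whole edge.
  The point argument serves as the value of the empty walk.\<close>

fun walk :: "('v, 'e) pre_digraph \<Rightarrow> ('v, 'e) gpoint \<Rightarrow> ('e \<times> real \<times> real) list \<Rightarrow> real \<Rightarrow> ('v, 'e) gpoint" where
  "walk G x [] = (\<lambda>_. x)"
| "walk G x ((e, a, b) # l) = path_join (seg G e a b) (walk G (edge_path G e b) l)"

fun is_walk :: "('v, 'e) pre_digraph \<Rightarrow> 'e set \<Rightarrow> ('v, 'e) gpoint \<Rightarrow> ('e \<times> real \<times> real) list \<Rightarrow> ('v, 'e) gpoint \<Rightarrow> bool" where
  "is_walk G E x [] y \<longleftrightarrow> x = y \<and> x \<in> gpoints G"
| "is_walk G E x ((e, a, b) # l) y \<longleftrightarrow>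
     e \<in> E \<and> a \<in> {0..1} \<and> b \<in> {0..1} \<and> x = edge_path G e a \<and> is_walk G E (edge_path G e b) l y"

lemma seg_ends [simp]: "seg G e a b 0 = edge_path G e a" "seg G e a b 1 = edge_path G e b"
  by (auto simp: seg_def)

lemma seg_const [simp]: "seg G e a a = (\<lambda>_. edge_path G e a)"
  by (auto simp: seg_def)

lemma pathin_seg:
  assumes "wf_digraph G" "e \<in> arcs G" "a \<in> {0..1}" "b \<in> {0..1}"
  shows "pathin (realization G) (seg G e a b)"
  using pathin_sub[OF pathin_edge_path[OF assms(1,2)] assms(3,4)] by (simp add: seg_def[abs_def])

lemma walk_props:
  assumes "is_walk G E x l y" "wf_digraph G" "E \<subseteq> arcs G"
  shows "pathin (realization G) (walk G x l)" "walk G x l 0 = x" "walk G x l 1 = y"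
proof -
  have "pathin (realization G) (walk G x l) \<and> walk G x l 0 = x \<and> walk G x l 1 = y"
    using assms(1)
  proof (induction l arbitrary: x)
    case Nil
    then show ?case using assms by auto
  next
    case (Cons s l)
    obtain e a b where s: "s = (e, a, b)" by (cases s) auto
    with Cons assms(3) have "e \<in> arcs G" "a \<in> {0..1}" "b \<in> {0..1}" by auto
    with Cons s pathin_seg[OF assms(2), of e a b] show ?case by auto
  qed
  then show "pathin (realization G) (walk G x l)" "walk G x l 0 = x" "walk G x l 1 = y" by auto
qed

lemma is_walk_append:
  "is_walk G E x l y \<Longrightarrow> is_walk G E y l' z \<Longrightarrow> is_walk G E x (l @ l') z"
  by (induction G E x l y rule: is_walk.induct) auto

lemma walk_append:
  assumes "is_walk G E x l y" "is_walk G E y l' z" "wf_digraph G" "E \<subseteq> arcs G"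
  shows "path_homotopic (realization G) (walk G x (l @ l')) (path_join (walk G x l) (walk G y l'))"
  using assms(1)
proof (induction l arbitrary: x)
  case Nil
  then have "x = y" by simp
  then show ?case
    using path_homotopic_lid[of "realization G" "walk G y l'"] walk_props[OF assms(2-4)]
    by (auto intro: path_homotopic_sym)
next
  case (Cons s l)
  obtain e a b where s: "s = (e, a, b)" by (cases s) auto
  with Cons assms(4) have ab: "e \<in> arcs G" "a \<in> {0..1}" "b \<in> {0..1}" "x = edge_path G e a"
    and w: "is_walk G E (edge_path G e b) l y" by auto
  note sg = pathin_seg[OF assms(3) ab(1-3)]
  note wp = walk_props[OF w assms(3,4)] walk_props[OF assms(2-4)]
    walk_props[OF is_walk_append[OF w assms(2)] assms(3,4)]
  have "path_homotopic (realization G) (path_join (seg G e a b) (walk G (edge_path G e b) (l @ l')))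
      (path_join (seg G e a b) (path_join (walk G (edge_path G e b) l) (walk G y l')))"
    using sg wp by (intro path_homotopic_join[OF _ Cons.IH[OF w]]) auto
  also have "path_homotopic (realization G) \<dots>
      (path_join (path_join (seg G e a b) (walk G (edge_path G e b) l)) (walk G y l'))"
    using sg wp by (intro path_homotopic_sym[OF path_homotopic_assoc]) auto
  finally show ?case by (simp add: s)
qed

lemma walk_single:
  assumes "wf_digraph G" "e \<in> arcs G" "a \<in> {0..1}" "b \<in> {0..1}"
  shows "path_homotopic (realization G) (walk G x [(e, a, b)]) (seg G e a b)"
  using path_homotopic_rid[OF pathin_seg[OF assms]] by simp

text \<open>The edges met by a path are recorded, so that the results below also apply to paths in
  subgraphs.\<close>

definition meets_only :: "'e set \<Rightarrow> (real \<Rightarrow> ('v, 'e) gpoint) \<Rightarrow> bool" where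
  "meets_only E p \<longleftrightarrow> (\<forall>t\<in>{0..1}. \<forall>e s. p t = Inner e s \<longrightarrow> e \<in> E)"

lemma meets_onlyD: "meets_only E p \<Longrightarrow> 0 \<le> t \<Longrightarrow> t \<le> 1 \<Longrightarrow> p t = Inner e s \<Longrightarrow> e \<in> E"
  by (auto simp: meets_only_def)

text \<open>The radius 1/3 matches \<open>collapse_param\<close>: the deformation ends with the
  whole star at its vertex. A loop contributes both of its ends.\<close>

definition star :: "('v, 'e) pre_digraph \<Rightarrow> 'v \<Rightarrow> ('v, 'e) gpoint set" where
  "star G v = insert (Vertex v) {Inner e t |e t. e \<in> arcs G \<and> 0 < t \<and> t < 1 \<and>
     (tail G e = v \<and> t < 1/3 \<or> head G e = v \<and> 2/3 < t)}"

lemma openin_star: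
  assumes wf: "wf_digraph G" "v \<in> verts G"
  shows "openin (realization G) (star G v)"
  unfolding openin_realization
proof (intro conjI ballI)
  show "star G v \<subseteq> gpoints G" using assms by (auto simp: star_def)
  fix e assume e: "e \<in> arcs G"
  have "{t \<in> {0..1}. edge_path G e t \<in> star G v} = {0..1} \<inter>
      ((if tail G e = v then {..<1/3} else {}) \<union> (if head G e = v then {2/3<..} else {}))"
    using e by (auto simp: star_def edge_path_def split: if_splits)
  moreover have "open ((if tail G e = v then {..<1/3::real} else {}) \<union> (if head G e = v then {2/3<..} else {}))"
    by auto
  ultimately show "openin (top_of_set {0..1}) {t \<in> {0..1}. edge_path G e t \<in> star G v}"
    by (simp only: openin_open_Int)
qed

lemma collapse_star: "x \<in> star G v \<Longrightarrow> collapse_homotopy G (1, x) = Vertex v"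
  by (auto simp: star_def collapse_param_def edge_path_def)

text \<open>The square of the deformation along \<open>q\<close> has a constant side at time 1, so
  \<open>q\<close> is homotopic to the trace of its start followed by the reversed trace of its end.
  Each trace is a single segment of an edge, or trivial at the vertex.\<close>

lemma walk_in_star:
  assumes wf: "wf_digraph G" and q: "pathin (realization G) q" and E: "meets_only E q" "E \<subseteq> arcs G"
    and st: "\<And>t. t \<in> {0..1} \<Longrightarrow> q t \<in> star G v" and v: "v \<in> verts G"
  shows "\<exists>l. is_walk G E (q 0) l (q 1) \<and> path_homotopic (realization G) q (walk G (q 0) l)"
proof -
  let ?R = "realization G" and ?K = "collapse_homotopy G"
  have "continuous_map (top_of_set unit_square) (realization G) (\<lambda>x. q (snd x))"
    using q unfolding pathin_def
    by (rule continuous_map_top_of_set_compose) (auto intro!: continuous_intros)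
  then have "continuous_map (top_of_set unit_square) ?R (\<lambda>x. ?K (fst x, q (snd x)))"
    by (intro continuous_map_unit_prod[OF continuous_map_collapse_homotopy[OF wf]])
       (auto intro!: continuous_intros simp: continuous_map_in_subtopology)
  then have "continuous_map (top_of_set unit_square) ?R (\<lambda>(s, t). ?K (s, q t))"
    by (simp add: case_prod_unfold)
  from path_homotopic_square[OF this]
  have sq: "path_homotopic ?R (path_join (\<lambda>t. ?K (0, q t)) (\<lambda>s. ?K (s, q 1)))
      (path_join (\<lambda>s. ?K (s, q 0)) (\<lambda>t. ?K (1, q t)))" by simp
  have gp: "q t \<in> gpoints G" if "t \<in> {0..1}" for t
    using path_image_subset_topspace[OF q] that wf by auto
  have K0: "?K (0, x) = x" if "x \<in> gpoints G" for x
    using that by (cases rule: gpoints_cases) (auto simp: collapse_param_def edge_path_inner)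
  have track: "\<exists>l l'. is_walk G E (q t) l (Vertex v) \<and> is_walk G E (Vertex v) l' (q t) \<and>
      path_homotopic ?R (\<lambda>s. ?K (s, q t)) (walk G (q t) l) \<and>
      path_homotopic ?R (path_reverse (\<lambda>s. ?K (s, q t))) (walk G (Vertex v) l')" if t: "t \<in> {0..1}" for t
  proof (cases "q t")
    case (Vertex u)
    then have "u = v" using collapse_star[OF st[OF t]] by simp
    then show ?thesis using Vertex v wf by (intro exI[of _ "[]"]) auto
  next
    case (Inner e a)
    then have e: "e \<in> E" "e \<in> arcs G" and a: "0 < a" "a < 1"
      using E t gp[OF t] by (auto simp: meets_only_def)
    \<comment> \<open>In the star this is 0 or 1, according to the end of the edge that is closer;
      the trace runs linearly from \<open>a\<close> to \<open>b\<close>.\<close>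
    define b where "b = max 0 (min 1 (3 * a - 1))"
    have b: "b \<in> {0..1}" by (auto simp: b_def)
    have vb: "edge_path G e b = Vertex v"
      using collapse_star[OF st[OF t]] Inner by (simp add: collapse_param_def b_def)
    have eq: "(\<lambda>s. ?K (s, q t)) = seg G e a b"
      by (rule ext) (simp add: Inner collapse_param_def seg_def b_def algebra_simps)
    have eq': "path_reverse (seg G e a b) = seg G e b a"
      by (rule ext) (simp add: path_reverse_def seg_def algebra_simps)
    have "is_walk G E (q t) [(e, a, b)] (Vertex v)" "is_walk G E (Vertex v) [(e, b, a)] (q t)"
      using e a b vb Inner v by (auto simp: edge_path_inner)
    moreover have "path_homotopic ?R (\<lambda>s. ?K (s, q t)) (walk G (q t) [(e, a, b)])"
      unfolding eq using a b by (intro path_homotopic_sym[OF walk_single[OF wf e(2)]]) auto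
    moreover have "path_homotopic ?R (path_reverse (\<lambda>s. ?K (s, q t))) (walk G (Vertex v) [(e, b, a)])"
      unfolding eq eq' using a b by (intro path_homotopic_sym[OF walk_single[OF wf e(2)]]) auto
    ultimately show ?thesis by blast
  qed
  obtain l where l: "is_walk G E (q 0) l (Vertex v)" "path_homotopic ?R (\<lambda>s. ?K (s, q 0)) (walk G (q 0) l)"
    using track[of 0] by auto
  obtain l' where l': "is_walk G E (Vertex v) l' (q 1)"
    "path_homotopic ?R (path_reverse (\<lambda>s. ?K (s, q 1))) (walk G (Vertex v) l')"
    using track[of 1] by auto
  have Kq: "path_homotopic ?R (\<lambda>t. ?K (0, q t)) q"
    using K0 gp by (intro path_homotopic_sym[OF path_homotopic_eq[OF q]]) auto
  have K1: "path_homotopic ?R (\<lambda>t. ?K (1, q t)) (\<lambda>_. Vertex v)"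
    using collapse_star[OF st] v wf by (intro path_homotopic_sym[OF path_homotopic_eq]) auto
  have p1: "pathin ?R (\<lambda>s. ?K (s, q 1))" using path_homotopic_imp_pathin(1)[OF l'(2)] by simp
  have p0: "pathin ?R (\<lambda>s. ?K (s, q 0))" using path_homotopic_imp_pathin(1)[OF l(2)] by simp
  have "path_homotopic ?R q (\<lambda>t. ?K (0, q t))" using Kq by (rule path_homotopic_sym)
  also have "path_homotopic ?R \<dots>
      (path_join (\<lambda>s. ?K (s, q 0)) (path_join (\<lambda>t. ?K (1, q t)) (path_reverse (\<lambda>s. ?K (s, q 1)))))"
    using path_homotopic_imp_pathin[OF Kq] path_homotopic_imp_pathin[OF K1] p0 p1
    by (intro path_homotopic_cancel_right[OF sq]) auto
  also have "path_homotopic ?R \<dots> (path_join (walk G (q 0) l) (path_join (\<lambda>_. Vertex v) (walk G (Vertex v) l')))"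
    by (rule path_homotopic_join[OF l(2) path_homotopic_join[OF K1 l'(2)]]) simp_all
  also have "path_homotopic ?R \<dots> (path_join (walk G (q 0) l) (walk G (Vertex v) l'))"
    using path_homotopic_lid[of ?R "walk G (Vertex v) l'"] walk_props[OF l'(1) wf E(2)] walk_props[OF l(1) wf E(2)]
    by (intro path_homotopic_join) auto
  also have "path_homotopic ?R \<dots> (walk G (q 0) (l @ l'))"
    by (rule path_homotopic_sym[OF walk_append[OF l(1) l'(1) wf E(2)]])
  finally show ?thesis using is_walk_append[OF l(1) l'(1)] by blast
qed

lemma openin_Inner:
  assumes "e \<in> arcs G" "open U"
  shows "openin (realization G) (Inner e ` (U \<inter> {0<..<1}))"
  unfolding openin_realization
proof (intro conjI ballI)
  show "Inner e ` (U \<inter> {0<..<1}) \<subseteq> gpoints G" using assms by auto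
  fix d assume "d \<in> arcs G"
  have "{t \<in> {0..1}. edge_path G d t \<in> Inner e ` (U \<inter> {0<..<1})} = {0..1} \<inter> (if d = e then U \<inter> {0<..<1} else {})"
    by (auto simp: edge_path_def split: if_splits)
  moreover have "open (if d = e then U \<inter> {0<..<1} else {})" using assms by auto
  ultimately show "openin (top_of_set {0..1}) {t \<in> {0..1}. edge_path G d t \<in> Inner e ` (U \<inter> {0<..<1})}"
    by (simp only: openin_open_Int)
qed

lemma openin_open_edge: "e \<in> arcs G \<Longrightarrow> openin (realization G) (open_edge e)"
  using openin_Inner[of e G UNIV] by (simp add: open_edge_def)

text \<open>Within an open edge the path is a real function \<open>c\<close>, continuous because
  open sets of parameters give open sets of the realization. It is straightened linearly.\<close>

lemma walk_in_open_edge: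
  assumes wf: "wf_digraph G" and q: "pathin (realization G) q" and E: "meets_only E q" "E \<subseteq> arcs G"
    and st: "\<And>t. t \<in> {0..1} \<Longrightarrow> q t \<in> open_edge e" and e: "e \<in> arcs G"
  shows "\<exists>l. is_walk G E (q 0) l (q 1) \<and> path_homotopic (realization G) q (walk G (q 0) l)"
proof -
  define c where "c t = (case q t of Inner _ s \<Rightarrow> s)" for t
  have c: "q t = Inner e (c t)" "0 < c t" "c t < 1" if "t \<in> {0..1}" for t
    using st[OF that] by (auto simp: c_def open_edge_def)
  have eE: "e \<in> E" using meets_onlyD[OF E(1) _ _ c(1)[of 0]] by simp
  have "continuous_on {0..1} c"
    unfolding continuous_on_open_invariant
  proof (intro allI impI)
    fix B :: "real set" assume "open B"
    then have "openin (top_of_set {0..1}) {t \<in> topspace (top_of_set {0..1}). q t \<in> Inner e ` (B \<inter> {0<..<1})}"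
      using q openin_Inner[OF e] unfolding pathin_def continuous_map_def by blast
    moreover have "{t \<in> topspace (top_of_set {0..1}). q t \<in> Inner e ` (B \<inter> {0<..<1})} = c -` B \<inter> {0..1}"
      using c by auto
    ultimately have "openin (top_of_set {0..1}) (c -` B \<inter> {0..1})" by simp
    then show "\<exists>A. open A \<and> A \<inter> {0..1} = c -` B \<inter> {0..1}"
      by (auto simp: openin_open)
  qed
  then have "path_homotopic (realization G) (\<lambda>t. edge_path G e (c t)) (\<lambda>t. edge_path G e (c 0 + (c 1 - c 0) * t))"
    using c convex_comb_in_unit[of "c 0" "c 1"]
    by (intro path_homotopic_convex[of "{0..1}"] pathin_edge_path[OF wf e, unfolded pathin_def])
       (auto intro!: continuous_intros simp: less_imp_le)
  moreover have "path_homotopic (realization G) q (\<lambda>t. edge_path G e (c t))"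
    using c by (intro path_homotopic_eq[OF q]) (auto simp: edge_path_inner)
  ultimately have "path_homotopic (realization G) q (seg G e (c 0) (c 1))"
    using path_homotopic_trans by (simp add: seg_def[abs_def]) blast
  moreover have "path_homotopic (realization G) (seg G e (c 0) (c 1)) (walk G (q 0) [(e, c 0, c 1)])"
    using c[of 0] c[of 1] by (intro path_homotopic_sym[OF walk_single[OF wf e]]) auto
  ultimately have "path_homotopic (realization G) q (walk G (q 0) [(e, c 0, c 1)])"
    using path_homotopic_trans by blast
  moreover have "is_walk G E (q 0) [(e, c 0, c 1)] (q 1)"
    using c[of 0] c[of 1] eE e by (auto simp: edge_path_inner)
  ultimately show ?thesis by blast
qed

text \<open>Being homotopic to a walk is additive under subdivision and holds for short pieces
  because stars and open edges are open, so it passes to the whole interval by bisection.\<close>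

theorem path_homotopic_walk:
  assumes wf: "wf_digraph G" and p: "pathin (realization G) p" and E: "meets_only E p" "E \<subseteq> arcs G"
  shows "\<exists>l. is_walk G E (p 0) l (p 1) \<and> path_homotopic (realization G) p (walk G (p 0) l)"
proof -
  let ?q = "\<lambda>a b t. p (a + (b - a) * t)"
  \<comment> \<open>Membership in the unit interval is part of the implication because the bisection
    rule also tests intervals that reach beyond it.\<close>
  define P where "P a b \<longleftrightarrow> (a \<in> {0..1} \<longrightarrow> b \<in> {0..1} \<longrightarrow>
      (\<exists>l. is_walk G E (p a) l (p b) \<and> path_homotopic (realization G) (?q a b) (walk G (p a) l)))" for a b
  have "P 0 1"
  proof (rule Bolzano)
    fix a b c assume *: "P a b" "P b c" "a \<le> b" "b \<le> c"
    show "P a c"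
      unfolding P_def
    proof (intro impI)
      assume "a \<in> {0..1}" "c \<in> {0..1}"
      with * have ab: "a \<in> {0..1}" "b \<in> {0..1}" "c \<in> {0..1}" by auto
      with * obtain l l' where l: "is_walk G E (p a) l (p b)" "path_homotopic (realization G) (?q a b) (walk G (p a) l)"
        and l': "is_walk G E (p b) l' (p c)" "path_homotopic (realization G) (?q b c) (walk G (p b) l')"
        unfolding P_def by blast
      have "path_homotopic (realization G) (?q a c) (path_join (?q a b) (?q b c))"
        by (rule path_homotopic_sub_join[OF p ab])
      also have "path_homotopic (realization G) \<dots> (path_join (walk G (p a) l) (walk G (p b) l'))"
        using l l' by (intro path_homotopic_join) auto
      also have "path_homotopic (realization G) \<dots> (walk G (p a) (l @ l'))"
        by (rule path_homotopic_sym[OF walk_append[OF l(1) l'(1) wf E(2)]])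
      finally show "\<exists>l. is_walk G E (p a) l (p c) \<and> path_homotopic (realization G) (?q a c) (walk G (p a) l)"
        using is_walk_append[OF l(1) l'(1)] by blast
    qed
  next
    fix x :: real assume x: "0 \<le> x" "x \<le> 1"
    have sub: "meets_only E (?q a b)" "pathin (realization G) (?q a b)" if "a \<in> {0..1}" "b \<in> {0..1}" for a b
      using meets_onlyD[OF E(1)] convex_comb_in_unit[OF that] pathin_sub[OF p that]
      by (auto simp: meets_only_def) blast
    obtain U where U: "openin (realization G) U" "p x \<in> U"
      and Uw: "\<And>q. pathin (realization G) q \<Longrightarrow> meets_only E q \<Longrightarrow> (\<And>t. t \<in> {0..1} \<Longrightarrow> q t \<in> U) \<Longrightarrow>
         \<exists>l. is_walk G E (q 0) l (q 1) \<and> path_homotopic (realization G) q (walk G (q 0) l)"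
    proof -
      have "p x \<in> gpoints G" using path_image_subset_topspace[OF p] x wf by auto
      then show thesis
      proof (cases rule: gpoints_cases)
        case (vertex v)
        show thesis
        proof (rule that)
          show "openin (realization G) (star G v)" using vertex openin_star[OF wf] by simp
          show "p x \<in> star G v" using vertex by (simp add: star_def)
        qed (use vertex walk_in_star[OF wf _ _ E(2)] in blast)
      next
        case (inner e t)
        show thesis
        proof (rule that)
          show "openin (realization G) (open_edge e)" by (rule openin_open_edge[OF inner(1)])
          show "p x \<in> open_edge e" using inner by (simp add: open_edge_def)
        qed (use inner walk_in_open_edge[OF wf _ _ E(2)] in blast)
      qed
    qed
    have "openin (top_of_set {0..1}) {t \<in> topspace (top_of_set {0..1}). p t \<in> U}"
      using p U(1) unfolding pathin_def continuous_map_def by blast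
    moreover have "x \<in> {t \<in> topspace (top_of_set {0..1}). p t \<in> U}" using x U(2) by simp
    ultimately have "\<exists>d>0. \<forall>t\<in>{0..1}. dist t x < d \<longrightarrow> t \<in> {t \<in> topspace (top_of_set {0..1}). p t \<in> U}"
      unfolding openin_euclidean_subtopology_iff by blast
    then obtain d where d: "d > 0" "\<And>t. t \<in> {0..1} \<Longrightarrow> dist t x < d \<Longrightarrow> p t \<in> U"
      by auto
    show "\<exists>d>0. \<forall>a b. a \<le> x \<and> x \<le> b \<and> b - a < d \<longrightarrow> P a b"
    proof (intro exI conjI allI impI)
      show "d > 0" by fact
      fix a b assume ab: "a \<le> x \<and> x \<le> b \<and> b - a < d"
      show "P a b"
        unfolding P_def
      proof (intro impI)
        assume abI: "a \<in> {0..1}" "b \<in> {0..1}"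
        have "?q a b t \<in> U" if t: "t \<in> {0..1}" for t
        proof (rule d(2))
          show "a + (b - a) * t \<in> {0..1}" using convex_comb_in_unit[OF abI] t by auto
          have "0 \<le> (b - a) * t" "(b - a) * t \<le> b - a" using t ab by (auto simp: mult_left_le)
          then show "dist (a + (b - a) * t) x < d" using ab by (auto simp: dist_real_def abs_if)
        qed
        from Uw[OF sub(2)[OF abI] sub(1)[OF abI] this]
        show "\<exists>l. is_walk G E (p a) l (p b) \<and> path_homotopic (realization G) (?q a b) (walk G (p a) l)"
          by simp
      qed
    qed
  qed simp
  then show ?thesis by (simp add: P_def)
qed

subsection \<open>Reduced walks\<close>

text \<open>Consecutive segments meet at vertices and do not return through the end of the edge just
  reached. A loop may be run through repeatedly in one direction, since its two ends carry different
  parameters.\<close>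

fun reduced_walk :: "('e \<times> real \<times> real) list \<Rightarrow> bool" where
  "reduced_walk [] \<longleftrightarrow> True"
| "reduced_walk [(e, a, b)] \<longleftrightarrow> a \<noteq> b"
| "reduced_walk ((e, a, b) # (e', a', b') # l) \<longleftrightarrow> a \<noteq> b \<and> b \<in> {0, 1} \<and> a' \<in> {0, 1} \<and> (e, b) \<noteq> (e', a') \<and>
     reduced_walk ((e', a', b') # l)"

lemma edge_path_eq_Vertex: "edge_path G e t = Vertex v \<Longrightarrow> t \<in> {0..1} \<Longrightarrow> t \<in> {0, 1}"
  by (auto simp: edge_path_def split: if_splits)

lemma edge_path_eq_edge_path:
  assumes "edge_path G e b = edge_path G e' a" "b \<in> {0..1}" "a \<in> {0..1}"
  shows "b \<in> {0, 1} \<and> a \<in> {0, 1} \<or> e = e' \<and> b = a"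
  using assms by (auto simp: edge_path_def split: if_splits)

text \<open>A defect is a trivial segment, which is dropped, or a pair of successive segments on one
  edge with a common parameter, which are merged; merging covers turning back as well. Either way
  one segment is saved.\<close>

lemma shorten_walk:
  assumes "is_walk G E x l y" "\<not> reduced_walk l" and wf: "wf_digraph G" and E: "E \<subseteq> arcs G"
  shows "\<exists>l'. length l' < length l \<and> is_walk G E x l' y \<and>
     path_homotopic (realization G) (walk G x l) (walk G x l')"
  using assms(1,2)
proof (induction l arbitrary: x rule: reduced_walk.induct)
  case (2 e a b)
  then have ab: "e \<in> arcs G" "a = b" "a \<in> {0..1}" "x = edge_path G e a" "y = x" using E by auto
  then have "path_homotopic (realization G) (walk G x [(e, a, b)]) (\<lambda>_. x)"
    using walk_single[OF wf ab(1), of a b x] by (simp add: seg_def)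
  then show ?case using ab edge_path_in_gpoints[OF wf ab(1)] by (intro exI[of _ "[]"]) auto
next
  case (3 e a b e' a' b' l)
  then have ab: "e \<in> arcs G" "a \<in> {0..1}" "b \<in> {0..1}" "x = edge_path G e a" "e \<in> E"
    and ab': "e' \<in> arcs G" "a' \<in> {0..1}" "b' \<in> {0..1}" "edge_path G e b = edge_path G e' a'" "e' \<in> E"
    and w: "is_walk G E (edge_path G e b) ((e', a', b') # l) y" and w': "is_walk G E (edge_path G e' b') l y"
    using E by auto
  note sg = pathin_seg[OF wf ab(1-3)] and sg' = pathin_seg[OF wf ab'(1-3)]
  note wp = walk_props[OF w wf E] and wp' = walk_props[OF w' wf E]
  \<comment> \<open>Segments that meet do so at an interior point, where edge and parameter
    coincide, or at end parameters. So a failure of the conditions at this joint is one of the first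
    two cases.\<close>
  consider "a = b" | "(e, b) = (e', a')" | "\<not> reduced_walk ((e', a', b') # l)"
    using 3(3) edge_path_eq_edge_path[OF ab'(4)] ab ab' by auto
  then show ?case
  proof cases
    case 1
    then have "walk G x ((e, a, b) # (e', a', b') # l) =
        path_join (\<lambda>_. edge_path G e b) (walk G (edge_path G e b) ((e', a', b') # l))"
      by (simp add: seg_def[abs_def])
    moreover have "path_homotopic (realization G) \<dots> (walk G (edge_path G e b) ((e', a', b') # l))"
      using path_homotopic_lid[OF wp(1)] wp(2) by simp
    ultimately show ?thesis using w 1 ab by (intro exI[of _ "(e', a', b') # l"]) simp
  next
    case 2
    have "path_homotopic (realization G) (walk G x ((e, a, b) # (e', a', b') # l))
        (path_join (path_join (seg G e a b) (seg G e' a' b')) (walk G (edge_path G e' b') l))"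
      using sg sg' wp' ab' by (simp del: seg_ends add: seg_ends, intro path_homotopic_sym[OF path_homotopic_assoc]) auto
    also have "path_homotopic (realization G) \<dots> (path_join (seg G e a b') (walk G (edge_path G e' b') l))"
    proof (rule path_homotopic_join)
      show "path_homotopic (realization G) (path_join (seg G e a b) (seg G e' a' b')) (seg G e a b')"
        using path_homotopic_sub_join[OF pathin_edge_path[OF wf ab(1)] ab(2,3) ab'(3)] 2
        by (auto simp: seg_def[abs_def] intro: path_homotopic_sym)
    qed (use wp' in auto)
    finally show ?thesis
      using 2 ab ab' w' by (intro exI[of _ "(e, a, b') # l"]) auto
  next
    case 3
    then obtain l' where l': "length l' < length ((e', a', b') # l)" "is_walk G E (edge_path G e b) l' y"
      "path_homotopic (realization G) (walk G (edge_path G e b) ((e', a', b') # l)) (walk G (edge_path G e b) l')"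
      using "3.IH"[OF w] by blast
    have "path_homotopic (realization G) (walk G x ((e, a, b) # (e', a', b') # l)) (walk G x ((e, a, b) # l'))"
      unfolding walk.simps(2)[of G x e a b]
      using sg wp by (intro path_homotopic_join[OF _ l'(3)]) auto
    then show ?thesis
      using l' ab by (intro exI[of _ "(e, a, b) # l'"]) auto
  qed
qed simp

theorem path_homotopic_reduced_walk:
  assumes wf: "wf_digraph G" and p: "pathin (realization G) p" and E: "meets_only E p" "E \<subseteq> arcs G"
  obtains l where "is_walk G E (p 0) l (p 1)" "path_homotopic (realization G) p (walk G (p 0) l)" "reduced_walk l"
proof -
  let ?P = "\<lambda>l. is_walk G E (p 0) l (p 1) \<and> path_homotopic (realization G) p (walk G (p 0) l)"
  obtain l0 where "?P l0" using path_homotopic_walk[OF assms] by blast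
  \<comment> \<open>A homotopic walk with the fewest segments has no defect left.\<close>
  then obtain l where l: "?P l" "\<And>l'. ?P l' \<Longrightarrow> length l \<le> length l'"
    using ex_has_least_nat[of ?P l0 length] by blast
  have "reduced_walk l"
  proof (rule ccontr)
    assume "\<not> reduced_walk l"
    then obtain l' where "length l' < length l" "is_walk G E (p 0) l' (p 1)"
     "path_homotopic (realization G) (walk G (p 0) l) (walk G (p 0) l')"
      using shorten_walk[OF conjunct1[OF l(1)] _ wf E(2)] by blast
    then show False using l path_homotopic_trans by (meson not_le)
  qed
  with l that show ?thesis by blast
qed

definition locally_injective :: "(real \<Rightarrow> 'a) \<Rightarrow> bool" where
  "locally_injective p \<longleftrightarrow> (\<forall>t\<in>{0<..<1::real}. \<exists>\<epsilon>>0. inj_on p ({t - \<epsilon><..<t + \<epsilon>} \<inter> {0<..<1}))"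

text \<open>\<open>walk\<close> ends with a constant path, which is not locally injective; here the
  last segment is kept bare. The empty walk has no such form.\<close>

fun tight_walk :: "('v, 'e) pre_digraph \<Rightarrow> ('e \<times> real \<times> real) list \<Rightarrow> real \<Rightarrow> ('v, 'e) gpoint" where
  "tight_walk G [] = undefined"
| "tight_walk G [(e, a, b)] = seg G e a b"
| "tight_walk G ((e, a, b) # s # l) = path_join (seg G e a b) (tight_walk G (s # l))"

lemma path_homotopic_tight_walk:
  assumes "is_walk G E x (s # l) y" and wf: "wf_digraph G" and E: "E \<subseteq> arcs G"
  shows "path_homotopic (realization G) (walk G x (s # l)) (tight_walk G (s # l))"
  using assms(1)
proof (induction l arbitrary: x s)
  case Nil
  obtain e a b where s: "s = (e, a, b)" by (cases s) auto
  then show ?case using walk_single[OF wf, of e a b x] Nil E by auto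
next
  case (Cons s' l)
  obtain e a b where s: "s = (e, a, b)" by (cases s) auto
  then have ab: "e \<in> arcs G" "a \<in> {0..1}" "b \<in> {0..1}" and w: "is_walk G E (edge_path G e b) (s' # l) y"
    using Cons E by auto
  show ?case
    unfolding s walk.simps tight_walk.simps
    using pathin_seg[OF wf ab] walk_props[OF w wf E] by (intro path_homotopic_join[OF _ Cons.IH[OF w]]) auto
qed

lemma seg_inner:
  assumes "a \<in> {0..1}" "b \<in> {0..1}" "a \<noteq> b" "0 < t" "t < 1"
  shows "seg G e a b t = Inner e (a + (b - a) * t)"
  using convex_comb_in_open_unit[OF assms] by (simp add: seg_def edge_path_inner)

text \<open>Only the joint at 1/2 is critical. There the path crosses a vertex, and
  \<open>(e, b) \<noteq> (e', a')\<close> says that it leaves through another end of an edge than it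
  arrived by. The number \<open>m\<close> is the speed of the first segment of \<open>q\<close>,
  which nested joins compress.\<close>

lemma locally_injective_join:
  assumes ab: "a \<in> {0..1}" "b \<in> {0..1}" "a \<noteq> b" "b \<in> {0, 1}"
    and ab': "a' \<in> {0, 1}" "b' \<in> {0..1}" "a' \<noteq> b'" "(e, b) \<noteq> (e', a')" and q: "locally_injective q"
    and m: "0 < m" "\<And>t. 0 \<le> t \<Longrightarrow> m * t \<le> 1 \<Longrightarrow> t \<le> 1 \<Longrightarrow> q t = seg G e' a' b' (m * t)"
  shows "locally_injective (path_join (seg G e a b) q)"
  unfolding locally_injective_def
proof
  fix t :: real assume t: "t \<in> {0<..<1}"
  let ?f = "path_join (seg G e a b) q"
  have lo: "?f x = Inner e (a + (b - a) * (2 * x))" if "0 < x" "x < 1/2" for x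
    using seg_inner[OF ab(1-3), of "2 * x" G e] that by (simp add: path_join_def)
  have mid: "\<exists>v. ?f (1/2) = Vertex v"
    using ab(4) by (auto simp: path_join_def)
  consider "t < 1/2" | "t = 1/2" | "1/2 < t" by linarith
  then show "\<exists>\<epsilon>>0. inj_on ?f ({t - \<epsilon><..<t + \<epsilon>} \<inter> {0<..<1})"
  proof cases
    case 1
    have "inj_on ?f ({t - (1/2 - t)<..<t + (1/2 - t)} \<inter> {0<..<1})"
      using lo ab(3) by (intro inj_onI) auto
    then show ?thesis using 1 by (intro exI[of _ "1/2 - t"]) auto
  next
    case 2
    \<comment> \<open>Left of the joint the bound 1/4 keeps the path in the second half of its
      segment; right of it \<open>1 / (4 * m)\<close> keeps the path in the first half of the first
      segment of \<open>q\<close>.\<close>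
    define \<epsilon> where "\<epsilon> = min (1/4) (1 / (4 * m))"
    have \<epsilon>: "\<epsilon> > 0" "\<epsilon> \<le> 1/4" "m * (2 * \<epsilon>) \<le> 1/2"
      using m(1) by (auto simp: \<epsilon>_def min_def field_simps)
    have hi: "?f x = Inner e' (a' + (b' - a') * (m * (2 * x - 1)))" "0 < m * (2 * x - 1)" "m * (2 * x - 1) < 1/2"
      if x: "1/2 < x" "x < 1/2 + \<epsilon>" for x
    proof -
      show pos: "0 < m * (2 * x - 1)" using m(1) x by simp
      have "m * (2 * x - 1) < m * (2 * \<epsilon>)" using m(1) x by (intro mult_strict_left_mono) auto
      with \<epsilon> show lt: "m * (2 * x - 1) < 1/2" by linarith
      have "?f x = q (2 * x - 1)" using x by (simp add: path_join_def)
      also have "\<dots> = seg G e' a' b' (m * (2 * x - 1))" using x \<epsilon> lt by (intro m(2)) auto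
      also have "\<dots> = Inner e' (a' + (b' - a') * (m * (2 * x - 1)))"
        using ab' pos lt by (intro seg_inner) auto
      finally show "?f x = Inner e' (a' + (b' - a') * (m * (2 * x - 1)))" .
    qed
    have "inj_on ?f ({t - \<epsilon><..<t + \<epsilon>} \<inter> {0<..<1})"
    proof (rule linorder_inj_onI)
      fix x y :: real
      assume xy: "x < y" "x \<in> {t - \<epsilon><..<t + \<epsilon>} \<inter> {0<..<1}" "y \<in> {t - \<epsilon><..<t + \<epsilon>} \<inter> {0<..<1}"
      consider "y < 1/2" | "x < 1/2" "y = 1/2" | "x < 1/2" "1/2 < y" | "x = 1/2" | "1/2 < x"
        using xy by linarith
      then show "?f x \<noteq> ?f y"
      proof cases
        case 1 then show ?thesis using lo[of x] lo[of y] xy ab(3) by auto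
      next
        case 2
        then have y: "y = 1/2" by simp
        show ?thesis unfolding y using lo[of x] mid xy 2 by auto
      next
        case 3
        have y: "y < 1/2 + \<epsilon>" and x: "0 < x" "1/4 < x" using xy 2 \<epsilon> by auto
        show ?thesis
        proof
          assume "?f x = ?f y"
          then have eq: "e = e'" "a + (b - a) * (2 * x) = a' + (b' - a') * (m * (2 * y - 1))"
            using lo[OF x(1) 3(1)] hi(1)[OF 3(2) y] by auto
          \<comment> \<open>On one and the same edge \<open>b\<close> and \<open>a'\<close> are
            opposite ends. The left point has weight more than 1/2 at \<open>b\<close>, the right
            one more than 1/2 at \<open>a'\<close>, so they lie in different halves of the
            edge.\<close>
          define u where "u = 2 * x"
          define v where "v = m * (2 * y - 1)"
          have uv: "1/2 < u" "u < 1" "0 < v" "v < 1/2" using 3 x hi(2,3)[OF 3(2) y] by (auto simp: u_def v_def)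
          have E: "(1 - u) * a + u * b = (1 - v) * a' + v * b'"
            using eq(2) unfolding u_def[symmetric] v_def[symmetric] by (simp add: algebra_simps)
          have n: "b \<noteq> a'" using ab'(4) eq(1) by simp
          have A: "0 \<le> (1 - u) * a" "(1 - u) * a \<le> 1 - u" using ab uv by (auto simp: mult_left_le)
          have B: "0 \<le> v * b'" "v * b' \<le> v" using ab' uv by (auto simp: mult_left_le)
          show False
            using ab(4) ab'(1)
          proof (elim insertE; simp)
            assume "b = 0" "a' = 1" then show False using E A B uv by simp
          next
            assume "b = 1" "a' = 0" then show False using E A B uv by simp
          qed (use n in auto)
        qed
      next
        case 4
        then have "1/2 < y" "y < 1/2 + \<epsilon>" using xy 2 by auto
        then show ?thesis unfolding 4 using hi(1)[of y] mid by auto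
      next
        case 5
        then show ?thesis using hi(1)[of x] hi(1)[of y] xy 2 ab'(3) m(1) by auto
      qed
    qed auto
    then show ?thesis using \<epsilon> by blast
  next
    case 3
    then have "2 * t - 1 \<in> {0<..<1}" using t by auto
    then obtain \<epsilon> where \<epsilon>: "\<epsilon> > 0" "inj_on q ({2 * t - 1 - \<epsilon><..<2 * t - 1 + \<epsilon>} \<inter> {0<..<1})"
      using q unfolding locally_injective_def by blast
    have "inj_on ?f ({t - min (\<epsilon> / 2) (t - 1/2)<..<t + min (\<epsilon> / 2) (t - 1/2)} \<inter> {0<..<1})"
    proof (rule inj_onI)
      fix x y assume x: "x \<in> {t - min (\<epsilon> / 2) (t - 1/2)<..<t + min (\<epsilon> / 2) (t - 1/2)} \<inter> {0<..<1}"
        and y: "y \<in> {t - min (\<epsilon> / 2) (t - 1/2)<..<t + min (\<epsilon> / 2) (t - 1/2)} \<inter> {0<..<1}"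
        and eq: "?f x = ?f y"
      have "x > 1/2" "y > 1/2" using x y by auto
      then have "q (2 * x - 1) = q (2 * y - 1)" using eq by (auto simp: path_join_def)
      then have "2 * x - 1 = 2 * y - 1"
        using x y by (intro inj_onD[OF \<epsilon>(2)]) auto
      then show "x = y" by simp
    qed
    then show ?thesis using 3 \<epsilon>(1) by (intro exI[of _ "min (\<epsilon> / 2) (t - 1/2)"]) auto
  qed
qed

text \<open>The second claim strengthens the induction: the next joint has to know that the path
  begins with its first segment at a constant speed, which is 1 for a single segment and 2 for a
  join.\<close>

lemma locally_injective_tight_walk:
  assumes "is_walk G E x ((e, a, b) # l) y" "reduced_walk ((e, a, b) # l)"
  shows "locally_injective (tight_walk G ((e, a, b) # l))"
    and "\<exists>m>0. \<forall>t. 0 \<le> t \<longrightarrow> m * t \<le> 1 \<longrightarrow> t \<le> 1 \<longrightarrow> tight_walk G ((e, a, b) # l) t = seg G e a b (m * t)"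
proof -
  have "locally_injective (tight_walk G ((e, a, b) # l)) \<and>
     (\<exists>m>0. \<forall>t. 0 \<le> t \<longrightarrow> m * t \<le> 1 \<longrightarrow> t \<le> 1 \<longrightarrow> tight_walk G ((e, a, b) # l) t = seg G e a b (m * t))"
    using assms
  proof (induction l arbitrary: x e a b)
    case Nil
    then have "inj_on (seg G e a b) {0<..<1}"
      by (intro inj_onI) (auto simp: seg_inner)
    then have "locally_injective (seg G e a b)"
      unfolding locally_injective_def by (intro ballI exI[of _ 1]) (auto intro: inj_on_subset)
    then show ?case by (auto intro!: exI[of _ 1])
  next
    case (Cons s l)
    obtain e' a' b' where s: "s = (e', a', b')" by (cases s) auto
    have w: "is_walk G E (edge_path G e b) ((e', a', b') # l) y" "reduced_walk ((e', a', b') # l)"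
      using Cons.prems s by auto
    obtain m where m: "m > 0" "\<And>t. 0 \<le> t \<Longrightarrow> m * t \<le> 1 \<Longrightarrow> t \<le> 1 \<Longrightarrow> tight_walk G ((e', a', b') # l) t = seg G e' a' b' (m * t)"
      and li: "locally_injective (tight_walk G ((e', a', b') # l))"
      using Cons.IH[OF w] by blast
    have "a' \<noteq> b'" using w(2) by (cases "(e', a', b') # l" rule: reduced_walk.cases) auto
    then have "locally_injective (tight_walk G ((e, a, b) # s # l))"
      unfolding s tight_walk.simps using Cons.prems s
      by (intro locally_injective_join[OF _ _ _ _ _ _ _ _ li m]) auto
    moreover have "tight_walk G ((e, a, b) # s # l) t = seg G e a b (2 * t)" if "2 * t \<le> 1" for t
      using that by (simp add: path_join_def)
    ultimately show ?case by (auto intro!: exI[of _ 2])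
  qed
  then show "locally_injective (tight_walk G ((e, a, b) # l))"
    "\<exists>m>0. \<forall>t. 0 \<le> t \<longrightarrow> m * t \<le> 1 \<longrightarrow> t \<le> 1 \<longrightarrow> tight_walk G ((e, a, b) # l) t = seg G e a b (m * t)"
    by auto
qed

text \<open>The hypothesis \<open>nontriv\<close> excludes the empty reduced walk, whose path is
  constant.\<close>

theorem path_homotopic_locally_injective:
  assumes wf: "wf_digraph G" and p: "pathin (realization G) p"
    and nontriv: "\<not> path_homotopic (realization G) p (\<lambda>_. p 0)"
  obtains q where "path_homotopic (realization G) p q" "locally_injective q"
proof -
  have "meets_only (arcs G) p"
    unfolding meets_only_def
  proof (intro ballI allI impI)
    fix t e s assume "t \<in> {0..1}" "p t = Inner e s"
    moreover have "p t \<in> gpoints G" using path_image_subset_topspace[OF p] \<open>t \<in> {0..1}\<close> wf by auto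
    ultimately show "e \<in> arcs G" by simp
  qed
  then obtain l where l: "is_walk G (arcs G) (p 0) l (p 1)" "path_homotopic (realization G) p (walk G (p 0) l)" "reduced_walk l"
    using path_homotopic_reduced_walk[OF wf p] by blast
  obtain e a b l' where *: "l = (e, a, b) # l'"
    using l(2) nontriv by (cases l) auto
  have "path_homotopic (realization G) p (tight_walk G l)"
    using l(1,2) path_homotopic_tight_walk[OF _ wf order_refl] path_homotopic_trans unfolding * by blast
  moreover have "locally_injective (tight_walk G l)"
    using locally_injective_tight_walk(1) l(1,3) unfolding * by fast
  ultimately show ?thesis using that by blast
qed

subsection \<open>Edge paths\<close>

text \<open>The clauses copy those of \<open>virtual_sequence\<close>, with an arbitrary set
  \<open>E\<close> of edges in place of the virtual loops at one vertex. For the petals of a rose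
  they generate the words of the free group.\<close>

inductive dart_walk :: "('v, 'e) pre_digraph \<Rightarrow> 'e set \<Rightarrow> 'v \<Rightarrow> (real \<Rightarrow> ('v, 'e) gpoint) \<Rightarrow> 'v \<Rightarrow> bool"
  for G E where
  nil: "dart_walk G E u (\<lambda>_. Vertex u) u"
| forward: "e \<in> E \<Longrightarrow> dart_walk G E (head G e) p w \<Longrightarrow> dart_walk G E (tail G e) (path_join (edge_path G e) p) w"
| backward: "e \<in> E \<Longrightarrow> dart_walk G E (tail G e) p w \<Longrightarrow> dart_walk G E (head G e) (path_join (path_reverse (edge_path G e)) p) w"

text \<open>In a reduced walk all inner break points are vertices. If the ends are vertices too,
  every segment is a whole edge in one of its two directions.\<close>

theorem path_homotopic_dart_walk:
  assumes wf: "wf_digraph G" and p: "pathin (realization G) p" and E: "meets_only E p" "E \<subseteq> arcs G"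
    and ends: "p 0 = Vertex u" "p 1 = Vertex w"
  obtains q where "dart_walk G E u q w" "path_homotopic (realization G) p q"
proof -
  obtain l where l: "is_walk G E (p 0) l (p 1)" "path_homotopic (realization G) p (walk G (p 0) l)" "reduced_walk l"
    using path_homotopic_reduced_walk[OF wf p E] by blast
  have seg: "seg G e 0 1 = edge_path G e" "seg G e 1 0 = path_reverse (edge_path G e)" for e
    by (auto simp: seg_def path_reverse_def)
  have "is_walk G E (Vertex u) l (Vertex w) \<Longrightarrow> reduced_walk l \<Longrightarrow> dart_walk G E u (walk G (Vertex u) l) w" for u
  proof (induction l arbitrary: u)
    case Nil
    then show ?case by (auto intro: dart_walk.intros)
  next
    case (Cons s l)
    obtain e a b where s: "s = (e, a, b)" by (cases s) auto
    have w: "e \<in> E" "a \<in> {0..1}" "b \<in> {0..1}" "Vertex u = edge_path G e a" "is_walk G E (edge_path G e b) l (Vertex w)"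
      using Cons.prems s by auto
    have a: "a \<in> {0, 1}" using edge_path_eq_Vertex[OF w(4)[symmetric] w(2)] .
    have b: "b \<in> {0, 1} \<and> a \<noteq> b \<and> reduced_walk l"
    proof (cases l)
      case Nil
      then show ?thesis using w(5) edge_path_eq_Vertex[OF _ w(3)] Cons.prems s by auto
    next
      case (Cons s' l')
      obtain e' a' b' where "s' = (e', a', b')" by (cases s') auto
      then show ?thesis using Cons Cons.prems s by auto
    qed
    then consider "a = 0" "b = 1" | "a = 1" "b = 0" using a by auto
    then show ?case
    proof cases
      case 1
      then have "dart_walk G E (head G e) (walk G (Vertex (head G e)) l) w"
        using Cons.IH w b by simp
      with 1 w show ?thesis by (simp add: s seg dart_walk.forward)
    next
      case 2
      then have "dart_walk G E (tail G e) (walk G (Vertex (tail G e)) l) w"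
        using Cons.IH w b by simp
      with 2 w show ?thesis by (simp add: s seg dart_walk.backward)
    qed
  qed
  with l ends that show ?thesis by metis
qed

section \<open>Outer automorphisms\<close>

context group
begin

definition inner :: "'a \<Rightarrow> 'a \<Rightarrow> 'a" where
  "inner a = (\<lambda>x\<in>carrier G. a \<otimes> x \<otimes> inv a)"

lemma Inn_eq: "Inn G = inner ` carrier G"
  by (simp add: Inn_def inner_def)

lemma carrier_AutoGroup [simp]: "carrier (AutoGroup G) = auto G"
  by (simp add: AutoGroup_def)

lemma mult_AutoGroup:
  "\<alpha> \<in> auto G \<Longrightarrow> \<beta> \<in> auto G \<Longrightarrow> \<alpha> \<otimes>\<^bsub>AutoGroup G\<^esub> \<beta> = compose (carrier G) \<alpha> \<beta>"
  by (simp add: AutoGroup_def BijGroup_def auto_def)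

lemma one_AutoGroup: "\<one>\<^bsub>AutoGroup G\<^esub> = (\<lambda>x\<in>carrier G. x)"
  by (simp add: AutoGroup_def BijGroup_def)

lemma inner_inner: "a \<in> carrier G \<Longrightarrow> b \<in> carrier G \<Longrightarrow> compose (carrier G) (inner a) (inner b) = inner (a \<otimes> b)"
  by (auto simp: compose_def inner_def fun_eq_iff inv_mult_group m_assoc)

lemma inner_one: "inner \<one> = (\<lambda>x\<in>carrier G. x)"
  by (auto simp: inner_def fun_eq_iff)

lemma inner_in_auto:
  assumes a: "a \<in> carrier G"
  shows "inner a \<in> auto G"
proof -
  have cl: "inner b x \<in> carrier G" if "b \<in> carrier G" "x \<in> carrier G" for b x
    using that by (simp add: inner_def)
  have inv: "inner b (inner (inv b) x) = x" if "b \<in> carrier G" "x \<in> carrier G" for b x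
    using fun_cong[OF inner_inner[of b "inv b"], of x] that by (simp add: inner_one compose_def)
  have "inner a \<in> hom G G"
    using a by (auto intro!: homI simp: cl) (simp add: inner_def m_assoc inv_solve_left)
  moreover have "bij_betw (inner a) (carrier G) (carrier G)"
  proof (rule bij_betw_byWitness[where f' = "inner (inv a)"])
    show "\<forall>x\<in>carrier G. inner (inv a) (inner a x) = x" using inv[of "inv a"] a by simp
    show "\<forall>x\<in>carrier G. inner a (inner (inv a) x) = x" using inv a by simp
  qed (use cl a in auto)
  ultimately show ?thesis
    by (auto simp: auto_def Bij_def inner_def)
qed

text \<open>Moving \<open>\<alpha>\<close> past an inner automorphism replaces \<open>a\<close> by
  \<open>\<alpha> a\<close>; this is the normality of the inner automorphisms.\<close>

lemma auto_inner:
  assumes \<alpha>: "\<alpha> \<in> auto G" and a: "a \<in> carrier G"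
  shows "\<alpha> \<otimes>\<^bsub>AutoGroup G\<^esub> inner a = inner (\<alpha> a) \<otimes>\<^bsub>AutoGroup G\<^esub> \<alpha>"
proof -
  have h: "\<alpha> \<in> hom G G" using \<alpha> by (simp add: auto_def)
  then have cl: "\<alpha> x \<in> carrier G" if "x \<in> carrier G" for x using that by (auto simp: hom_def)
  interpret h: group_hom G G \<alpha> using h by unfold_locales
  show ?thesis
    unfolding mult_AutoGroup[OF \<alpha> inner_in_auto[OF a]] mult_AutoGroup[OF inner_in_auto[OF cl[OF a]] \<alpha>]
    using a cl by (auto simp: compose_def inner_def fun_eq_iff)
qed

lemma normal_Inn: "Inn G \<lhd> AutoGroup G"
proof -
  interpret A: group "AutoGroup G" by (rule AutoGroup)
  have "subgroup (Inn G) (AutoGroup G)"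
  proof (rule subgroup.intro)
    show "Inn G \<subseteq> carrier (AutoGroup G)" using inner_in_auto by (auto simp: Inn_eq)
    show "\<one>\<^bsub>AutoGroup G\<^esub> \<in> Inn G" using inner_one by (auto simp: Inn_eq one_AutoGroup intro!: image_eqI[of _ _ \<one>])
    fix x y assume "x \<in> Inn G" "y \<in> Inn G"
    then show "x \<otimes>\<^bsub>AutoGroup G\<^esub> y \<in> Inn G"
      using inner_inner inner_in_auto by (auto simp: Inn_eq mult_AutoGroup)
  next
    fix x assume "x \<in> Inn G"
    then obtain a where a: "a \<in> carrier G" "x = inner a" by (auto simp: Inn_eq)
    have "inv\<^bsub>AutoGroup G\<^esub> x = inner (inv a)"
      using a inner_in_auto inner_inner[of "inv a" a]
      by (intro A.inv_equality) (auto simp: mult_AutoGroup one_AutoGroup inner_one)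
    then show "inv\<^bsub>AutoGroup G\<^esub> x \<in> Inn G" using a by (auto simp: Inn_eq)
  qed
  moreover have "\<alpha> \<otimes>\<^bsub>AutoGroup G\<^esub> h \<otimes>\<^bsub>AutoGroup G\<^esub> inv\<^bsub>AutoGroup G\<^esub> \<alpha> \<in> Inn G"
    if \<alpha>: "\<alpha> \<in> carrier (AutoGroup G)" and "h \<in> Inn G" for \<alpha> h
  proof -
    obtain a where a: "a \<in> carrier G" "h = inner a" using \<open>h \<in> Inn G\<close> by (auto simp: Inn_eq)
    have cl: "\<alpha> a \<in> carrier G" using \<alpha> a by (auto simp: auto_def hom_def)
    have "\<alpha> \<otimes>\<^bsub>AutoGroup G\<^esub> h \<otimes>\<^bsub>AutoGroup G\<^esub> inv\<^bsub>AutoGroup G\<^esub> \<alpha> =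
        inner (\<alpha> a) \<otimes>\<^bsub>AutoGroup G\<^esub> \<alpha> \<otimes>\<^bsub>AutoGroup G\<^esub> inv\<^bsub>AutoGroup G\<^esub> \<alpha>"
      using auto_inner \<alpha> a by simp
    also have "\<dots> = inner (\<alpha> a)"
      using \<alpha> inner_in_auto[OF cl] A.inv_closed[OF \<alpha>] A.r_inv[OF \<alpha>]
      by (subst A.m_assoc) auto
    finally show ?thesis using cl by (simp add: Inn_eq)
  qed
  ultimately show ?thesis by (simp add: A.normal_inv_iff)
qed

lemma group_Out: "group (Out G)"
  unfolding Out_def by (rule normal.factorgroup_is_group[OF normal_Inn])

lemma carrier_Out: "carrier (Out G) = (\<lambda>\<alpha>. Inn G #>\<^bsub>AutoGroup G\<^esub> \<alpha>) ` auto G"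
  by (auto simp: Out_def FactGroup_def RCOSETS_def)

lemma mem_coset_Inn:
  "\<beta> \<in> auto G \<Longrightarrow> \<alpha> \<in> Inn G #>\<^bsub>AutoGroup G\<^esub> \<beta> \<longleftrightarrow> (\<exists>a\<in>carrier G. \<alpha> = compose (carrier G) (inner a) \<beta>)"
  by (auto simp: r_coset_def Inn_eq mult_AutoGroup inner_in_auto)

lemma auto_in_coset_Inn: "\<alpha> \<in> auto G \<Longrightarrow> \<alpha> \<in> Inn G #>\<^bsub>AutoGroup G\<^esub> \<alpha>"
proof -
  assume \<alpha>: "\<alpha> \<in> auto G"
  interpret N: normal "Inn G" "AutoGroup G" by (rule normal_Inn)
  show ?thesis using \<alpha> N.is_group N.rcos_self[of \<alpha>] N.subgroup_axioms by simp
qed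

lemma Out_subset_auto: "A \<in> carrier (Out G) \<Longrightarrow> A \<subseteq> auto G"
proof -
  assume "A \<in> carrier (Out G)"
  then obtain \<alpha> where \<alpha>: "\<alpha> \<in> auto G" "A = Inn G #>\<^bsub>AutoGroup G\<^esub> \<alpha>" by (auto simp: carrier_Out)
  interpret N: normal "Inn G" "AutoGroup G" by (rule normal_Inn)
  show ?thesis using N.r_coset_subset_G[OF N.subset, of \<alpha>] \<alpha> by simp
qed

lemma Out_nonempty: "A \<in> carrier (Out G) \<Longrightarrow> \<exists>\<alpha>. \<alpha> \<in> A"
  using auto_in_coset_Inn by (auto simp: carrier_Out)

text \<open>An element of \<open>Out\<close> is a coset, that is, a set of automorphisms, and any
  member can serve as the coset representative.\<close>

lemma Out_elements:
  assumes A: "A \<in> carrier (Out G)" and \<alpha>: "\<alpha> \<in> A" and \<beta>: "\<beta> \<in> A"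
  shows "\<exists>a\<in>carrier G. \<alpha> = compose (carrier G) (inner a) \<beta>"
proof -
  interpret N: normal "Inn G" "AutoGroup G" by (rule normal_Inn)
  obtain \<gamma> where \<gamma>: "\<gamma> \<in> auto G" "A = Inn G #>\<^bsub>AutoGroup G\<^esub> \<gamma>" using A by (auto simp: carrier_Out)
  have "A = Inn G #>\<^bsub>AutoGroup G\<^esub> \<beta>"
    using N.repr_independence[of \<beta> "Inn G" \<gamma>] \<gamma> \<beta> N.subgroup_axioms by simp
  then show ?thesis using mem_coset_Inn[of \<beta> \<alpha>] \<alpha> \<beta> Out_subset_auto[OF A] by auto
qed

lemma Out_one: "(\<lambda>x\<in>carrier G. x) \<in> \<one>\<^bsub>Out G\<^esub>"
  using inner_one by (auto simp: Out_def FactGroup_def Inn_eq intro!: image_eqI[of _ _ \<one>])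

lemma Out_mult:
  "A \<in> carrier (Out G) \<Longrightarrow> B \<in> carrier (Out G) \<Longrightarrow> \<alpha> \<in> A \<Longrightarrow> \<beta> \<in> B \<Longrightarrow>
     compose (carrier G) \<alpha> \<beta> \<in> A \<otimes>\<^bsub>Out G\<^esub> B"
proof -
  assume *: "A \<in> carrier (Out G)" "B \<in> carrier (Out G)" "\<alpha> \<in> A" "\<beta> \<in> B"
  then have "\<alpha> \<otimes>\<^bsub>AutoGroup G\<^esub> \<beta> = compose (carrier G) \<alpha> \<beta>"
    using Out_subset_auto by (intro mult_AutoGroup) auto
  then have "compose (carrier G) \<alpha> \<beta> \<in> A <#>\<^bsub>AutoGroup G\<^esub> B"
    using * by (force simp: set_mult_def)
  then show ?thesis by (simp add: Out_def FactGroup_def)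
qed

end

section \<open>The fundamental group\<close>

lemma path_class_mem [simp]: "q \<in> path_class X p \<longleftrightarrow> path_homotopic X p q"
  by (simp add: path_class_def)

lemma path_class_eq:
  "pathin X p \<Longrightarrow> path_class X p = path_class X q \<longleftrightarrow> path_homotopic X p q"
proof (rule iffI)
  assume p: "pathin X p" and eq: "path_class X p = path_class X q"
  have "p \<in> path_class X p" using p by (simp add: path_class_def)
  then have "p \<in> path_class X q" using eq by simp
  then show "path_homotopic X p q" by (simp add: path_class_def path_homotopic_sym)
next
  assume "path_homotopic X p q"
  then show "path_class X p = path_class X q"
    using path_homotopic_sym path_homotopic_trans unfolding path_class_def by blast
qed

lemma path_class_eqI: "path_homotopic X p q \<Longrightarrow> path_class X p = path_class X q"
  using path_class_eq path_homotopic_imp_pathin(1) by blast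

lemma loops_at_iff: "p \<in> loops_at X x \<longleftrightarrow> pathin X p \<and> p 0 = x \<and> p 1 = x"
  by (simp add: loops_at_def)

lemma carrier_fundamental_group:
  "A \<in> carrier (fundamental_group X x) \<longleftrightarrow> (\<exists>p\<in>loops_at X x. A = path_class X p)"
  by (auto simp: fundamental_group_def)

text \<open>The product is defined as a union over all representatives; by homotopy invariance of
  the join all members of the union are the same class.\<close>

lemma mult_fundamental_group:
  assumes "p \<in> loops_at X x" "q \<in> loops_at X x"
  shows "path_class X p \<otimes>\<^bsub>fundamental_group X x\<^esub> path_class X q = path_class X (path_join p q)"
proof -
  have *: "path_class X (path_join p' q') = path_class X (path_join p q)"
    if "path_homotopic X p p'" "path_homotopic X q q'" for p' q'
  proof -
    have "path_homotopic X (path_join p q) (path_join p' q')"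
      using that assms by (intro path_homotopic_join) (auto simp: loops_at_def)
    then show ?thesis by (rule path_class_eqI[symmetric])
  qed
  have "p \<in> path_class X p" "q \<in> path_class X q" using assms by (auto simp: loops_at_def)
  then have "path_class X p \<noteq> {}" "path_class X q \<noteq> {}" by blast+
  moreover have "(\<Union>p'\<in>path_class X p. \<Union>q'\<in>path_class X q. path_class X (path_join p' q')) =
      (\<Union>p'\<in>path_class X p. \<Union>q'\<in>path_class X q. path_class X (path_join p q))"
    using * by (intro SUP_cong refl) (simp add: path_class_def)
  ultimately show ?thesis by (simp add: fundamental_group_def)
qed

lemma loops_at_join: "p \<in> loops_at X x \<Longrightarrow> q \<in> loops_at X x \<Longrightarrow> path_join p q \<in> loops_at X x"
  by (auto simp: loops_at_def)

lemma loops_at_reverse: "p \<in> loops_at X x \<Longrightarrow> path_reverse p \<in> loops_at X x"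
  by (auto simp: loops_at_def)

lemma one_fundamental_group: "\<one>\<^bsub>fundamental_group X x\<^esub> = path_class X (\<lambda>_. x)"
  by (simp add: fundamental_group_def)

lemma group_fundamental_group:
  assumes "x \<in> topspace X"
  shows "group (fundamental_group X x)"
proof (rule groupI)
  let ?P = "fundamental_group X x"
  have c: "(\<lambda>_. x) \<in> loops_at X x" using assms by (simp add: loops_at_def)
  fix A B C
  show "\<one>\<^bsub>?P\<^esub> \<in> carrier ?P" using c by (auto simp: carrier_fundamental_group one_fundamental_group)
  assume "A \<in> carrier ?P"
  then obtain p where p: "p \<in> loops_at X x" "A = path_class X p" by (auto simp: carrier_fundamental_group)
  then have P: "pathin X p" "p 0 = x" "p 1 = x" by (auto simp: loops_at_def)
  show "\<one>\<^bsub>?P\<^esub> \<otimes>\<^bsub>?P\<^esub> A = A"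
    using path_class_eqI[OF path_homotopic_lid[OF P(1)]] unfolding p(2) P(2)
    by (simp only: one_fundamental_group mult_fundamental_group[OF c p(1)])
  have "path_class X (path_reverse p) \<otimes>\<^bsub>?P\<^esub> A = \<one>\<^bsub>?P\<^esub>"
    using path_class_eqI[OF path_homotopic_linv[OF P(1)]] unfolding p(2) P(3)
    by (simp only: one_fundamental_group mult_fundamental_group[OF loops_at_reverse[OF p(1)] p(1)])
  then show "\<exists>B\<in>carrier ?P. B \<otimes>\<^bsub>?P\<^esub> A = \<one>\<^bsub>?P\<^esub>"
    using p(1) loops_at_reverse[OF p(1)]
    by (intro bexI[of _ "path_class X (path_reverse p)"]) (auto simp: carrier_fundamental_group)
  assume "B \<in> carrier ?P"
  then obtain q where q: "q \<in> loops_at X x" "B = path_class X q" by (auto simp: carrier_fundamental_group)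
  show "A \<otimes>\<^bsub>?P\<^esub> B \<in> carrier ?P"
    using p q loops_at_join[OF p(1) q(1)]
    by (auto simp: mult_fundamental_group carrier_fundamental_group intro!: bexI[of _ "path_join p q"])
  assume "C \<in> carrier ?P"
  then obtain r where r: "r \<in> loops_at X x" "C = path_class X r" by (auto simp: carrier_fundamental_group)
  have "path_homotopic X (path_join (path_join p q) r) (path_join p (path_join q r))"
    using p q r by (intro path_homotopic_assoc) (auto simp: loops_at_def)
  then show "A \<otimes>\<^bsub>?P\<^esub> B \<otimes>\<^bsub>?P\<^esub> C = A \<otimes>\<^bsub>?P\<^esub> (B \<otimes>\<^bsub>?P\<^esub> C)"
    using p q r by (simp add: mult_fundamental_group loops_at_join path_class_eqI)
qed

lemma inv_fundamental_group:
  assumes "p \<in> loops_at X x"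
  shows "inv\<^bsub>fundamental_group X x\<^esub> (path_class X p) = path_class X (path_reverse p)"
proof -
  have x: "x \<in> topspace X" using assms path_start_in_topspace by (auto simp: loops_at_def)
  interpret group "fundamental_group X x" by (rule group_fundamental_group[OF x])
  show ?thesis
    using assms path_class_eqI[OF path_homotopic_linv[of X p]] loops_at_reverse[OF assms]
    by (intro inv_equality)
       (auto simp: carrier_fundamental_group one_fundamental_group mult_fundamental_group loops_at_iff)
qed

section \<open>Self-maps of the rose\<close>

abbreviation rose_space :: "nat \<Rightarrow> (unit, nat) gpoint topology" where
  "rose_space g \<equiv> realization (rose g)"

abbreviation rose_loops :: "nat \<Rightarrow> (real \<Rightarrow> (unit, nat) gpoint) set" where
  "rose_loops g \<equiv> loops_at (rose_space g) (Vertex ())"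

lemma group_Fg [simp]: "group (Fg g)"
  unfolding Fg_def by (rule group_fundamental_group) simp

lemma edge_path_rose_loops [simp]: "i < g \<Longrightarrow> edge_path (rose g) i \<in> rose_loops g"
  by (auto simp: loops_at_def)

text \<open>Every loop is homotopic to a word in the petals and their inverses. The last premise
  closes the property under homotopy, so that claims about all loops reduce to the
  generators.\<close>

lemma rose_loop_induct [consumes 1, case_names one fwd bwd hom]:
  assumes p: "p \<in> rose_loops g"
    and one: "P (\<lambda>_. Vertex ())"
    and fwd: "\<And>i q. i < g \<Longrightarrow> q \<in> rose_loops g \<Longrightarrow> P q \<Longrightarrow> P (path_join (edge_path (rose g) i) q)"
    and bwd: "\<And>i q. i < g \<Longrightarrow> q \<in> rose_loops g \<Longrightarrow> P q \<Longrightarrow> P (path_join (path_reverse (edge_path (rose g) i)) q)"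
    and hom: "\<And>q q'. path_homotopic (rose_space g) q q' \<Longrightarrow> q \<in> rose_loops g \<Longrightarrow> P q \<Longrightarrow> P q'"
  shows "P p"
proof -
  have p': "pathin (rose_space g) p" "p 0 = Vertex ()" "p 1 = Vertex ()" using p by (auto simp: loops_at_def)
  have m: "meets_only {..<g} p"
    unfolding meets_only_def
  proof (intro ballI allI impI)
    fix t e s assume "t \<in> {0..1}" "p t = Inner e s"
    moreover have "p t \<in> gpoints (rose g)" using path_image_subset_topspace[OF p'(1)] \<open>t \<in> {0..1}\<close> by auto
    ultimately show "e \<in> {..<g}" by simp
  qed
  obtain q where q: "dart_walk (rose g) {..<g} () q ()" "path_homotopic (rose_space g) p q"
    using path_homotopic_dart_walk[OF wf_digraph_rose p'(1) m _ p'(2,3)] by auto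
  have "q \<in> rose_loops g \<and> P q"
    using q(1)
  proof (induction)
    case (nil u)
    then show ?case using one by (auto simp: loops_at_def)
  next
    case (forward e p w)
    then show ?case using fwd by (auto intro!: loops_at_join)
  next
    case (backward e p w)
    then show ?case using bwd by (auto intro!: loops_at_join loops_at_reverse)
  qed
  then show ?thesis using hom[OF path_homotopic_sym[OF q(2)]] by blast
qed

text \<open>Being a homotopy equivalence is left out; for automorphisms it is derived by composing
  with a map that realizes the inverse.\<close>

definition realizes :: "nat \<Rightarrow> ((unit, nat) gpoint \<Rightarrow> (unit, nat) gpoint) \<Rightarrow>
    ((real \<Rightarrow> (unit, nat) gpoint) set \<Rightarrow> (real \<Rightarrow> (unit, nat) gpoint) set) \<Rightarrow> bool" where
  "realizes g f \<alpha> \<longleftrightarrow> continuous_map (rose_space g) (rose_space g) f \<and> f (Vertex ()) = Vertex () \<and>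
     (\<forall>p\<in>rose_loops g. path_class (rose_space g) (f \<circ> p) = \<alpha> (path_class (rose_space g) p))"

lemma rose_loops_compose:
  "continuous_map (rose_space g) (rose_space g) f \<Longrightarrow> f (Vertex ()) = Vertex () \<Longrightarrow>
     p \<in> rose_loops g \<Longrightarrow> f \<circ> p \<in> rose_loops g"
  by (auto simp: loops_at_def intro: pathin_compose)

text \<open>Both sides are multiplicative in the loop, so agreement on the generators propagates
  along words.\<close>

lemma realizesI:
  assumes \<alpha>: "\<alpha> \<in> hom (Fg g) (Fg g)"
    and f: "continuous_map (rose_space g) (rose_space g) f" "f (Vertex ()) = Vertex ()"
    and eq: "\<And>i. i < g \<Longrightarrow> path_class (rose_space g) (f \<circ> edge_path (rose g) i) =
       \<alpha> (path_class (rose_space g) (edge_path (rose g) i))"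
  shows "realizes g f \<alpha>"
proof -
  interpret group_hom "Fg g" "Fg g" \<alpha> using \<alpha> by (simp add: group_hom_def group_hom_axioms_def)
  have car: "path_class (rose_space g) p \<in> carrier (Fg g)" if "p \<in> rose_loops g" for p
    using that by (auto simp: Fg_def carrier_fundamental_group)
  note fl = rose_loops_compose[OF f]
  have "path_class (rose_space g) (f \<circ> p) = \<alpha> (path_class (rose_space g) p)" if "p \<in> rose_loops g" for p
    using that
  proof (induction rule: rose_loop_induct)
    case one
    have "f \<circ> (\<lambda>_::real. Vertex ()) = (\<lambda>_. Vertex ())" using f by auto
    moreover have "\<alpha> (path_class (rose_space g) (\<lambda>_. Vertex ())) = path_class (rose_space g) (\<lambda>_. Vertex ())"
      using hom_one by (simp add: Fg_def one_fundamental_group)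
    ultimately show ?case by (simp only:)
  next
    case (fwd i q)
    then have "path_class (rose_space g) (f \<circ> q) = \<alpha> (path_class (rose_space g) q)"
      by (simp add: o_def)
    with fwd show ?case
      using hom_mult[OF car[of "edge_path (rose g) i"] car[of q]] fl eq[of i]
      by (simp add: Fg_def mult_fundamental_group comp_path_join flip: mult_fundamental_group[OF fl fl])
  next
    case (bwd i q)
    then have IH: "path_class (rose_space g) (f \<circ> q) = \<alpha> (path_class (rose_space g) q)"
      by (simp add: o_def)
    have "path_class (rose_space g) (f \<circ> path_reverse (edge_path (rose g) i)) =
       \<alpha> (path_class (rose_space g) (path_reverse (edge_path (rose g) i)))"
      using hom_inv[OF car[of "edge_path (rose g) i"]] bwd fl eq[of i]
      by (simp add: Fg_def inv_fundamental_group comp_path_reverse flip: inv_fundamental_group[OF fl])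
    then show ?case
      using bwd IH hom_mult[OF car[OF loops_at_reverse[of "edge_path (rose g) i"]] car[of q]] fl loops_at_reverse
      by (simp add: Fg_def mult_fundamental_group comp_path_join loops_at_reverse flip: mult_fundamental_group[OF fl fl])
  next
    case (hom q q')
    have "path_class (rose_space g) q = path_class (rose_space g) q'"
      using hom path_class_eqI by blast
    moreover have "path_class (rose_space g) (f \<circ> q) = path_class (rose_space g) (f \<circ> q')"
      by (rule path_class_eqI[OF path_homotopic_compose[OF hom(1) f(1)]])
    ultimately show ?case using hom by (simp add: o_def)
  qed
  then show ?thesis using f by (simp add: realizes_def)
qed

text \<open>A map of the rose is given by one loop for each petal, so the images of the generators
  may be prescribed.\<close>

lemma realizes_exists:
  assumes \<alpha>: "\<alpha> \<in> hom (Fg g) (Fg g)"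
  shows "\<exists>f. realizes g f \<alpha>"
proof -
  have "\<exists>p\<in>rose_loops g. \<alpha> (path_class (rose_space g) (edge_path (rose g) i)) = path_class (rose_space g) p" if "i < g" for i
  proof -
    have "path_class (rose_space g) (edge_path (rose g) i) \<in> carrier (Fg g)"
      unfolding Fg_def carrier_fundamental_group using that by auto
    then have "\<alpha> (path_class (rose_space g) (edge_path (rose g) i)) \<in> carrier (Fg g)"
      using \<alpha> by (auto simp: hom_def)
    then show ?thesis by (simp add: Fg_def carrier_fundamental_group)
  qed
  then obtain ps where ps: "\<And>i. i < g \<Longrightarrow> ps i \<in> rose_loops g \<and>
      \<alpha> (path_class (rose_space g) (edge_path (rose g) i)) = path_class (rose_space g) (ps i)"
    by metis
  have f: "continuous_map (rose_space g) (rose_space g) (rose_of (Vertex ()) ps)"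
    using ps by (intro continuous_map_rose_of) (auto simp: loops_at_def)
  have "realizes g (rose_of (Vertex ()) ps) \<alpha>"
  proof (rule realizesI[OF \<alpha> f])
    fix i assume i: "i < g"
    have "path_homotopic (rose_space g) (rose_of (Vertex ()) ps \<circ> edge_path (rose g) i) (ps i)"
      using ps[OF i] by (intro path_homotopic_rose_of) (auto simp: loops_at_def)
    then show "path_class (rose_space g) (rose_of (Vertex ()) ps \<circ> edge_path (rose g) i) =
        \<alpha> (path_class (rose_space g) (edge_path (rose g) i))"
      using ps[OF i] path_class_eqI by metis
  qed simp
  then show ?thesis by blast
qed

lemma realizes_homotopic:
  assumes "realizes g f \<alpha>" "realizes g f' \<alpha>"
  shows "homotopic_with (\<lambda>_. True) (rose_space g) (rose_space g) f f'"
proof (rule homotopic_rose)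
  fix i assume "i < g"
  then have "path_class (rose_space g) (f \<circ> edge_path (rose g) i) = path_class (rose_space g) (f' \<circ> edge_path (rose g) i)"
    using assms by (auto simp: realizes_def)
  then show "path_homotopic (rose_space g) (f \<circ> edge_path (rose g) i) (f' \<circ> edge_path (rose g) i)"
    by (rule iffD1[OF path_class_eq, rotated])
       (use assms \<open>i < g\<close> in \<open>auto simp: realizes_def intro!: pathin_compose\<close>)
qed (use assms in \<open>auto simp: realizes_def\<close>)

lemma realizes_compose:
  assumes "realizes g f \<alpha>" "realizes g f' \<beta>"
  shows "realizes g (f \<circ> f') (compose (carrier (Fg g)) \<alpha> \<beta>)"
proof -
  have "path_class (rose_space g) (f \<circ> f' \<circ> p) = compose (carrier (Fg g)) \<alpha> \<beta> (path_class (rose_space g) p)"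
    if p: "p \<in> rose_loops g" for p
  proof -
    have "f' \<circ> p \<in> rose_loops g" using assms p rose_loops_compose by (auto simp: realizes_def)
    then have "path_class (rose_space g) (f \<circ> (f' \<circ> p)) = \<alpha> (\<beta> (path_class (rose_space g) p))"
      using assms p by (simp add: realizes_def)
    moreover have "path_class (rose_space g) p \<in> carrier (Fg g)"
      using p by (auto simp: Fg_def carrier_fundamental_group)
    ultimately show ?thesis by (simp add: compose_def comp_assoc)
  qed
  then show ?thesis
    using assms by (auto simp: realizes_def intro: continuous_map_compose)
qed

lemma realizes_id: "realizes g id (\<lambda>x\<in>carrier (Fg g). x)"
  by (auto simp: realizes_def Fg_def carrier_fundamental_group)

text \<open>The choice in \<open>rose_map\<close> has a witness: maps realizing
  \<open>\<alpha>\<close> and its inverse compose to maps realizing the identity, and these are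
  homotopic to it by \<open>realizes_homotopic\<close>.\<close>

lemma rose_map_props:
  assumes \<alpha>: "\<alpha> \<in> auto (Fg g)"
  shows "homotopy_equivalence (rose_space g) (rose_space g) (rose_map g \<alpha>)" and "realizes g (rose_map g \<alpha>) \<alpha>"
proof -
  let ?S = "carrier (Fg g)"
  let ?\<beta> = "restrict (inv_into ?S \<alpha>) ?S"
  have h: "\<alpha> \<in> hom (Fg g) (Fg g)" and B: "\<alpha> \<in> Bij ?S" using \<alpha> by (auto simp: auto_def)
  have \<beta>: "?\<beta> \<in> hom (Fg g) (Fg g)" "?\<beta> \<in> Bij ?S"
    using group.restrict_inv_into_hom[OF group_Fg h B] restrict_inv_into_Bij[OF B] by auto
  obtain f where f: "realizes g f \<alpha>" using realizes_exists[OF h] by blast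
  obtain f' where f': "realizes g f' ?\<beta>" using realizes_exists[OF \<beta>(1)] by blast
  have "compose ?S ?\<beta> \<alpha> = (\<lambda>x\<in>?S. x)" by (rule Bij_compose_restrict_eq[OF B])
  moreover have "compose ?S \<alpha> ?\<beta> = (\<lambda>x\<in>?S. x)"
    using B by (auto simp: compose_def fun_eq_iff Bij_def bij_betw_def f_inv_into_f)
  ultimately have "homotopy_equivalence (rose_space g) (rose_space g) f"
    unfolding homotopy_equivalence_def
    using realizes_homotopic[OF realizes_compose[OF f f'], of id] realizes_homotopic[OF realizes_compose[OF f' f], of id]
      realizes_id f f' by (auto simp: realizes_def)
  then have "\<exists>f. homotopy_equivalence (rose_space g) (rose_space g) f \<and> f (Vertex ()) = Vertex () \<and>
     (\<forall>p\<in>rose_loops g. path_class (rose_space g) (f \<circ> p) = \<alpha> (path_class (rose_space g) p))"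
    using f by (auto simp: realizes_def)
  from someI_ex[OF this] show "homotopy_equivalence (rose_space g) (rose_space g) (rose_map g \<alpha>)"
    "realizes g (rose_map g \<alpha>) \<alpha>"
    unfolding rose_map_def[symmetric] by (auto simp: realizes_def homotopy_equivalence_def)
qed

lemma compose_auto:
  assumes "\<alpha> \<in> auto (Fg g)" "\<beta> \<in> auto (Fg g)"
  shows "compose (carrier (Fg g)) \<alpha> \<beta> \<in> auto (Fg g)"
proof -
  interpret F: group "Fg g" by simp
  interpret A: group "AutoGroup (Fg g)" by (rule F.AutoGroup)
  show ?thesis using A.m_closed[of \<alpha> \<beta>] assms by (simp add: F.mult_AutoGroup)
qed

lemma rose_map_compose:
  assumes "\<alpha> \<in> auto (Fg g)" "\<beta> \<in> auto (Fg g)"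
  shows "homotopic_with (\<lambda>_. True) (rose_space g) (rose_space g)
     (rose_map g \<alpha> \<circ> rose_map g \<beta>) (rose_map g (compose (carrier (Fg g)) \<alpha> \<beta>))"
  using realizes_homotopic realizes_compose rose_map_props(2) compose_auto assms by metis

lemma rose_map_one:
  "homotopic_with (\<lambda>_. True) (rose_space g) (rose_space g) (rose_map g (\<lambda>x\<in>carrier (Fg g). x)) id"
  using realizes_homotopic realizes_id rose_map_props(2) group.id_in_auto[OF group_Fg] by metis

text \<open>Conjugation by the class of \<open>c\<close> is the change of base point along the loop
  \<open>c\<close>, and dragging the base point is a free homotopy. Hence all automorphisms in one
  outer class give homotopic maps of the rose.\<close>

lemma rose_map_inner:
  assumes \<beta>: "\<beta> \<in> auto (Fg g)" and a: "a \<in> carrier (Fg g)"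
  shows "homotopic_with (\<lambda>_. True) (rose_space g) (rose_space g)
     (rose_map g (compose (carrier (Fg g)) (group.inner (Fg g) a) \<beta>)) (rose_map g \<beta>)"
proof -
  interpret F: group "Fg g" by simp
  let ?\<alpha> = "compose (carrier (Fg g)) (F.inner a) \<beta>"
  obtain c where c: "c \<in> rose_loops g" "a = path_class (rose_space g) c"
    using a by (auto simp: Fg_def carrier_fundamental_group)
  let ?f = "rose_map g \<beta>"
  note f = rose_map_props[OF \<beta>]
  have \<alpha>: "?\<alpha> \<in> auto (Fg g)" using compose_auto[OF F.inner_in_auto[OF a] \<beta>] .
  note f' = rose_map_props(2)[OF \<alpha>]
  let ?k = "rose_of (c 0) (\<lambda>i. path_conj c (?f \<circ> edge_path (rose g) i))"
  have cont: "continuous_map (rose_space g) (rose_space g) ?f" "?f (Vertex ()) = Vertex ()"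
    using f by (auto simp: realizes_def)
  have c': "pathin (rose_space g) c" "c 0 = Vertex ()" "c 1 = Vertex ()" using c by (auto simp: loops_at_def)
  have 1: "homotopic_with (\<lambda>_. True) (rose_space g) (rose_space g) ?k ?f"
    using c' cont by (intro homotopic_rose_conj) auto
  have "homotopic_with (\<lambda>_. True) (rose_space g) (rose_space g) (rose_map g ?\<alpha>) ?k"
  proof (rule homotopic_rose)
    show "continuous_map (rose_space g) (rose_space g) ?k"
      using 1 homotopic_with_imp_continuous_maps by blast
    fix i assume i: "i < g"
    let ?e = "edge_path (rose g) i" and ?P = "path_class (rose_space g)"
    have fe: "?f \<circ> ?e \<in> rose_loops g" using rose_loops_compose[OF cont] i by simp
    have "?P (rose_map g ?\<alpha> \<circ> ?e) = ?\<alpha> (?P ?e)" using f' i by (simp add: realizes_def)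
    also have "\<dots> = F.inner a (\<beta> (?P ?e))"
      using i by (auto simp: compose_def Fg_def carrier_fundamental_group)
    also have "\<beta> (?P ?e) = ?P (?f \<circ> ?e)" using f i by (simp add: realizes_def)
    also have "F.inner a (?P (?f \<circ> ?e)) = ?P (path_join (path_join c (?f \<circ> ?e)) (path_reverse c))"
      using fe c by (simp add: F.inner_def) (auto simp: Fg_def carrier_fundamental_group inv_fundamental_group
          mult_fundamental_group loops_at_join loops_at_reverse)
    finally have "path_homotopic (rose_space g) (rose_map g ?\<alpha> \<circ> ?e) (path_join (path_join c (?f \<circ> ?e)) (path_reverse c))"
    proof (rule iffD1[OF path_class_eq, rotated])
      show "pathin (rose_space g) (rose_map g ?\<alpha> \<circ> ?e)"
        by (rule pathin_compose) (use f' i in \<open>auto simp: realizes_def\<close>)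
    qed
    also have "path_homotopic (rose_space g) \<dots> (path_conj c (?f \<circ> ?e))"
      unfolding path_conj_def using fe c' by (intro path_homotopic_assoc) (auto simp: loops_at_def)
    also have "path_homotopic (rose_space g) \<dots> (?k \<circ> ?e)"
    proof (rule path_homotopic_sym[OF path_homotopic_rose_of])
      have "pathin (rose_space g) (?f \<circ> ?e)" "(?f \<circ> ?e) 0 = Vertex ()" "(?f \<circ> ?e) 1 = Vertex ()"
        using fe by (simp_all only: loops_at_iff)
      then show "pathin (rose_space g) (path_conj c (?f \<circ> ?e))"
        using c' by (intro pathin_conj) simp_all
    qed simp_all
    finally show "path_homotopic (rose_space g) (rose_map g ?\<alpha> \<circ> ?e) (?k \<circ> ?e)" .
  qed (use f' c' in \<open>auto simp: realizes_def\<close>)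
  from homotopic_with_trans[OF this 1] show ?thesis .
qed

lemma rose_map_Out:
  assumes "A \<in> carrier (Out (Fg g))" "\<alpha> \<in> A" "\<beta> \<in> A"
  shows "homotopic_with (\<lambda>_. True) (rose_space g) (rose_space g) (rose_map g \<alpha>) (rose_map g \<beta>)"
proof -
  interpret F: group "Fg g" by simp
  show ?thesis
    using F.Out_elements[OF assms] F.Out_subset_auto[OF assms(1)] assms rose_map_inner by blast
qed

subsection \<open>Homotopy equivalences and loops\<close>

lemma homotopy_equivalence_compose:
  assumes "homotopy_equivalence X Y f" "homotopy_equivalence Y Z k"
  shows "homotopy_equivalence X Z (k \<circ> f)"
proof -
  obtain f' k' where f: "continuous_map X Y f" "continuous_map Y X f'"
    "homotopic_with (\<lambda>_. True) X X (f' \<circ> f) id" "homotopic_with (\<lambda>_. True) Y Y (f \<circ> f') id"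
    and k: "continuous_map Y Z k" "continuous_map Z Y k'"
    "homotopic_with (\<lambda>_. True) Y Y (k' \<circ> k) id" "homotopic_with (\<lambda>_. True) Z Z (k \<circ> k') id"
    using assms unfolding homotopy_equivalence_def by blast
  have r: "homotopic_with (\<lambda>_. True) X Y f f" "homotopic_with (\<lambda>_. True) Y X f' f'"
    "homotopic_with (\<lambda>_. True) Y Z k k" "homotopic_with (\<lambda>_. True) Z Y k' k'"
    using f k by auto
  have 1: "homotopic_with (\<lambda>_. True) X X (f' \<circ> k' \<circ> (k \<circ> f)) (f' \<circ> f)"
    using homotopic_compose[OF homotopic_compose[OF r(1) k(3)] r(2)] by (simp add: o_assoc)
  have 2: "homotopic_with (\<lambda>_. True) Z Z (k \<circ> f \<circ> (f' \<circ> k')) (k \<circ> k')"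
    using homotopic_compose[OF homotopic_compose[OF r(4) f(4)] r(3)] by (simp add: o_assoc)
  show ?thesis
    unfolding homotopy_equivalence_def
  proof (intro conjI exI)
    show "continuous_map X Z (k \<circ> f)" "continuous_map Z X (f' \<circ> k')" using f k continuous_map_compose by blast+
    show "homotopic_with (\<lambda>_. True) X X (f' \<circ> k' \<circ> (k \<circ> f)) id" by (rule homotopic_with_trans[OF 1 f(3)])
    show "homotopic_with (\<lambda>_. True) Z Z (k \<circ> f \<circ> (f' \<circ> k')) id" by (rule homotopic_with_trans[OF 2 k(4)])
  qed
qed

lemma homotopy_equivalence_homotopic:
  assumes "homotopy_equivalence X Y f" "homotopic_with (\<lambda>_. True) X Y f k"
  shows "homotopy_equivalence X Y k"
proof -
  obtain f' where f: "continuous_map X Y f" "continuous_map Y X f'"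
    "homotopic_with (\<lambda>_. True) X X (f' \<circ> f) id" "homotopic_with (\<lambda>_. True) Y Y (f \<circ> f') id"
    using assms unfolding homotopy_equivalence_def by blast
  have 1: "homotopic_with (\<lambda>_. True) X X (f' \<circ> k) (f' \<circ> f)"
    by (rule homotopic_compose[OF homotopic_with_symD[OF assms(2)]]) (use f in auto)
  have 2: "homotopic_with (\<lambda>_. True) Y Y (k \<circ> f') (f \<circ> f')"
    by (rule homotopic_compose[OF _ homotopic_with_symD[OF assms(2)]]) (use f in auto)
  show ?thesis
    unfolding homotopy_equivalence_def
    using homotopic_with_trans[OF 1 f(3)] homotopic_with_trans[OF 2 f(4)] f(2)
      homotopic_with_imp_continuous_maps[OF assms(2)] by blast
qed

lemma homotopy_equivalence_homeomorphic:
  assumes "homeomorphic_maps X Y f k"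
  shows "homotopy_equivalence X Y f"
  using assms unfolding homeomorphic_maps_def homotopy_equivalence_def
  by (auto intro!: exI[of _ k] homotopic_with_equal continuous_map_compose)

text \<open>A homotopy inverse turns the given null-homotopy into one for the image of
  \<open>p\<close> under the composite, and up to conjugation by the trace of the base point that
  image is \<open>p\<close> itself.\<close>

lemma homotopy_equivalence_null:
  assumes f: "homotopy_equivalence X Y f" and p: "pathin X p" "p 0 = p 1"
    and null: "path_homotopic Y (f \<circ> p) (\<lambda>_. f (p 0))"
  shows "path_homotopic X p (\<lambda>_. p 0)"
proof -
  obtain k where k: "continuous_map Y X k" "homotopic_with (\<lambda>_. True) X X (k \<circ> f) id"
    using f unfolding homotopy_equivalence_def by blast
  obtain c where c: "pathin X c" "c 0 = id (p 0)" "c 1 = (k \<circ> f) (p 0)"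
    "\<And>q. pathin X q \<Longrightarrow> q 0 = p 0 \<Longrightarrow> q 1 = p 0 \<Longrightarrow> path_homotopic X (id \<circ> q) (path_conj c (k \<circ> f \<circ> q))"
    using homotopic_track_loops[OF homotopic_with_symD[OF k(2)] path_start_in_topspace[OF p(1)]] by blast
  have "path_homotopic X p (path_conj c (k \<circ> f \<circ> p))" using c(4)[OF p(1) refl p(2)[symmetric]] by simp
  also have "path_homotopic X \<dots> (path_conj c (\<lambda>_. c 1))"
    using path_homotopic_compose[OF null k(1)] c p
    by (intro path_homotopic_conj) (auto simp: o_def)
  also have "path_homotopic X \<dots> (\<lambda>_. p 0)"
    using path_homotopic_conj_const[OF c(1)] c by simp
  finally show ?thesis .
qed

lemma rose_path_connected:
  assumes "x \<in> gpoints (rose g)"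
  obtains d where "pathin (rose_space g) d" "d 0 = Vertex ()" "d 1 = x"
  using assms
proof (cases rule: gpoints_cases)
  case (vertex v)
  then show ?thesis by (intro that[of "\<lambda>_. Vertex ()"]) auto
next
  case (inner e t)
  then show ?thesis using pathin_seg[OF wf_digraph_rose, of e g 0 t]
    by (intro that[of "seg (rose g) e 0 t"]) (auto simp: edge_path_inner)
qed

text \<open>A self-equivalence may move the vertex. It is first homotoped to a map \<open>k\<close>
  that fixes it, by dragging the base point along \<open>d\<close>; then \<open>k\<close> induces an
  automorphism of the fundamental group and realizes it.\<close>

lemma rose_self_equivalence:
  assumes f: "homotopy_equivalence (rose_space g) (rose_space g) f"
  shows "\<exists>\<alpha>\<in>auto (Fg g). homotopic_with (\<lambda>_. True) (rose_space g) (rose_space g) f (rose_map g \<alpha>)"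
proof -
  let ?R = "rose_space g" and ?v = "Vertex () :: (unit, nat) gpoint" and ?P = "path_class (rose_space g)"
  interpret F: group "Fg g" by simp
  have "continuous_map ?R ?R f" using f by (simp add: homotopy_equivalence_def)
  moreover from this have "f ?v \<in> gpoints (rose g)" using continuous_map_funspace by fastforce
  then obtain d where d: "pathin ?R d" "d 0 = ?v" "d 1 = f ?v" by (rule rose_path_connected)
  define k where "k = rose_of (d 0) (\<lambda>i. path_conj d (f \<circ> edge_path (rose g) i))"
  ultimately have kf: "homotopic_with (\<lambda>_. True) ?R ?R k f"
    unfolding k_def using d by (intro homotopic_rose_conj) auto
  have ke: "homotopy_equivalence ?R ?R k"
    using homotopy_equivalence_homotopic[OF f homotopic_with_symD[OF kf]] .
  have kv: "k ?v = ?v" by (simp add: k_def d)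
  have kc: "continuous_map ?R ?R k" using ke by (simp add: homotopy_equivalence_def)
  note kl = rose_loops_compose[OF kc kv]
  define \<alpha> where "\<alpha> = (\<lambda>A\<in>carrier (Fg g). ?P (k \<circ> (SOME p. p \<in> rose_loops g \<and> A = ?P p)))"
  have car: "?P p \<in> carrier (Fg g)" if "p \<in> rose_loops g" for p
    using that by (auto simp: Fg_def carrier_fundamental_group)
  have carE: "\<exists>p\<in>rose_loops g. A = ?P p" if "A \<in> carrier (Fg g)" for A
    using that by (auto simp: Fg_def carrier_fundamental_group)
  have Peq: "?P p = ?P q \<longleftrightarrow> path_homotopic ?R p q" if "p \<in> rose_loops g" for p q
    using that path_class_eq by (auto simp: loops_at_def)
  have \<alpha>: "\<alpha> (?P p) = ?P (k \<circ> p)" if p: "p \<in> rose_loops g" for p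
  proof -
    define q where "q = (SOME q. q \<in> rose_loops g \<and> ?P p = ?P q)"
    have "q \<in> rose_loops g \<and> ?P p = ?P q"
      unfolding q_def by (rule someI[of _ p]) (use p in simp)
    then have "path_homotopic ?R p q" using Peq[OF p] by blast
    then have "?P (k \<circ> p) = ?P (k \<circ> q)"
      using path_homotopic_compose[OF _ kc] Peq[OF kl[OF p]] by blast
    then show ?thesis using car[OF p] by (simp add: \<alpha>_def q_def)
  qed
  have hom: "\<alpha> \<in> hom (Fg g) (Fg g)"
  proof (rule homI)
    fix A B assume A: "A \<in> carrier (Fg g)" and B: "B \<in> carrier (Fg g)"
    obtain p where p: "p \<in> rose_loops g" "A = ?P p" using carE[OF A] by blast
    obtain q where q: "q \<in> rose_loops g" "B = ?P q" using carE[OF B] by blast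
    show "\<alpha> A \<in> carrier (Fg g)" using p \<alpha> car kl by simp
    show "\<alpha> (A \<otimes>\<^bsub>Fg g\<^esub> B) = \<alpha> A \<otimes>\<^bsub>Fg g\<^esub> \<alpha> B"
      using p q \<alpha> kl by (simp add: Fg_def mult_fundamental_group loops_at_join comp_path_join)
  qed
  have inj: "inj_on \<alpha> (carrier (Fg g))"
  proof -
    interpret h: group_hom "Fg g" "Fg g" \<alpha> using hom by unfold_locales
    have "\<forall>A\<in>carrier (Fg g). \<alpha> A = \<one>\<^bsub>Fg g\<^esub> \<longrightarrow> A = \<one>\<^bsub>Fg g\<^esub>"
    proof (intro ballI impI)
      fix A assume A: "A \<in> carrier (Fg g)" "\<alpha> A = \<one>\<^bsub>Fg g\<^esub>"
      obtain p where p: "p \<in> rose_loops g" "A = ?P p" using carE[OF A(1)] by blast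
      have "path_homotopic ?R (k \<circ> p) (\<lambda>_. ?v)"
        using A(2) p \<alpha> Peq[OF kl[OF p(1)]] by (simp add: Fg_def one_fundamental_group)
      then have "path_homotopic ?R p (\<lambda>_. p 0)"
        using p kv by (intro homotopy_equivalence_null[OF ke]) (auto simp: loops_at_def)
      then show "A = \<one>\<^bsub>Fg g\<^esub>"
        using p Peq[OF p(1)] by (auto simp: Fg_def one_fundamental_group loops_at_def)
    qed
    then show ?thesis using h.inj_iff_trivial_ker by (auto simp: kernel_def)
  qed
  have surj: "\<exists>p\<in>rose_loops g. path_homotopic ?R (k \<circ> p) q" if q: "q \<in> rose_loops g" for q
  proof -
    obtain k' where k': "continuous_map ?R ?R k'" "homotopic_with (\<lambda>_. True) ?R ?R (k \<circ> k') id"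
      using ke unfolding homotopy_equivalence_def by blast
    obtain c where c: "pathin ?R c" "c 0 = id ?v" "c 1 = (k \<circ> k') ?v"
      "\<And>q. pathin ?R q \<Longrightarrow> q 0 = ?v \<Longrightarrow> q 1 = ?v \<Longrightarrow> path_homotopic ?R (id \<circ> q) (path_conj c (k \<circ> k' \<circ> q))"
      using homotopic_track_loops[OF homotopic_with_symD[OF k'(2)], of ?v] by auto
    have "k' ?v \<in> gpoints (rose g)" using continuous_map_funspace[OF k'(1)] by auto
    then obtain d where d: "pathin ?R d" "d 0 = ?v" "d 1 = k' ?v" by (rule rose_path_connected)
    \<comment> \<open>Up to homotopy \<open>k \<circ> k'\<close> is conjugation by the reverse of
      \<open>c\<close>, so together with the passage along \<open>d\<close> it amounts to
      conjugation by this loop \<open>m\<close>. The loop \<open>q\<close> is conjugated by its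
      reverse beforehand.\<close>
    define m where "m = path_join (k \<circ> d) (path_reverse c)"
    have m: "pathin ?R m" "m 0 = ?v" "m 1 = ?v"
      using c d kv kc by (auto simp: m_def intro!: pathin_join pathin_compose)
    define q' where "q' = path_conj (path_reverse m) q"
    have q': "pathin ?R q'" "q' 0 = ?v" "q' 1 = ?v" using m q by (auto simp: q'_def loops_at_def)
    define p where "p = path_conj d (k' \<circ> q')"
    have k'q: "pathin ?R (k' \<circ> q')" using q' k' by (auto intro: pathin_compose)
    have p: "p \<in> rose_loops g" using d q' k'q by (auto simp: p_def loops_at_def)
    have kd: "pathin ?R (k \<circ> d)" using kc d by (auto intro: pathin_compose)
    have kkq: "pathin ?R (k \<circ> (k' \<circ> q'))" using kc k'q by (auto intro: pathin_compose)
    have 1: "path_homotopic ?R (k \<circ> (k' \<circ> q')) (path_conj (path_reverse c) q')"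
      using c(4)[OF q'] c q' kkq by (intro path_homotopic_conj_swap) (auto simp: o_assoc)
    have "path_homotopic ?R (k \<circ> p) (path_conj (k \<circ> d) (path_conj (path_reverse c) q'))"
      unfolding p_def comp_path_conj using kd d q' by (intro path_homotopic_conj[OF 1]) auto
    also have "path_homotopic ?R \<dots> (path_conj m q')"
      unfolding m_def using kd c d q' by (intro path_homotopic_conj_conj) auto
    also have "path_homotopic ?R \<dots> (path_conj (path_join m (path_reverse m)) q)"
      unfolding q'_def using m q by (intro path_homotopic_conj_conj) (auto simp: loops_at_def)
    also have "path_homotopic ?R \<dots> q"
      using path_homotopic_rinv[OF m(1)] m q by (intro path_homotopic_conj_null) (auto simp: loops_at_def)
    finally show ?thesis using p by blast
  qed
  have "\<alpha> ` carrier (Fg g) = carrier (Fg g)"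
  proof
    show "\<alpha> ` carrier (Fg g) \<subseteq> carrier (Fg g)" using hom by (auto simp: hom_def)
    show "carrier (Fg g) \<subseteq> \<alpha> ` carrier (Fg g)"
    proof
      fix B assume B: "B \<in> carrier (Fg g)"
      obtain q where q: "q \<in> rose_loops g" "B = ?P q" using carE[OF B] by blast
      obtain p where p: "p \<in> rose_loops g" "path_homotopic ?R (k \<circ> p) q" using surj[OF q(1)] by blast
      have "\<alpha> (?P p) = B" using \<alpha>[OF p(1)] Peq[OF kl[OF p(1)]] p q by simp
      then show "B \<in> \<alpha> ` carrier (Fg g)" using car[OF p(1)] by blast
    qed
  qed
  with inj hom have a: "\<alpha> \<in> auto (Fg g)"
    by (auto simp: auto_def Bij_def bij_betw_def) (simp add: \<alpha>_def)
  have "realizes g k \<alpha>" using kc kv \<alpha> by (simp add: realizes_def)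
  from realizes_homotopic[OF this rose_map_props(2)[OF a]] a homotopic_with_trans[OF homotopic_with_symD[OF kf]]
  show ?thesis by blast
qed

text \<open>One petal is wrapped once around the circle in the punctured plane and the others are
  sent to a point. A null-homotopy of the petal would give the circle winding number 0 instead of
  1.\<close>

lemma rose_loop_nontrivial:
  assumes i: "i < g"
  shows "\<not> path_homotopic (rose_space g) (edge_path (rose g) i) (\<lambda>_. Vertex ())"
proof
  assume h: "path_homotopic (rose_space g) (edge_path (rose g) i) (\<lambda>_. Vertex ())"
  define f where "f = rose_of (1::complex) (\<lambda>j. if j = i then circlepath 0 1 else (\<lambda>_. 1))"
  let ?Y = "top_of_set (- {0::complex})"
  have circ: "circlepath 0 1 0 = (1::complex)" "circlepath 0 1 1 = (1::complex)"
    by (auto simp: circlepath)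
  have pc: "pathin ?Y (circlepath 0 1)"
    using path_circlepath[of 0 1]
    by (auto simp: pathin_def path_def continuous_map_in_subtopology circlepath)
  have "continuous_map (rose_space g) ?Y f"
    unfolding f_def using pc circ by (intro continuous_map_rose_of) auto
  from path_homotopic_compose[OF h this]
  have "path_homotopic ?Y (f \<circ> edge_path (rose g) i) (\<lambda>_. 1)" by (simp add: o_def f_def)
  moreover have "path_homotopic ?Y (f \<circ> edge_path (rose g) i) (circlepath 0 1)"
    unfolding f_def using pc circ path_homotopic_rose_of[of ?Y "\<lambda>j. if j = i then circlepath 0 1 else (\<lambda>_. 1)" i 1 g] by simp
  ultimately have "path_homotopic ?Y (circlepath 0 1) (\<lambda>_. 1)"
    using path_homotopic_sym path_homotopic_trans by meson
  then have "homotopic_paths (- {0}) (circlepath 0 1) (linepath 1 1)"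
    by (simp add: path_homotopic_def homotopic_paths_def pathstart_def pathfinish_def linepath_def[abs_def])
  then have "winding_number (circlepath 0 1) 0 = winding_number (linepath 1 1) 0"
    by (rule winding_number_homotopic_paths)
  then show False
    using winding_number_circlepath_centre[of 1 0] winding_number_trivial[of 0 1] by simp
qed

section \<open>Equivalence of markings\<close>

lemma path_homotopic_reverse_join:
  assumes "pathin X p" "pathin X q" "p 1 = q 0"
  shows "path_homotopic X (path_reverse (path_join p q)) (path_join (path_reverse q) (path_reverse p))"
proof -
  have "path_reverse (path_join p q) t = path_join (path_reverse q) (path_reverse p) t" for t
    using assms by (cases "t = 1/2") (auto simp: path_reverse_def path_join_def algebra_simps)
  then have "path_reverse (path_join p q) = path_join (path_reverse q) (path_reverse p)" by (rule ext)
  then show ?thesis using assms by simp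
qed

section \<open>Replacement of virtual loops in paths\<close>

definition virtual_part :: "wgraph \<Rightarrow> nat \<Rightarrow> (nat, nat + nat \<times> nat) gpoint set" where
  "virtual_part Y u = insert (Vertex u) (\<Union>i<snd Y u. open_edge (Inr (u, i)))"

lemma with_virtual_loops_simps [simp]:
  "verts (with_virtual_loops Y) = verts (fst Y)"
  "Inl e \<in> arcs (with_virtual_loops Y) \<longleftrightarrow> e \<in> arcs (fst Y)"
  "Inr (v, i) \<in> arcs (with_virtual_loops Y) \<longleftrightarrow> v \<in> verts (fst Y) \<and> i < snd Y v"
  "tail (with_virtual_loops Y) (Inl e) = tail (fst Y) e"
  "head (with_virtual_loops Y) (Inl e) = head (fst Y) e"
  "tail (with_virtual_loops Y) (Inr l) = fst l"
  "head (with_virtual_loops Y) (Inr l) = fst l"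
  by (auto simp: with_virtual_loops_def)

lemma arcs_with_virtual_loops_cases:
  assumes "a \<in> arcs (with_virtual_loops Y)"
  obtains (real) e where "a = Inl e" "e \<in> arcs (fst Y)"
  | (virtual) v i where "a = Inr (v, i)" "v \<in> verts (fst Y)" "i < snd Y v"
  using assms by (auto simp: with_virtual_loops_def)

lemma wf_with_virtual_loops [simp]:
  "wf_digraph (fst Y) \<Longrightarrow> wf_digraph (with_virtual_loops Y)"
  by (auto simp: wf_digraph_def elim!: arcs_with_virtual_loops_cases)

lemma virtual_sequence_props:
  assumes "virtual_sequence Y u s" "wf_digraph (fst Y)" "u \<in> verts (fst Y)"
  shows "pathin (vrealization Y) s" "s 0 = Vertex u" "s 1 = Vertex u" "\<And>t. t \<in> {0..1} \<Longrightarrow> s t \<in> virtual_part Y u"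
proof -
  have e: "pathin (vrealization Y) (edge_path (with_virtual_loops Y) (Inr (u, i)))"
    "edge_path (with_virtual_loops Y) (Inr (u, i)) t \<in> virtual_part Y u" if "i < snd Y u" for i t
    using that assms by (auto simp: virtual_part_def edge_path_def open_edge_def image_iff)
  have "pathin (vrealization Y) s \<and> s 0 = Vertex u \<and> s 1 = Vertex u \<and> (\<forall>t\<in>{0..1}. s t \<in> virtual_part Y u)"
    using assms(1)
  proof induction
    case empty
    then show ?case using assms by (auto simp: virtual_part_def)
  next
    case (forward i s)
    have "path_join (edge_path (with_virtual_loops Y) (Inr (u, i))) s t \<in> virtual_part Y u" if "t \<in> {0..1}" for t
      using forward e that by (simp add: path_join_def)
    then show ?case using forward e by simp
  next
    case (backward i s)
    have "path_join (path_reverse (edge_path (with_virtual_loops Y) (Inr (u, i)))) s t \<in> virtual_part Y u" if "t \<in> {0..1}" for t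
      using backward e that by (simp add: path_join_def path_reverse_def)
    then show ?case using backward e by simp
  qed
  then show "pathin (vrealization Y) s" "s 0 = Vertex u" "s 1 = Vertex u" "\<And>t. t \<in> {0..1} \<Longrightarrow> s t \<in> virtual_part Y u"
    by auto
qed

text \<open>The loop meets only virtual edges at \<open>u\<close>, so its dart walk over these edges
  is literally a virtual sequence.\<close>

lemma virtual_part_loop:
  assumes wf: "wf_digraph (fst Y)" and u: "u \<in> verts (fst Y)"
    and p: "pathin (vrealization Y) p" "p 0 = Vertex u" "p 1 = Vertex u"
    and img: "\<And>t. t \<in> {0..1} \<Longrightarrow> p t \<in> virtual_part Y u"
  obtains s where "virtual_sequence Y u s" "path_homotopic (vrealization Y) p s"
proof -
  let ?E = "{Inr (u, i) |i. i < snd Y u}" and ?G = "with_virtual_loops Y"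
  have "meets_only ?E p"
    unfolding meets_only_def using img by (fastforce simp: virtual_part_def open_edge_def)
  moreover have "?E \<subseteq> arcs ?G" using u by auto
  ultimately obtain q where q: "dart_walk ?G ?E u q u" "path_homotopic (vrealization Y) p q"
    using path_homotopic_dart_walk[OF wf_with_virtual_loops[OF wf] p(1) _ _ p(2,3)] by blast
  have "virtual_sequence Y u q" if "dart_walk ?G ?E a q b" "a = u" for a b q
    using that
  proof (induction rule: dart_walk.induct)
    case (nil u')
    then show ?case by (simp add: virtual_sequence.empty)
  next
    case (forward e p w)
    then obtain i where "e = Inr (u, i)" "i < snd Y u" by auto
    with forward show ?case by (auto intro: virtual_sequence.forward)
  next
    case (backward e p w)
    then obtain i where "e = Inr (u, i)" "i < snd Y u" by auto
    with backward show ?case by (auto intro: virtual_sequence.backward)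
  qed
  with q that show ?thesis by blast
qed

lemma virtual_equiv_props:
  assumes "virtual_equiv Y p q" "wf_digraph (fst Y)"
  shows "pathin (vrealization Y) p" "pathin (vrealization Y) q" "q 0 = p 0" "q 1 = p 1"
proof -
  have "pathin (vrealization Y) p \<and> pathin (vrealization Y) q \<and> q 0 = p 0 \<and> q 1 = p 1"
    using assms(1)
  proof induction
    case (homotopy p q)
    then show ?case using path_homotopic_imp_pathin path_homotopic_imp_endpoints by metis
  next
    case (replace u s s' a b)
    then show ?case
      using virtual_sequence_props[OF replace(2) assms(2) replace(1)]
        virtual_sequence_props[OF replace(3) assms(2) replace(1)] by auto
  qed auto
  then show "pathin (vrealization Y) p" "pathin (vrealization Y) q" "q 0 = p 0" "q 1 = p 1" by auto
qed

lemma virtual_equiv_sym: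
  assumes "virtual_equiv Y p q"
  shows "virtual_equiv Y q p"
  using assms by induction (auto intro: virtual_equiv.intros path_homotopic_sym)

text \<open>Congruence under joins is not built into the definition; associativity absorbs the new
  initial path into the prefix of the replacement rule.\<close>

lemma virtual_equiv_left:
  assumes "virtual_equiv Y p q" "wf_digraph (fst Y)" "pathin (vrealization Y) a" "a 1 = p 0"
  shows "virtual_equiv Y (path_join a p) (path_join a q)"
  using assms(1,4)
proof induction
  case (homotopy p q)
  then show ?case using assms by (intro virtual_equiv.homotopy path_homotopic_join) auto
next
  case (replace u s s' c b)
  note S = virtual_sequence_props[OF replace(2) assms(2) replace(1)]
    virtual_sequence_props[OF replace(3) assms(2) replace(1)]
  have A: "path_homotopic (vrealization Y) (path_join a (path_join c (path_join s b)))
     (path_join (path_join a c) (path_join s b))" if "pathin (vrealization Y) s" "s 0 = Vertex u" "s 1 = Vertex u" for s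
    using replace that assms by (intro path_homotopic_sym[OF path_homotopic_assoc]) auto
  have "virtual_equiv Y (path_join (path_join a c) (path_join s b)) (path_join (path_join a c) (path_join s' b))"
    using replace assms by (intro virtual_equiv.replace) auto
  then show ?case
    using A[OF S(1-3)] A[OF S(5-7)] by (meson path_homotopic_sym virtual_equiv.homotopy virtual_equiv.trans)
next
  case (trans p q r)
  then show ?case using virtual_equiv_props[OF trans(1) assms(2)] virtual_equiv.trans by metis
qed

lemma virtual_equiv_right:
  assumes "virtual_equiv Y p q" "wf_digraph (fst Y)" "pathin (vrealization Y) a" "p 1 = a 0"
  shows "virtual_equiv Y (path_join p a) (path_join q a)"
  using assms(1,4)
proof induction
  case (homotopy p q)
  then show ?case using assms by (intro virtual_equiv.homotopy path_homotopic_join) auto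
next
  case (replace u s s' c b)
  note S = virtual_sequence_props[OF replace(2) assms(2) replace(1)]
    virtual_sequence_props[OF replace(3) assms(2) replace(1)]
  have A: "path_homotopic (vrealization Y) (path_join (path_join c (path_join s b)) a)
     (path_join c (path_join s (path_join b a)))" if s: "pathin (vrealization Y) s" "s 0 = Vertex u" "s 1 = Vertex u" for s
  proof -
    have "path_homotopic (vrealization Y) (path_join (path_join c (path_join s b)) a)
     (path_join c (path_join (path_join s b) a))"
      using replace s assms by (intro path_homotopic_assoc) auto
    also have "path_homotopic (vrealization Y) \<dots> (path_join c (path_join s (path_join b a)))"
      using replace s assms by (intro path_homotopic_join[OF _ path_homotopic_assoc]) auto
    finally show ?thesis .
  qed
  have "virtual_equiv Y (path_join c (path_join s (path_join b a))) (path_join c (path_join s' (path_join b a)))"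
    using replace assms by (intro virtual_equiv.replace) auto
  then show ?case
    using A[OF S(1-3)] A[OF S(5-7)] by (meson path_homotopic_sym virtual_equiv.homotopy virtual_equiv.trans)
next
  case (trans p q r)
  then show ?case using virtual_equiv_props[OF trans(1) assms(2)] virtual_equiv.trans by metis
qed

lemma virtual_equiv_join:
  assumes "virtual_equiv Y p p'" "virtual_equiv Y q q'" "wf_digraph (fst Y)" "p 1 = q 0"
  shows "virtual_equiv Y (path_join p q) (path_join p' q')"
proof -
  note P = virtual_equiv_props[OF assms(1,3)] virtual_equiv_props[OF assms(2,3)]
  have "virtual_equiv Y (path_join p q) (path_join p q')"
    using P assms by (intro virtual_equiv_left) auto
  moreover have "virtual_equiv Y (path_join p q') (path_join p' q')"
    using P assms by (intro virtual_equiv_right) auto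
  ultimately show ?thesis by (rule virtual_equiv.trans)
qed

text \<open>The rule \<open>replace\<close> speaks of formal sequences of virtual loops; here any
  two loops in the bouquet at \<open>u\<close> are allowed. This form survives maps that
  reparametrize or permute the virtual loops.\<close>

lemma virtual_equiv_replace:
  assumes wf: "wf_digraph (fst Y)" and u: "u \<in> verts (fst Y)"
    and a: "pathin (vrealization Y) a" "a 1 = Vertex u" and b: "pathin (vrealization Y) b" "b 0 = Vertex u"
    and p: "pathin (vrealization Y) p" "p 0 = Vertex u" "p 1 = Vertex u" "\<And>t. t \<in> {0..1} \<Longrightarrow> p t \<in> virtual_part Y u"
    and q: "pathin (vrealization Y) q" "q 0 = Vertex u" "q 1 = Vertex u" "\<And>t. t \<in> {0..1} \<Longrightarrow> q t \<in> virtual_part Y u"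
  shows "virtual_equiv Y (path_join a (path_join p b)) (path_join a (path_join q b))"
proof -
  obtain s where s: "virtual_sequence Y u s" "path_homotopic (vrealization Y) p s"
    using virtual_part_loop[OF wf u p] by blast
  obtain s' where s': "virtual_sequence Y u s'" "path_homotopic (vrealization Y) q s'"
    using virtual_part_loop[OF wf u q] by blast
  have "path_homotopic (vrealization Y) (path_join a (path_join p b)) (path_join a (path_join s b))"
    using a b p by (intro path_homotopic_join[OF _ path_homotopic_join[OF s(2)]]) auto
  moreover have "virtual_equiv Y (path_join a (path_join s b)) (path_join a (path_join s' b))"
    using s s' a b u by (intro virtual_equiv.replace) auto
  moreover have "path_homotopic (vrealization Y) (path_join a (path_join q b)) (path_join a (path_join s' b))"
    using a b q by (intro path_homotopic_join[OF _ path_homotopic_join[OF s'(2)]]) auto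
  ultimately show ?thesis by (meson path_homotopic_sym virtual_equiv.homotopy virtual_equiv.trans)
qed

lemma virtual_equiv_reverse:
  assumes "virtual_equiv Y p q" "wf_digraph (fst Y)"
  shows "virtual_equiv Y (path_reverse p) (path_reverse q)"
  using assms(1)
proof induction
  case (homotopy p q)
  then show ?case by (intro virtual_equiv.homotopy path_homotopic_reverse)
next
  case (replace u s s' a b)
  note S = virtual_sequence_props[OF replace(2) assms(2) replace(1)]
    virtual_sequence_props[OF replace(3) assms(2) replace(1)]
  have A: "path_homotopic (vrealization Y) (path_reverse (path_join a (path_join s b)))
     (path_join (path_reverse b) (path_join (path_reverse s) (path_reverse a)))"
    if s: "pathin (vrealization Y) s" "s 0 = Vertex u" "s 1 = Vertex u" for s
  proof -
    have "path_homotopic (vrealization Y) (path_reverse (path_join a (path_join s b)))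
        (path_join (path_reverse (path_join s b)) (path_reverse a))"
      using s replace by (intro path_homotopic_reverse_join) auto
    also have "path_homotopic (vrealization Y) \<dots> (path_join (path_join (path_reverse b) (path_reverse s)) (path_reverse a))"
      using s replace by (intro path_homotopic_join[OF path_homotopic_reverse_join]) auto
    also have "path_homotopic (vrealization Y) \<dots> (path_join (path_reverse b) (path_join (path_reverse s) (path_reverse a)))"
      using s replace by (intro path_homotopic_assoc) auto
    finally show ?thesis .
  qed
  have "virtual_equiv Y (path_join (path_reverse b) (path_join (path_reverse s) (path_reverse a)))
      (path_join (path_reverse b) (path_join (path_reverse s') (path_reverse a)))"
    using S replace by (intro virtual_equiv_replace[OF assms(2) replace(1)]) (auto simp: path_reverse_def)
  then show ?case
    using A[OF S(1-3)] A[OF S(5-7)] by (meson path_homotopic_sym virtual_equiv.homotopy virtual_equiv.trans)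
next
  case (trans p q r)
  then show ?case using virtual_equiv.trans by blast
qed

lemma virtual_equiv_conj:
  assumes "virtual_equiv Y p q" "wf_digraph (fst Y)" "pathin (vrealization Y) c" "c 1 = p 0" "c 1 = p 1"
  shows "virtual_equiv Y (path_conj c p) (path_conj c q)"
  unfolding path_conj_def using assms
  by (intro virtual_equiv_join virtual_equiv.homotopy[of _ c] virtual_equiv.homotopy[of _ "path_reverse c"]) auto

text \<open>The bouquets of virtual loops are respected as a whole. Isomorphisms and contractions of
  edges both qualify, although a contraction merges two bouquets or adds a loop to one.\<close>

definition virtual_map :: "wgraph \<Rightarrow> wgraph \<Rightarrow> ((nat, nat + nat \<times> nat) gpoint \<Rightarrow> (nat, nat + nat \<times> nat) gpoint) \<Rightarrow> bool" where
  "virtual_map Y Y' f \<longleftrightarrow> continuous_map (vrealization Y) (vrealization Y') f \<and>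
     (\<forall>u\<in>verts (fst Y). \<exists>u'\<in>verts (fst Y'). f (Vertex u) = Vertex u' \<and> f ` virtual_part Y u \<subseteq> virtual_part Y' u')"

lemma virtual_equiv_map:
  assumes "virtual_equiv Y p q" and wf: "wf_digraph (fst Y)" "wf_digraph (fst Y')" and f: "virtual_map Y Y' f"
  shows "virtual_equiv Y' (f \<circ> p) (f \<circ> q)"
  using assms(1)
proof induction
  case (homotopy p q)
  then show ?case using f by (intro virtual_equiv.homotopy path_homotopic_compose) (auto simp: virtual_map_def)
next
  case (replace u s s' a b)
  note S = virtual_sequence_props[OF replace(2) wf(1) replace(1)]
    virtual_sequence_props[OF replace(3) wf(1) replace(1)]
  have fc: "continuous_map (vrealization Y) (vrealization Y') f" using f by (simp add: virtual_map_def)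
  obtain u' where u': "u' \<in> verts (fst Y')" "f (Vertex u) = Vertex u'" "f ` virtual_part Y u \<subseteq> virtual_part Y' u'"
    using f replace(1) by (auto simp: virtual_map_def)
  show ?case
    unfolding comp_path_join
    using S replace u' pathin_compose[OF _ fc] by (intro virtual_equiv_replace[OF wf(2) u'(1)]) auto
next
  case (trans p q r)
  then show ?case using virtual_equiv.trans by blast
qed

lemma virtual_equiv_refl: "pathin (vrealization Y) p \<Longrightarrow> virtual_equiv Y p p"
  by (simp add: virtual_equiv.homotopy)

lemma virtual_equiv_homotopic_trans:
  "virtual_equiv Y p q \<Longrightarrow> path_homotopic (vrealization Y) p p' \<Longrightarrow> path_homotopic (vrealization Y) q q' \<Longrightarrow> virtual_equiv Y p' q'"
  by (meson path_homotopic_sym virtual_equiv.homotopy virtual_equiv.trans)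

text \<open>Equivalence on the petals extends to all loops along words in the petals. It is applied
  to the images of petals under a self-map of the rose.\<close>

lemma virtual_equiv_rose_loops:
  assumes wf: "wf_digraph (fst Y)"
    and h: "continuous_map (rose_space g) (vrealization Y) h" and k: "continuous_map (rose_space g) (vrealization Y) k"
    and eq: "h (Vertex ()) = k (Vertex ())"
    and ve: "\<And>i. i < g \<Longrightarrow> virtual_equiv Y (h \<circ> edge_path (rose g) i) (k \<circ> edge_path (rose g) i)"
    and p: "p \<in> rose_loops g"
  shows "virtual_equiv Y (h \<circ> p) (k \<circ> p)"
  using p
proof (induction rule: rose_loop_induct)
  case one
  have "h \<circ> (\<lambda>_::real. Vertex ()) = (\<lambda>_. h (Vertex ()))" "k \<circ> (\<lambda>_::real. Vertex ()) = (\<lambda>_. h (Vertex ()))"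
    using eq by auto
  moreover have "h (Vertex ()) \<in> topspace (vrealization Y)" using continuous_map_funspace[OF h] by auto
  ultimately show ?case by (auto intro!: virtual_equiv_refl simp del: comp_apply)
next
  case (fwd i q)
  then have "virtual_equiv Y (h \<circ> q) (k \<circ> q)" by (simp add: o_def)
  with fwd show ?case unfolding comp_path_join
    by (intro virtual_equiv_join ve wf) (auto simp: loops_at_def)
next
  case (bwd i q)
  then have "virtual_equiv Y (h \<circ> q) (k \<circ> q)" by (simp add: o_def)
  with bwd show ?case unfolding comp_path_join comp_path_reverse
    by (intro virtual_equiv_join virtual_equiv_reverse ve wf) (auto simp: loops_at_def)
next
  case (hom q q')
  then show ?case
    using virtual_equiv_homotopic_trans[OF _ path_homotopic_compose[OF hom(1) h] path_homotopic_compose[OF hom(1) k]]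
    by (simp add: o_def)
qed

text \<open>This notion does not constrain the base point and does not require immersions, which makes it
  easier to handle; for markings it agrees with \<^const>\<open>marking_equiv\<close>.\<close>

definition loose_equiv :: "nat \<Rightarrow> wgraph \<Rightarrow> marking \<Rightarrow> marking \<Rightarrow> bool" where
  "loose_equiv g Y h h' \<longleftrightarrow> continuous_map (rose_space g) (vrealization Y) h \<and>
     (\<exists>k. homotopic_with (\<lambda>_. True) (rose_space g) (vrealization Y) h' k \<and> k (Vertex ()) = h (Vertex ()) \<and>
       (\<forall>i<g. virtual_equiv Y (h \<circ> edge_path (rose g) i) (k \<circ> edge_path (rose g) i)))"

section \<open>The loose relation is an equivalence and is compatible with composition\<close>

lemma loose_equiv_continuous:
  assumes "loose_equiv g Y h h'"
  shows "continuous_map (rose_space g) (vrealization Y) h" "continuous_map (rose_space g) (vrealization Y) h'"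
  using assms homotopic_with_imp_continuous_maps unfolding loose_equiv_def by blast+

lemma loose_equiv_homotopic:
  assumes "homotopic_with (\<lambda>_. True) (rose_space g) (vrealization Y) h h'"
  shows "loose_equiv g Y h h'"
  unfolding loose_equiv_def
  using homotopic_with_imp_continuous_maps[OF assms] rose_loop(1) homotopic_with_symD[OF assms]
  by (auto intro!: exI[of _ h] virtual_equiv_refl)

text \<open>Virtual equivalence is a congruence for conjugation, so it follows the base point when
  that is dragged along \<open>c\<close>.\<close>

lemma virtual_equiv_rose_of_conj:
  assumes wf: "wf_digraph (fst Y)" and k: "continuous_map (rose_space g) (vrealization Y) k"
    and c: "pathin (vrealization Y) c" "c 1 = k (Vertex ())" and i: "i < g"
    and ve: "virtual_equiv Y p (k \<circ> edge_path (rose g) i)"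
    and q: "path_homotopic (vrealization Y) q (path_conj c p)"
  shows "virtual_equiv Y q (rose_of (c 0) (\<lambda>i. path_conj c (k \<circ> edge_path (rose g) i)) \<circ> edge_path (rose g) i)"
proof -
  note R = rose_loop[OF i k]
  have p: "p 0 = c 1" "p 1 = c 1" using virtual_equiv_props[OF ve wf] c by auto
  have "virtual_equiv Y (path_conj c p) (path_conj c (k \<circ> edge_path (rose g) i))"
    using p c by (intro virtual_equiv_conj[OF ve wf]) auto
  moreover have "path_homotopic (vrealization Y)
      (rose_of (c 0) (\<lambda>i. path_conj c (k \<circ> edge_path (rose g) i)) \<circ> edge_path (rose g) i)
      (path_conj c (k \<circ> edge_path (rose g) i))"
    using R c by (intro path_homotopic_rose_of) (auto simp del: comp_apply intro!: pathin_conj)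
  ultimately show ?thesis
    using q virtual_equiv_homotopic_trans path_homotopic_sym by meson
qed

text \<open>The definition homotopes only the second map. Here \<open>h\<close> is moved instead:
  conjugation by the trace \<open>c\<close> of the base point under the homotopy from
  \<open>h'\<close> to \<open>k\<close> brings it to the base point of \<open>h'\<close>.\<close>

lemma loose_equiv_sym:
  assumes wf: "wf_digraph (fst Y)" and h: "loose_equiv g Y h h'"
  shows "loose_equiv g Y h' h"
proof -
  obtain k where k: "homotopic_with (\<lambda>_. True) (rose_space g) (vrealization Y) h' k" "k (Vertex ()) = h (Vertex ())"
    "\<And>i. i < g \<Longrightarrow> virtual_equiv Y (h \<circ> edge_path (rose g) i) (k \<circ> edge_path (rose g) i)"
    using h unfolding loose_equiv_def by blast
  note H = loose_equiv_continuous[OF h]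
  obtain c where c: "pathin (vrealization Y) c" "c 0 = h' (Vertex ())" "c 1 = k (Vertex ())"
    "\<And>p. pathin (rose_space g) p \<Longrightarrow> p 0 = Vertex () \<Longrightarrow> p 1 = Vertex () \<Longrightarrow>
       path_homotopic (vrealization Y) (h' \<circ> p) (path_conj c (k \<circ> p))"
    using homotopic_track_loops[OF k(1), of "Vertex ()"] by auto
  let ?k = "rose_of (c 0) (\<lambda>i. path_conj c (h \<circ> edge_path (rose g) i))"
  have "homotopic_with (\<lambda>_. True) (rose_space g) (vrealization Y) ?k h"
    using c k(2) by (intro homotopic_rose_conj H) auto
  moreover have "virtual_equiv Y (h' \<circ> edge_path (rose g) i) (?k \<circ> edge_path (rose g) i)" if i: "i < g" for i
    using c k(2) i by (intro virtual_equiv_rose_of_conj[OF wf H(1) c(1) _ i virtual_equiv_sym[OF k(3)[OF i]]]) auto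
  ultimately show ?thesis
    unfolding loose_equiv_def using H c homotopic_with_symD by (auto intro!: exI[of _ ?k])
qed

text \<open>The two given relations live at different base points. The trace \<open>c\<close> of the
  homotopy from \<open>k\<close> to \<open>h'\<close> moves the second relation to the base point of
  the first.\<close>

lemma loose_equiv_trans:
  assumes wf: "wf_digraph (fst Y)" and h: "loose_equiv g Y h h'" and h': "loose_equiv g Y h' h''"
  shows "loose_equiv g Y h h''"
proof -
  obtain k where k: "homotopic_with (\<lambda>_. True) (rose_space g) (vrealization Y) h' k" "k (Vertex ()) = h (Vertex ())"
    "\<And>i. i < g \<Longrightarrow> virtual_equiv Y (h \<circ> edge_path (rose g) i) (k \<circ> edge_path (rose g) i)"
    using h unfolding loose_equiv_def by blast
  obtain k' where k': "homotopic_with (\<lambda>_. True) (rose_space g) (vrealization Y) h'' k'" "k' (Vertex ()) = h' (Vertex ())"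
    "\<And>i. i < g \<Longrightarrow> virtual_equiv Y (h' \<circ> edge_path (rose g) i) (k' \<circ> edge_path (rose g) i)"
    using h' unfolding loose_equiv_def by blast
  note H = loose_equiv_continuous[OF h]
  have K': "continuous_map (rose_space g) (vrealization Y) k'" using k'(1) homotopic_with_imp_continuous_maps by blast
  obtain c where c: "pathin (vrealization Y) c" "c 0 = k (Vertex ())" "c 1 = h' (Vertex ())"
    "\<And>p. pathin (rose_space g) p \<Longrightarrow> p 0 = Vertex () \<Longrightarrow> p 1 = Vertex () \<Longrightarrow>
       path_homotopic (vrealization Y) (k \<circ> p) (path_conj c (h' \<circ> p))"
    using homotopic_track_loops[OF homotopic_with_symD[OF k(1)], of "Vertex ()"] by auto
  let ?k = "rose_of (c 0) (\<lambda>i. path_conj c (k' \<circ> edge_path (rose g) i))"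
  have "homotopic_with (\<lambda>_. True) (rose_space g) (vrealization Y) ?k k'"
    using c k'(2) by (intro homotopic_rose_conj K') auto
  then have "homotopic_with (\<lambda>_. True) (rose_space g) (vrealization Y) h'' ?k"
    using k'(1) homotopic_with_trans homotopic_with_symD by meson
  moreover have "virtual_equiv Y (h \<circ> edge_path (rose g) i) (?k \<circ> edge_path (rose g) i)" if i: "i < g" for i
  proof -
    have "virtual_equiv Y (k \<circ> edge_path (rose g) i) (?k \<circ> edge_path (rose g) i)"
      using c k'(2) i by (intro virtual_equiv_rose_of_conj[OF wf K' c(1) _ i k'(3)[OF i]]) auto
    with k(3)[OF i] show ?thesis by (rule virtual_equiv.trans)
  qed
  ultimately show ?thesis
    unfolding loose_equiv_def using H c k by (auto intro!: exI[of _ ?k])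
qed

lemma loose_equiv_map:
  assumes wf: "wf_digraph (fst Y)" "wf_digraph (fst Y')" and h: "loose_equiv g Y h h'" and f: "virtual_map Y Y' f"
  shows "loose_equiv g Y' (f \<circ> h) (f \<circ> h')"
proof -
  obtain k where k: "homotopic_with (\<lambda>_. True) (rose_space g) (vrealization Y) h' k" "k (Vertex ()) = h (Vertex ())"
    "\<And>i. i < g \<Longrightarrow> virtual_equiv Y (h \<circ> edge_path (rose g) i) (k \<circ> edge_path (rose g) i)"
    using h unfolding loose_equiv_def by blast
  have fc: "continuous_map (vrealization Y) (vrealization Y') f" using f by (simp add: virtual_map_def)
  show ?thesis
    unfolding loose_equiv_def
  proof (intro conjI exI allI impI)
    show "continuous_map (rose_space g) (vrealization Y') (f \<circ> h)"
      using loose_equiv_continuous(1)[OF h] fc by (rule continuous_map_compose)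
    show "homotopic_with (\<lambda>_. True) (rose_space g) (vrealization Y') (f \<circ> h') (f \<circ> k)"
      using k(1) fc by (rule homotopic_with_compose_continuous_map_left) simp
    show "(f \<circ> k) (Vertex ()) = (f \<circ> h) (Vertex ())" using k by simp
    show "virtual_equiv Y' (f \<circ> h \<circ> edge_path (rose g) i) (f \<circ> k \<circ> edge_path (rose g) i)" if "i < g" for i
      using virtual_equiv_map[OF k(3)[OF that] wf f] by (simp add: comp_assoc)
  qed
qed

lemma loose_equiv_precompose:
  assumes wf: "wf_digraph (fst Y)" and h: "loose_equiv g Y h h'"
    and f: "continuous_map (rose_space g) (rose_space g) f" "f (Vertex ()) = Vertex ()"
  shows "loose_equiv g Y (h \<circ> f) (h' \<circ> f)"
proof -
  obtain k where k: "homotopic_with (\<lambda>_. True) (rose_space g) (vrealization Y) h' k" "k (Vertex ()) = h (Vertex ())"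
    "\<And>i. i < g \<Longrightarrow> virtual_equiv Y (h \<circ> edge_path (rose g) i) (k \<circ> edge_path (rose g) i)"
    using h unfolding loose_equiv_def by blast
  note H = loose_equiv_continuous[OF h]
  have K: "continuous_map (rose_space g) (vrealization Y) k" using k(1) homotopic_with_imp_continuous_maps by blast
  show ?thesis
    unfolding loose_equiv_def
  proof (intro conjI exI allI impI)
    show "continuous_map (rose_space g) (vrealization Y) (h \<circ> f)"
      using f(1) H(1) by (rule continuous_map_compose)
    show "homotopic_with (\<lambda>_. True) (rose_space g) (vrealization Y) (h' \<circ> f) (k \<circ> f)"
      using k(1) f(1) by (rule homotopic_with_compose_continuous_map_right) simp
    show "(k \<circ> f) (Vertex ()) = (h \<circ> f) (Vertex ())" using k f by simp
    show "virtual_equiv Y (h \<circ> f \<circ> edge_path (rose g) i) (k \<circ> f \<circ> edge_path (rose g) i)" if "i < g" for i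
      using virtual_equiv_rose_loops[OF wf H(1) K k(2)[symmetric] k(3) rose_loops_compose[OF f edge_path_rose_loops[OF that]]]
      by (simp add: comp_assoc)
  qed
qed

section \<open>Immersed representatives of markings\<close>

lemma marking_continuous: "is_marking g Y h \<Longrightarrow> continuous_map (rose_space g) (vrealization Y) h"
  by (simp add: is_marking_def homotopy_equivalence_def)

text \<open>By \<open>rose_loop_nontrivial\<close> and the injectivity of homotopy equivalences on
  loops no petal has a null-homotopic image, so each petal can be pulled tight without moving the
  base point.\<close>

lemma tight_marking:
  assumes wf: "wf_digraph (fst Y)" and h: "is_marking g Y h"
  obtains k where "homotopic_with (\<lambda>_. True) (rose_space g) (vrealization Y) h k" "k (Vertex ()) = h (Vertex ())"
    "immersed_on_loops g k" "\<And>i. i < g \<Longrightarrow> path_homotopic (vrealization Y) (h \<circ> edge_path (rose g) i) (k \<circ> edge_path (rose g) i)"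
proof -
  note H = marking_continuous[OF h]
  let ?p = "\<lambda>i. h \<circ> edge_path (rose g) i"
  have "\<exists>q. path_homotopic (vrealization Y) (?p i) q \<and> locally_injective q" if i: "i < g" for i
  proof -
    note R = rose_loop[OF i H]
    have "\<not> path_homotopic (vrealization Y) (?p i) (\<lambda>_. ?p i 0)"
    proof
      assume "path_homotopic (vrealization Y) (?p i) (\<lambda>_. ?p i 0)"
      then have "path_homotopic (rose_space g) (edge_path (rose g) i) (\<lambda>_. edge_path (rose g) i 0)"
        using i by (intro homotopy_equivalence_null[OF h[unfolded is_marking_def]]) auto
      then show False using rose_loop_nontrivial[OF i] by simp
    qed
    then show ?thesis
      using path_homotopic_locally_injective[OF wf_with_virtual_loops[OF wf] R(1)] by blast
  qed
  then obtain q where q: "\<And>i. i < g \<Longrightarrow> path_homotopic (vrealization Y) (?p i) (q i) \<and> locally_injective (q i)"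
    by metis
  have qe: "pathin (vrealization Y) (q i)" "q i 0 = h (Vertex ())" "q i 1 = h (Vertex ())" if i: "i < g" for i
    using q[OF i] path_homotopic_imp_pathin path_homotopic_imp_endpoints[of "vrealization Y" "?p i" "q i"] rose_loop[OF i H] by auto
  let ?k = "rose_of (h (Vertex ())) q"
  have hv: "h (Vertex ()) \<in> topspace (vrealization Y)" using continuous_map_funspace[OF H] by auto
  have kc: "continuous_map (rose_space g) (vrealization Y) ?k" using qe hv by (intro continuous_map_rose_of) auto
  have 1: "path_homotopic (vrealization Y) (?p i) (?k \<circ> edge_path (rose g) i)" if i: "i < g" for i
    using q[OF i] path_homotopic_rose_of[of "vrealization Y" q i "h (Vertex ())" g] qe[OF i]
      path_homotopic_trans path_homotopic_sym by meson
  show ?thesis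
  proof
    show "homotopic_with (\<lambda>_. True) (rose_space g) (vrealization Y) h ?k"
      by (rule homotopic_rose[OF H kc]) (use 1 in auto)
    show "immersed_on_loops g ?k"
      using q unfolding immersed_on_loops_def locally_injective_def by simp
    show "path_homotopic (vrealization Y) (?p i) (?k \<circ> edge_path (rose g) i)" if "i < g" for i using 1[OF that] .
  qed simp
qed

text \<open>The homotopy inverse leads back to the rose: \<open>x\<close> is joined to its image
  under \<open>h \<circ> k\<close>, and this to the base point by the image of a path in the
  rose.\<close>

lemma marking_path_connected:
  assumes h: "is_marking g Y h" and x: "x \<in> topspace (vrealization Y)"
  obtains c where "pathin (vrealization Y) c" "c 0 = x" "c 1 = h (Vertex ())"
proof -
  obtain k where k: "continuous_map (vrealization Y) (rose_space g) k"
    "homotopic_with (\<lambda>_. True) (vrealization Y) (vrealization Y) (h \<circ> k) id"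
    using h unfolding is_marking_def homotopy_equivalence_def by blast
  obtain c where c: "pathin (vrealization Y) (c x)" "c x 0 = id x" "c x 1 = (h \<circ> k) x"
    using homotopic_track[OF homotopic_with_symD[OF k(2)]] x by metis
  have "k x \<in> gpoints (rose g)" using continuous_map_funspace[OF k(1)] x by auto
  then obtain d where d: "pathin (rose_space g) d" "d 0 = Vertex ()" "d 1 = k x" by (rule rose_path_connected)
  have "pathin (vrealization Y) (path_reverse (h \<circ> d))"
    using d marking_continuous[OF h] by (auto intro: pathin_compose)
  then show ?thesis
    using c d by (intro that[of "path_join (c x) (path_reverse (h \<circ> d))"]) auto
qed

lemma is_marking_homotopic:
  "is_marking g Y h \<Longrightarrow> homotopic_with (\<lambda>_. True) (rose_space g) (vrealization Y) h k \<Longrightarrow> is_marking g Y k"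
  unfolding is_marking_def by (rule homotopy_equivalence_homotopic)

lemma base_points_exist:
  assumes wf: "wf_digraph (fst Y)" and h: "is_marking g Y h"
  shows "\<exists>m. m \<in> base_points Y \<and> m \<in> topspace (vrealization Y)"
proof (cases "arcs (fst Y) = {}")
  case True
  have "h (Vertex ()) \<in> gpoints (with_virtual_loops Y)"
    using continuous_map_funspace[OF marking_continuous[OF h]] wf by auto
  then obtain v where "v \<in> verts (fst Y)"
    using wf_with_virtual_loops[OF wf]
    by (cases rule: gpoints_cases) (auto dest: wf_digraph.tail_in_verts)
  then show ?thesis using True wf by (auto simp: base_points_def)
next
  case False
  then obtain e where "e \<in> arcs (fst Y)" by blast
  moreover have "Inner (Inl e) (1/2) \<in> open_edge (Inl e)" unfolding open_edge_def by (rule imageI) simp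
  ultimately show ?thesis using wf
    by (intro exI[of _ "Inner (Inl e) (1/2)"]) (auto simp: base_points_def)
qed

text \<open>Tightening keeps the base point and the homotopy classes of the petals, so a loose
  relation becomes a strict one once both maps have been dragged to an admissible base point along
  the same path.\<close>

theorem marking_equiv_iff_loose:
  assumes wf: "wf_digraph (fst Y)" and h: "is_marking g Y h" and h': "is_marking g Y h'"
  shows "marking_equiv g Y h h' \<longleftrightarrow> loose_equiv g Y h h'"
proof
  assume "marking_equiv g Y h h'"
  then obtain k k' where k: "homotopic_with (\<lambda>_. True) (rose_space g) (vrealization Y) h k"
     "homotopic_with (\<lambda>_. True) (rose_space g) (vrealization Y) h' k'"
     "k (Vertex ()) = k' (Vertex ())"
     "\<forall>i<g. virtual_equiv Y (k \<circ> edge_path (rose g) i) (k' \<circ> edge_path (rose g) i)"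
    unfolding marking_equiv_def by blast
  have "loose_equiv g Y k k'"
    using k homotopic_with_imp_continuous_maps[OF k(1)] homotopic_with_imp_continuous_maps[OF k(2)]
    unfolding loose_equiv_def by (auto intro!: exI[of _ k'])
  then show "loose_equiv g Y h h'"
    using loose_equiv_homotopic[OF k(1)] loose_equiv_homotopic[OF homotopic_with_symD[OF k(2)]] loose_equiv_trans[OF wf] by blast
next
  assume l: "loose_equiv g Y h h'"
  obtain k where k: "homotopic_with (\<lambda>_. True) (rose_space g) (vrealization Y) h' k" "k (Vertex ()) = h (Vertex ())"
    "\<And>i. i < g \<Longrightarrow> virtual_equiv Y (h \<circ> edge_path (rose g) i) (k \<circ> edge_path (rose g) i)"
    using l unfolding loose_equiv_def by blast
  obtain m where m: "m \<in> base_points Y" "m \<in> topspace (vrealization Y)" using base_points_exist[OF wf h] by blast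
  obtain c where c: "pathin (vrealization Y) c" "c 0 = m" "c 1 = h (Vertex ())" using marking_path_connected[OF h m(2)] by blast
  note H = marking_continuous[OF h]
  have K: "continuous_map (rose_space g) (vrealization Y) k" using k(1) homotopic_with_imp_continuous_maps by blast
  let ?h = "rose_of (c 0) (\<lambda>i. path_conj c (h \<circ> edge_path (rose g) i))"
  let ?k = "rose_of (c 0) (\<lambda>i. path_conj c (k \<circ> edge_path (rose g) i))"
  have hh: "homotopic_with (\<lambda>_. True) (rose_space g) (vrealization Y) h ?h"
    using c by (intro homotopic_with_symD[OF homotopic_rose_conj] H) auto
  have kk: "homotopic_with (\<lambda>_. True) (rose_space g) (vrealization Y) h' ?k"
    using c k(2) by (intro homotopic_with_trans[OF k(1) homotopic_with_symD[OF homotopic_rose_conj]] K) auto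
  have ve: "virtual_equiv Y (?h \<circ> edge_path (rose g) i) (?k \<circ> edge_path (rose g) i)" if i: "i < g" for i
  proof (rule virtual_equiv_rose_of_conj[OF wf K c(1) _ i k(3)[OF i]])
    note R = rose_loop[OF i H]
    show "path_homotopic (vrealization Y) (?h \<circ> edge_path (rose g) i) (path_conj c (h \<circ> edge_path (rose g) i))"
      using R c by (intro path_homotopic_rose_of) (auto simp del: comp_apply intro!: pathin_conj)
  qed (use c k in auto)
  obtain t where t: "homotopic_with (\<lambda>_. True) (rose_space g) (vrealization Y) ?h t" "t (Vertex ()) = ?h (Vertex ())"
    "immersed_on_loops g t" "\<And>i. i < g \<Longrightarrow> path_homotopic (vrealization Y) (?h \<circ> edge_path (rose g) i) (t \<circ> edge_path (rose g) i)"
    using tight_marking[OF wf is_marking_homotopic[OF h hh]] by blast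
  obtain t' where t': "homotopic_with (\<lambda>_. True) (rose_space g) (vrealization Y) ?k t'" "t' (Vertex ()) = ?k (Vertex ())"
    "immersed_on_loops g t'" "\<And>i. i < g \<Longrightarrow> path_homotopic (vrealization Y) (?k \<circ> edge_path (rose g) i) (t' \<circ> edge_path (rose g) i)"
    using tight_marking[OF wf is_marking_homotopic[OF h' kk]] by blast
  show "marking_equiv g Y h h'"
    unfolding marking_equiv_def
  proof (intro exI conjI allI impI)
    show "homotopic_with (\<lambda>_. True) (rose_space g) (vrealization Y) h t" by (rule homotopic_with_trans[OF hh t(1)])
    show "homotopic_with (\<lambda>_. True) (rose_space g) (vrealization Y) h' t'" by (rule homotopic_with_trans[OF kk t'(1)])
    show "virtual_equiv Y (t \<circ> edge_path (rose g) i) (t' \<circ> edge_path (rose g) i)" if "i < g" for i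
      using virtual_equiv_homotopic_trans[OF ve t(4) t'(4)] that by blast
  qed (use t t' m c in auto)
qed

section \<open>Isomorphisms\<close>

lemma graph_iso_id: "graph_iso G G id id"
  by (auto simp: graph_iso_def bij_betw_def)

lemma graph_iso_compose:
  assumes "graph_iso G G' fV fE" "graph_iso G' G'' fV' fE'"
  shows "graph_iso G G'' (fV' \<circ> fV) (fE' \<circ> fE)"
proof -
  have "fE e \<in> arcs G'" if "e \<in> arcs G" for e using assms(1) that by (auto simp: graph_iso_def bij_betw_def)
  then have "{tail G'' (fE' (fE e)), head G'' (fE' (fE e))} = (fV' \<circ> fV) ` {tail G e, head G e}" if "e \<in> arcs G" for e
    using assms that unfolding graph_iso_def image_comp[symmetric] by metis
  then show ?thesis
    using assms by (auto simp: graph_iso_def intro: bij_betw_trans)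
qed

lemma graph_iso_inverse:
  assumes iso: "graph_iso G G' fV fE" and wf: "wf_digraph G"
  shows "graph_iso G' G (inv_into (verts G) fV) (inv_into (arcs G) fE)"
proof -
  have V: "bij_betw fV (verts G) (verts G')" and E: "bij_betw fE (arcs G) (arcs G')"
    and ends: "\<And>e. e \<in> arcs G \<Longrightarrow> {tail G' (fE e), head G' (fE e)} = fV ` {tail G e, head G e}"
    using iso by (auto simp: graph_iso_def)
  have "{tail G (inv_into (arcs G) fE e'), head G (inv_into (arcs G) fE e')} =
      inv_into (verts G) fV ` {tail G' e', head G' e'}" if "e' \<in> arcs G'" for e'
  proof -
    obtain e where e: "e \<in> arcs G" "e' = fE e" using E \<open>e' \<in> arcs G'\<close> by (auto simp: bij_betw_def)
    have "inv_into (arcs G) fE e' = e" using E e by (simp add: bij_betw_def inv_into_f_f)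
    moreover have "inv_into (verts G) fV ` (fV ` {tail G e, head G e}) = {tail G e, head G e}"
      using V e wf by (intro inv_into_image_cancel) (auto simp: bij_betw_def wf_digraph_def)
    ultimately show ?thesis using ends[OF e(1)] e(2) by metis
  qed
  then show ?thesis using V E by (auto simp: graph_iso_def bij_betw_inv_into)
qed

lemma open_edge_subset_gpoints: "e \<in> arcs G \<Longrightarrow> open_edge e \<subseteq> gpoints G"
  by (auto simp: gpoints_def)

lemma complex_iso_id: "complex_iso G G id id id"
  using homeomorphic_map_id[of "realization G" "realization G"] by (simp add: complex_iso_def graph_iso_id)

lemma complex_iso_compose:
  assumes "complex_iso G G' fV fE \<gamma>" "complex_iso G' G'' fV' fE' \<gamma>'"
  shows "complex_iso G G'' (fV' \<circ> fV) (fE' \<circ> fE) (\<gamma>' \<circ> \<gamma>)"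
proof -
  have "fV v \<in> verts G'" if "v \<in> verts G" for v using assms(1) that by (auto simp: complex_iso_def graph_iso_def bij_betw_def)
  moreover have "fE e \<in> arcs G'" if "e \<in> arcs G" for e using assms(1) that by (auto simp: complex_iso_def graph_iso_def bij_betw_def)
  ultimately show ?thesis
    using assms unfolding complex_iso_def image_comp[symmetric]
    by (auto intro: graph_iso_compose homeomorphic_map_compose)
qed

lemma complex_iso_inverse:
  assumes iso: "complex_iso G G' fV fE \<gamma>" and wf: "wf_digraph G"
    and inv: "homeomorphic_maps (realization G) (realization G') \<gamma> \<gamma>'"
  shows "complex_iso G' G (inv_into (verts G) fV) (inv_into (arcs G) fE) \<gamma>'"
proof -
  have V: "bij_betw fV (verts G) (verts G')" and E: "bij_betw fE (arcs G) (arcs G')"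
    using iso by (auto simp: complex_iso_def graph_iso_def)
  have cancel: "\<gamma>' (\<gamma> x) = x" if "x \<in> gpoints G" for x
    using inv that wf by (auto simp: homeomorphic_maps_def)
  have "\<gamma>' (Vertex v') = Vertex (inv_into (verts G) fV v')" if "v' \<in> verts G'" for v'
  proof -
    obtain v where v: "v \<in> verts G" "v' = fV v" using V \<open>v' \<in> verts G'\<close> by (auto simp: bij_betw_def)
    then show ?thesis using V cancel[of "Vertex v"] iso by (auto simp: complex_iso_def bij_betw_def inv_into_f_f)
  qed
  moreover have "\<gamma>' ` open_edge e' = open_edge (inv_into (arcs G) fE e')" if "e' \<in> arcs G'" for e'
  proof -
    obtain e where e: "e \<in> arcs G" "e' = fE e" using E \<open>e' \<in> arcs G'\<close> by (auto simp: bij_betw_def)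
    have "\<gamma>' ` open_edge e' = \<gamma>' ` \<gamma> ` open_edge e" using iso e by (auto simp: complex_iso_def)
    also have "\<dots> = open_edge e" using cancel open_edge_subset_gpoints[OF e(1)] by (force simp: image_image)
    finally show ?thesis using E e by (simp add: bij_betw_def inv_into_f_f)
  qed
  ultimately show ?thesis
    using iso graph_iso_inverse[OF _ wf] homeomorphic_maps_map[of "realization G" "realization G'" \<gamma> \<gamma>'] inv
    by (auto simp: complex_iso_def)
qed

text \<open>An isomorphism of graphs does not respect the parametrization of the edges: its realization
  reverses those edges whose direction is not preserved.\<close>

lemma continuous_graph_iso_map:
  assumes iso: "graph_iso G G' fV fE" and wf: "wf_digraph G" "wf_digraph G'"
    and v: "\<And>v. v \<in> verts G \<Longrightarrow> \<gamma> (Vertex v) = Vertex (fV v)"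
    and e: "\<And>e t. e \<in> arcs G \<Longrightarrow> 0 < t \<Longrightarrow> t < 1 \<Longrightarrow>
       \<gamma> (Inner e t) = Inner (fE e) (if tail G' (fE e) = fV (tail G e) then t else 1 - t)"
  shows "continuous_map (realization G) (realization G') \<gamma>"
  unfolding continuous_map_realization[OF wf(1)]
proof safe
  show "\<gamma> (Vertex u) \<in> topspace (realization G')" if "u \<in> verts G" for u
    using that iso v wf by (auto simp: graph_iso_def bij_betw_def)
next
  fix a assume a: "a \<in> arcs G"
  then have a': "fE a \<in> arcs G'" using iso by (auto simp: graph_iso_def bij_betw_def)
  have ends: "{tail G' (fE a), head G' (fE a)} = {fV (tail G a), fV (head G a)}"
    using iso a by (auto simp: graph_iso_def)
  have vs: "tail G a \<in> verts G" "head G a \<in> verts G" using a wf by (auto simp: wf_digraph_def)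
  show "pathin (realization G') (\<gamma> \<circ> edge_path G a)"
  proof (cases "tail G' (fE a) = fV (tail G a)")
    case True
    then have "head G' (fE a) = fV (head G a)" using ends by (auto simp: doubleton_eq_iff)
    then have "\<gamma> \<circ> edge_path G a = edge_path G' (fE a)"
      using True a v[OF vs(1)] v[OF vs(2)] e by (auto simp: edge_path_def)
    then show ?thesis using wf a' by simp
  next
    case False
    then have "head G' (fE a) = fV (tail G a)" "tail G' (fE a) = fV (head G a)" using ends by (auto simp: doubleton_eq_iff)
    then have "\<gamma> \<circ> edge_path G a = path_reverse (edge_path G' (fE a))"
      using False a v[OF vs(1)] v[OF vs(2)] e by (auto simp: edge_path_def path_reverse_def)
    then show ?thesis using wf a' by simp
  qed
qed

text \<open>Edges whose direction changes are reversed by \<open>1 - t\<close>; a loop is always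
  mapped without reversal, since its tail can only go to the tail of its image.\<close>

lemma graph_iso_complex_iso:
  assumes iso: "graph_iso G G' fV fE" and wf: "wf_digraph G" "wf_digraph G'"
  shows "\<exists>\<gamma>. complex_iso G G' fV fE \<gamma>"
proof -
  let ?fV = "inv_into (verts G) fV" and ?fE = "inv_into (arcs G) fE"
  note iso' = graph_iso_inverse[OF iso wf(1)]
  have V: "bij_betw fV (verts G) (verts G')" and E: "bij_betw fE (arcs G) (arcs G')"
    using iso by (auto simp: graph_iso_def)
  define \<gamma> where "\<gamma> x = (case x of Vertex v \<Rightarrow> Vertex (fV v)
    | Inner e t \<Rightarrow> Inner (fE e) (if tail G' (fE e) = fV (tail G e) then t else 1 - t))" for x
  define \<gamma>' where "\<gamma>' x = (case x of Vertex v \<Rightarrow> Vertex (?fV v)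
    | Inner e t \<Rightarrow> Inner (?fE e) (if tail G (?fE e) = ?fV (tail G' e) then t else 1 - t))" for x
  have c: "continuous_map (realization G) (realization G') \<gamma>"
    by (rule continuous_graph_iso_map[OF iso wf]) (auto simp: \<gamma>_def)
  have c': "continuous_map (realization G') (realization G) \<gamma>'"
    by (rule continuous_graph_iso_map[OF iso' wf(2,1)]) (auto simp: \<gamma>'_def)
  \<comment> \<open>The inverse map has to reverse exactly the edges that \<open>\<gamma>\<close>
    reverses.\<close>
  have flip: "tail G e = ?fV (tail G' (fE e)) \<longleftrightarrow> tail G' (fE e) = fV (tail G e)" if e: "e \<in> arcs G" for e
  proof -
    have 1: "tail G e \<in> verts G" using e wf by (auto simp: wf_digraph_def)
    have 2: "tail G' (fE e) \<in> verts G'" using e wf E by (auto simp: wf_digraph_def bij_betw_def)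
    show ?thesis using bij_betw_inv_into_left[OF V 1] bij_betw_inv_into_right[OF V 2] by metis
  qed
  have 1: "\<gamma>' (\<gamma> x) = x" if "x \<in> gpoints G" for x
    using that
  proof (cases rule: gpoints_cases)
    case (vertex v)
    then show ?thesis using V by (simp add: \<gamma>_def \<gamma>'_def bij_betw_inv_into_left)
  next
    case (inner e t)
    then show ?thesis using flip[OF inner(1)] E by (simp add: \<gamma>_def \<gamma>'_def bij_betw_inv_into_left)
  qed
  have 2: "\<gamma> (\<gamma>' y) = y" if "y \<in> gpoints G'" for y
    using that
  proof (cases rule: gpoints_cases)
    case (vertex v)
    then show ?thesis using V by (simp add: \<gamma>_def \<gamma>'_def bij_betw_inv_into_right)
  next
    case (inner e' t)
    then obtain e where e: "e \<in> arcs G" "e' = fE e" using E by (auto simp: bij_betw_def)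
    then show ?thesis using inner flip[OF e(1)] E by (simp add: \<gamma>_def \<gamma>'_def bij_betw_inv_into_left)
  qed
  have "homeomorphic_map (realization G) (realization G') \<gamma>"
    using c c' 1 2 wf by (auto simp: homeomorphic_map_maps homeomorphic_maps_def intro!: exI[of _ \<gamma>'])
  moreover have "\<gamma> ` open_edge e = open_edge (fE e)" for e
  proof -
    have "(\<lambda>t::real. 1 - t) ` {0<..<1} = {0<..<1}"
      by (auto intro!: image_eqI[of _ _ "1 - _"])
    then have "(\<lambda>t. Inner (fE e) (1 - t)) ` {0<..<1} = (Inner (fE e) ` {0<..<1} :: ('c, 'd) gpoint set)"
      by (metis (no_types, lifting) image_cong image_image)
    then show ?thesis
      by (cases "tail G' (fE e) = fV (tail G e)") (simp_all add: \<gamma>_def open_edge_def image_image)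
  qed
  moreover have "\<gamma> (Vertex v) = Vertex (fV v)" for v by (simp add: \<gamma>_def)
  ultimately show ?thesis using iso unfolding complex_iso_def by blast
qed

section \<open>Isomorphisms that respect virtual loops\<close>

definition virtual_iso :: "wgraph \<Rightarrow> wgraph \<Rightarrow> (nat \<Rightarrow> nat) \<Rightarrow>
    ((nat, nat + nat \<times> nat) gpoint \<Rightarrow> (nat, nat + nat \<times> nat) gpoint) \<Rightarrow> bool" where
  "virtual_iso Y Y' fE \<gamma> \<longleftrightarrow> (\<exists>fV fA.
     complex_iso (with_virtual_loops Y) (with_virtual_loops Y') fV fA \<gamma> \<and>
     (\<forall>e\<in>arcs (fst Y). fA (Inl e) = Inl (fE e)) \<and>
     (\<forall>l. Inr l \<in> arcs (with_virtual_loops Y) \<longrightarrow> fA (Inr l) \<in> range Inr))"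

lemma marked_iso_iff:
  "marked_iso g X X' fE \<longleftrightarrow> (\<exists>\<gamma>. virtual_iso (fst X) (fst X') fE \<gamma> \<and> marking_equiv g (fst X') (\<gamma> \<circ> snd X) (snd X'))"
  unfolding marked_iso_def virtual_iso_def by blast

lemma virtual_iso_id: "virtual_iso Y Y id id"
  unfolding virtual_iso_def using complex_iso_id by (intro exI[of _ id]) auto

lemma virtual_iso_compose:
  assumes "virtual_iso Y Y' fE \<gamma>" "virtual_iso Y' Y'' fE' \<gamma>'"
  shows "virtual_iso Y Y'' (fE' \<circ> fE) (\<gamma>' \<circ> \<gamma>)"
proof -
  obtain fV fA fV' fA' where
    1: "complex_iso (with_virtual_loops Y) (with_virtual_loops Y') fV fA \<gamma>"
     "\<forall>e\<in>arcs (fst Y). fA (Inl e) = Inl (fE e)"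
     "\<forall>l. Inr l \<in> arcs (with_virtual_loops Y) \<longrightarrow> fA (Inr l) \<in> range Inr" and
    2: "complex_iso (with_virtual_loops Y') (with_virtual_loops Y'') fV' fA' \<gamma>'"
     "\<forall>e\<in>arcs (fst Y'). fA' (Inl e) = Inl (fE' e)"
     "\<forall>l. Inr l \<in> arcs (with_virtual_loops Y') \<longrightarrow> fA' (Inr l) \<in> range Inr"
    using assms unfolding virtual_iso_def by blast
  have A: "fA a \<in> arcs (with_virtual_loops Y')" if "a \<in> arcs (with_virtual_loops Y)" for a
    using 1(1) that by (auto simp: complex_iso_def graph_iso_def bij_betw_def)
  have "(fA' \<circ> fA) (Inl e) = Inl ((fE' \<circ> fE) e)" if "e \<in> arcs (fst Y)" for e
    using A[of "Inl e"] 1(2) 2(2) that by auto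
  moreover have "(fA' \<circ> fA) (Inr l) \<in> range Inr" if l: "Inr l \<in> arcs (with_virtual_loops Y)" for l
  proof -
    obtain l' where "fA (Inr l) = Inr l'" using 1(3) l by blast
    moreover from this have "fA' (Inr l') \<in> range Inr" using A[OF l] 2(3) by metis
    ultimately show ?thesis by simp
  qed
  ultimately show ?thesis
    unfolding virtual_iso_def using complex_iso_compose[OF 1(1) 2(1)] by blast
qed

lemma virtual_iso_homeomorphic:
  "virtual_iso Y Y' fE \<gamma> \<Longrightarrow> homeomorphic_map (vrealization Y) (vrealization Y') \<gamma>"
  by (auto simp: virtual_iso_def complex_iso_def)

text \<open>Surjectivity rests on virtual loops going to virtual loops: the preimage of a
  non-virtual edge cannot be virtual.\<close>

lemma virtual_iso_bij:
  assumes "virtual_iso Y Y' fE \<gamma>"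
  shows "bij_betw fE (arcs (fst Y)) (arcs (fst Y'))"
proof -
  let ?G = "with_virtual_loops Y" and ?G' = "with_virtual_loops Y'"
  obtain fV fA where
    1: "complex_iso ?G ?G' fV fA \<gamma>"
     "\<forall>e\<in>arcs (fst Y). fA (Inl e) = Inl (fE e)"
     "\<forall>l. Inr l \<in> arcs (with_virtual_loops Y) \<longrightarrow> fA (Inr l) \<in> range Inr"
    using assms unfolding virtual_iso_def by blast
  have A: "bij_betw fA (arcs ?G) (arcs ?G')" using 1(1) by (auto simp: complex_iso_def graph_iso_def)
  show ?thesis
    unfolding bij_betw_def
  proof
    show "inj_on fE (arcs (fst Y))"
    proof (rule inj_onI)
      fix x y assume xy: "x \<in> arcs (fst Y)" "y \<in> arcs (fst Y)" "fE x = fE y"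
      then have "fA (Inl x) = fA (Inl y)" using 1(2) by simp
      then have "Inl x = (Inl y :: nat + nat \<times> nat)"
        by (rule inj_onD[OF bij_betw_imp_inj_on[OF A]]) (use xy in simp_all)
      then show "x = y" by simp
    qed
    show "fE ` arcs (fst Y) = arcs (fst Y')"
    proof
      show "fE ` arcs (fst Y) \<subseteq> arcs (fst Y')"
      proof
        fix d assume "d \<in> fE ` arcs (fst Y)"
        then obtain e where e: "e \<in> arcs (fst Y)" "d = fE e" by blast
        then have "Inl d = fA (Inl e)" "Inl e \<in> arcs ?G" using 1(2) by auto
        then have "Inl d \<in> arcs ?G'" using A by (auto simp: bij_betw_def)
        then show "d \<in> arcs (fst Y')" by simp
      qed
      show "arcs (fst Y') \<subseteq> fE ` arcs (fst Y)"
      proof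
        fix d assume "d \<in> arcs (fst Y')"
        then have "Inl d \<in> fA ` arcs ?G" using A by (auto simp: bij_betw_def)
        then obtain a where a: "a \<in> arcs ?G" "Inl d = fA a" by blast
        from a(1) show "d \<in> fE ` arcs (fst Y)"
        proof (cases rule: arcs_with_virtual_loops_cases)
          case (real e)
          then show ?thesis using a 1(2) by auto
        next
          case (virtual v i)
          then have "fA a \<in> range Inr" using 1(3) a(1) by simp
          then show ?thesis using a(2) by auto
        qed
      qed
    qed
  qed
qed

lemma virtual_iso_inverse:
  assumes vi: "virtual_iso Y Y' fE \<gamma>" and wf: "wf_digraph (fst Y)"
  obtains \<gamma>' where "virtual_iso Y' Y (inv_into (arcs (fst Y)) fE) \<gamma>'"
    "homeomorphic_maps (vrealization Y) (vrealization Y') \<gamma> \<gamma>'"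
proof -
  let ?G = "with_virtual_loops Y" and ?G' = "with_virtual_loops Y'"
  obtain fV fA where
    1: "complex_iso ?G ?G' fV fA \<gamma>"
     "\<forall>e\<in>arcs (fst Y). fA (Inl e) = Inl (fE e)"
     "\<forall>l. Inr l \<in> arcs (with_virtual_loops Y) \<longrightarrow> fA (Inr l) \<in> range Inr"
    using vi unfolding virtual_iso_def by blast
  have A: "bij_betw fA (arcs ?G) (arcs ?G')" using 1(1) by (auto simp: complex_iso_def graph_iso_def)
  note B = virtual_iso_bij[OF vi]
  obtain \<gamma>' where inv: "homeomorphic_maps (vrealization Y) (vrealization Y') \<gamma> \<gamma>'"
    using virtual_iso_homeomorphic[OF vi] homeomorphic_map_maps by blast
  let ?fA = "inv_into (arcs ?G) fA" and ?fE = "inv_into (arcs (fst Y)) fE"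
  have "?fA (Inl d) = Inl (?fE d)" if d: "d \<in> arcs (fst Y')" for d
  proof -
    have "?fE d \<in> arcs (fst Y)" "fE (?fE d) = d" using B d by (auto simp: bij_betw_def inv_into_into f_inv_into_f)
    then have "fA (Inl (?fE d)) = Inl d" "Inl (?fE d) \<in> arcs ?G" using 1(2) by auto
    then show ?thesis using A by (metis bij_betw_inv_into_left)
  qed
  moreover have "?fA (Inr l) \<in> range Inr" if l: "Inr l \<in> arcs ?G'" for l
  proof -
    have "?fA (Inr l) \<in> arcs ?G" "fA (?fA (Inr l)) = Inr l" using A l by (auto simp: bij_betw_def inv_into_into f_inv_into_f)
    then show ?thesis
      by (cases rule: arcs_with_virtual_loops_cases) (use 1(2) in auto)
  qed
  ultimately have "virtual_iso Y' Y ?fE \<gamma>'"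
    unfolding virtual_iso_def using complex_iso_inverse[OF 1(1) wf_with_virtual_loops[OF wf] inv] by blast
  with inv that show ?thesis by blast
qed

text \<open>The virtual loops at a vertex are mapped bijectively to those at its image, so counting
  them recovers the weights. The same bookkeeping shows that bouquets go into bouquets.\<close>

lemma virtual_iso_wgraph_iso:
  assumes vi: "virtual_iso Y Y' fE \<gamma>" and wf: "wf_digraph (fst Y)" "wf_digraph (fst Y')"
  shows "\<exists>fV. wgraph_iso Y Y' fV fE \<and> virtual_map Y Y' \<gamma> \<and> (\<forall>v\<in>verts (fst Y). \<gamma> (Vertex v) = Vertex (fV v))"
proof -
  let ?G = "with_virtual_loops Y" and ?G' = "with_virtual_loops Y'"
  obtain fV fA where
    1: "complex_iso ?G ?G' fV fA \<gamma>"
     "\<forall>e\<in>arcs (fst Y). fA (Inl e) = Inl (fE e)"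
     "\<forall>l. Inr l \<in> arcs (with_virtual_loops Y) \<longrightarrow> fA (Inr l) \<in> range Inr"
    using vi unfolding virtual_iso_def by blast
  have A: "bij_betw fA (arcs ?G) (arcs ?G')" and V: "bij_betw fV (verts (fst Y)) (verts (fst Y'))"
    and ends: "\<And>a. a \<in> arcs ?G \<Longrightarrow> {tail ?G' (fA a), head ?G' (fA a)} = fV ` {tail ?G a, head ?G a}"
    and vv: "\<And>v. v \<in> verts (fst Y) \<Longrightarrow> \<gamma> (Vertex v) = Vertex (fV v)"
    and oe: "\<And>a. a \<in> arcs ?G \<Longrightarrow> \<gamma> ` open_edge a = open_edge (fA a)"
    using 1(1) by (auto simp: complex_iso_def graph_iso_def)
  note B = virtual_iso_bij[OF vi]
  have Aim: "fA a \<in> arcs ?G'" if "a \<in> arcs ?G" for a using A that by (auto simp: bij_betw_def)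
  have L: "\<exists>j. fA (Inr (u, i)) = Inr (fV u, j) \<and> j < snd Y' (fV u)" if "u \<in> verts (fst Y)" "i < snd Y u" for u i
  proof -
    have a: "Inr (u, i) \<in> arcs ?G" using that by simp
    obtain l where l: "fA (Inr (u, i)) = Inr l" using 1(3) a by blast
    then have "{fst l} = {fV u}" using ends[OF a] by auto
    then have "fst l = fV u" by simp
    moreover have "Inr l \<in> arcs ?G'" using Aim[OF a] l by simp
    ultimately show ?thesis using l by (cases l) auto
  qed
  have giso: "graph_iso (fst Y) (fst Y') fV fE"
    unfolding graph_iso_def
  proof (intro conjI ballI B V)
    fix e assume e: "e \<in> arcs (fst Y)"
    then show "{tail (fst Y') (fE e), head (fst Y') (fE e)} = fV ` {tail (fst Y) e, head (fst Y) e}"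
      using ends[of "Inl e"] 1(2) by simp
  qed
  have weight: "snd Y' (fV u) = snd Y u" if u: "u \<in> verts (fst Y)" for u
  proof -
    have "fA ` (\<lambda>i. Inr (u, i)) ` {..<snd Y u} = (\<lambda>i. Inr (fV u, i)) ` {..<snd Y' (fV u)}"
    proof
      show "fA ` (\<lambda>i. Inr (u, i)) ` {..<snd Y u} \<subseteq> (\<lambda>i. Inr (fV u, i)) ` {..<snd Y' (fV u)}"
        using L[OF u] by force
      show "(\<lambda>i. Inr (fV u, i)) ` {..<snd Y' (fV u)} \<subseteq> fA ` (\<lambda>i. Inr (u, i)) ` {..<snd Y u}"
      proof
        fix x :: "nat + nat \<times> nat" assume "x \<in> (\<lambda>i. Inr (fV u, i)) ` {..<snd Y' (fV u)}"
        then obtain j where j: "x = Inr (fV u, j)" "j < snd Y' (fV u)" by auto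
        have "fV u \<in> verts (fst Y')" using V u by (auto simp: bij_betw_def)
        then have "x \<in> fA ` arcs ?G" using A j by (auto simp: bij_betw_def)
        then obtain a where a: "a \<in> arcs ?G" "x = fA a" by blast
        from a(1) show "x \<in> fA ` (\<lambda>i. Inr (u, i)) ` {..<snd Y u}"
        proof (cases rule: arcs_with_virtual_loops_cases)
          case (real e)
          then show ?thesis using a j 1(2) by auto
        next
          case (virtual v i)
          then have "fV v = fV u" using L[OF virtual(2,3)] a j by auto
          then have "v = u" using V u virtual(2) by (auto simp: bij_betw_def inj_on_def)
          then show ?thesis using virtual a by auto
        qed
      qed
    qed
    then have "card (fA ` (\<lambda>i. Inr (u, i)) ` {..<snd Y u}) = snd Y' (fV u)"
      by (simp add: card_image inj_on_def)
    moreover have "card (fA ` (\<lambda>i. Inr (u, i)) ` {..<snd Y u}) = snd Y u"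
    proof -
      have "(\<lambda>i. Inr (u, i)) ` {..<snd Y u} \<subseteq> arcs ?G" using u by auto
      then have "inj_on fA ((\<lambda>i. Inr (u, i)) ` {..<snd Y u})"
        using A by (auto simp: bij_betw_def intro: inj_on_subset)
      then show ?thesis by (simp add: card_image inj_on_def[of "\<lambda>i. Inr (u, i)"])
    qed
    ultimately show ?thesis by simp
  qed
  have "\<gamma> ` virtual_part Y u \<subseteq> virtual_part Y' (fV u)" if u: "u \<in> verts (fst Y)" for u
  proof -
    have "\<gamma> x \<in> virtual_part Y' (fV u)" if x: "x \<in> open_edge (Inr (u, i))" "i < snd Y u" for x i
    proof -
      obtain j where "fA (Inr (u, i)) = Inr (fV u, j)" "j < snd Y' (fV u)" using L[OF u x(2)] by blast
      then show ?thesis using oe[of "Inr (u, i)"] x u by (auto simp: virtual_part_def)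
    qed
    then show ?thesis using vv[OF u] by (auto simp: virtual_part_def)
  qed
  then have "virtual_map Y Y' \<gamma>"
    using V vv homeomorphic_imp_continuous_map[OF virtual_iso_homeomorphic[OF vi]]
    by (auto simp: virtual_map_def bij_betw_def intro!: bexI[of _ "fV _"])
  with giso weight vv show ?thesis by (auto simp: wgraph_iso_def)
qed

text \<open>The weights agree, so the virtual loop with index \<open>i\<close> at \<open>v\<close>
  can be sent to the one with the same index at \<open>fV v\<close>.\<close>

lemma wgraph_iso_virtual_iso:
  assumes iso: "wgraph_iso Y Y' fV fE" and wf: "wf_digraph (fst Y)" "wf_digraph (fst Y')"
  shows "\<exists>\<gamma>. virtual_iso Y Y' fE \<gamma>"
proof -
  let ?G = "with_virtual_loops Y" and ?G' = "with_virtual_loops Y'"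
  let ?fA = "map_sum fE (\<lambda>(v, i). (fV v, i :: nat))"
  have V: "bij_betw fV (verts (fst Y)) (verts (fst Y'))" and E: "bij_betw fE (arcs (fst Y)) (arcs (fst Y'))"
    and ends: "\<And>e. e \<in> arcs (fst Y) \<Longrightarrow> {tail (fst Y') (fE e), head (fst Y') (fE e)} = fV ` {tail (fst Y) e, head (fst Y) e}"
    and w: "\<And>v. v \<in> verts (fst Y) \<Longrightarrow> snd Y' (fV v) = snd Y v"
    using iso by (auto simp: wgraph_iso_def graph_iso_def)
  have "bij_betw ?fA (arcs ?G) (arcs ?G')"
    unfolding bij_betw_def
  proof
    show "inj_on ?fA (arcs ?G)"
    proof (rule inj_onI)
      fix x y assume x: "x \<in> arcs ?G" and y: "y \<in> arcs ?G" and "?fA x = ?fA y"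
      from x show "x = y"
      proof (cases rule: arcs_with_virtual_loops_cases)
        case (real e)
        from y show ?thesis
          by (cases rule: arcs_with_virtual_loops_cases)
             (use real \<open>?fA x = ?fA y\<close> inj_onD[OF bij_betw_imp_inj_on[OF E]] in auto)
      next
        case (virtual v i)
        from y show ?thesis
          by (cases rule: arcs_with_virtual_loops_cases)
             (use virtual \<open>?fA x = ?fA y\<close> inj_onD[OF bij_betw_imp_inj_on[OF V]] in auto)
      qed
    qed
    show "?fA ` arcs ?G = arcs ?G'"
    proof
      show "?fA ` arcs ?G \<subseteq> arcs ?G'"
        using V E w by (auto elim!: arcs_with_virtual_loops_cases simp: bij_betw_def)
      show "arcs ?G' \<subseteq> ?fA ` arcs ?G"
      proof
        fix x assume "x \<in> arcs ?G'"
        then show "x \<in> ?fA ` arcs ?G"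
        proof (cases rule: arcs_with_virtual_loops_cases)
          case (real e)
          then obtain d where "d \<in> arcs (fst Y)" "e = fE d" using E by (auto simp: bij_betw_def)
          then show ?thesis using real by (intro image_eqI[of _ _ "Inl d"]) auto
        next
          case (virtual v i)
          then obtain u where "u \<in> verts (fst Y)" "v = fV u" using V by (auto simp: bij_betw_def)
          then show ?thesis using virtual w by (intro image_eqI[of _ _ "Inr (u, i)"]) auto
        qed
      qed
    qed
  qed
  moreover have "{tail ?G' (?fA a), head ?G' (?fA a)} = fV ` {tail ?G a, head ?G a}" if "a \<in> arcs ?G" for a
    using that by (cases rule: arcs_with_virtual_loops_cases) (use ends in auto)
  ultimately have "graph_iso ?G ?G' fV ?fA" using V by (simp add: graph_iso_def)
  from graph_iso_complex_iso[OF this] wf obtain \<gamma> where "complex_iso ?G ?G' fV ?fA \<gamma>" by auto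
  then have "virtual_iso Y Y' fE \<gamma>"
    unfolding virtual_iso_def by (intro exI[of _ fV] exI[of _ ?fA]) auto
  then show ?thesis by blast
qed

section \<open>Isomorphisms of marked graphs\<close>

text \<open>Stability and genus are left out, so that the notion passes to contractions without
  counting valences.\<close>

definition well_marked :: "nat \<Rightarrow> marked \<Rightarrow> bool" where
  "well_marked g X \<longleftrightarrow> wf_digraph (fst (fst X)) \<and> is_marking g (fst X) (snd X)"

text \<open>A marking composed with an isomorphism is again a marking, so the strict equivalence may
  be traded for the loose one, for which transitivity and compatibility with maps are
  available.\<close>

lemma marked_iso_loose:
  assumes X: "well_marked g X" and X': "well_marked g X'"
  shows "marked_iso g X X' fE \<longleftrightarrow> (\<exists>\<gamma>. virtual_iso (fst X) (fst X') fE \<gamma> \<and> loose_equiv g (fst X') (\<gamma> \<circ> snd X) (snd X'))"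
proof -
  have "is_marking g (fst X') (\<gamma> \<circ> snd X)" if "virtual_iso (fst X) (fst X') fE \<gamma>" for \<gamma>
  proof -
    obtain \<gamma>' where "homeomorphic_maps (vrealization (fst X)) (vrealization (fst X')) \<gamma> \<gamma>'"
      using virtual_iso_homeomorphic[OF \<open>virtual_iso (fst X) (fst X') fE \<gamma>\<close>] homeomorphic_map_maps by blast
    then have "homotopy_equivalence (vrealization (fst X)) (vrealization (fst X')) \<gamma>"
      by (rule homotopy_equivalence_homeomorphic)
    then show ?thesis
      using X homotopy_equivalence_compose unfolding well_marked_def is_marking_def by blast
  qed
  then have "virtual_iso (fst X) (fst X') fE \<gamma> \<and> marking_equiv g (fst X') (\<gamma> \<circ> snd X) (snd X') \<longleftrightarrow>
      virtual_iso (fst X) (fst X') fE \<gamma> \<and> loose_equiv g (fst X') (\<gamma> \<circ> snd X) (snd X')" for \<gamma>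
    using marking_equiv_iff_loose X' unfolding well_marked_def by blast
  then show ?thesis
    unfolding marked_iso_iff by simp
qed

lemma marked_iso_homotopic:
  assumes X: "well_marked g (Y, h)" and h: "homotopic_with (\<lambda>_. True) (rose_space g) (vrealization Y) h h'"
  shows "marked_iso g (Y, h) (Y, h') id" "well_marked g (Y, h')"
proof -
  show X': "well_marked g (Y, h')" using X is_marking_homotopic[OF _ h] by (simp add: well_marked_def)
  show "marked_iso g (Y, h) (Y, h') id"
    unfolding marked_iso_loose[OF X X'] using virtual_iso_id loose_equiv_homotopic[OF h] by (intro exI[of _ id]) auto
qed

lemma marked_iso_refl: "well_marked g X \<Longrightarrow> marked_iso g X X id"
  using marked_iso_homotopic(1)[of g "fst X" "snd X" "snd X"] marking_continuous[of g "fst X" "snd X"]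
  by (simp add: well_marked_def)

lemma marked_iso_trans:
  assumes X: "well_marked g X" "well_marked g X'" "well_marked g X''"
    and 1: "marked_iso g X X' fE" and 2: "marked_iso g X' X'' fE'"
  shows "marked_iso g X X'' (fE' \<circ> fE)"
proof -
  obtain \<gamma> where \<gamma>: "virtual_iso (fst X) (fst X') fE \<gamma>" "loose_equiv g (fst X') (\<gamma> \<circ> snd X) (snd X')"
    using 1 marked_iso_loose X by blast
  obtain \<gamma>' where \<gamma>': "virtual_iso (fst X') (fst X'') fE' \<gamma>'" "loose_equiv g (fst X'') (\<gamma>' \<circ> snd X') (snd X'')"
    using 2 marked_iso_loose X by blast
  have wf: "wf_digraph (fst (fst X'))" "wf_digraph (fst (fst X''))" using X by (auto simp: well_marked_def)
  have "virtual_map (fst X') (fst X'') \<gamma>'" using virtual_iso_wgraph_iso[OF \<gamma>'(1) wf] by blast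
  then have "loose_equiv g (fst X'') (\<gamma>' \<circ> (\<gamma> \<circ> snd X)) (\<gamma>' \<circ> snd X')"
    by (rule loose_equiv_map[OF wf \<gamma>(2)])
  then have "loose_equiv g (fst X'') (\<gamma>' \<circ> \<gamma> \<circ> snd X) (snd X'')"
    using loose_equiv_trans[OF wf(2) _ \<gamma>'(2)] by (simp add: comp_assoc)
  then show ?thesis
    using marked_iso_loose X virtual_iso_compose[OF \<gamma>(1) \<gamma>'(1)] by blast
qed

lemma marked_iso_sym:
  assumes X: "well_marked g X" "well_marked g X'" and 1: "marked_iso g X X' fE"
  shows "marked_iso g X' X (inv_into (arcs (fst (fst X))) fE)"
proof -
  obtain \<gamma> where \<gamma>: "virtual_iso (fst X) (fst X') fE \<gamma>" "loose_equiv g (fst X') (\<gamma> \<circ> snd X) (snd X')"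
    using 1 marked_iso_loose X by blast
  have wf: "wf_digraph (fst (fst X))" "wf_digraph (fst (fst X'))" using X by (auto simp: well_marked_def)
  obtain \<gamma>' where \<gamma>': "virtual_iso (fst X') (fst X) (inv_into (arcs (fst (fst X))) fE) \<gamma>'"
    "homeomorphic_maps (vrealization (fst X)) (vrealization (fst X')) \<gamma> \<gamma>'"
    using virtual_iso_inverse[OF \<gamma>(1) wf(1)] by blast
  have vm: "virtual_map (fst X') (fst X) \<gamma>'" using virtual_iso_wgraph_iso[OF \<gamma>'(1) wf(2,1)] by blast
  have "loose_equiv g (fst X) (\<gamma>' \<circ> snd X') (\<gamma>' \<circ> (\<gamma> \<circ> snd X))"
    by (rule loose_equiv_map[OF wf(2,1) loose_equiv_sym[OF wf(2) \<gamma>(2)] vm])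
  moreover have "loose_equiv g (fst X) (\<gamma>' \<circ> (\<gamma> \<circ> snd X)) (snd X)"
  proof (rule loose_equiv_homotopic[OF homotopic_with_symD[OF homotopic_with_equal]])
    have H: "continuous_map (rose_space g) (vrealization (fst X)) (snd X)"
      using X marking_continuous by (auto simp: well_marked_def)
    then show "continuous_map (rose_space g) (vrealization (fst X)) (snd X)" .
    show "snd X x = (\<gamma>' \<circ> (\<gamma> \<circ> snd X)) x" if "x \<in> topspace (rose_space g)" for x
      using continuous_map_funspace[OF H] that \<gamma>'(2) by (auto simp: homeomorphic_maps_def Pi_iff)
  qed auto
  ultimately have "loose_equiv g (fst X) (\<gamma>' \<circ> snd X') (snd X)" by (rule loose_equiv_trans[OF wf(1)])
  then show ?thesis using marked_iso_loose X \<gamma>'(1) by blast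
qed

lemma well_marked_precompose:
  assumes X: "well_marked g X" and f: "homotopy_equivalence (rose_space g) (rose_space g) f"
  shows "well_marked g (fst X, snd X \<circ> f)"
  using X homotopy_equivalence_compose[OF f] by (auto simp: well_marked_def is_marking_def)

lemma marked_iso_precompose:
  assumes X: "well_marked g X" "well_marked g X'" and 1: "marked_iso g X X' fE"
    and f: "homotopy_equivalence (rose_space g) (rose_space g) f" "f (Vertex ()) = Vertex ()"
  shows "marked_iso g (fst X, snd X \<circ> f) (fst X', snd X' \<circ> f) fE"
proof -
  obtain \<gamma> where \<gamma>: "virtual_iso (fst X) (fst X') fE \<gamma>" "loose_equiv g (fst X') (\<gamma> \<circ> snd X) (snd X')"
    using 1 marked_iso_loose X by blast
  have "wf_digraph (fst (fst X'))" using X by (auto simp: well_marked_def)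
  moreover have "continuous_map (rose_space g) (rose_space g) f" using f by (simp add: homotopy_equivalence_def)
  ultimately have "loose_equiv g (fst X') (\<gamma> \<circ> snd X \<circ> f) (snd X' \<circ> f)"
    using loose_equiv_precompose \<gamma>(2) f(2) by blast
  then show ?thesis
    using marked_iso_loose[OF well_marked_precompose[OF X(1) f(1)] well_marked_precompose[OF X(2) f(1)]] \<gamma>(1)
    by (auto simp: comp_assoc)
qed

lemma marked_iso_wgraph_iso:
  assumes X: "well_marked g X" "well_marked g X'" and 1: "marked_iso g X X' fE"
  shows "\<exists>fV. wgraph_iso (fst X) (fst X') fV fE"
proof -
  obtain \<gamma> where "virtual_iso (fst X) (fst X') fE \<gamma>" using 1 marked_iso_iff by blast
  then show ?thesis using virtual_iso_wgraph_iso[of "fst X" "fst X'"] X unfolding well_marked_def by blast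
qed

section \<open>Isomorphisms of weighted graphs, and the comparison of two markings\<close>

lemma wgraph_iso_bij: "wgraph_iso Y Y' fV fE \<Longrightarrow> bij_betw fE (arcs (fst Y)) (arcs (fst Y'))"
  by (simp add: wgraph_iso_def graph_iso_def)

lemma wgraph_iso_id: "wgraph_iso Y Y id id"
  by (simp add: wgraph_iso_def graph_iso_id)

lemma wgraph_iso_compose:
  assumes "wgraph_iso Y Y' fV fE" "wgraph_iso Y' Y'' fV' fE'"
  shows "wgraph_iso Y Y'' (fV' \<circ> fV) (fE' \<circ> fE)"
proof -
  have "fV v \<in> verts (fst Y')" if "v \<in> verts (fst Y)" for v
    using assms(1) that by (auto simp: wgraph_iso_def graph_iso_def bij_betw_def)
  then show ?thesis using assms graph_iso_compose by (auto simp: wgraph_iso_def)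
qed

lemma wgraph_iso_inverse:
  assumes iso: "wgraph_iso Y Y' fV fE" and wf: "wf_digraph (fst Y)"
  shows "wgraph_iso Y' Y (inv_into (verts (fst Y)) fV) (inv_into (arcs (fst Y)) fE)"
proof -
  have V: "bij_betw fV (verts (fst Y)) (verts (fst Y'))" using iso by (auto simp: wgraph_iso_def graph_iso_def)
  have "snd Y (inv_into (verts (fst Y)) fV v) = snd Y' v" if "v \<in> verts (fst Y')" for v
    using V iso that bij_betw_inv_into_right[OF V that] bij_betw_apply[OF bij_betw_inv_into[OF V] that]
    by (metis wgraph_iso_def)
  then show ?thesis using iso graph_iso_inverse[OF _ wf] by (auto simp: wgraph_iso_def)
qed

text \<open>With \<open>h'\<close> a homotopy inverse of \<open>h\<close>, the composite
  \<open>h' \<circ> k\<close> is a self-equivalence of the rose and hence homotopic to some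
  \<open>rose_map g \<alpha>\<close>; composing with \<open>h\<close> returns
  \<open>k\<close>.\<close>

theorem markings_transitive:
  assumes h: "is_marking g Y h" and k: "is_marking g Y k"
  shows "\<exists>\<alpha>\<in>auto (Fg g). homotopic_with (\<lambda>_. True) (rose_space g) (vrealization Y) (h \<circ> rose_map g \<alpha>) k"
proof -
  obtain h' where h': "continuous_map (vrealization Y) (rose_space g) h'"
    "homotopic_with (\<lambda>_. True) (rose_space g) (rose_space g) (h' \<circ> h) id"
    "homotopic_with (\<lambda>_. True) (vrealization Y) (vrealization Y) (h \<circ> h') id"
    using h unfolding is_marking_def homotopy_equivalence_def by blast
  have "homotopy_equivalence (vrealization Y) (rose_space g) h'"
    unfolding homotopy_equivalence_def using h' marking_continuous[OF h] by blast
  then have "homotopy_equivalence (rose_space g) (rose_space g) (h' \<circ> k)"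
    using homotopy_equivalence_compose k is_marking_def by blast
  then obtain \<alpha> where \<alpha>: "\<alpha> \<in> auto (Fg g)"
    "homotopic_with (\<lambda>_. True) (rose_space g) (rose_space g) (h' \<circ> k) (rose_map g \<alpha>)"
    using rose_self_equivalence by blast
  have "homotopic_with (\<lambda>_. True) (rose_space g) (vrealization Y) (h \<circ> rose_map g \<alpha>) (h \<circ> (h' \<circ> k))"
    using homotopic_with_symD[OF \<alpha>(2)] marking_continuous[OF h] by (rule homotopic_with_compose_continuous_map_left) simp
  moreover have "homotopic_with (\<lambda>_. True) (rose_space g) (vrealization Y) (h \<circ> h' \<circ> k) (id \<circ> k)"
    using h'(3) marking_continuous[OF k] by (rule homotopic_with_compose_continuous_map_right) simp
  ultimately have "homotopic_with (\<lambda>_. True) (rose_space g) (vrealization Y) (h \<circ> rose_map g \<alpha>) k"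
    using homotopic_with_trans by (simp add: comp_assoc) blast
  with \<alpha>(1) show ?thesis by blast
qed

section \<open>Quotients of graphs\<close>

text \<open>An edge labelled \<^term>\<open>None\<close> is collapsed to a point.\<close>

definition edge_quotient :: "('v, 'e) pre_digraph \<Rightarrow> ('w, 'd) pre_digraph \<Rightarrow>
    (('v, 'e) gpoint \<Rightarrow> ('w, 'd) gpoint) \<Rightarrow> ('v \<Rightarrow> 'w) \<Rightarrow> ('e \<Rightarrow> 'd option) \<Rightarrow> bool" where
  "edge_quotient G G' c cV L \<longleftrightarrow>
     (\<forall>v\<in>verts G. c (Vertex v) = Vertex (cV v)) \<and> cV ` verts G = verts G' \<and>
     (\<forall>e\<in>arcs G. \<forall>d. L e = Some d \<longrightarrow> d \<in> arcs G' \<and> (\<forall>t. 0 < t \<and> t < 1 \<longrightarrow> c (Inner e t) = Inner d t) \<and>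
        tail G' d = cV (tail G e) \<and> head G' d = cV (head G e)) \<and>
     (\<forall>e\<in>arcs G. L e = None \<longrightarrow> cV (head G e) = cV (tail G e) \<and>
        (\<forall>t. 0 < t \<and> t < 1 \<longrightarrow> c (Inner e t) = Vertex (cV (tail G e)))) \<and>
     (\<forall>d\<in>arcs G'. \<exists>e\<in>arcs G. L e = Some d) \<and>
     (\<forall>e\<in>arcs G. \<forall>e'\<in>arcs G. L e = L e' \<longrightarrow> L e \<noteq> None \<longrightarrow> e = e')"

lemma edge_quotient_edge_path:
  assumes "edge_quotient G G' c cV L" "wf_digraph G" "e \<in> arcs G"
  shows "L e = Some d \<Longrightarrow> c (edge_path G e t) = edge_path G' d t"
    and "L e = None \<Longrightarrow> c (edge_path G e t) = Vertex (cV (tail G e))"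
proof -
  have "tail G e \<in> verts G" "head G e \<in> verts G" using assms by (auto simp: wf_digraph_def)
  then show "L e = Some d \<Longrightarrow> c (edge_path G e t) = edge_path G' d t"
    "L e = None \<Longrightarrow> c (edge_path G e t) = Vertex (cV (tail G e))"
    using assms(1,3) unfolding edge_quotient_def edge_path_def by auto
qed

lemma edge_quotient_continuous:
  assumes q: "edge_quotient G G' c cV L" and wf: "wf_digraph G" "wf_digraph G'"
  shows "continuous_map (realization G) (realization G') c"
  unfolding continuous_map_realization[OF wf(1)]
proof safe
  show "c (Vertex v) \<in> topspace (realization G')" if "v \<in> verts G" for v
    using q that wf by (auto simp: edge_quotient_def)
  fix e assume e: "e \<in> arcs G"
  show "pathin (realization G') (c \<circ> edge_path G e)"
  proof (cases "L e")
    case None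
    have "c \<circ> edge_path G e = (\<lambda>_. Vertex (cV (tail G e)))"
      using edge_quotient_edge_path(2)[OF q wf(1) e None] by auto
    moreover have "cV (tail G e) \<in> verts G'" using q wf e by (auto simp: edge_quotient_def wf_digraph_def)
    ultimately show ?thesis using wf by simp
  next
    case (Some d)
    have "c \<circ> edge_path G e = edge_path G' d"
      using edge_quotient_edge_path(1)[OF q wf(1) e Some] by auto
    moreover have "d \<in> arcs G'" using q e Some by (auto simp: edge_quotient_def)
    ultimately show ?thesis using wf by simp
  qed
qed

lemma edge_quotient_surj:
  assumes q: "edge_quotient G G' c cV L" and y: "y \<in> gpoints G'"
  shows "\<exists>x\<in>gpoints G. c x = y"
  using y
proof (cases rule: gpoints_cases)
  case (vertex w)
  then have "w \<in> cV ` verts G" using q by (simp add: edge_quotient_def)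
  then obtain v where "v \<in> verts G" "w = cV v" by blast
  then show ?thesis using vertex q by (intro bexI[of _ "Vertex v"]) (auto simp: edge_quotient_def)
next
  case (inner d t)
  then obtain e where "e \<in> arcs G" "L e = Some d" using q unfolding edge_quotient_def by blast
  then show ?thesis using inner q by (intro bexI[of _ "Inner e t"]) (auto simp: edge_quotient_def)
qed

text \<open>Each edge of the quotient is a copy of an edge upstairs, so openness downstairs can be
  read off from the preimage.\<close>

lemma edge_quotient_quotient_map:
  assumes q: "edge_quotient G G' c cV L" and wf: "wf_digraph G" "wf_digraph G'"
  shows "quotient_map (realization G) (realization G') c"
  unfolding quotient_map_def
proof (intro conjI allI impI)
  note cont = edge_quotient_continuous[OF assms]
  show "c ` topspace (realization G) = topspace (realization G')"
    using continuous_map_image_subset_topspace[OF cont] edge_quotient_surj[OF q] wf by (simp add: set_eq_iff image_iff subset_iff) metis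
  fix U assume U: "U \<subseteq> topspace (realization G')"
  show "openin (realization G) {x \<in> topspace (realization G). c x \<in> U} = openin (realization G') U"
  proof
    assume o: "openin (realization G) {x \<in> topspace (realization G). c x \<in> U}"
    show "openin (realization G') U"
      unfolding openin_realization
    proof (intro conjI ballI)
      show "U \<subseteq> gpoints G'" using U wf by simp
      fix d assume "d \<in> arcs G'"
      then obtain e where e: "e \<in> arcs G" "L e = Some d" using q unfolding edge_quotient_def by blast
      have "{t \<in> {0..1}. edge_path G' d t \<in> U} =
          {t \<in> {0..1}. edge_path G e t \<in> {x \<in> topspace (realization G). c x \<in> U}}"
        using edge_quotient_edge_path(1)[OF q wf(1) e] edge_path_in_gpoints[OF wf(1) e(1)] wf by auto
      then show "openin (top_of_set {0..1}) {t \<in> {0..1}. edge_path G' d t \<in> U}"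
        using o e(1) unfolding openin_realization by simp
    qed
  qed (use cont openin_continuous_map_preimage in blast)
qed

text \<open>The given homeomorphism may parametrize edges arbitrarily, so the induced map is
  obtained from the quotient topology. Only \<open>K1\<close> and \<open>K2\<close> can be fibres
  with more than one point, and \<open>\<gamma>\<close> matches them; hence \<open>\<gamma>\<close>
  and its inverse both factor, and the factors are inverse to each other.\<close>

lemma complex_iso_descends:
  assumes q1: "edge_quotient G1 G1' c1 cV1 L1" and q2: "edge_quotient G2 G2' c2 cV2 L2"
    and wf: "wf_digraph G1" "wf_digraph G1'" "wf_digraph G2" "wf_digraph G2'"
    and iso: "complex_iso G1 G2 fV fA \<gamma>"
    and L: "\<And>e. e \<in> arcs G1 \<Longrightarrow> L1 e = None \<longleftrightarrow> L2 (fA e) = None"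
    and K1: "\<And>x y. x \<in> gpoints G1 \<Longrightarrow> y \<in> gpoints G1 \<Longrightarrow> c1 x = c1 y \<longleftrightarrow> x = y \<or> x \<in> K1 \<and> y \<in> K1"
    and K2: "\<And>x y. x \<in> gpoints G2 \<Longrightarrow> y \<in> gpoints G2 \<Longrightarrow> c2 x = c2 y \<longleftrightarrow> x = y \<or> x \<in> K2 \<and> y \<in> K2"
    and K: "\<And>x. x \<in> gpoints G1 \<Longrightarrow> x \<in> K1 \<longleftrightarrow> \<gamma> x \<in> K2"
  obtains fV' fA' \<gamma>' where "complex_iso G1' G2' fV' fA' \<gamma>'"
    "\<And>x. x \<in> gpoints G1 \<Longrightarrow> \<gamma>' (c1 x) = c2 (\<gamma> x)"
    "\<And>e d. e \<in> arcs G1 \<Longrightarrow> L1 e = Some d \<Longrightarrow> L2 (fA e) = Some (fA' d)"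
proof -
  note qm1 = edge_quotient_quotient_map[OF q1 wf(1,2)] and qm2 = edge_quotient_quotient_map[OF q2 wf(3,4)]
  have V: "bij_betw fV (verts G1) (verts G2)" and A: "bij_betw fA (arcs G1) (arcs G2)"
    and ends: "\<And>e. e \<in> arcs G1 \<Longrightarrow> {tail G2 (fA e), head G2 (fA e)} = fV ` {tail G1 e, head G1 e}"
    and vv: "\<And>v. v \<in> verts G1 \<Longrightarrow> \<gamma> (Vertex v) = Vertex (fV v)"
    and oe: "\<And>e. e \<in> arcs G1 \<Longrightarrow> \<gamma> ` open_edge e = open_edge (fA e)"
    and hm: "homeomorphic_map (realization G1) (realization G2) \<gamma>"
    using iso by (auto simp: complex_iso_def graph_iso_def)
  obtain \<delta> where \<delta>: "homeomorphic_maps (realization G1) (realization G2) \<gamma> \<delta>"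
    using hm homeomorphic_map_maps by blast
  have \<gamma>\<delta>: "\<gamma> x \<in> gpoints G2" "\<delta> (\<gamma> x) = x" if "x \<in> gpoints G1" for x
    using \<delta> that wf continuous_map_funspace[of "realization G1" "realization G2" \<gamma>]
    by (auto simp: homeomorphic_maps_def)
  have \<delta>\<gamma>: "\<delta> y \<in> gpoints G1" "\<gamma> (\<delta> y) = y" if "y \<in> gpoints G2" for y
    using \<delta> that wf continuous_map_funspace[of "realization G2" "realization G1" \<delta>]
    by (auto simp: homeomorphic_maps_def)
  have "continuous_map (realization G1) (realization G2') (c2 \<circ> \<gamma>)"
    using hm qm2 homeomorphic_imp_continuous_map quotient_imp_continuous_map continuous_map_compose by metis
  moreover have "(c2 \<circ> \<gamma>) x = (c2 \<circ> \<gamma>) y" if "x \<in> topspace (realization G1)" "y \<in> topspace (realization G1)" "c1 x = c1 y" for x y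
    using that K1[of x y] K2[of "\<gamma> x" "\<gamma> y"] K \<gamma>\<delta> wf by auto
  ultimately obtain \<gamma>' where \<gamma>': "continuous_map (realization G1') (realization G2') \<gamma>'"
    "\<And>x. x \<in> topspace (realization G1) \<Longrightarrow> \<gamma>' (c1 x) = (c2 \<circ> \<gamma>) x"
    using quotient_map_lift_exists[OF qm1] by metis
  have "continuous_map (realization G2) (realization G1') (c1 \<circ> \<delta>)"
    using \<delta> qm1 quotient_imp_continuous_map continuous_map_compose unfolding homeomorphic_maps_def by metis
  moreover have "(c1 \<circ> \<delta>) x = (c1 \<circ> \<delta>) y" if "x \<in> topspace (realization G2)" "y \<in> topspace (realization G2)" "c2 x = c2 y" for x y
    using that K2[of x y] K1[of "\<delta> x" "\<delta> y"] K[of "\<delta> x"] K[of "\<delta> y"] \<delta>\<gamma> wf by auto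
  ultimately obtain \<delta>' where \<delta>': "continuous_map (realization G2') (realization G1') \<delta>'"
    "\<And>x. x \<in> topspace (realization G2) \<Longrightarrow> \<delta>' (c2 x) = (c1 \<circ> \<delta>) x"
    using quotient_map_lift_exists[OF qm2] by metis
  have c: "\<gamma>' (c1 x) = c2 (\<gamma> x)" if "x \<in> gpoints G1" for x using \<gamma>'(2) that wf by simp
  have d: "\<delta>' (c2 x) = c1 (\<delta> x)" if "x \<in> gpoints G2" for x using \<delta>'(2) that wf by simp
  have inv1: "\<delta>' (\<gamma>' y) = y" if y: "y \<in> gpoints G1'" for y
  proof -
    obtain x where x: "x \<in> gpoints G1" "y = c1 x" using edge_quotient_surj[OF q1 y] by blast
    then show ?thesis using c[OF x(1)] d[OF \<gamma>\<delta>(1)[OF x(1)]] \<gamma>\<delta>(2)[OF x(1)] by simp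
  qed
  have inv2: "\<gamma>' (\<delta>' y) = y" if y: "y \<in> gpoints G2'" for y
  proof -
    obtain x where x: "x \<in> gpoints G2" "y = c2 x" using edge_quotient_surj[OF q2 y] by blast
    then show ?thesis using d[OF x(1)] c[OF \<delta>\<gamma>(1)[OF x(1)]] \<delta>\<gamma>(2)[OF x(1)] by simp
  qed
  have hm': "homeomorphic_map (realization G1') (realization G2') \<gamma>'"
    using \<gamma>' \<delta>' inv1 inv2 wf by (auto simp: homeomorphic_map_maps homeomorphic_maps_def intro!: exI[of _ \<delta>'])
  have inj: "inj_on \<gamma>' (gpoints G1')" using inv1 by (metis inj_onI)
  define fV' where "fV' v' = (SOME w. \<gamma>' (Vertex v') = Vertex w)" for v'
  define fA' where "fA' d = the (L2 (fA (SOME e. e \<in> arcs G1 \<and> L1 e = Some d)))" for d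
  have fV': "fV' (cV1 v) = cV2 (fV v)" "\<gamma>' (Vertex (cV1 v)) = Vertex (fV' (cV1 v))" if v: "v \<in> verts G1" for v
  proof -
    have "fV v \<in> verts G2" using V v by (auto simp: bij_betw_def)
    then have "\<gamma>' (Vertex (cV1 v)) = Vertex (cV2 (fV v))"
      using c[of "Vertex v"] v vv[OF v] q1 q2 by (auto simp: edge_quotient_def)
    then show "fV' (cV1 v) = cV2 (fV v)" "\<gamma>' (Vertex (cV1 v)) = Vertex (fV' (cV1 v))"
      by (auto simp: fV'_def)
  qed
  have fA': "L2 (fA e) = Some (fA' d)" if e: "e \<in> arcs G1" "L1 e = Some d" for e d
  proof -
    have "(SOME e. e \<in> arcs G1 \<and> L1 e = Some d) = e"
      using e q1 by (intro some_equality) (auto simp: edge_quotient_def)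
    then show ?thesis using L[OF e(1)] e by (auto simp: fA'_def)
  qed
  have S1: "\<exists>e\<in>arcs G1. L1 e = Some d" if "d \<in> arcs G1'" for d using q1 that unfolding edge_quotient_def by blast
  have V1: "cV1 ` verts G1 = verts G1'" and V2: "cV2 ` verts G2 = verts G2'" using q1 q2 by (auto simp: edge_quotient_def)
  have "complex_iso G1' G2' fV' fA' \<gamma>'"
    unfolding complex_iso_def graph_iso_def
  proof (intro conjI ballI hm')
    show "bij_betw fV' (verts G1') (verts G2')"
      unfolding bij_betw_def
    proof
      show "inj_on fV' (verts G1')"
      proof (rule inj_onI)
        fix x y assume xy: "x \<in> verts G1'" "y \<in> verts G1'" "fV' x = fV' y"
        then have "\<gamma>' (Vertex x) = \<gamma>' (Vertex y)" using fV'(2) V1 by (metis imageE)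
        then have "Vertex x = (Vertex y :: ('c, 'd) gpoint)" by (rule inj_onD[OF inj]) (use xy in auto)
        then show "x = y" by simp
      qed
      have "fV' ` verts G1' = (\<lambda>v. cV2 (fV v)) ` verts G1" using fV'(1) by (simp flip: V1 add: image_image)
      also have "\<dots> = verts G2'" using V V2 by (simp add: bij_betw_def flip: image_image)
      finally show "fV' ` verts G1' = verts G2'" .
    qed
    show "bij_betw fA' (arcs G1') (arcs G2')"
      unfolding bij_betw_def
    proof
      show "inj_on fA' (arcs G1')"
      proof (rule inj_onI)
        fix x y assume xy: "x \<in> arcs G1'" "y \<in> arcs G1'" "fA' x = fA' y"
        obtain e e' where e: "e \<in> arcs G1" "L1 e = Some x" "e' \<in> arcs G1" "L1 e' = Some y" using S1 xy by meson
        then have "L2 (fA e) = L2 (fA e')" "L2 (fA e) \<noteq> None" using fA' xy(3) by auto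
        moreover have "fA e \<in> arcs G2" "fA e' \<in> arcs G2" using A e by (auto simp: bij_betw_def)
        ultimately have "fA e = fA e'" using q2 unfolding edge_quotient_def by blast
        then have "e = e'" using A e by (auto simp: bij_betw_def inj_on_def)
        then show "x = y" using e by simp
      qed
      show "fA' ` arcs G1' = arcs G2'"
      proof
        show "fA' ` arcs G1' \<subseteq> arcs G2'"
        proof
          fix x assume "x \<in> fA' ` arcs G1'"
          then obtain d e where "x = fA' d" "e \<in> arcs G1" "L1 e = Some d" using S1 by blast
          then have "L2 (fA e) = Some x" "fA e \<in> arcs G2" using fA' A by (auto simp: bij_betw_def)
          then show "x \<in> arcs G2'" using q2 by (auto simp: edge_quotient_def)
        qed
        show "arcs G2' \<subseteq> fA' ` arcs G1'"
        proof
          fix x assume "x \<in> arcs G2'"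
          then obtain a where "a \<in> arcs G2" "L2 a = Some x" using q2 unfolding edge_quotient_def by blast
          moreover from this have "a \<in> fA ` arcs G1" using A by (simp add: bij_betw_def)
          ultimately obtain e where e: "e \<in> arcs G1" "L2 (fA e) = Some x" by blast
          then obtain d where d: "L1 e = Some d" using L[OF e(1)] by auto
          then have "d \<in> arcs G1'" using q1 e(1) by (auto simp: edge_quotient_def)
          then show "x \<in> fA' ` arcs G1'" using fA'[OF e(1) d] e(2) by auto
        qed
      qed
    qed
    show "\<gamma>' (Vertex v) = Vertex (fV' v)" if "v \<in> verts G1'" for v using fV'(2) V1 that by (metis imageE)
    fix d assume "d \<in> arcs G1'"
    then obtain e where e: "e \<in> arcs G1" "L1 e = Some d" using S1 by blast
    have e2: "fA e \<in> arcs G2" "L2 (fA e) = Some (fA' d)" using A e fA' by (auto simp: bij_betw_def)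
    have t1: "tail G1' d = cV1 (tail G1 e)" "head G1' d = cV1 (head G1 e)" using q1 e by (auto simp: edge_quotient_def)
    have t2: "tail G2' (fA' d) = cV2 (tail G2 (fA e))" "head G2' (fA' d) = cV2 (head G2 (fA e))" using q2 e2 by (auto simp: edge_quotient_def)
    have vs: "tail G1 e \<in> verts G1" "head G1 e \<in> verts G1" using wf e by (auto simp: wf_digraph_def)
    have "{tail G2' (fA' d), head G2' (fA' d)} = cV2 ` {tail G2 (fA e), head G2 (fA e)}" using t2 by simp
    also have "\<dots> = {cV2 (fV (tail G1 e)), cV2 (fV (head G1 e))}" using ends[OF e(1)] by simp
    also have "\<dots> = fV' ` {tail G1' d, head G1' d}" using t1 fV'(1) vs by simp
    finally show "{tail G2' (fA' d), head G2' (fA' d)} = fV' ` {tail G1' d, head G1' d}" .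
    have I1: "c1 ` open_edge e = open_edge d" using q1 e by (auto simp: edge_quotient_def open_edge_def image_image intro!: image_cong)
    have I2: "c2 ` open_edge (fA e) = open_edge (fA' d)" using q2 e2 by (auto simp: edge_quotient_def open_edge_def image_image intro!: image_cong)
    have "\<gamma>' ` open_edge d = (\<lambda>x. \<gamma>' (c1 x)) ` open_edge e" by (simp flip: I1 add: image_image)
    also have "\<dots> = (\<lambda>x. c2 (\<gamma> x)) ` open_edge e"
      using c open_edge_subset_gpoints[OF e(1)] by (intro image_cong) auto
    also have "\<dots> = open_edge (fA' d)" using I2 oe[OF e(1)] by (simp flip: image_image)
    finally show "\<gamma>' ` open_edge d = open_edge (fA' d)" .
  qed
  with c fA' that show ?thesis by blast
qed

subsection \<open>Collapsing an edge which is not a loop\<close>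

context
  fixes G :: "('v, 'e) pre_digraph" and G' :: "('v, 'd) pre_digraph" and c L e0 a b
  assumes q: "edge_quotient G G' c (id(b := a)) L" and wf: "wf_digraph G" and wf': "wf_digraph G'"
    and e0: "e0 \<in> arcs G" "tail G e0 = a" "head G e0 = b" and ab: "a \<noteq> b"
    and L: "\<And>e. e \<in> arcs G \<Longrightarrow> L e = None \<longleftrightarrow> e = e0"
begin

lemma collapse_edge_cases:
  assumes "x \<in> gpoints G"
  obtains (collapsed) "x \<in> {Vertex a, Vertex b} \<union> open_edge e0" "c x = Vertex a"
  | (vertex) v where "x = Vertex v" "v \<in> verts G" "v \<noteq> a" "v \<noteq> b" "c x = Vertex v"
  | (inner) e d t where "x = Inner e t" "e \<in> arcs G" "e \<noteq> e0" "L e = Some d" "0 < t" "t < 1" "c x = Inner d t" "d \<in> arcs G'"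
  using assms
proof (cases rule: gpoints_cases)
  case v: (vertex v)
  then have "c x = Vertex ((id(b := a)) v)" using q by (auto simp: edge_quotient_def)
  then show ?thesis using v collapsed vertex[of v] by (auto split: if_splits)
next
  case i: (inner e t)
  show ?thesis
  proof (cases "e = e0")
    case True
    then have "c x = Vertex a" using i q L[of e] e0 ab by (auto simp: edge_quotient_def)
    then show ?thesis using i True collapsed by (auto simp: open_edge_def)
  next
    case False
    then obtain d where d: "L e = Some d" using L i by blast
    then have "d \<in> arcs G'" "c x = Inner d t" using q i by (auto simp: edge_quotient_def)
    then show ?thesis using i False d inner by blast
  qed
qed

lemma collapse_edge_fibres:
  assumes "x \<in> gpoints G" "y \<in> gpoints G"
  shows "c x = c y \<longleftrightarrow> x = y \<or> x \<in> {Vertex a, Vertex b} \<union> open_edge e0 \<and> y \<in> {Vertex a, Vertex b} \<union> open_edge e0"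
proof -
  have inj: "e = e'" if "e \<in> arcs G" "e' \<in> arcs G" "L e = Some d" "L e' = Some d" for e e' d
    using q that unfolding edge_quotient_def by (metis option.distinct(1))
  show ?thesis
    using assms(1)
  proof (cases rule: collapse_edge_cases)
    case x: collapsed
    from assms(2) show ?thesis by (cases rule: collapse_edge_cases) (use x ab in \<open>auto simp: open_edge_def\<close>)
  next
    case x: (vertex v)
    from assms(2) show ?thesis by (cases rule: collapse_edge_cases) (use x ab in \<open>auto simp: open_edge_def\<close>)
  next
    case x: (inner e d t)
    from assms(2) show ?thesis
      by (cases rule: collapse_edge_cases) (use x ab inj in \<open>auto simp: open_edge_def\<close>)
  qed
qed

text \<open>The parameter of an edge is extended to the interval from -1 to 2 by continuing along the
  collapsed edge.\<close>

definition extended_edge :: "'e \<Rightarrow> real \<Rightarrow> ('v, 'e) gpoint" where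
  "extended_edge d x = (if x \<le> 0 then (if tail G d = b then edge_path G e0 (1 + x) else Vertex (tail G d))
     else if x \<le> 1 then edge_path G d x
     else (if head G d = b then edge_path G e0 (2 - x) else Vertex (head G d)))"

text \<open>The vertex \<open>b\<close> travels along \<open>e0\<close> to \<open>a\<close> and
  drags the ends of all edges at \<open>b\<close> with it. The parameter
  \<open>t + s * (2 * t - 1)\<close> passes from \<open>t\<close> to \<open>3 * t - 1\<close>, which
  covers the extended interval from -1 to 2.\<close>

fun slide :: "real \<times> ('v, 'e) gpoint \<Rightarrow> ('v, 'e) gpoint" where
  "slide (s, Vertex v) = (if v = b then edge_path G e0 (1 - s) else Vertex v)"
| "slide (s, Inner d t) = (if d = e0 then edge_path G e0 ((1 - s) * t) else extended_edge d (t + s * (2 * t - 1)))"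

lemma continuous_extended_edge:
  assumes d: "d \<in> arcs G"
  shows "continuous_map (top_of_set {-1..2}) (realization G) (extended_edge d)"
proof -
  note E0 = pathin_edge_path[OF wf e0(1), unfolded pathin_def]
  have vs: "tail G d \<in> verts G" "head G d \<in> verts G" using d wf by (auto simp: wf_digraph_def)
  let ?I = "top_of_set {-1..2::real}"
  let ?A = "\<lambda>x. if tail G d = b then edge_path G e0 (1 + x) else Vertex (tail G d)"
  let ?C = "\<lambda>x. if head G d = b then edge_path G e0 (2 - x) else Vertex (head G d)"
  have A: "continuous_map (top_of_set {-1..0}) (realization G) ?A"
  proof (cases "tail G d = b")
    case True
    have "continuous_map (top_of_set {-1..0}) (realization G) (\<lambda>x. edge_path G e0 (1 + x))"
      by (rule continuous_map_top_of_set_compose[OF E0]) (auto intro!: continuous_intros)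
    then show ?thesis using True by simp
  qed (use vs wf in simp)
  have B: "continuous_map (top_of_set {0..1}) (realization G) (edge_path G d)"
    using pathin_edge_path[OF wf d] by (simp add: pathin_def)
  have C: "continuous_map (top_of_set {1..2}) (realization G) ?C"
  proof (cases "head G d = b")
    case True
    have "continuous_map (top_of_set {1..2}) (realization G) (\<lambda>x. edge_path G e0 (2 - x))"
      by (rule continuous_map_top_of_set_compose[OF E0]) (auto intro!: continuous_intros)
    then show ?thesis using True by simp
  qed (use vs wf in simp)
  have BC: "continuous_map (top_of_set {0..2}) (realization G) (\<lambda>x. if x \<le> 1 then edge_path G d x else ?C x)"
  proof (rule continuous_map_cases_le)
    have "{0..2} \<inter> {x \<in> topspace (top_of_set {0..2}). x \<le> (1::real)} = {0..1}" by auto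
    then show "continuous_map (subtopology (top_of_set {0..2}) {x \<in> topspace (top_of_set {0..2}). x \<le> 1}) (realization G) (edge_path G d)"
      using B by (simp add: subtopology_subtopology)
    have "{0..2} \<inter> {x \<in> topspace (top_of_set {0..2}). (1::real) \<le> x} = {1..2}" by auto
    then show "continuous_map (subtopology (top_of_set {0..2}) {x \<in> topspace (top_of_set {0..2}). 1 \<le> x}) (realization G) ?C"
      using C by (simp only: subtopology_subtopology)
    show "edge_path G d x = ?C x" if "x = 1" for x using that e0 by simp
  qed auto
  have "continuous_map ?I (realization G) (\<lambda>x. if x \<le> 0 then ?A x else (\<lambda>x. if x \<le> 1 then edge_path G d x else ?C x) x)"
  proof (rule continuous_map_cases_le)
    have "{-1..2} \<inter> {x \<in> topspace ?I. x \<le> (0::real)} = {-1..0}" by auto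
    then show "continuous_map (subtopology ?I {x \<in> topspace ?I. x \<le> 0}) (realization G) ?A"
      using A by (simp only: subtopology_subtopology)
    have "{-1..2} \<inter> {x \<in> topspace ?I. (0::real) \<le> x} = {0..2}" by auto
    then show "continuous_map (subtopology ?I {x \<in> topspace ?I. 0 \<le> x}) (realization G) (\<lambda>x. if x \<le> 1 then edge_path G d x else ?C x)"
      using BC by (simp only: subtopology_subtopology)
    show "?A x = (if x \<le> 1 then edge_path G d x else ?C x)" if "x = 0" for x using that e0 by simp
  qed auto
  then show ?thesis unfolding extended_edge_def[abs_def] by simp
qed

lemma slide_edge_path:
  assumes d: "d \<in> arcs G" and t: "0 \<le> t" "t \<le> 1" and s: "0 \<le> s" "s \<le> 1"
  shows "slide (s, edge_path G d t) = (if d = e0 then edge_path G e0 ((1 - s) * t) else extended_edge d (t + s * (2 * t - 1)))"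
proof -
  consider "t = 0" | "t = 1" | "0 < t" "t < 1" using t by linarith
  then show ?thesis
  proof cases
    case 1
    then show ?thesis using e0 ab s by (auto simp: extended_edge_def)
  next
    case 2
    then show ?thesis using e0 ab s by (auto simp: extended_edge_def)
  next
    case 3
    then show ?thesis by (simp add: edge_path_inner)
  qed
qed

lemma homotopic_slide:
  "homotopic_with (\<lambda>_. True) (realization G) (realization G) id (\<lambda>x. slide (1, x))"
proof (rule homotopic_realizationI[OF wf])
  note E0 = pathin_edge_path[OF wf e0(1), unfolded pathin_def]
  show "pathin (realization G) (\<lambda>s. slide (s, Vertex v))" if "v \<in> verts G" for v
  proof (cases "v = b")
    case True
    have "continuous_map (top_of_set {0..1}) (realization G) (\<lambda>s. edge_path G e0 (1 - s))"
      by (rule continuous_map_top_of_set_compose[OF E0]) (auto intro!: continuous_intros)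
    then show ?thesis using True by (simp add: pathin_def)
  qed (use that wf in simp)
  fix d assume d: "d \<in> arcs G"
  show "continuous_map (top_of_set unit_square) (realization G) (\<lambda>x. slide (fst x, edge_path G d (snd x)))"
  proof (cases "d = e0")
    case True
    have "continuous_map (top_of_set unit_square) (realization G) (\<lambda>x. edge_path G e0 ((1 - fst x) * snd x))"
      by (rule continuous_map_top_of_set_compose[OF E0]) (auto intro!: continuous_intros mult_le_one)
    then show ?thesis
      by (rule continuous_map_eq) (use True d in \<open>auto simp: slide_edge_path simp del: slide.simps\<close>)
  next
    case False
    have "continuous_map (top_of_set unit_square) (realization G) (\<lambda>x. extended_edge d (snd x + fst x * (2 * snd x - 1)))"
    proof (rule continuous_map_top_of_set_compose[OF continuous_extended_edge[OF d]])
      fix x :: "real \<times> real" assume "x \<in> unit_square"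
      then obtain s t where x: "x = (s, t)" "0 \<le> s" "s \<le> 1" "0 \<le> t" "t \<le> 1" by (cases x) auto
      then have "\<bar>s * (2 * t - 1)\<bar> \<le> 1" by (auto simp: abs_mult intro!: mult_le_one)
      then show "snd x + fst x * (2 * snd x - 1) \<in> {-1..2}" using x by (auto simp: abs_le_iff)
    qed (intro continuous_intros)
    then show ?thesis
      by (rule continuous_map_eq) (use False d in \<open>auto simp: slide_edge_path simp del: slide.simps\<close>)
  qed
next
  fix x assume "x \<in> gpoints G"
  then show "slide (0, x) = id x"
    by (cases rule: gpoints_cases) (auto simp: e0 extended_edge_def edge_path_inner)
qed simp

text \<open>The stretches at both ends of an extended edge run along \<open>e0\<close> or rest at a
  vertex, and \<open>c\<close> sends them to a vertex. What remains is the parameter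
  \<open>3 * t - 1\<close> on the edge, that is, \<open>collapse\<close>.\<close>

lemma collapse_slide:
  assumes "x \<in> gpoints G"
  shows "c (slide (1, x)) = collapse G' (c x)"
  using assms
proof (cases rule: gpoints_cases)
  case (vertex v)
  have "a \<in> verts G" using e0 wf by (auto simp: wf_digraph_def)
  then have "c (Vertex (if v = b then a else v)) = Vertex ((id(b := a)) v)" using vertex q ab by (auto simp: edge_quotient_def)
  moreover have "c x = Vertex ((id(b := a)) v)" using vertex q by (auto simp: edge_quotient_def)
  ultimately show ?thesis using vertex e0 by (auto simp: collapse_def)
next
  case (inner e t)
  have vab: "a \<in> verts G" "b \<in> verts G" using e0 wf by (auto simp: wf_digraph_def)
  have ca: "c (Vertex a) = Vertex a" using q vab ab by (auto simp: edge_quotient_def)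
  show ?thesis
  proof (cases "e = e0")
    case True
    have "c (Inner e0 t) = Vertex a" using True inner q L[of e0] e0 ab by (auto simp: edge_quotient_def)
    then show ?thesis using True inner ca e0 by (simp add: collapse_def)
  next
    case False
    then obtain d where d: "L e = Some d" using L inner by blast
    then have d': "c x = Inner d t" "tail G' d = (id(b := a)) (tail G e)" "head G' d = (id(b := a)) (head G e)"
      using q inner by (auto simp: edge_quotient_def)
    note ep = edge_quotient_edge_path[OF q wf]
    have vs: "tail G e \<in> verts G" "head G e \<in> verts G" using inner wf by (auto simp: wf_digraph_def)
    have cv: "c (Vertex v) = Vertex ((id(b := a)) v)" if "v \<in> verts G" for v using q that by (auto simp: edge_quotient_def)
    have ce0: "c (edge_path G e0 u) = Vertex a" for u using ep(2)[OF e0(1)] L[OF e0(1)] e0 ab by simp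
    have "c (extended_edge e u) = edge_path G' d u" for u
    proof -
      consider "u \<le> 0" | "0 < u" "u \<le> 1" | "1 < u" by linarith
      then show ?thesis
      proof cases
        case 1
        then have "edge_path G' d u = Vertex (tail G' d)" by (simp add: edge_path_def)
        then show ?thesis using 1 ce0 cv[OF vs(1)] d' by (simp add: extended_edge_def)
      next
        case 2
        then show ?thesis using ep(1)[OF inner(1) d] by (simp add: extended_edge_def)
      next
        case 3
        then have "edge_path G' d u = Vertex (head G' d)" by (simp add: edge_path_def)
        then show ?thesis using 3 ce0 cv[OF vs(2)] d' by (simp add: extended_edge_def)
      qed
    qed
    moreover have "collapse G' (c x) = edge_path G' d (3 * t - 1)"
      using collapse_edge_path[of t G' d] inner d' by (simp add: edge_path_inner)
    ultimately show ?thesis using inner False by (simp add: algebra_simps)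
  qed
qed

text \<open>The end of the slide is constant on the collapsed edge, so it factors as
  \<open>k \<circ> c\<close>. One composite is the end of the slide, the other is
  \<open>collapse\<close>, and both are homotopic to the identity.\<close>

theorem homotopy_equivalence_collapse_edge:
  "homotopy_equivalence (realization G) (realization G') c"
proof -
  note qm = edge_quotient_quotient_map[OF q wf wf']
  note cont = quotient_imp_continuous_map[OF qm]
  let ?D = "\<lambda>x. slide (1, x)"
  have D: "continuous_map (realization G) (realization G) ?D"
    using homotopic_with_imp_continuous_maps[OF homotopic_slide] by simp
  have Dc: "?D x = Vertex a" if "x \<in> {Vertex a, Vertex b} \<union> open_edge e0" for x
  proof -
    consider "x = Vertex a" | "x = Vertex b" | t where "x = Inner e0 t" using \<open>x \<in> _\<close> by (auto simp: open_edge_def)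
    then show ?thesis using ab e0 by cases simp_all
  qed
  have "?D x = ?D y" if "x \<in> topspace (realization G)" "y \<in> topspace (realization G)" "c x = c y" for x y
    using collapse_edge_fibres[of x y] that wf Dc[of x] Dc[of y] by (metis topspace_realization)
  then obtain k where k: "continuous_map (realization G') (realization G) k"
    "\<And>x. x \<in> topspace (realization G) \<Longrightarrow> k (c x) = ?D x"
    using quotient_map_lift_exists[OF qm D] by metis
  have "homotopic_with (\<lambda>_. True) (realization G) (realization G) (k \<circ> c) id"
    by (rule homotopic_with_eq_on[OF homotopic_with_symD[OF homotopic_slide]]) (use k in auto)
  moreover have "homotopic_with (\<lambda>_. True) (realization G') (realization G') (c \<circ> k) id"
  proof (rule homotopic_with_eq_on[OF homotopic_with_symD[OF homotopic_collapse[OF wf']]])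
    fix y assume "y \<in> topspace (realization G')"
    then have "y \<in> gpoints G'" using wf' by simp
    then obtain x where x: "x \<in> gpoints G" "y = c x" using edge_quotient_surj[OF q] by metis
    then show "(c \<circ> k) y = collapse G' y" using k(2)[of x] collapse_slide[OF x(1)] wf by simp
  qed simp
  ultimately show ?thesis unfolding homotopy_equivalence_def using cont k(1) by blast
qed

end

section \<open>Contraction of an edge of a weighted graph\<close>

text \<open>A contracted loop gets the old weight of its vertex, the first free number, as its
  index, and the virtual loops of the head are numbered after those of the tail. \<open>None\<close>
  marks the edge that becomes a point.\<close>

fun contract_label :: "nat \<Rightarrow> wgraph \<Rightarrow> nat + nat \<times> nat \<Rightarrow> (nat + nat \<times> nat) option" where
  "contract_label e Y (Inl d) = (if d \<noteq> e then Some (Inl d)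
     else if tail (fst Y) e = head (fst Y) e then Some (Inr (tail (fst Y) e, snd Y (tail (fst Y) e))) else None)"
| "contract_label e Y (Inr (v, i)) = (if tail (fst Y) e \<noteq> head (fst Y) e \<and> v = head (fst Y) e
     then Some (Inr (tail (fst Y) e, snd Y (tail (fst Y) e) + i)) else Some (Inr (v, i)))"

abbreviation contract_vertex :: "nat \<Rightarrow> wgraph \<Rightarrow> nat \<Rightarrow> nat" where
  "contract_vertex e Y \<equiv> id(head (fst Y) e := tail (fst Y) e)"

lemma contract_edge_loop:
  assumes "tail (fst Y) e = head (fst Y) e"
  shows "verts (fst (contract_edge e Y)) = verts (fst Y)"
    "arcs (fst (contract_edge e Y)) = arcs (fst Y) - {e}"
    "tail (fst (contract_edge e Y)) = tail (fst Y)"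
    "head (fst (contract_edge e Y)) = head (fst Y)"
    "snd (contract_edge e Y) = (snd Y)(tail (fst Y) e := snd Y (tail (fst Y) e) + 1)"
  using assms by (auto simp: contract_edge_def Let_def)

lemma contract_edge_nonloop:
  assumes "tail (fst Y) e \<noteq> head (fst Y) e"
  shows "verts (fst (contract_edge e Y)) = verts (fst Y) - {head (fst Y) e}"
    "arcs (fst (contract_edge e Y)) = arcs (fst Y) - {e}"
    "tail (fst (contract_edge e Y)) = contract_vertex e Y \<circ> tail (fst Y)"
    "head (fst (contract_edge e Y)) = contract_vertex e Y \<circ> head (fst Y)"
    "snd (contract_edge e Y) = (snd Y)(tail (fst Y) e := snd Y (tail (fst Y) e) + snd Y (head (fst Y) e))"
  using assms by (auto simp: contract_edge_def Let_def)

lemma arcs_contract_edge [simp]: "arcs (fst (contract_edge e Y)) = arcs (fst Y) - {e}"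
  using contract_edge_loop[of Y e] contract_edge_nonloop[of Y e] by blast

lemma wf_contract_edge:
  assumes "wf_digraph (fst Y)" "e \<in> arcs (fst Y)"
  shows "wf_digraph (fst (contract_edge e Y))"
  using assms
  by (cases "tail (fst Y) e = head (fst Y) e")
     (auto simp: wf_digraph_def contract_edge_loop contract_edge_nonloop)

lemma edge_quotient_contract:
  assumes wf: "wf_digraph (fst Y)" and e: "e \<in> arcs (fst Y)"
  shows "edge_quotient (with_virtual_loops Y) (with_virtual_loops (contract_edge e Y)) (contract_map e Y)
     (contract_vertex e Y) (contract_label e Y)"
proof -
  let ?G = "with_virtual_loops Y" and ?G' = "with_virtual_loops (contract_edge e Y)"
  let ?a = "tail (fst Y) e" and ?b = "head (fst Y) e" and ?L = "contract_label e Y"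
  have vab: "?a \<in> verts (fst Y)" "?b \<in> verts (fst Y)" using wf e by (auto simp: wf_digraph_def)
  have 1: "contract_map e Y (Vertex v) = Vertex (contract_vertex e Y v)" for v by simp
  have 2: "contract_vertex e Y ` verts ?G = verts ?G'"
  proof (cases "?a = ?b")
    case True
    then have "contract_vertex e Y = id" by auto
    then show ?thesis using True by (simp add: contract_edge_loop)
  next
    case False
    then show ?thesis using vab by (auto simp: contract_edge_nonloop image_iff)
  qed
  have 3: "d \<in> arcs ?G' \<and> (\<forall>t. 0 < t \<and> t < 1 \<longrightarrow> contract_map e Y (Inner x t) = Inner d t) \<and>
        tail ?G' d = contract_vertex e Y (tail ?G x) \<and> head ?G' d = contract_vertex e Y (head ?G x)"
    if "x \<in> arcs ?G" "?L x = Some d" for x d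
    using that(1)
  proof (cases rule: arcs_with_virtual_loops_cases)
    case (real y)
    then show ?thesis using that(2) vab
      by (cases "?a = ?b"; cases "y = e") (auto simp: contract_edge_loop contract_edge_nonloop)
  next
    case (virtual v i)
    then show ?thesis using that(2) vab
      by (cases "?a = ?b"; cases "v = ?b") (auto simp: contract_edge_loop contract_edge_nonloop)
  qed
  have 4: "contract_vertex e Y (head ?G x) = contract_vertex e Y (tail ?G x) \<and>
        (\<forall>t. 0 < t \<and> t < 1 \<longrightarrow> contract_map e Y (Inner x t) = Vertex (contract_vertex e Y (tail ?G x)))"
    if "x \<in> arcs ?G" "?L x = None" for x
    using that(1)
  proof (cases rule: arcs_with_virtual_loops_cases)
    case (real y)
    then show ?thesis using that(2) by (auto split: if_splits)
  next
    case (virtual v i)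
    then show ?thesis using that(2) by (auto split: if_splits)
  qed
  have 5: "\<exists>x\<in>arcs ?G. ?L x = Some d" if "d \<in> arcs ?G'" for d
    using that
  proof (cases rule: arcs_with_virtual_loops_cases)
    case (real y)
    then show ?thesis by (intro bexI[of _ "Inl y"]) auto
  next
    case (virtual v i)
    show ?thesis
    proof (cases "?a = ?b")
      case True
      show ?thesis
      proof (cases "v = ?a \<and> i = snd Y ?a")
        case T: True
        then show ?thesis using virtual True e by (intro bexI[of _ "Inl e"]) auto
      next
        case False
        then show ?thesis using virtual True
          by (intro bexI[of _ "Inr (v, i)"]) (auto simp: contract_edge_loop split: if_splits)
      qed
    next
      case False
      \<comment> \<open>Indices from the old weight of \<open>?a\<close> on belong to the loops that
        came from \<open>?b\<close>.\<close>
      show ?thesis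
      proof (cases "v = ?a \<and> i \<ge> snd Y ?a")
        case T: True
        then show ?thesis using virtual False vab
          by (intro bexI[of _ "Inr (?b, i - snd Y ?a)"]) (auto simp: contract_edge_nonloop)
      next
        case F: False
        then show ?thesis using virtual False
          by (intro bexI[of _ "Inr (v, i)"]) (auto simp: contract_edge_nonloop split: if_splits)
      qed
    qed
  qed
  have 6: "x = y" if "x \<in> arcs ?G" "y \<in> arcs ?G" "?L x = ?L y" "?L x \<noteq> None" for x y
    using that(1)
  proof (cases rule: arcs_with_virtual_loops_cases)
    case x: (real d)
    from that(2) show ?thesis
      by (cases rule: arcs_with_virtual_loops_cases) (use x that(3,4) in \<open>auto split: if_splits\<close>)
  next
    case x: (virtual v i)
    from that(2) show ?thesis
      by (cases rule: arcs_with_virtual_loops_cases) (use x that(3,4) in \<open>auto split: if_splits\<close>)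
  qed
  show ?thesis
    unfolding edge_quotient_def
    apply (intro conjI)
    subgoal using 1 by simp
    subgoal using 2 .
    subgoal using 3 by simp
    subgoal using 4 by simp
    subgoal using 5 by simp
    subgoal using 6 by simp
    done
qed

definition collapsed_part :: "nat \<Rightarrow> wgraph \<Rightarrow> (nat, nat + nat \<times> nat) gpoint set" where
  "collapsed_part e Y = (if tail (fst Y) e = head (fst Y) e then {}
     else {Vertex (tail (fst Y) e), Vertex (head (fst Y) e)} \<union> open_edge (Inl e))"

lemma contract_label_None:
  "contract_label e Y x = None \<longleftrightarrow> x = Inl e \<and> tail (fst Y) e \<noteq> head (fst Y) e"
  by (cases "(e, Y, x)" rule: contract_label.cases) auto

text \<open>For a contracted loop no label is \<open>None\<close> and the map is injective;
  otherwise the closed edge is the only fibre with more than one point.\<close>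

lemma contract_map_fibres:
  assumes wf: "wf_digraph (fst Y)" and e: "e \<in> arcs (fst Y)"
    and xy: "x \<in> gpoints (with_virtual_loops Y)" "y \<in> gpoints (with_virtual_loops Y)"
  shows "contract_map e Y x = contract_map e Y y \<longleftrightarrow> x = y \<or> x \<in> collapsed_part e Y \<and> y \<in> collapsed_part e Y"
proof (cases "tail (fst Y) e = head (fst Y) e")
  case False
  note q = edge_quotient_contract[OF wf e]
  show ?thesis
    using collapse_edge_fibres[OF q wf_with_virtual_loops[OF wf] wf_with_virtual_loops[OF wf_contract_edge[OF wf e]] _ _ _ False _ xy, of "Inl e"]
      False e by (simp add: collapsed_part_def contract_label_None)
next
  case True
  note q = edge_quotient_contract[OF wf e]
  have cV: "contract_vertex e Y = id" using True by auto
  have "x = y" if eq: "contract_map e Y x = contract_map e Y y"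
    using xy(1)
  proof (cases rule: gpoints_cases)
    case x: (vertex v)
    from xy(2) show ?thesis
    proof (cases rule: gpoints_cases)
      case (vertex u)
      then show ?thesis using x eq True by (auto split: if_splits)
    next
      case (inner d t)
      then obtain d' where "contract_map e Y y = Inner d' t"
        using q contract_label_None[of e Y d] True unfolding edge_quotient_def by (metis not_Some_eq)
      then show ?thesis using x eq by auto
    qed
  next
    case x: (inner d t)
    then obtain d' where d': "contract_label e Y d = Some d'" "contract_map e Y x = Inner d' t"
      using q contract_label_None[of e Y d] True unfolding edge_quotient_def by (metis not_Some_eq)
    from xy(2) show ?thesis
    proof (cases rule: gpoints_cases)
      case (vertex u)
      then show ?thesis using d' eq by auto
    next
      case (inner f s)
      then obtain f' where f': "contract_label e Y f = Some f'" "contract_map e Y y = Inner f' s"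
        using q contract_label_None[of e Y f] True unfolding edge_quotient_def by (metis not_Some_eq)
      then have "f' = d'" "s = t" using d' eq by auto
      moreover from this have "f = d" using q d'(1) f'(1) x(1) inner(1) unfolding edge_quotient_def by (metis option.distinct(1))
      ultimately show ?thesis using x inner by simp
    qed
  qed
  then show ?thesis using True by (auto simp: collapsed_part_def)
qed

lemma virtual_map_contract:
  assumes wf: "wf_digraph (fst Y)" and e: "e \<in> arcs (fst Y)"
  shows "virtual_map Y (contract_edge e Y) (contract_map e Y)"
  unfolding virtual_map_def
proof (intro conjI ballI)
  note q = edge_quotient_contract[OF wf e]
  show "continuous_map (vrealization Y) (vrealization (contract_edge e Y)) (contract_map e Y)"
    using edge_quotient_continuous[OF q] wf wf_contract_edge[OF wf e] by simp
  fix u assume u: "u \<in> verts (fst Y)"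
  have vab: "tail (fst Y) e \<in> verts (fst Y)" "head (fst Y) e \<in> verts (fst Y)" using wf e by (auto simp: wf_digraph_def)
  let ?u = "contract_vertex e Y u"
  have "contract_map e Y ` virtual_part Y u \<subseteq> virtual_part (contract_edge e Y) ?u"
  proof
    fix x assume "x \<in> contract_map e Y ` virtual_part Y u"
    then consider "x = Vertex ?u" | i t where "i < snd Y u" "0 < t" "t < 1" "x = contract_map e Y (Inner (Inr (u, i)) t)"
      by (auto simp: virtual_part_def open_edge_def)
    then show "x \<in> virtual_part (contract_edge e Y) ?u"
    proof cases
      case 1
      then show ?thesis by (simp add: virtual_part_def)
    next
      case 2
      have "\<exists>j. x = Inner (Inr (?u, j)) t \<and> j < snd (contract_edge e Y) ?u"
      proof (cases "tail (fst Y) e = head (fst Y) e")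
        case True
        then show ?thesis using 2 by (auto simp: contract_edge_loop)
      next
        case False
        then show ?thesis using 2 by (cases "u = head (fst Y) e") (auto simp: contract_edge_nonloop Let_def)
      qed
      then obtain j where j: "x = Inner (Inr (?u, j)) t" "j < snd (contract_edge e Y) ?u" by blast
      have "x \<in> open_edge (Inr (?u, j))" unfolding open_edge_def j(1) using 2 by (intro imageI) simp
      then show ?thesis using j(2) unfolding virtual_part_def by blast
    qed
  qed
  moreover have "?u \<in> verts (fst (contract_edge e Y))"
    using u vab by (cases "tail (fst Y) e = head (fst Y) e") (auto simp: contract_edge_loop contract_edge_nonloop)
  ultimately show "\<exists>u'\<in>verts (fst (contract_edge e Y)). contract_map e Y (Vertex u) = Vertex u' \<and>
      contract_map e Y ` virtual_part Y u \<subseteq> virtual_part (contract_edge e Y) u'"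
    by (intro bexI[of _ ?u]) auto
qed

text \<open>A contracted loop merely changes its name into a virtual loop, which is a homeomorphism;
  any other edge is collapsed.\<close>

theorem homotopy_equivalence_contract:
  assumes wf: "wf_digraph (fst Y)" and e: "e \<in> arcs (fst Y)"
  shows "homotopy_equivalence (vrealization Y) (vrealization (contract_edge e Y)) (contract_map e Y)"
proof -
  note q = edge_quotient_contract[OF wf e]
  note W = wf_with_virtual_loops[OF wf] wf_with_virtual_loops[OF wf_contract_edge[OF wf e]]
  show ?thesis
  proof (cases "tail (fst Y) e = head (fst Y) e")
    case True
    have "inj_on (contract_map e Y) (topspace (vrealization Y))"
      using contract_map_fibres[OF wf e] True W by (auto simp: inj_on_def collapsed_part_def)
    then have "homeomorphic_map (vrealization Y) (vrealization (contract_edge e Y)) (contract_map e Y)"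
      using edge_quotient_quotient_map[OF q W] by (simp add: homeomorphic_map_def)
    then show ?thesis using homeomorphic_map_maps homotopy_equivalence_homeomorphic by blast
  next
    case False
    show ?thesis
      using homotopy_equivalence_collapse_edge[OF q W _ _ _ False, of "Inl e"] False e by (simp add: contract_label_None)
  qed
qed

lemma well_marked_contract:
  assumes X: "well_marked g X" and e: "e \<in> arcs (fst (fst X))"
  shows "well_marked g (contract_marked e X)"
  using X homotopy_equivalence_compose[OF _ homotopy_equivalence_contract[OF _ e]] wf_contract_edge[OF _ e]
  by (auto simp: well_marked_def contract_marked_def is_marking_def)

text \<open>The isomorphism takes contracted edge to contracted edge and loops to loops, hence
  collapsed part to collapsed part, and so it descends to the quotients. That the markings still
  match comes from \<open>virtual_map_contract\<close>.\<close>

theorem marked_iso_contract: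
  assumes X: "well_marked g X" "well_marked g X'" and iso: "marked_iso g X X' fE" and e: "e \<in> arcs (fst (fst X))"
  shows "marked_iso g (contract_marked e X) (contract_marked (fE e) X') fE"
proof -
  let ?Y = "fst X" and ?Y' = "fst X'" and ?e = "fE e"
  obtain \<gamma> where \<gamma>: "virtual_iso ?Y ?Y' fE \<gamma>" "loose_equiv g ?Y' (\<gamma> \<circ> snd X) (snd X')"
    using iso marked_iso_loose X by blast
  obtain fV fA where fA:
    "complex_iso (with_virtual_loops ?Y) (with_virtual_loops ?Y') fV fA \<gamma>"
     "\<forall>e\<in>arcs (fst ?Y). fA (Inl e) = Inl (fE e)"
     "\<forall>l. Inr l \<in> arcs (with_virtual_loops ?Y) \<longrightarrow> fA (Inr l) \<in> range Inr"
    using \<gamma>(1) unfolding virtual_iso_def by blast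
  have wf: "wf_digraph (fst ?Y)" "wf_digraph (fst ?Y')" using X by (auto simp: well_marked_def)
  note W = wf_with_virtual_loops[OF wf(1)] wf_with_virtual_loops[OF wf_contract_edge[OF wf(1) e]]
  have B: "bij_betw fE (arcs (fst ?Y)) (arcs (fst ?Y'))" by (rule virtual_iso_bij[OF \<gamma>(1)])
  then have e': "?e \<in> arcs (fst ?Y')" using e by (auto simp: bij_betw_def)
  note W' = wf_with_virtual_loops[OF wf(2)] wf_with_virtual_loops[OF wf_contract_edge[OF wf(2) e']]
  have V: "bij_betw fV (verts (fst ?Y)) (verts (fst ?Y'))" and A: "bij_betw fA (arcs (with_virtual_loops ?Y)) (arcs (with_virtual_loops ?Y'))"
    and ends': "\<forall>x\<in>arcs (with_virtual_loops ?Y). {tail (with_virtual_loops ?Y') (fA x), head (with_virtual_loops ?Y') (fA x)} =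
        fV ` {tail (with_virtual_loops ?Y) x, head (with_virtual_loops ?Y) x}"
    and vv: "\<And>v. v \<in> verts (fst ?Y) \<Longrightarrow> \<gamma> (Vertex v) = Vertex (fV v)"
    and oe': "\<forall>x\<in>arcs (with_virtual_loops ?Y). \<gamma> ` open_edge x = open_edge (fA x)"
    using fA(1) by (simp_all add: complex_iso_def graph_iso_def)
  have Ie: "Inl e \<in> arcs (with_virtual_loops ?Y)" "fA (Inl e) = Inl ?e" using e fA(2) by simp_all
  have ends: "{tail (fst ?Y') ?e, head (fst ?Y') ?e} = fV ` {tail (fst ?Y) e, head (fst ?Y) e}"
    using bspec[OF ends' Ie(1)] Ie(2) by simp
  have oe: "\<gamma> ` open_edge (Inl e) = open_edge (Inl ?e)"
    using bspec[OF oe' Ie(1)] Ie(2) by simp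
  have vs: "tail (fst ?Y) e \<in> verts (fst ?Y)" "head (fst ?Y) e \<in> verts (fst ?Y)" using wf e by (auto simp: wf_digraph_def)
  have loop: "tail (fst ?Y) e = head (fst ?Y) e \<longleftrightarrow> tail (fst ?Y') ?e = head (fst ?Y') ?e"
    using ends V vs by (auto simp: bij_betw_def inj_on_def doubleton_eq_iff)
  have Lab: "contract_label e ?Y x = None \<longleftrightarrow> contract_label ?e ?Y' (fA x) = None" if x: "x \<in> arcs (with_virtual_loops ?Y)" for x
  proof -
    have "x = Inl e \<longleftrightarrow> fA x = Inl ?e"
      using fA(2) A x e bij_betw_imp_inj_on[OF A] by (metis inj_onD with_virtual_loops_simps(2))
    then show ?thesis using loop by (simp add: contract_label_None)
  qed
  have inj: "inj_on \<gamma> (gpoints (with_virtual_loops ?Y))"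
    using virtual_iso_homeomorphic[OF \<gamma>(1)] W by (simp add: homeomorphic_map_def)
  have Kim: "\<gamma> ` collapsed_part e ?Y = collapsed_part ?e ?Y'"
  proof (cases "tail (fst ?Y) e = head (fst ?Y) e")
    case False
    have "\<gamma> ` {Vertex (tail (fst ?Y) e), Vertex (head (fst ?Y) e)} = Vertex ` fV ` {tail (fst ?Y) e, head (fst ?Y) e}"
      using vv vs by simp
    also have "\<dots> = Vertex ` {tail (fst ?Y') ?e, head (fst ?Y') ?e}" by (simp only: ends)
    also have "\<dots> = {Vertex (tail (fst ?Y') ?e), Vertex (head (fst ?Y') ?e)}" by simp
    finally have "\<gamma> ` {Vertex (tail (fst ?Y) e), Vertex (head (fst ?Y) e)} = {Vertex (tail (fst ?Y') ?e), Vertex (head (fst ?Y') ?e)}" .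
    then show ?thesis using False loop oe by (simp only: collapsed_part_def image_Un if_False)
  qed (use loop in \<open>simp add: collapsed_part_def\<close>)
  have Ksub: "collapsed_part e ?Y \<subseteq> gpoints (with_virtual_loops ?Y)"
    using vs e open_edge_subset_gpoints[of "Inl e" "with_virtual_loops ?Y"] by (auto simp: collapsed_part_def)
  have K: "x \<in> collapsed_part e ?Y \<longleftrightarrow> \<gamma> x \<in> collapsed_part ?e ?Y'" if "x \<in> gpoints (with_virtual_loops ?Y)" for x
    using inj_on_image_mem_iff[OF inj that Ksub] Kim by simp
  obtain fV' fA' \<gamma>' where \<gamma>': "complex_iso (with_virtual_loops (contract_edge e ?Y)) (with_virtual_loops (contract_edge ?e ?Y')) fV' fA' \<gamma>'"
    "\<And>x. x \<in> gpoints (with_virtual_loops ?Y) \<Longrightarrow> \<gamma>' (contract_map e ?Y x) = contract_map ?e ?Y' (\<gamma> x)"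
    "\<And>x d. x \<in> arcs (with_virtual_loops ?Y) \<Longrightarrow> contract_label e ?Y x = Some d \<Longrightarrow> contract_label ?e ?Y' (fA x) = Some (fA' d)"
    using complex_iso_descends[OF edge_quotient_contract[OF wf(1) e] edge_quotient_contract[OF wf(2) e'] W W' fA(1) Lab
      contract_map_fibres[OF wf(1) e] contract_map_fibres[OF wf(2) e'] K] by blast
  have "fA' (Inl d) = Inl (fE d)" if d: "d \<in> arcs (fst ?Y) - {e}" for d
  proof -
    have "fE d \<noteq> ?e" using B d e by (auto simp: bij_betw_def inj_on_def)
    then show ?thesis using \<gamma>'(3)[of "Inl d" "Inl d"] d fA(2) by auto
  qed
  \<comment> \<open>A virtual loop downstairs is an old virtual loop or the contracted loop, and the
    image of either is virtual downstairs.\<close>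
  moreover have "fA' (Inr l) \<in> range Inr" if l: "Inr l \<in> arcs (with_virtual_loops (contract_edge e ?Y))" for l
  proof -
    obtain x where x: "x \<in> arcs (with_virtual_loops ?Y)" "contract_label e ?Y x = Some (Inr l)"
      using edge_quotient_contract[OF wf(1) e] l unfolding edge_quotient_def by blast
    have r: "contract_label ?e ?Y' (Inr m) \<in> Some ` range Inr" for m by (cases m) auto
    from x(1) have "contract_label ?e ?Y' (fA x) \<in> Some ` range Inr"
    proof (cases rule: arcs_with_virtual_loops_cases)
      case (real d)
      then have "d = e" "tail (fst ?Y) e = head (fst ?Y) e" using x(2) by (auto split: if_splits)
      then show ?thesis using real fA(2) loop by auto
    next
      case (virtual v i)
      then obtain m where "fA x = Inr m" using fA(3) x(1) by blast
      then show ?thesis using r by simp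
    qed
    then show ?thesis using \<gamma>'(3)[OF x] by auto
  qed
  ultimately have vi: "virtual_iso (contract_edge e ?Y) (contract_edge ?e ?Y') fE \<gamma>'"
    unfolding virtual_iso_def using \<gamma>'(1) by (intro exI[of _ fV'] exI[of _ fA']) auto
  have "loose_equiv g (contract_edge ?e ?Y') (contract_map ?e ?Y' \<circ> (\<gamma> \<circ> snd X)) (contract_map ?e ?Y' \<circ> snd X')"
    using loose_equiv_map[OF wf(2) wf_contract_edge[OF wf(2) e'] \<gamma>(2) virtual_map_contract[OF wf(2) e']] .
  moreover have "loose_equiv g (contract_edge ?e ?Y') (\<gamma>' \<circ> (contract_map e ?Y \<circ> snd X)) (contract_map ?e ?Y' \<circ> (\<gamma> \<circ> snd X))"
  proof (rule loose_equiv_homotopic[OF homotopic_with_symD[OF homotopic_with_equal]])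
    show "continuous_map (rose_space g) (vrealization (contract_edge ?e ?Y')) (contract_map ?e ?Y' \<circ> (\<gamma> \<circ> snd X))"
      using loose_equiv_continuous(1)[OF calculation] .
    show "(contract_map ?e ?Y' \<circ> (\<gamma> \<circ> snd X)) x = (\<gamma>' \<circ> (contract_map e ?Y \<circ> snd X)) x" if "x \<in> topspace (rose_space g)" for x
      using \<gamma>'(2)[of "snd X x"] that continuous_map_funspace[OF marking_continuous[of g ?Y "snd X"]] X W
      by (auto simp: well_marked_def Pi_iff)
  qed auto
  ultimately have "loose_equiv g (contract_edge ?e ?Y') (\<gamma>' \<circ> (contract_map e ?Y \<circ> snd X)) (contract_map ?e ?Y' \<circ> snd X')"
    using loose_equiv_trans[OF wf_contract_edge[OF wf(2) e']] by blast
  then show ?thesis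
    using marked_iso_loose[OF well_marked_contract[OF X(1) e] well_marked_contract[OF X(2) e']] vi
    by (auto simp: contract_marked_def)
qed

section \<open>Successive contractions\<close>

lemma fst_fold_contract_marked: "fst (fold contract_marked es X) = fold contract_edge es (fst X)"
  by (induction es arbitrary: X) (auto simp: contract_marked_def)

lemma arcs_fold_contract_edge: "arcs (fst (fold contract_edge es Y)) = arcs (fst Y) - set es"
  by (induction es arbitrary: Y) auto

lemma wf_fold_contract_edge:
  "wf_digraph (fst Y) \<Longrightarrow> distinct es \<Longrightarrow> set es \<subseteq> arcs (fst Y) \<Longrightarrow> wf_digraph (fst (fold contract_edge es Y))"
proof (induction es arbitrary: Y)
  case (Cons e es)
  then have "wf_digraph (fst (contract_edge e Y))" "set es \<subseteq> arcs (fst (contract_edge e Y))" by (auto simp: wf_contract_edge)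
  then show ?case using Cons.IH[of "contract_edge e Y"] Cons.prems by simp
qed simp

lemma well_marked_fold_contract:
  "well_marked g X \<Longrightarrow> distinct es \<Longrightarrow> set es \<subseteq> arcs (fst (fst X)) \<Longrightarrow> well_marked g (fold contract_marked es X)"
proof (induction es arbitrary: X)
  case (Cons e es)
  then have "well_marked g (contract_marked e X)" by (simp add: well_marked_contract)
  moreover have "arcs (fst (fst (contract_marked e X))) = arcs (fst (fst X)) - {e}" by (simp add: contract_marked_def)
  ultimately show ?case using Cons.IH[of "contract_marked e X"] Cons.prems by auto
qed simp

theorem marked_iso_fold_contract:
  assumes "well_marked g X" "well_marked g X'" "marked_iso g X X' fE" "distinct es" "set es \<subseteq> arcs (fst (fst X))"
  shows "marked_iso g (fold contract_marked es X) (fold contract_marked (map fE es) X') fE"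
  using assms
proof (induction es arbitrary: X X')
  case (Cons e es)
  have "bij_betw fE (arcs (fst (fst X))) (arcs (fst (fst X')))"
    using Cons.prems(3) virtual_iso_bij unfolding marked_iso_iff by blast
  then have "fE e \<in> arcs (fst (fst X'))" using Cons.prems by (auto simp: bij_betw_def)
  moreover have "arcs (fst (fst (contract_marked e X))) = arcs (fst (fst X)) - {e}" by (simp add: contract_marked_def)
  ultimately have "marked_iso g (fold contract_marked es (contract_marked e X))
      (fold contract_marked (map fE es) (contract_marked (fE e) X')) fE"
    using Cons.prems by (intro Cons.IH marked_iso_contract well_marked_contract) auto
  then show ?case by simp
qed simp

text \<open>Contraction composes with the marking on the left and a map of the rose on the right, so
  the two operations commute exactly, not just up to equivalence.\<close>

lemma fold_contract_marked_precompose: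
  "fold contract_marked es (Y, h \<circ> f) = (fst (fold contract_marked es (Y, h)), snd (fold contract_marked es (Y, h)) \<circ> f)"
proof (induction es arbitrary: Y h)
  case (Cons e es)
  have "contract_marked e (Y, h \<circ> f) = (contract_edge e Y, (contract_map e Y \<circ> h) \<circ> f)"
    "contract_marked e (Y, h) = (contract_edge e Y, contract_map e Y \<circ> h)"
    by (simp_all add: contract_marked_def comp_assoc)
  then show ?case using Cons.IH[of "contract_edge e Y" "contract_map e Y \<circ> h"] by (simp only: fold_simps)
qed simp

section \<open>Existence of markings\<close>

definition graph_links :: "('v, 'e) pre_digraph \<Rightarrow> ('v \<times> 'v) set" where
  "graph_links G = (\<Union>e\<in>arcs G. {(tail G e, head G e), (head G e, tail G e)})"

text \<open>Induction on the number of vertices. Contracting an edge that is not a loop preserves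
  genus and connectedness, and a marking of the contraction is pulled back by a homotopy inverse.
  With loops only, the graph with its virtual loops is a rose with \<open>g\<close> petals.\<close>

lemma marking_exists_aux:
  assumes "fin_digraph (fst Y)" "verts (fst Y) \<noteq> {}"
    and "\<And>u v. u \<in> verts (fst Y) \<Longrightarrow> v \<in> verts (fst Y) \<Longrightarrow> (u, v) \<in> (graph_links (fst Y))\<^sup>*"
    and "graph_genus (fst Y) + int (\<Sum>v\<in>verts (fst Y). snd Y v) = int g"
  shows "\<exists>h. is_marking g Y h"
  using assms
proof (induction "card (verts (fst Y))" arbitrary: Y rule: less_induct)
  case less
  let ?G = "fst Y" and ?w = "snd Y"
  have fin: "finite (verts ?G)" "finite (arcs ?G)" and wf: "wf_digraph ?G"
    using less.prems(1) by (auto simp: fin_digraph_def fin_digraph_axioms_def)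
  show ?case
  proof (cases "\<exists>e\<in>arcs ?G. tail ?G e \<noteq> head ?G e")
    case False
    have "(u, v) \<in> (graph_links ?G)\<^sup>* \<Longrightarrow> u = v" for u v
      by (induction rule: rtrancl_induct) (use False in \<open>auto simp: graph_links_def\<close>)
    then obtain v where v: "verts ?G = {v}" using less.prems(2,3) by blast
    have g: "card (arcs ?G) + ?w v = g" using less.prems(4) v by (simp add: graph_genus_def)
    have va: "arcs (with_virtual_loops Y) = Inl ` arcs ?G \<union> (\<lambda>i. Inr (v, i)) ` {..<?w v}"
      using v by (auto simp: with_virtual_loops_def)
    have "card (arcs (with_virtual_loops Y)) = card (Inl ` arcs ?G :: (nat + nat \<times> nat) set) + card ((\<lambda>i. Inr (v, i)) ` {..<?w v} :: (nat + nat \<times> nat) set)"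
      unfolding va using fin by (intro card_Un_disjoint) auto
    also have "\<dots> = g" using g by (simp add: card_image inj_on_def)
    finally have "card (arcs (with_virtual_loops Y)) = g" .
    moreover have "finite (arcs (with_virtual_loops Y))" unfolding va using fin by auto
    ultimately obtain f where f: "bij_betw f {0..<g} (arcs (with_virtual_loops Y))" using ex_bij_betw_nat_finite by blast
    have "tail (with_virtual_loops Y) x = v \<and> head (with_virtual_loops Y) x = v" if "x \<in> arcs (with_virtual_loops Y)" for x
      using wf_with_virtual_loops[OF wf] that v by (auto simp: wf_digraph_def)
    moreover have "f i \<in> arcs (with_virtual_loops Y)" if "i < g" for i using f that by (auto simp: bij_betw_def)
    ultimately have "graph_iso (rose g) (with_virtual_loops Y) (\<lambda>_. v) f"
      using f v by (simp add: graph_iso_def bij_betw_def[of _ UNIV] lessThan_atLeast0 inj_on_def)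
    then obtain \<gamma> where "complex_iso (rose g) (with_virtual_loops Y) (\<lambda>_. v) f \<gamma>"
      using graph_iso_complex_iso wf by (metis wf_digraph_rose wf_with_virtual_loops)
    then have "homeomorphic_map (rose_space g) (vrealization Y) \<gamma>" by (simp add: complex_iso_def)
    then show ?thesis using homeomorphic_map_maps homotopy_equivalence_homeomorphic by (metis is_marking_def)
  next
    case True
    then obtain e where e: "e \<in> arcs ?G" "tail ?G e \<noteq> head ?G e" by blast
    let ?a = "tail ?G e" and ?b = "head ?G e" and ?Y = "contract_edge e Y"
    note C = contract_edge_nonloop[OF e(2)]
    have vab: "?a \<in> verts ?G" "?b \<in> verts ?G" using wf e by (auto simp: wf_digraph_def)
    have "\<exists>h. is_marking g ?Y h"
    proof (rule less.hyps)
      show "card (verts (fst ?Y)) < card (verts ?G)" unfolding C using fin vab by (intro psubset_card_mono) auto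
      show "fin_digraph (fst ?Y)"
        using wf_contract_edge[OF wf e(1)] fin C by (simp add: fin_digraph_def fin_digraph_axioms_def)
      show "verts (fst ?Y) \<noteq> {}" using vab e C by auto
      show "(u, v) \<in> (graph_links (fst ?Y))\<^sup>*" if uv: "u \<in> verts (fst ?Y)" "v \<in> verts (fst ?Y)" for u v
      proof -
        \<comment> \<open>Links survive the contraction as links between the images of their ends,
          except that the contracted edge degenerates to an equality.\<close>
        have link: "(contract_vertex e Y x, contract_vertex e Y y) \<in> (graph_links (fst ?Y))\<^sup>*" if "(x, y) \<in> graph_links ?G" for x y
        proof -
          obtain d where d: "d \<in> arcs ?G" "(x, y) = (tail ?G d, head ?G d) \<or> (x, y) = (head ?G d, tail ?G d)"
            using \<open>(x, y) \<in> graph_links ?G\<close> by (auto simp: graph_links_def)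
          show ?thesis
          proof (cases "d = e")
            case True
            then have "contract_vertex e Y x = contract_vertex e Y y" using d e by auto
            then show ?thesis by simp
          next
            case False
            then have "(contract_vertex e Y x, contract_vertex e Y y) \<in> graph_links (fst ?Y)"
              using d unfolding graph_links_def C by auto
            then show ?thesis by blast
          qed
        qed
        have "(contract_vertex e Y x, contract_vertex e Y y) \<in> (graph_links (fst ?Y))\<^sup>*"
          if "(x, y) \<in> (graph_links ?G)\<^sup>*" for x y
          using that
        proof (induction rule: rtrancl_induct)
          case (step y z)
          from step.IH link[OF step.hyps(2)] show ?case by (rule rtrancl_trans)
        qed (rule rtrancl_refl)
        from this[OF less.prems(3)[of u v]] have "(contract_vertex e Y u, contract_vertex e Y v) \<in> (graph_links (fst ?Y))\<^sup>*"
          using uv C(1) by simp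
        moreover have "contract_vertex e Y u = u" "contract_vertex e Y v = v" using uv C(1) by auto
        ultimately show ?thesis by metis
      qed
      have "(\<Sum>v\<in>verts (fst ?Y). snd ?Y v) = (\<Sum>v\<in>verts ?G. ?w v)"
      proof -
        have "(\<Sum>v\<in>verts (fst ?Y). snd ?Y v) = snd ?Y ?a + (\<Sum>v\<in>verts ?G - {?b} - {?a}. snd ?Y v)"
          unfolding C(1) using fin vab e by (intro sum.remove) auto
        also have "(\<Sum>v\<in>verts ?G - {?b} - {?a}. snd ?Y v) = (\<Sum>v\<in>verts ?G - {?b} - {?a}. ?w v)"
          unfolding C by (intro sum.cong) auto
        also have "snd ?Y ?a = ?w ?b + ?w ?a" unfolding C by simp
        also have "?w ?b + ?w ?a + (\<Sum>v\<in>verts ?G - {?b} - {?a}. ?w v) = ?w ?b + (\<Sum>v\<in>verts ?G - {?b}. ?w v)"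
          using fin vab e by (subst sum.remove[of "verts ?G - {?b}" ?a]) auto
        also have "\<dots> = (\<Sum>v\<in>verts ?G. ?w v)"
          using fin vab by (subst sum.remove[of "verts ?G" ?b]) auto
        finally show ?thesis .
      qed
      moreover have "graph_genus (fst ?Y) = graph_genus ?G"
      proof -
        have "card (verts ?G) > 0" "card (arcs ?G) > 0" using fin vab e by (auto simp: card_gt_0_iff)
        then show ?thesis unfolding graph_genus_def C using fin vab e by simp
      qed
      ultimately show "graph_genus (fst ?Y) + int (\<Sum>v\<in>verts (fst ?Y). snd ?Y v) = int g"
        using less.prems(4) by simp
    qed
    then obtain h where h: "is_marking g ?Y h" by blast
    obtain k where k: "continuous_map (vrealization ?Y) (vrealization Y) k"
      "homotopic_with (\<lambda>_. True) (vrealization Y) (vrealization Y) (k \<circ> contract_map e Y) id"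
      "homotopic_with (\<lambda>_. True) (vrealization ?Y) (vrealization ?Y) (contract_map e Y \<circ> k) id"
      and "continuous_map (vrealization Y) (vrealization ?Y) (contract_map e Y)"
      using homotopy_equivalence_contract[OF wf e(1)] unfolding homotopy_equivalence_def by blast
    then have "homotopy_equivalence (vrealization ?Y) (vrealization Y) k" unfolding homotopy_equivalence_def by blast
    then show ?thesis using h homotopy_equivalence_compose is_marking_def by blast
  qed
qed

theorem marking_exists:
  assumes "Y \<in> stable_wgraphs g"
  shows "\<exists>h. is_marking g Y h"
proof -
  have fin: "fin_digraph (fst Y)" and con: "Digraph_Component.connected (fst Y)"
    and gen: "graph_genus (fst Y) + int (\<Sum>v\<in>verts (fst Y). snd Y v) = int g"
    using assms by (auto simp: stable_wgraphs_def)
  have "verts (fst Y) \<noteq> {}" using con by (auto simp: Digraph_Component.connected_def strongly_connected_def)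
  moreover have "(u, v) \<in> (graph_links (fst Y))\<^sup>*" if uv: "u \<in> verts (fst Y)" "v \<in> verts (fst Y)" for u v
  proof -
    have "(u, v) \<in> rtrancl_on (verts (fst Y)) (parcs (mk_symmetric (fst Y)))"
      using con uv by (auto simp: Digraph_Component.connected_def strongly_connected_def reachable_def)
    then show ?thesis
      by (induction rule: rtrancl_on_induct) (auto simp: graph_links_def parcs_mk_symmetric intro: rtrancl_into_rtrancl)
  qed
  ultimately show ?thesis using marking_exists_aux fin gen by blast
qed

section \<open>Maps of stacky fans\<close>

definition cell_space :: "'i stacky_fan \<Rightarrow> 'i \<Rightarrow> (nat \<Rightarrow> real) topology" where
  "cell_space X i = subtopology (powertop_real (coords X i)) (cell_cone X i)"

definition finite_fan :: "'i stacky_fan \<Rightarrow> bool" where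
  "finite_fan X \<longleftrightarrow> (\<forall>i\<in>cells X. finite (coords X i) \<and> cell_cone X i \<subseteq> coords X i \<rightarrow>\<^sub>E UNIV)"

lemma topspace_cell_space [simp]:
  "finite_fan X \<Longrightarrow> i \<in> cells X \<Longrightarrow> topspace (cell_space X i) = cell_cone X i"
  by (auto simp: cell_space_def finite_fan_def)

lemma fan_space_eq: "fan_space X = quotient_space (sum_topology (cell_space X) (cells X)) (glue X)"
  by (simp add: fan_space_def cell_space_def[abs_def])

lemma topspace_sum_cells:
  "finite_fan X \<Longrightarrow> topspace (sum_topology (cell_space X) (cells X)) = cone_points X"
  by (auto simp: cone_points_def)

lemma topspace_quotient_space: "topspace (quotient_space T r) = topspace T // r"
proof
  show "topspace (quotient_space T r) \<subseteq> topspace T // r"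
    using openin_topspace[of "quotient_space T r"] unfolding openin_quotient_space by blast
  have "{x \<in> topspace T. r `` {x} \<in> topspace T // r} = topspace T" by (auto simp: quotient_def)
  then have "openin (quotient_space T r) (topspace T // r)" by (simp add: openin_quotient_space)
  then show "topspace T // r \<subseteq> topspace (quotient_space T r)" by (rule openin_subset)
qed

lemma quotient_map_quotient_space: "quotient_map T (quotient_space T r) (\<lambda>x. r `` {x})"
  unfolding quotient_map_def topspace_quotient_space
  by (auto simp: openin_quotient_space quotient_def)

lemma topspace_fan_space: "finite_fan X \<Longrightarrow> topspace (fan_space X) = cone_points X // glue X"
  by (simp only: fan_space_eq topspace_quotient_space topspace_sum_cells)

lemma equiv_glue: "equiv (cone_points X) (glue X)"
proof (rule equivI)
  show "refl_on (cone_points X) (glue X)" by (auto simp: refl_on_def glue_def)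
  have "sym ((glue_step X \<union> (glue_step X)\<inverse>)\<^sup>*)" by (rule sym_rtrancl) (auto simp: sym_def)
  then show "sym (glue X)" by (auto simp: glue_def sym_def)
  show "trans (glue X)" by (auto simp: glue_def trans_def)
qed (auto simp: glue_def)

lemma glue_class_eq:
  "(p, q) \<in> glue X \<Longrightarrow> glue X `` {p} = glue X `` {q}"
  by (rule equiv_class_eq[OF equiv_glue])

lemma glue_trans: "(p, q) \<in> glue X \<Longrightarrow> (q, r) \<in> glue X \<Longrightarrow> (p, r) \<in> glue X"
  using equiv_glue[of X] unfolding equiv_def trans_def by blast

lemma glue_refl: "p \<in> cone_points X \<Longrightarrow> (p, p) \<in> glue X"
  by (auto simp: glue_def)

lemma glue_step_subset: "glue_step X \<subseteq> glue X"
  by (auto simp: glue_def glue_step_def)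

text \<open>Reduces every question of well-definedness on a fan to the generating steps.\<close>

lemma glue_induct:
  assumes pq: "(p, q) \<in> glue X" and step: "\<And>p q. (p, q) \<in> glue_step X \<Longrightarrow> F p = F q"
  shows "F p = F q"
proof -
  have "(p, q) \<in> (glue_step X \<union> (glue_step X)\<inverse>)\<^sup>*" using pq by (simp add: glue_def)
  then show ?thesis
  proof (induction rule: rtrancl_induct)
    case (step y z)
    then show ?case using assms(2)[of y z] assms(2)[of z y] by auto
  qed simp
qed

lemma fan_space_cases:
  assumes "finite_fan X" "p \<in> topspace (fan_space X)"
  obtains i x where "i \<in> cells X" "x \<in> cell_cone X i" "p = glue X `` {(i, x)}"
  using assms by (auto simp: topspace_fan_space quotient_def cone_points_def)

lemma fan_class_in_topspace:
  "finite_fan X \<Longrightarrow> i \<in> cells X \<Longrightarrow> x \<in> cell_cone X i \<Longrightarrow> glue X `` {(i, x)} \<in> topspace (fan_space X)"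
  by (auto simp: topspace_fan_space quotient_def cone_points_def)

lemma continuous_map_cell_class:
  "finite_fan X \<Longrightarrow> i \<in> cells X \<Longrightarrow> continuous_map (cell_space X i) (fan_space X) (\<lambda>x. glue X `` {(i, x)})"
  using continuous_map_compose[OF continuous_map_component_injection[of i "cells X" "cell_space X"]
      quotient_imp_continuous_map[OF quotient_map_quotient_space[of "sum_topology (cell_space X) (cells X)" "glue X"]]]
  by (simp add: o_def fan_space_eq)

text \<open>The space is a quotient of the disjoint union of the cones, so a family of maps
  compatible with the generating steps factors through it.\<close>

lemma fan_space_lift:
  assumes X: "finite_fan X"
    and F: "\<And>i. i \<in> cells X \<Longrightarrow> continuous_map (cell_space X i) Z (F i)"
    and step: "\<And>i x j y. ((i, x), (j, y)) \<in> glue_step X \<Longrightarrow> F i x = F j y"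
  obtains f where "continuous_map (fan_space X) Z f"
    "\<And>i x. i \<in> cells X \<Longrightarrow> x \<in> cell_cone X i \<Longrightarrow> f (glue X `` {(i, x)}) = F i x"
proof -
  let ?S = "sum_topology (cell_space X) (cells X)"
  have "continuous_map ?S Z (\<lambda>(i, x). F i x)"
    unfolding continuous_map_def
  proof safe
    fix i x assume "(i, x) \<in> topspace ?S"
    then show "F i x \<in> topspace Z" using continuous_map_funspace[OF F] by auto
  next
    fix U assume U: "openin Z U"
    have "{x. (i, x) \<in> {x \<in> topspace ?S. (case x of (i, x) \<Rightarrow> F i x) \<in> U}} = {x \<in> topspace (cell_space X i). F i x \<in> U}"
      if "i \<in> cells X" for i using that by auto
    then show "openin ?S {x \<in> topspace ?S. (case x of (i, x) \<Rightarrow> F i x) \<in> U}"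
      unfolding openin_sum_topology using F U by (auto simp: continuous_map_def)
  qed
  moreover have "(\<lambda>(i, x). F i x) p = (\<lambda>(i, x). F i x) q"
    if pq: "p \<in> topspace ?S" "q \<in> topspace ?S" "glue X `` {p} = glue X `` {q}" for p q
  proof -
    have "(p, q) \<in> glue X" using pq eq_equiv_class[OF pq(3) equiv_glue] topspace_sum_cells[OF X] by simp
    then show ?thesis by (rule glue_induct) (use step in auto)
  qed
  ultimately obtain f where "continuous_map (fan_space X) Z f"
     "\<And>p. p \<in> topspace ?S \<Longrightarrow> f (glue X `` {p}) = (\<lambda>(i, x). F i x) p"
    using quotient_map_lift_exists[OF quotient_map_quotient_space[of ?S "glue X"]] unfolding fan_space_eq by metis
  with that X show ?thesis by (auto simp: cone_points_def)
qed

lemma integral_linear_continuous: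
  assumes X: "finite_fan X" "i \<in> cells X" and Y: "finite_fan Y" "j \<in> cells Y"
    and L: "integral_linear (coords X i) (coords Y j) L" and cone: "L ` cell_cone X i \<subseteq> cell_cone Y j"
  shows "continuous_map (cell_space X i) (cell_space Y j) L"
proof -
  let ?A = "coords X i" and ?B = "coords Y j"
  obtain M :: "nat \<Rightarrow> nat \<Rightarrow> int" where M: "\<And>x. x \<in> ?A \<rightarrow>\<^sub>E UNIV \<Longrightarrow> L x = (\<lambda>b\<in>?B. \<Sum>a\<in>?A. of_int (M b a) * x a)"
    using L unfolding integral_linear_def by blast
  have fin: "finite ?A" using X by (auto simp: finite_fan_def)
  have "continuous_map (powertop_real ?A) (powertop_real ?B) (\<lambda>x. \<lambda>b\<in>?B. \<Sum>a\<in>?A. of_int (M b a) * x a)"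
    unfolding continuous_map_componentwise
  proof (intro conjI ballI)
    fix b assume b: "b \<in> ?B"
    have "continuous_map (powertop_real ?A) euclideanreal (\<lambda>x. \<Sum>a\<in>?A. of_int (M b a) * x a)"
      using fin by (intro continuous_map_sum continuous_map_real_mult_left continuous_map_product_projection) auto
    then show "continuous_map (powertop_real ?A) euclideanreal (\<lambda>x. (\<lambda>b\<in>?B. \<Sum>a\<in>?A. of_int (M b a) * x a) b)"
      using b by simp
  qed auto
  then have "continuous_map (powertop_real ?A) (powertop_real ?B) L"
    by (rule continuous_map_eq) (use M in simp)
  then have "continuous_map (cell_space X i) (powertop_real ?B) L"
    unfolding cell_space_def by (rule continuous_map_from_subtopology)
  then show ?thesis
    unfolding cell_space_def[of Y] continuous_map_in_subtopology using cone topspace_cell_space[OF X] by auto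
qed

text \<open>Steps of \<open>X\<close> have to become glued pairs of \<open>Y\<close>, not steps;
  this leaves room for the isomorphisms chosen on the cones.\<close>

lemma fan_morphism_lift:
  assumes X: "finite_fan X" and Y: "finite_fan Y"
    and c: "\<And>i. i \<in> cells X \<Longrightarrow> c i \<in> cells Y \<and> integral_linear (coords X i) (coords Y (c i)) (L i) \<and> L i ` cell_cone X i \<subseteq> cell_cone Y (c i)"
    and step: "\<And>i x j y. ((i, x), (j, y)) \<in> glue_step X \<Longrightarrow> ((c i, L i x), (c j, L j y)) \<in> glue Y"
  obtains f where "fan_morphism X Y f"
    "\<And>i x. i \<in> cells X \<Longrightarrow> x \<in> cell_cone X i \<Longrightarrow> f (glue X `` {(i, x)}) = glue Y `` {(c i, L i x)}"
proof -
  have "continuous_map (cell_space X i) (fan_space Y) (\<lambda>x. glue Y `` {(c i, L i x)})" if i: "i \<in> cells X" for i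
    using continuous_map_compose[OF integral_linear_continuous[OF X i Y] continuous_map_cell_class[OF Y]] c[OF i]
    by (auto simp: o_def)
  then obtain f where f: "continuous_map (fan_space X) (fan_space Y) f"
     "\<And>i x. i \<in> cells X \<Longrightarrow> x \<in> cell_cone X i \<Longrightarrow> f (glue X `` {(i, x)}) = glue Y `` {(c i, L i x)}"
  proof (rule fan_space_lift[OF X, of "fan_space Y" "\<lambda>i x. glue Y `` {(c i, L i x)}"])
    show "glue Y `` {(c i, L i x)} = glue Y `` {(c j, L j y)}" if "((i, x), (j, y)) \<in> glue_step X" for i x j y
      by (rule glue_class_eq[OF step[OF that]])
  qed blast+
  have "fan_morphism X Y f"
    unfolding fan_morphism_def using f c by blast
  with f that show ?thesis by blast
qed

section \<open>Quotients of stacky fans\<close>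

text \<open>Everything is stated for cones. The laws \<open>\<theta>_one\<close> and
  \<open>\<theta>_mult\<close> hold only up to gluing, because the maps between cones come from
  chosen isomorphisms; on points they become the laws of an action.\<close>

locale fan_action =
  fixes X :: "'i stacky_fan" and G :: "('g, 'm) monoid_scheme" and ca :: "'i \<Rightarrow> 'g \<Rightarrow> 'i"
    and \<theta> :: "'i \<Rightarrow> 'g \<Rightarrow> (nat \<Rightarrow> real) \<Rightarrow> nat \<Rightarrow> real"
  assumes group_G: "group G"
    and finite_X: "finite_fan X"
    and ca_closed: "i \<in> cells X \<Longrightarrow> \<gamma> \<in> carrier G \<Longrightarrow> ca i \<gamma> \<in> cells X"
    and ca_one: "i \<in> cells X \<Longrightarrow> ca i \<one>\<^bsub>G\<^esub> = i"
    and ca_mult: "i \<in> cells X \<Longrightarrow> \<gamma> \<in> carrier G \<Longrightarrow> \<delta> \<in> carrier G \<Longrightarrow> ca (ca i \<gamma>) \<delta> = ca i (\<gamma> \<otimes>\<^bsub>G\<^esub> \<delta>)"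
    and \<theta>_iso: "i \<in> cells X \<Longrightarrow> \<gamma> \<in> carrier G \<Longrightarrow> lattice_iso (coords X i) (coords X (ca i \<gamma>)) (\<theta> i \<gamma>)"
    and \<theta>_bij: "i \<in> cells X \<Longrightarrow> \<gamma> \<in> carrier G \<Longrightarrow> bij_betw (\<theta> i \<gamma>) (cell_cone X i) (cell_cone X (ca i \<gamma>))"
    and \<theta>_step: "\<gamma> \<in> carrier G \<Longrightarrow> ((i, x), (j, y)) \<in> glue_step X \<Longrightarrow> ((ca i \<gamma>, \<theta> i \<gamma> x), (ca j \<gamma>, \<theta> j \<gamma> y)) \<in> glue X"
    and \<theta>_one: "i \<in> cells X \<Longrightarrow> x \<in> cell_cone X i \<Longrightarrow> ((i, \<theta> i \<one>\<^bsub>G\<^esub> x), (i, x)) \<in> glue X"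
    and \<theta>_mult: "i \<in> cells X \<Longrightarrow> x \<in> cell_cone X i \<Longrightarrow> \<gamma> \<in> carrier G \<Longrightarrow> \<delta> \<in> carrier G \<Longrightarrow>
       ((ca i (\<gamma> \<otimes>\<^bsub>G\<^esub> \<delta>), \<theta> (ca i \<gamma>) \<delta> (\<theta> i \<gamma> x)), (ca i (\<gamma> \<otimes>\<^bsub>G\<^esub> \<delta>), \<theta> i (\<gamma> \<otimes>\<^bsub>G\<^esub> \<delta>) x)) \<in> glue X"
begin

abbreviation act :: "('i \<times> (nat \<Rightarrow> real)) set \<Rightarrow> 'g \<Rightarrow> ('i \<times> (nat \<Rightarrow> real)) set" where
  "act \<equiv> point_action X ca \<theta>"

lemma \<theta>_in_cone: "i \<in> cells X \<Longrightarrow> \<gamma> \<in> carrier G \<Longrightarrow> x \<in> cell_cone X i \<Longrightarrow> \<theta> i \<gamma> x \<in> cell_cone X (ca i \<gamma>)"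
  using \<theta>_bij bij_betw_apply by metis

text \<open>\<open>point_action\<close> is a union over all representatives of a point, and
  \<open>\<theta>_step\<close> makes the members of this union equal.\<close>

lemma act_class:
  assumes i: "i \<in> cells X" "x \<in> cell_cone X i" and \<gamma>: "\<gamma> \<in> carrier G"
  shows "act (glue X `` {(i, x)}) \<gamma> = glue X `` {(ca i \<gamma>, \<theta> i \<gamma> x)}"
proof -
  have *: "glue X `` {(ca j \<gamma>, \<theta> j \<gamma> y)} = glue X `` {(ca i \<gamma>, \<theta> i \<gamma> x)}" if "((i, x), (j, y)) \<in> glue X" for j y
  proof -
    have "(\<lambda>(i, x). glue X `` {(ca i \<gamma>, \<theta> i \<gamma> x)}) (i, x) = (\<lambda>(i, x). glue X `` {(ca i \<gamma>, \<theta> i \<gamma> x)}) (j, y)"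
      by (rule glue_induct[OF that]) (auto intro!: glue_class_eq \<theta>_step[OF \<gamma>])
    then show ?thesis by simp
  qed
  have "((i, x), (i, x)) \<in> glue X" using i by (auto intro!: glue_refl simp: cone_points_def)
  moreover have "act (glue X `` {(i, x)}) \<gamma> = (\<Union>p\<in>glue X `` {(i, x)}. glue X `` {(ca i \<gamma>, \<theta> i \<gamma> x)})"
    unfolding point_action_def
  proof (intro SUP_cong refl)
    fix p assume "p \<in> glue X `` {(i, x)}"
    then obtain j y where "p = (j, y)" "((i, x), (j, y)) \<in> glue X" by (cases p) auto
    then show "(case p of (j, y) \<Rightarrow> glue X `` {(ca j \<gamma>, \<theta> j \<gamma> y)}) = glue X `` {(ca i \<gamma>, \<theta> i \<gamma> x)}"
      using * by simp
  qed
  ultimately show ?thesis by auto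
qed

lemma act_in_topspace: "p \<in> topspace (fan_space X) \<Longrightarrow> \<gamma> \<in> carrier G \<Longrightarrow> act p \<gamma> \<in> topspace (fan_space X)"
  by (erule fan_space_cases[OF finite_X]) (simp add: act_class fan_class_in_topspace finite_X ca_closed \<theta>_in_cone)

lemma act_one: "p \<in> topspace (fan_space X) \<Longrightarrow> act p \<one>\<^bsub>G\<^esub> = p"
  using group.is_monoid[OF group_G] glue_class_eq[OF \<theta>_one]
  by (elim fan_space_cases[OF finite_X]) (simp add: act_class ca_one monoid.one_closed)

lemma act_mult:
  assumes "p \<in> topspace (fan_space X)" "\<gamma> \<in> carrier G" "\<delta> \<in> carrier G"
  shows "act (act p \<gamma>) \<delta> = act p (\<gamma> \<otimes>\<^bsub>G\<^esub> \<delta>)"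
proof -
  obtain i x where ix: "i \<in> cells X" "x \<in> cell_cone X i" "p = glue X `` {(i, x)}" using fan_space_cases[OF finite_X assms(1)] .
  have "\<gamma> \<otimes>\<^bsub>G\<^esub> \<delta> \<in> carrier G" using assms group.is_monoid[OF group_G] by (simp add: monoid.m_closed)
  then show ?thesis
    using ix assms glue_class_eq[OF \<theta>_mult[OF ix(1,2) assms(2,3)]]
    by (simp add: act_class ca_closed \<theta>_in_cone ca_mult)
qed

theorem admissible: "admissible_action X G ca \<theta>"
proof -
  have "continuous_map (fan_space X) (fan_space X) (\<lambda>p. act p \<gamma>)" if \<gamma>: "\<gamma> \<in> carrier G" for \<gamma>
  proof -
    obtain f where f: "fan_morphism X X f"
      "\<And>i x. i \<in> cells X \<Longrightarrow> x \<in> cell_cone X i \<Longrightarrow> f (glue X `` {(i, x)}) = glue X `` {(ca i \<gamma>, \<theta> i \<gamma> x)}"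
    proof (rule fan_morphism_lift[OF finite_X finite_X, of "\<lambda>i. ca i \<gamma>" "\<lambda>i. \<theta> i \<gamma>"])
      show "ca i \<gamma> \<in> cells X \<and> integral_linear (coords X i) (coords X (ca i \<gamma>)) (\<theta> i \<gamma>) \<and>
          \<theta> i \<gamma> ` cell_cone X i \<subseteq> cell_cone X (ca i \<gamma>)" if "i \<in> cells X" for i
        using that \<gamma> ca_closed \<theta>_iso \<theta>_in_cone by (auto simp: lattice_iso_def)
    qed (use \<theta>_step \<gamma> in blast)+
    then have "continuous_map (fan_space X) (fan_space X) f" by (simp add: fan_morphism_def)
    then show ?thesis
    proof (rule continuous_map_eq)
      fix p assume "p \<in> topspace (fan_space X)"
      then show "f p = act p \<gamma>"
        by (elim fan_space_cases[OF finite_X]) (simp add: f act_class \<gamma>)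
    qed
  qed
  then show ?thesis
    unfolding admissible_action_def
    by (intro conjI ballI)
       (simp_all add: group_G act_one act_mult ca_one ca_mult ca_closed \<theta>_iso \<theta>_bij act_class)
qed

end

text \<open>\<open>M_step_lift\<close> is the essential assumption: a generating step of
  \<open>M\<close> becomes a face map of \<open>X\<close> after acting by some group element. From
  it comes the inverse map from \<open>M\<close> to either quotient.\<close>

locale fan_projection = fan_action X G ca \<theta>
  for X :: "'i stacky_fan" and G :: "('g, 'm) monoid_scheme" and ca and \<theta> +
  fixes M :: "'j stacky_fan" and \<pi> :: "'i \<Rightarrow> 'j" and \<rho> :: "'i \<Rightarrow> (nat \<Rightarrow> real) \<Rightarrow> nat \<Rightarrow> real"
  assumes finite_M: "finite_fan M"
    and \<pi>_closed: "i \<in> cells X \<Longrightarrow> \<pi> i \<in> cells M"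
    and \<pi>_surj: "C \<in> cells M \<Longrightarrow> \<exists>i\<in>cells X. \<pi> i = C"
    and \<pi>_ca: "i \<in> cells X \<Longrightarrow> \<gamma> \<in> carrier G \<Longrightarrow> \<pi> (ca i \<gamma>) = \<pi> i"
    and \<pi>_orbit: "i \<in> cells X \<Longrightarrow> j \<in> cells X \<Longrightarrow> \<pi> i = \<pi> j \<Longrightarrow> j \<in> ca i ` carrier G"
    and \<rho>_iso: "i \<in> cells X \<Longrightarrow> lattice_iso (coords X i) (coords M (\<pi> i)) (\<rho> i)"
    and \<rho>_bij: "i \<in> cells X \<Longrightarrow> bij_betw (\<rho> i) (cell_cone X i) (cell_cone M (\<pi> i))"
    and \<rho>_step: "((i, x), (j, y)) \<in> glue_step X \<Longrightarrow> ((\<pi> i, \<rho> i x), (\<pi> j, \<rho> j y)) \<in> glue M"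
    and \<rho>_ca: "i \<in> cells X \<Longrightarrow> x \<in> cell_cone X i \<Longrightarrow> \<gamma> \<in> carrier G \<Longrightarrow>
       ((\<pi> i, \<rho> i x), (\<pi> i, \<rho> (ca i \<gamma>) (\<theta> i \<gamma> x))) \<in> glue M"
    and M_step_refl: "p \<in> cone_points M \<Longrightarrow> (p, p) \<in> glue_step M"
    and M_step_lift: "i \<in> cells X \<Longrightarrow> x \<in> cell_cone X i \<Longrightarrow> j \<in> cells X \<Longrightarrow> y \<in> cell_cone X j \<Longrightarrow>
       ((\<pi> i, \<rho> i x), (\<pi> j, \<rho> j y)) \<in> glue_step M \<Longrightarrow>
       \<exists>\<gamma>\<in>carrier G. \<exists>L\<in>face_maps X (ca i \<gamma>) j. y = L (\<theta> i \<gamma> x)"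
begin

text \<open>The inverse is taken from the lattice isomorphism, so that it is again integral and may
  serve in a morphism of fans.\<close>

definition \<rho>' :: "'i \<Rightarrow> (nat \<Rightarrow> real) \<Rightarrow> nat \<Rightarrow> real" where
  "\<rho>' i = (SOME L. integral_linear (coords M (\<pi> i)) (coords X i) L \<and>
     (\<forall>x \<in> coords X i \<rightarrow>\<^sub>E UNIV. L (\<rho> i x) = x) \<and> (\<forall>y \<in> coords M (\<pi> i) \<rightarrow>\<^sub>E UNIV. \<rho> i (L y) = y))"

lemma \<rho>'_props:
  assumes i: "i \<in> cells X"
  shows "integral_linear (coords M (\<pi> i)) (coords X i) (\<rho>' i)"
    "\<And>x. x \<in> cell_cone X i \<Longrightarrow> \<rho>' i (\<rho> i x) = x"
    "\<And>u. u \<in> cell_cone M (\<pi> i) \<Longrightarrow> \<rho> i (\<rho>' i u) = u"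
    "\<And>u. u \<in> cell_cone M (\<pi> i) \<Longrightarrow> \<rho>' i u \<in> cell_cone X i"
proof -
  have *: "integral_linear (coords M (\<pi> i)) (coords X i) (\<rho>' i) \<and>
     (\<forall>x \<in> coords X i \<rightarrow>\<^sub>E UNIV. \<rho>' i (\<rho> i x) = x) \<and> (\<forall>y \<in> coords M (\<pi> i) \<rightarrow>\<^sub>E UNIV. \<rho> i (\<rho>' i y) = y)"
  proof -
    have "\<exists>L. integral_linear (coords M (\<pi> i)) (coords X i) L \<and>
     (\<forall>x \<in> coords X i \<rightarrow>\<^sub>E UNIV. L (\<rho> i x) = x) \<and> (\<forall>y \<in> coords M (\<pi> i) \<rightarrow>\<^sub>E UNIV. \<rho> i (L y) = y)"
      using \<rho>_iso[OF i] unfolding lattice_iso_def by blast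
    from someI_ex[OF this] show ?thesis unfolding \<rho>'_def .
  qed
  have sub: "cell_cone X i \<subseteq> coords X i \<rightarrow>\<^sub>E UNIV" "cell_cone M (\<pi> i) \<subseteq> coords M (\<pi> i) \<rightarrow>\<^sub>E UNIV"
    using finite_X finite_M i \<pi>_closed by (auto simp: finite_fan_def)
  show "integral_linear (coords M (\<pi> i)) (coords X i) (\<rho>' i)"
    "\<And>x. x \<in> cell_cone X i \<Longrightarrow> \<rho>' i (\<rho> i x) = x" "\<And>u. u \<in> cell_cone M (\<pi> i) \<Longrightarrow> \<rho> i (\<rho>' i u) = u"
    using * sub by blast+
  then show "\<rho>' i u \<in> cell_cone X i" if u: "u \<in> cell_cone M (\<pi> i)" for u
    using \<rho>_bij[OF i] u unfolding bij_betw_def by (metis imageE)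
qed

lemma \<rho>_props:
  assumes i: "i \<in> cells X"
  shows "\<pi> i \<in> cells M \<and> integral_linear (coords X i) (coords M (\<pi> i)) (\<rho> i) \<and> \<rho> i ` cell_cone X i \<subseteq> cell_cone M (\<pi> i)"
  using \<rho>_iso[OF i] \<rho>_bij[OF i] \<pi>_closed[OF i] by (auto simp: lattice_iso_def bij_betw_def)

context
  fixes proj
  assumes proj: "\<And>i x q. i \<in> cells X \<Longrightarrow> x \<in> cell_cone X i \<Longrightarrow> proj (i, x) q \<Longrightarrow> ((\<pi> i, \<rho> i x), q) \<in> glue M"
begin

text \<open>Both maps are glued from cones: \<open>\<rho>\<close> on the representatives in one
  direction, and in the other its inverse on the unique representative above each cell of
  \<open>M\<close>.\<close>

theorem stratified: "is_stratified_quotient M X G ca \<theta> proj"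
  unfolding is_stratified_quotient_def
proof (intro conjI allI impI admissible)
  fix R assume R: "orbit_representatives X G ca R"
  let ?Q = "stratified_quotient X G ca \<theta> R"
  have Q: "cells ?Q = R" "coords ?Q = coords X" "cell_cone ?Q = cell_cone X"
    "face_maps ?Q i j = {L \<circ> \<theta> i \<gamma> |L \<gamma>. \<gamma> \<in> carrier G \<and> L \<in> face_maps X (ca i \<gamma>) j}" for i j
    by (auto simp: stratified_quotient_def)
  have RX: "R \<subseteq> cells X" and R1: "\<And>i. i \<in> cells X \<Longrightarrow> \<exists>!r. r \<in> R \<and> r \<in> ca i ` carrier G"
    using R by (auto simp: orbit_representatives_def)
  have finQ: "finite_fan ?Q" using finite_X RX by (auto simp: finite_fan_def Q)
  have one: "\<one>\<^bsub>G\<^esub> \<in> carrier G" using group.is_monoid[OF group_G] by (simp add: monoid.one_closed)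
  define r where "r C = (SOME i. i \<in> R \<and> \<pi> i = C)" for C
  have r: "r C \<in> R" "\<pi> (r C) = C" if C: "C \<in> cells M" for C
  proof -
    obtain i where i: "i \<in> cells X" "\<pi> i = C" using \<pi>_surj[OF C] by blast
    then obtain j where "j \<in> R" "j \<in> ca i ` carrier G" using R1 by blast
    then have "\<exists>i. i \<in> R \<and> \<pi> i = C" using i \<pi>_ca by auto
    from someI_ex[OF this] show "r C \<in> R" "\<pi> (r C) = C" by (auto simp: r_def)
  qed
  \<comment> \<open>Both \<open>i\<close> and the chosen index lie in the orbit of \<open>i\<close>,
    and \<open>R\<close> meets an orbit only once.\<close>
  have r\<pi>: "r (\<pi> i) = i" if i: "i \<in> R" for i
  proof -
    have iX: "i \<in> cells X" using i RX by blast
    note rr = r[OF \<pi>_closed[OF iX]]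
    have "r (\<pi> i) \<in> ca i ` carrier G" by (rule \<pi>_orbit[OF iX subsetD[OF RX rr(1)] rr(2)[symmetric]])
    moreover have "i \<in> ca i ` carrier G" by (rule image_eqI[OF _ one]) (simp add: ca_one[OF iX])
    ultimately show ?thesis using R1[OF iX] rr i by blast
  qed
  obtain \<phi> where \<phi>: "fan_morphism ?Q M \<phi>"
    "\<And>i x. i \<in> R \<Longrightarrow> x \<in> cell_cone X i \<Longrightarrow> \<phi> (glue ?Q `` {(i, x)}) = glue M `` {(\<pi> i, \<rho> i x)}"
  proof (rule fan_morphism_lift[OF finQ finite_M, of \<pi> \<rho>])
    show "\<pi> i \<in> cells M \<and> integral_linear (coords ?Q i) (coords M (\<pi> i)) (\<rho> i) \<and> \<rho> i ` cell_cone ?Q i \<subseteq> cell_cone M (\<pi> i)"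
      if "i \<in> cells ?Q" for i using \<rho>_props[of i] that RX by (auto simp: Q)
    fix i x j y assume "((i, x), (j, y)) \<in> glue_step ?Q"
    then obtain L \<gamma> where L: "i \<in> R" "x \<in> cell_cone X i" "j \<in> R" "y \<in> cell_cone X j" "\<gamma> \<in> carrier G"
      "L \<in> face_maps X (ca i \<gamma>) j" "y = L (\<theta> i \<gamma> x)"
      by (auto simp: glue_step_def cone_points_def Q)
    then have iX: "i \<in> cells X" "j \<in> cells X" using RX by auto
    \<comment> \<open>A face map of the stratified quotient is the action followed by a face map of
      \<open>X\<close>; \<open>\<rho>_ca\<close> deals with the first factor and
      \<open>\<rho>_step\<close> with the second.\<close>
    have "((ca i \<gamma>, \<theta> i \<gamma> x), (j, y)) \<in> glue_step X"
      using L iX \<theta>_in_cone ca_closed by (auto simp: glue_step_def cone_points_def)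
    from \<rho>_step[OF this] have "((\<pi> i, \<rho> (ca i \<gamma>) (\<theta> i \<gamma> x)), (\<pi> j, \<rho> j y)) \<in> glue M"
      using \<pi>_ca iX L by simp
    with \<rho>_ca[OF iX(1) L(2,5)] show "((\<pi> i, \<rho> i x), (\<pi> j, \<rho> j y)) \<in> glue M" by (rule glue_trans)
  next
    fix f assume "fan_morphism ?Q M f" "\<And>i x. i \<in> cells ?Q \<Longrightarrow> x \<in> cell_cone ?Q i \<Longrightarrow> f (glue ?Q `` {(i, x)}) = glue M `` {(\<pi> i, \<rho> i x)}"
    then show thesis by (intro that[of f]) (simp_all add: Q)
  qed
  obtain \<psi> where \<psi>: "fan_morphism M ?Q \<psi>"
    "\<And>C u. C \<in> cells M \<Longrightarrow> u \<in> cell_cone M C \<Longrightarrow> \<psi> (glue M `` {(C, u)}) = glue ?Q `` {(r C, \<rho>' (r C) u)}"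
  proof (rule fan_morphism_lift[OF finite_M finQ, of r "\<lambda>C. \<rho>' (r C)"])
    show "r C \<in> cells ?Q \<and> integral_linear (coords M C) (coords ?Q (r C)) (\<rho>' (r C)) \<and> \<rho>' (r C) ` cell_cone M C \<subseteq> cell_cone ?Q (r C)"
      if "C \<in> cells M" for C
      using r[OF that] \<rho>'_props[of "r C"] RX by (auto simp: Q)
    fix C u D v assume st: "((C, u), (D, v)) \<in> glue_step M"
    then have C: "C \<in> cells M" "D \<in> cells M" "u \<in> cell_cone M C" "v \<in> cell_cone M D" by (auto simp: glue_step_def cone_points_def)
    let ?x = "\<rho>' (r C) u" and ?y = "\<rho>' (r D) v"
    have rX: "r C \<in> cells X" "r D \<in> cells X" using r C RX by auto
    have xy: "?x \<in> cell_cone X (r C)" "?y \<in> cell_cone X (r D)" "\<rho> (r C) ?x = u" "\<rho> (r D) ?y = v"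
      using \<rho>'_props[OF rX(1)] \<rho>'_props[OF rX(2)] r C by auto
    have "\<exists>\<gamma>\<in>carrier G. \<exists>L\<in>face_maps X (ca (r C) \<gamma>) (r D). ?y = L (\<theta> (r C) \<gamma> ?x)"
      using st xy r C by (intro M_step_lift rX) auto
    then obtain \<gamma> L where "\<gamma> \<in> carrier G" "L \<in> face_maps X (ca (r C) \<gamma>) (r D)" "?y = (L \<circ> \<theta> (r C) \<gamma>) ?x"
      by auto
    then have "\<exists>L'\<in>face_maps ?Q (r C) (r D). ?y = L' ?x" unfolding Q by blast
    then have "((r C, ?x), (r D, ?y)) \<in> glue_step ?Q"
      using xy r C by (simp add: glue_step_def cone_points_def Q)
    then show "((r C, ?x), (r D, ?y)) \<in> glue ?Q" using glue_step_subset by blast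
  qed blast
  have "fan_isomorphism ?Q M \<phi>"
    unfolding fan_isomorphism_def
  proof (intro conjI exI ballI \<phi>(1) \<psi>(1))
    fix p assume "p \<in> topspace (fan_space ?Q)"
    then obtain i x where ix: "i \<in> R" "x \<in> cell_cone X i" "p = glue ?Q `` {(i, x)}"
      by (elim fan_space_cases[OF finQ]) (simp add: Q)
    then have "i \<in> cells X" using RX by blast
    then show "\<psi> (\<phi> p) = p"
      using ix \<rho>_props[of i] \<rho>'_props[of i] r\<pi> by (auto simp: \<phi> \<psi> image_subset_iff)
  next
    fix q assume "q \<in> topspace (fan_space M)"
    then obtain C u where C: "C \<in> cells M" "u \<in> cell_cone M C" "q = glue M `` {(C, u)}"
      by (elim fan_space_cases[OF finite_M])
    then show "\<phi> (\<psi> q) = q"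
      using r[OF C(1)] \<rho>'_props[of "r C"] RX by (auto simp: \<phi> \<psi>)
  qed (rule \<psi>(1))
  moreover have "\<phi> (glue ?Q `` {(i, x)}) = glue M `` {q}" if "i \<in> R" "x \<in> cell_cone X i" "proj (i, x) q" for i x q
    using \<phi>(2)[OF that(1,2)] glue_class_eq[OF proj[OF subsetD[OF RX that(1)] that(2,3)]] by simp
  ultimately show "\<exists>\<phi>. fan_isomorphism ?Q M \<phi> \<and>
      (\<forall>i\<in>R. \<forall>x\<in>cell_cone X i. \<forall>q. proj (i, x) q \<longrightarrow> \<phi> (glue ?Q `` {(i, x)}) = glue M `` {q})"
    by blast
qed

text \<open>The projection is constant on orbits and so descends to the orbit space. Its inverse is
  glued from the cones of \<open>M\<close>, each lifted to an arbitrary cone above it.\<close>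

theorem global: "is_global_quotient M X G ca \<theta> proj"
  unfolding is_global_quotient_def
proof (intro conjI admissible)
  let ?r = "{(p, q). p \<in> topspace (fan_space X) \<and> (\<exists>\<gamma>\<in>carrier G. q = act p \<gamma>)}"
  have GQ: "global_quotient X G ca \<theta> = quotient_space (fan_space X) ?r" by (simp add: global_quotient_def)
  note qm = quotient_map_quotient_space[of "fan_space X" ?r, folded GQ]
  have mon: "monoid G" using group.is_monoid[OF group_G] .
  have cls: "?r `` {p} = act p ` carrier G" if "p \<in> topspace (fan_space X)" for p using that by auto
  \<comment> \<open>The relation of \<open>global_quotient\<close> assigns to a point its orbit;
    that moving the point leaves the orbit unchanged uses inverses in the group.\<close>
  have orb: "?r `` {act p \<gamma>} = ?r `` {p}" if p: "p \<in> topspace (fan_space X)" and \<gamma>: "\<gamma> \<in> carrier G" for p \<gamma>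
  proof -
    have "act (act p \<gamma>) ` carrier G = act p ` carrier G"
    proof
      show "act (act p \<gamma>) ` carrier G \<subseteq> act p ` carrier G"
        using p \<gamma> act_mult mon by (auto simp: monoid.m_closed)
      show "act p ` carrier G \<subseteq> act (act p \<gamma>) ` carrier G"
      proof
        fix y assume "y \<in> act p ` carrier G"
        then obtain \<delta> where \<delta>: "\<delta> \<in> carrier G" "y = act p \<delta>" by blast
        have i: "inv\<^bsub>G\<^esub> \<gamma> \<in> carrier G" using group.inv_closed[OF group_G \<gamma>] .
        have "\<gamma> \<otimes>\<^bsub>G\<^esub> (inv\<^bsub>G\<^esub> \<gamma> \<otimes>\<^bsub>G\<^esub> \<delta>) = \<delta>"
          using i \<gamma> \<delta> group.r_inv[OF group_G \<gamma>] mon by (simp flip: monoid.m_assoc)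
        then have "y = act (act p \<gamma>) (inv\<^bsub>G\<^esub> \<gamma> \<otimes>\<^bsub>G\<^esub> \<delta>)"
          using act_mult[OF p \<gamma>] i \<delta> mon by (simp add: monoid.m_closed)
        then show "y \<in> act (act p \<gamma>) ` carrier G" using i \<delta> mon by (simp add: monoid.m_closed)
      qed
    qed
    then show ?thesis using cls[OF p] cls[OF act_in_topspace[OF p \<gamma>]] by simp
  qed
  obtain \<Psi> where \<Psi>: "fan_morphism X M \<Psi>"
    "\<And>i x. i \<in> cells X \<Longrightarrow> x \<in> cell_cone X i \<Longrightarrow> \<Psi> (glue X `` {(i, x)}) = glue M `` {(\<pi> i, \<rho> i x)}"
    using fan_morphism_lift[OF finite_X finite_M \<rho>_props \<rho>_step] by blast
  have \<Psi>c: "continuous_map (fan_space X) (fan_space M) \<Psi>" using \<Psi>(1) by (simp add: fan_morphism_def)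
  have \<Psi>act: "\<Psi> (act p \<gamma>) = \<Psi> p" if p: "p \<in> topspace (fan_space X)" and \<gamma>: "\<gamma> \<in> carrier G" for p \<gamma>
  proof -
    obtain i x where ix: "i \<in> cells X" "x \<in> cell_cone X i" "p = glue X `` {(i, x)}" using fan_space_cases[OF finite_X p] .
    then show ?thesis
      using \<gamma> glue_class_eq[OF \<rho>_ca[OF ix(1,2) \<gamma>]] by (simp add: act_class \<Psi> ca_closed \<theta>_in_cone \<pi>_ca)
  qed
  have self: "p \<in> act p ` carrier G" if "p \<in> topspace (fan_space X)" for p
    by (rule image_eqI[OF _ monoid.one_closed[OF mon]]) (simp add: act_one[OF that])
  have \<Psi>inv: "\<Psi> p = \<Psi> q" if "p \<in> topspace (fan_space X)" "q \<in> topspace (fan_space X)" "?r `` {p} = ?r `` {q}" for p q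
  proof -
    have "q \<in> act p ` carrier G"
      using self[OF that(2)] unfolding cls[OF that(1), symmetric] cls[OF that(2), symmetric] that(3) .
    then obtain \<gamma> where "\<gamma> \<in> carrier G" "q = act p \<gamma>" by blast
    then show ?thesis using \<Psi>act[OF that(1)] by simp
  qed
  obtain \<psi> where \<psi>: "continuous_map (global_quotient X G ca \<theta>) (fan_space M) \<psi>"
    "\<And>p. p \<in> topspace (fan_space X) \<Longrightarrow> \<psi> (?r `` {p}) = \<Psi> p"
  proof (rule quotient_map_lift_exists[OF qm \<Psi>c \<Psi>inv])
    fix k assume "continuous_map (global_quotient X G ca \<theta>) (fan_space M) k"
      "\<And>p. p \<in> topspace (fan_space X) \<Longrightarrow> k (?r `` {p}) = \<Psi> p"
    then show thesis by (rule that)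
  qed
  define s where "s C = (SOME i. i \<in> cells X \<and> \<pi> i = C)" for C
  have s: "s C \<in> cells X" "\<pi> (s C) = C" if "C \<in> cells M" for C
    using someI_ex[of "\<lambda>i. i \<in> cells X \<and> \<pi> i = C"] \<pi>_surj[OF that] by (auto simp: s_def)
  let ?F = "\<lambda>C u. ?r `` {glue X `` {(s C, \<rho>' (s C) u)}}"
  \<comment> \<open>This is where steps of \<open>M\<close> are lifted. The result concerns orbits
    in \<open>X\<close>, so the group element disappears.\<close>
  have lift_orbit: "?r `` {glue X `` {(i, x)}} = ?r `` {glue X `` {(j, y)}}"
    if st: "i \<in> cells X" "x \<in> cell_cone X i" "j \<in> cells X" "y \<in> cell_cone X j" "((\<pi> i, \<rho> i x), (\<pi> j, \<rho> j y)) \<in> glue_step M"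
    for i x j y
  proof -
    obtain \<gamma> L where \<gamma>: "\<gamma> \<in> carrier G" "L \<in> face_maps X (ca i \<gamma>) j" "y = L (\<theta> i \<gamma> x)"
      using M_step_lift[OF st] by blast
    then have "((ca i \<gamma>, \<theta> i \<gamma> x), (j, y)) \<in> glue_step X"
      using st \<theta>_in_cone ca_closed by (auto simp: glue_step_def cone_points_def)
    from glue_class_eq[OF subsetD[OF glue_step_subset this]]
    have "glue X `` {(j, y)} = act (glue X `` {(i, x)}) \<gamma>"
      using act_class[OF st(1,2) \<gamma>(1)] by simp
    then show ?thesis using orb[OF fan_class_in_topspace[OF finite_X st(1,2)] \<gamma>(1)] by simp
  qed
  have Fc: "continuous_map (cell_space M C) (global_quotient X G ca \<theta>) (?F C)" if C: "C \<in> cells M" for C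
  proof -
    note sC = s[OF C] and R = \<rho>'_props[OF s(1)[OF C]]
    have "continuous_map (cell_space M C) (cell_space X (s C)) (\<rho>' (s C))"
      using R sC by (intro integral_linear_continuous finite_M finite_X C) auto
    from continuous_map_compose[OF continuous_map_compose[OF this continuous_map_cell_class[OF finite_X sC(1)]] quotient_imp_continuous_map[OF qm]]
    show ?thesis by (simp add: o_def)
  qed
  have Fs: "?F C u = ?F D v" if st: "((C, u), (D, v)) \<in> glue_step M" for C u D v
  proof -
    have C: "C \<in> cells M" "D \<in> cells M" "u \<in> cell_cone M C" "v \<in> cell_cone M D" using st by (auto simp: glue_step_def cone_points_def)
    show ?thesis
      using s[OF C(1)] s[OF C(2)] \<rho>'_props[OF s(1)[OF C(1)]] \<rho>'_props[OF s(1)[OF C(2)]] C st by (intro lift_orbit) auto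
  qed
  obtain \<kappa> where \<kappa>: "continuous_map (fan_space M) (global_quotient X G ca \<theta>) \<kappa>"
    "\<And>C u. C \<in> cells M \<Longrightarrow> u \<in> cell_cone M C \<Longrightarrow> \<kappa> (glue M `` {(C, u)}) = ?F C u"
  proof (rule fan_space_lift[where Z = "global_quotient X G ca \<theta>" and F = ?F, OF finite_M Fc Fs])
    fix k assume "continuous_map (fan_space M) (global_quotient X G ca \<theta>) k"
      "\<And>C u. C \<in> cells M \<Longrightarrow> u \<in> cell_cone M C \<Longrightarrow> k (glue M `` {(C, u)}) = ?F C u"
    then show thesis by (rule that)
  qed
  have "homeomorphic_maps (global_quotient X G ca \<theta>) (fan_space M) \<psi> \<kappa>"
    unfolding homeomorphic_maps_def
  proof (intro conjI ballI \<psi>(1) \<kappa>(1))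
    fix o' assume "o' \<in> topspace (global_quotient X G ca \<theta>)"
    then obtain p where p: "p \<in> topspace (fan_space X)" "o' = ?r `` {p}"
      unfolding GQ topspace_quotient_space by (auto elim: quotientE)
    obtain i x where ix: "i \<in> cells X" "x \<in> cell_cone X i" "p = glue X `` {(i, x)}" using fan_space_cases[OF finite_X p(1)] .
    note C = \<pi>_closed[OF ix(1)]
    have u: "\<rho> i x \<in> cell_cone M (\<pi> i)" using \<rho>_props[OF ix(1)] ix by blast
    have "\<psi> o' = glue M `` {(\<pi> i, \<rho> i x)}" using \<psi>(2) p ix \<Psi> by simp
    then have "\<kappa> (\<psi> o') = ?F (\<pi> i) (\<rho> i x)" using \<kappa>(2)[OF C u] by simp
    \<comment> \<open>The cone chosen above \<open>\<pi> i\<close> may differ from \<open>i\<close>.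
      The two points have the same image in \<open>M\<close>, and lifting the reflexive step there
      shows that they lie in one orbit.\<close>
    also have "\<dots> = ?r `` {glue X `` {(i, x)}}"
      using s[OF C] \<rho>'_props[OF s(1)[OF C]] ix u C M_step_refl[of "(\<pi> i, \<rho> i x)"]
      by (intro lift_orbit) (auto simp: cone_points_def)
    finally show "\<kappa> (\<psi> o') = o'" using p ix by simp
  next
    fix q assume "q \<in> topspace (fan_space M)"
    then obtain C u where C: "C \<in> cells M" "u \<in> cell_cone M C" "q = glue M `` {(C, u)}"
      by (elim fan_space_cases[OF finite_M])
    have "\<psi> (\<kappa> q) = \<Psi> (glue X `` {(s C, \<rho>' (s C) u)})"
      unfolding C(3) \<kappa>(2)[OF C(1,2)]
      using C s[OF C(1)] \<rho>'_props[OF s(1)[OF C(1)]] by (intro \<psi>(2) fan_class_in_topspace finite_X) auto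
    also have "\<dots> = q" using C s[OF C(1)] \<rho>'_props[OF s(1)[OF C(1)]] by (simp add: \<Psi>)
    finally show "\<psi> (\<kappa> q) = q" .
  qed
  then have "homeomorphic_map (global_quotient X G ca \<theta>) (fan_space M) \<psi>" by (rule homeomorphic_maps_imp_map)
  moreover have "\<psi> (act (glue X `` {(i, x)}) ` carrier G) = glue M `` {q}"
    if ix: "i \<in> cells X" "x \<in> cell_cone X i" "proj (i, x) q" for i x q
  proof -
    note p = fan_class_in_topspace[OF finite_X ix(1,2)]
    have "\<psi> (?r `` {glue X `` {(i, x)}}) = glue M `` {q}"
      using \<psi>(2)[OF p] \<Psi>(2)[OF ix(1,2)] glue_class_eq[OF proj[OF ix]] by simp
    then show ?thesis by (simp only: cls[OF p])
  qed
  ultimately show "\<exists>\<psi>. homeomorphic_map (global_quotient X G ca \<theta>) (fan_space M) \<psi> \<and>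
        (\<forall>i\<in>cells X. \<forall>x\<in>cell_cone X i. \<forall>q. proj (i, x) q \<longrightarrow>
           \<psi> ((\<lambda>\<gamma>. act (glue X `` {(i, x)}) \<gamma>) ` carrier G) = glue M `` {q})" by blast
qed

end

end

section \<open>Relabelling coordinates\<close>

text \<open>A coordinate outside the image of the composite is 0 on both sides, whichever of the two
  maps misses it.\<close>

lemma face_inclusion_compose:
  assumes f: "inj_on f A" "f ` A \<subseteq> B" and h: "inj_on h B"
  shows "face_inclusion B C h (face_inclusion A B f x) = face_inclusion A C (h \<circ> f) x"
proof
  fix b
  show "face_inclusion B C h (face_inclusion A B f x) b = face_inclusion A C (h \<circ> f) x b"
  proof (cases "b \<in> C \<and> b \<in> h ` B")
    case True
    then obtain b' where b': "b' \<in> B" "b = h b'" by blast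
    have hb: "inv_into B h b = b'" using b' h by (simp add: inv_into_f_f)
    show ?thesis
    proof (cases "b' \<in> f ` A")
      case T: True
      then obtain a where a: "a \<in> A" "b' = f a" by blast
      have "inj_on (h \<circ> f) A" using comp_inj_on[OF f(1) inj_on_subset[OF h f(2)]] .
      from inv_into_f_f[OF this a(1)] have "inv_into A (h \<circ> f) b = a" using a b' by simp
      moreover have "inv_into A f b' = a" using a f by (simp add: inv_into_f_f)
      moreover have "b \<in> (h \<circ> f) ` A" using a b' by auto
      ultimately show ?thesis using True b' hb T by (simp add: face_inclusion_def)
    next
      case F: False
      have "b \<notin> (h \<circ> f) ` A"
      proof
        assume "b \<in> (h \<circ> f) ` A"
        then obtain a where a: "a \<in> A" "h b' = h (f a)" using b'(2) by auto
        then have "b' = f a" using f(2) by (intro inj_onD[OF h _ b'(1)]) auto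
        then show False using F a(1) by blast
      qed
      then show ?thesis using True b' hb F by (simp add: face_inclusion_def)
    qed
  next
    case False
    then have "b \<notin> C \<or> b \<notin> (h \<circ> f) ` A" using f by auto
    then show ?thesis using False by (auto simp: face_inclusion_def)
  qed
qed

lemma face_inclusion_cong:
  assumes "\<And>a. a \<in> A \<Longrightarrow> f a = f' a"
  shows "face_inclusion A B f = face_inclusion A B f'"
proof -
  have "f ` A = f' ` A" using assms by auto
  moreover have "inv_into A f b = inv_into A f' b" for b
    unfolding inv_into_def by (rule arg_cong[of _ _ Eps]) (use assms in auto)
  ultimately show ?thesis by (auto simp: face_inclusion_def fun_eq_iff)
qed

lemma face_inclusion_id: "x \<in> extensional A \<Longrightarrow> face_inclusion A A id x = x"
  by (auto simp: face_inclusion_def fun_eq_iff extensional_def inv_into_f_f[of id, simplified])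

lemma face_inclusion_bij:
  assumes "bij_betw f A B" "b \<in> B"
  shows "face_inclusion A B f x b = x (inv_into A f b)"
  using assms by (auto simp: face_inclusion_def bij_betw_def)

lemma face_inclusion_inverse:
  assumes f: "bij_betw f A B" and x: "x \<in> extensional A"
  shows "face_inclusion B A (inv_into A f) (face_inclusion A B f x) = x"
proof -
  have "face_inclusion B A (inv_into A f) (face_inclusion A B f x) = face_inclusion A A (inv_into A f \<circ> f) x"
    using f bij_betw_inv_into[OF f] by (intro face_inclusion_compose) (auto simp: bij_betw_def)
  also have "face_inclusion A A (inv_into A f \<circ> f) = face_inclusion A A id"
    using f by (intro face_inclusion_cong) (simp add: bij_betw_inv_into_left)
  finally show ?thesis using x by (simp add: face_inclusion_id)
qed

lemma face_inclusion_inverse':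
  assumes f: "bij_betw f A B" and y: "y \<in> extensional B"
  shows "face_inclusion A B f (face_inclusion B A (inv_into A f) y) = y"
proof -
  have "face_inclusion A B f (face_inclusion B A (inv_into A f) y) = face_inclusion B B (f \<circ> inv_into A f) y"
    using f bij_betw_inv_into[OF f] by (intro face_inclusion_compose) (auto simp: bij_betw_def)
  also have "face_inclusion B B (f \<circ> inv_into A f) = face_inclusion B B id"
    using f by (intro face_inclusion_cong) (simp add: bij_betw_inv_into_right)
  finally show ?thesis using y by (simp add: face_inclusion_id)
qed

text \<open>The matrix is the permutation matrix of \<open>f\<close>.\<close>

lemma integral_linear_face_inclusion:
  assumes f: "bij_betw f A B" and fin: "finite A"
  shows "integral_linear A B (face_inclusion A B f)"
  unfolding integral_linear_def
proof (intro exI ballI ext)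
  fix x :: "nat \<Rightarrow> real" and b assume "x \<in> A \<rightarrow>\<^sub>E UNIV"
  show "face_inclusion A B f x b = (\<lambda>b\<in>B. \<Sum>a\<in>A. of_int (if f a = b then 1 else 0) * x a) b"
  proof (cases "b \<in> B")
    case True
    have "(\<Sum>a\<in>A. of_int (if f a = b then 1 else 0) * x a) = (\<Sum>a\<in>A. if a = inv_into A f b then x a else 0)"
      using f True by (intro sum.cong) (auto simp: bij_betw_inv_into_left bij_betw_inv_into_right)
    also have "\<dots> = x (inv_into A f b)"
      using fin bij_betw_apply[OF bij_betw_inv_into[OF f] True] by simp
    finally show ?thesis using face_inclusion_bij[OF f True] True by simp
  next
    case False
    then show ?thesis by (simp add: face_inclusion_def)
  qed
qed

lemma lattice_iso_face_inclusion:
  assumes f: "bij_betw f A B" and fin: "finite A"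
  shows "lattice_iso A B (face_inclusion A B f)"
proof -
  have "finite B" using f fin bij_betw_finite by blast
  then show ?thesis
    unfolding lattice_iso_def
    using integral_linear_face_inclusion[OF f fin] integral_linear_face_inclusion[OF bij_betw_inv_into[OF f]]
      face_inclusion_inverse[OF f] face_inclusion_inverse'[OF f] by (auto simp: PiE_def)
qed

section \<open>Cycles\<close>

lemma contains_cycle_iso:
  assumes iso: "graph_iso G G' fV fE" and wf: "wf_digraph G" and F: "F \<subseteq> arcs G" and cyc: "contains_cycle G F"
  shows "contains_cycle G' (fE ` F)"
proof -
  obtain ds where ds: "ds \<noteq> []" "fst ` set ds \<subseteq> F" "distinct (map fst ds)" "distinct (map (dart_start G) ds)"
    "\<And>i. i < length ds \<Longrightarrow> dart_end G (ds ! i) = dart_start G (ds ! (Suc i mod length ds))"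
    using cyc unfolding contains_cycle_def by blast
  have V: "inj_on fV (verts G)" and E: "inj_on fE (arcs G)"
    and ends: "\<And>e. e \<in> arcs G \<Longrightarrow> {tail G' (fE e), head G' (fE e)} = {fV (tail G e), fV (head G e)}"
    using iso by (auto simp: graph_iso_def bij_betw_def)
  \<comment> \<open>An isomorphism may reverse edges, so the darts of the cycle are turned
    accordingly; a loop keeps its flag.\<close>
  define m where "m d = (fE (fst d), if tail G' (fE (fst d)) = fV (tail G (fst d)) then snd d else \<not> snd d)" for d
  have mm: "dart_start G' (m d) = fV (dart_start G d)" "dart_end G' (m d) = fV (dart_end G d)" if "fst d \<in> arcs G" for d
    using ends[OF that] by (auto simp: m_def dart_start_def dart_end_def doubleton_eq_iff)
  have dG: "fst d \<in> arcs G" if "d \<in> set ds" for d using that ds(2) F by auto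
  have sv: "dart_start G d \<in> verts G" if "d \<in> set ds" for d
    using dG[OF that] wf by (auto simp: dart_start_def wf_digraph_def)
  have 1: "map fst (map m ds) = map fE (map fst ds)" by (simp add: m_def)
  have 2: "map (dart_start G') (map m ds) = map fV (map (dart_start G) ds)" using mm(1) dG by simp
  show ?thesis
    unfolding contains_cycle_def
  proof (intro exI[of _ "map m ds"] conjI allI impI)
    show "map m ds \<noteq> []" using ds by simp
    show "fst ` set (map m ds) \<subseteq> fE ` F" using ds(2) by (auto simp: m_def)
    show "distinct (map fst (map m ds))"
      unfolding 1 distinct_map using ds(3) E dG by (auto simp: distinct_map intro: inj_on_subset)
    show "distinct (map (dart_start G') (map m ds))"
      unfolding 2 distinct_map[of fV] using ds(4) V sv by (auto intro: inj_on_subset)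
    fix i assume "i < length (map m ds)"
    then have i: "i < length ds" by simp
    moreover from this have "Suc i mod length ds < length ds" by (intro mod_less_divisor) linarith
    ultimately    show "dart_end G' (map m ds ! i) = dart_start G' (map m ds ! (Suc i mod length (map m ds)))"
      using ds(5)[OF i] mm dG nth_mem by simp
  qed
qed

text \<open>Weight is never lost: a contracted loop raises the weight of its vertex, and otherwise
  the weight of the head is added to that of the tail.\<close>

lemma not_pure_contract:
  assumes wf: "wf_digraph (fst Y)" and e: "e \<in> arcs (fst Y)" and np: "\<not> pure_wgraph Y \<or> tail (fst Y) e = head (fst Y) e"
  shows "\<not> pure_wgraph (contract_edge e Y)"
proof -
  have vab: "tail (fst Y) e \<in> verts (fst Y)" "head (fst Y) e \<in> verts (fst Y)" using wf e by (auto simp: wf_digraph_def)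
  show ?thesis
  proof (cases "tail (fst Y) e = head (fst Y) e")
    case True
    then have "snd (contract_edge e Y) (tail (fst Y) e) \<noteq> 0" by (simp add: contract_edge_loop)
    moreover have "tail (fst Y) e \<in> verts (fst (contract_edge e Y))" using True vab by (simp add: contract_edge_loop)
    ultimately have "\<exists>v\<in>verts (fst (contract_edge e Y)). snd (contract_edge e Y) v \<noteq> 0" by (rule bexI)
    then show ?thesis unfolding pure_wgraph_def by simp
  next
    case False
    then obtain v where v: "v \<in> verts (fst Y)" "snd Y v \<noteq> 0" using np by (auto simp: pure_wgraph_def)
    let ?v = "contract_vertex e Y v"
    have "?v \<in> verts (fst (contract_edge e Y))" using v vab False by (auto simp: contract_edge_nonloop)
    moreover have "snd (contract_edge e Y) ?v \<noteq> 0" using v False by (auto simp: contract_edge_nonloop)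
    ultimately have "\<exists>v\<in>verts (fst (contract_edge e Y)). snd (contract_edge e Y) v \<noteq> 0" by (rule bexI[rotated])
    then show ?thesis unfolding pure_wgraph_def by simp
  qed
qed

lemma not_pure_fold_contract:
  "wf_digraph (fst Y) \<Longrightarrow> distinct es \<Longrightarrow> set es \<subseteq> arcs (fst Y) \<Longrightarrow> \<not> pure_wgraph Y \<Longrightarrow> \<not> pure_wgraph (fold contract_edge es Y)"
proof (induction es arbitrary: Y)
  case (Cons e es)
  then have "wf_digraph (fst (contract_edge e Y))" "\<not> pure_wgraph (contract_edge e Y)"
    using wf_contract_edge not_pure_contract by auto
  then show ?case using Cons.IH[of "contract_edge e Y"] Cons.prems by auto
qed simp

text \<open>Following vertices through the contractions replaces an analysis of the connected
  components of the contracted set.\<close>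

fun merged_vertex :: "nat list \<Rightarrow> wgraph \<Rightarrow> nat \<Rightarrow> nat" where
  "merged_vertex [] Y v = v"
| "merged_vertex (e # es) Y v = merged_vertex es (contract_edge e Y) (contract_vertex e Y v)"

lemma tail_head_contract_edge:
  "tail (fst (contract_edge e Y)) d = contract_vertex e Y (tail (fst Y) d)"
  "head (fst (contract_edge e Y)) d = contract_vertex e Y (head (fst Y) d)"
  by (cases "tail (fst Y) e = head (fst Y) e"; simp add: contract_edge_loop contract_edge_nonloop)+

lemma merged_vertex_tail_head:
  "tail (fst (fold contract_edge es Y)) d = merged_vertex es Y (tail (fst Y) d)"
  "head (fst (fold contract_edge es Y)) d = merged_vertex es Y (head (fst Y) d)"
  by (induction es arbitrary: Y) (auto simp: tail_head_contract_edge simp del: fun_upd_apply)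

lemma merged_vertex_edge:
  "e \<in> set es \<Longrightarrow> merged_vertex es Y (tail (fst Y) e) = merged_vertex es Y (head (fst Y) e)"
proof (induction es arbitrary: Y)
  case (Cons d es)
  show ?case
  proof (cases "e = d")
    case False
    then show ?thesis using Cons.IH[of "contract_edge d Y"] Cons.prems
      by (simp add: tail_head_contract_edge del: fun_upd_apply)
  qed simp
qed simp

text \<open>The last edge of a cycle to be contracted is a loop at its turn, which increases the weight.\<close>

lemma pure_contract_acyclic:
  assumes wf: "wf_digraph (fst Y)" and es: "distinct es" "set es \<subseteq> arcs (fst Y)"
    and pure: "pure_wgraph (fold contract_edge es Y)"
  shows "\<not> contains_cycle (fst Y) (set es)"
proof
  assume "contains_cycle (fst Y) (set es)"
  then obtain ds where ds: "ds \<noteq> []" "fst ` set ds \<subseteq> set es" "distinct (map fst ds)"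
    "\<And>i. i < length ds \<Longrightarrow> dart_end (fst Y) (ds ! i) = dart_start (fst Y) (ds ! (Suc i mod length ds))"
    unfolding contains_cycle_def by blast
  have "\<exists>e\<in>set es. e \<in> fst ` set ds" using ds(1,2) by (cases ds) auto
  \<comment> \<open>\<open>e\<close> is the edge of the cycle that is contracted last, so all other
    edges of the cycle lie in \<open>pre\<close>.\<close>
  then obtain pre e post where split: "es = pre @ e # post" "e \<in> fst ` set ds" "\<And>d. d \<in> set post \<Longrightarrow> d \<notin> fst ` set ds"
    using split_list_last_prop[of es "\<lambda>e. e \<in> fst ` set ds"] by blast
  obtain k where k: "k < length ds" "fst (ds ! k) = e" using split(2) by (auto simp: in_set_conv_nth)
  let ?n = "length ds"
  let ?a = "\<lambda>j. merged_vertex pre Y (dart_start (fst Y) (ds ! (j mod ?n)))"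
  have step: "?a j = ?a (Suc j)" if "j mod ?n \<noteq> k" for j
  proof -
    have j: "j mod ?n < ?n" using ds(1) by simp
    have "fst (ds ! (j mod ?n)) \<noteq> e" using ds(3) k that j nth_eq_iff_index_eq[of "map fst ds" "j mod ?n" k] by auto
    moreover have "fst (ds ! (j mod ?n)) \<in> fst ` set ds" using nth_mem[OF j] by (rule imageI)
    ultimately have "fst (ds ! (j mod ?n)) \<in> set pre" using ds(2) split(1,3) by auto
    then have "merged_vertex pre Y (dart_start (fst Y) (ds ! (j mod ?n))) = merged_vertex pre Y (dart_end (fst Y) (ds ! (j mod ?n)))"
      using merged_vertex_edge by (simp add: dart_start_def dart_end_def)
    also have "\<dots> = ?a (Suc j)" using ds(4)[OF j] by (simp add: mod_Suc_eq)
    finally show ?thesis .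
  qed
  \<comment> \<open>Going once around the cycle from the end of the dart at index \<open>k\<close>,
    all darts met before returning there belong to \<open>pre\<close>. So both ends of
    \<open>e\<close> have been merged when its turn comes.\<close>
  have "m < ?n \<Longrightarrow> ?a (Suc k + m) = ?a (Suc k)" for m
  proof (induction m)
    case (Suc m)
    have "(Suc k + m) mod ?n \<noteq> k"
    proof
      assume "(Suc k + m) mod ?n = k"
      then have "[k + Suc m = k + 0] (mod ?n)" using k by (simp add: cong_def)
      then have "[Suc m = 0] (mod ?n)" by (simp only: cong_add_lcancel_nat)
      then show False using Suc.prems by (simp add: cong_def)
    qed
    from step[OF this] Suc show ?case by simp
  qed simp
  from this[of "?n - 1"] have "?a k = ?a (Suc k)" using ds(1) k by (simp add: Suc_le_eq)
  then have "merged_vertex pre Y (dart_start (fst Y) (ds ! k)) = merged_vertex pre Y (dart_end (fst Y) (ds ! k))"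
    using ds(4)[OF k(1)] k by simp
  then have "merged_vertex pre Y (tail (fst Y) e) = merged_vertex pre Y (head (fst Y) e)"
    using k by (auto simp: dart_start_def dart_end_def split: if_splits)
  then have loop: "tail (fst (fold contract_edge pre Y)) e = head (fst (fold contract_edge pre Y)) e"
    by (simp add: merged_vertex_tail_head)
  have wf1: "wf_digraph (fst (fold contract_edge pre Y))" using wf_fold_contract_edge[OF wf] es split(1) by simp
  have e1: "e \<in> arcs (fst (fold contract_edge pre Y))" using es split(1) by (auto simp: arcs_fold_contract_edge)
  have "\<not> pure_wgraph (contract_edge e (fold contract_edge pre Y))" using not_pure_contract[OF wf1 e1] loop by blast
  then have "\<not> pure_wgraph (fold contract_edge post (contract_edge e (fold contract_edge pre Y)))"
    using es split(1) by (intro not_pure_fold_contract wf_contract_edge wf1 e1) (auto simp: arcs_fold_contract_edge)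
  then show False using pure split(1) by simp
qed

section \<open>Isomorphisms acting on cones\<close>

text \<open>The relabelling \<open>E'\<close> cancels against its inverse, so both sides are the
  extension along \<open>E \<circ> \<iota>\<close>. In this form a face map is compared with its
  conjugate under a change of representatives.\<close>

lemma face_inclusion_transport:
  assumes E': "bij_betw E' A A'" and \<iota>: "inj_on \<iota> A" "\<iota> ` A \<subseteq> B" and E: "inj_on E B"
  shows "face_inclusion A' B' (E \<circ> \<iota> \<circ> inv_into A E') (face_inclusion A A' E' u) =
    face_inclusion B B' E (face_inclusion A B \<iota> u)"
proof -
  have 1: "bij_betw (inv_into A E') A' A" using bij_betw_inv_into[OF E'] .
  have 2: "inj_on (E \<circ> \<iota>) A" using comp_inj_on[OF \<iota>(1) inj_on_subset[OF E \<iota>(2)]] .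
  have "inj_on (E \<circ> \<iota> \<circ> inv_into A E') A'"
    using comp_inj_on[of "inv_into A E'" A' "E \<circ> \<iota>"] 1 2 by (simp add: bij_betw_def)
  then have "face_inclusion A' B' (E \<circ> \<iota> \<circ> inv_into A E') (face_inclusion A A' E' u) =
      face_inclusion A B' (E \<circ> \<iota> \<circ> inv_into A E' \<circ> E') u"
    using E' by (intro face_inclusion_compose) (auto simp: bij_betw_def)
  also have "face_inclusion A B' (E \<circ> \<iota> \<circ> inv_into A E' \<circ> E') = face_inclusion A B' (E \<circ> \<iota>)"
    using E' by (intro face_inclusion_cong) (simp add: bij_betw_inv_into_left)
  also have "face_inclusion A B' (E \<circ> \<iota>) u = face_inclusion B B' E (face_inclusion A B \<iota> u)"
    using face_inclusion_compose[OF \<iota> E] by simp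
  finally show ?thesis .
qed

definition graph_cone :: "bool \<Rightarrow> (nat, nat) pre_digraph \<Rightarrow> (nat \<Rightarrow> real) set" where
  "graph_cone P G = (if P then pure_cone G else full_cone G)"

lemma graph_cone_extensional: "x \<in> graph_cone P G \<Longrightarrow> x \<in> extensional (arcs G)"
  by (auto simp: graph_cone_def pure_cone_def full_cone_def PiE_iff split: if_splits)

lemma graph_cone_iff:
  "x \<in> graph_cone P G \<longleftrightarrow> x \<in> arcs G \<rightarrow>\<^sub>E {0..} \<and> (P \<longrightarrow> \<not> contains_cycle G {e \<in> arcs G. x e = 0})"
  by (auto simp: graph_cone_def pure_cone_def full_cone_def)

lemma wgraph_iso_graph_iso: "wgraph_iso Y Y' fV fE \<Longrightarrow> graph_iso (fst Y) (fst Y') fV fE"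
  by (simp add: wgraph_iso_def)

lemma contains_cycle_wgraph_iso:
  assumes iso: "wgraph_iso Y Y' fV fE" and wf: "wf_digraph (fst Y)" "wf_digraph (fst Y')" and F: "F \<subseteq> arcs (fst Y)"
    and cyc: "contains_cycle (fst Y') (fE ` F)"
  shows "contains_cycle (fst Y) F"
proof -
  have bij: "bij_betw fE (arcs (fst Y)) (arcs (fst Y'))" using wgraph_iso_bij[OF iso] .
  have "fE ` F \<subseteq> arcs (fst Y')" using F bij by (auto simp: bij_betw_def)
  from contains_cycle_iso[OF wgraph_iso_graph_iso[OF wgraph_iso_inverse[OF iso wf(1)]] wf(2) this cyc]
  have "contains_cycle (fst Y) (inv_into (arcs (fst Y)) fE ` fE ` F)" .
  moreover have "inv_into (arcs (fst Y)) fE ` fE ` F = F"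
    using bij F by (intro inv_into_image_cancel) (auto simp: bij_betw_def)
  ultimately show ?thesis by simp
qed

text \<open>The edges of length 0 correspond under the isomorphism, and a cycle among their images
  could be carried back.\<close>

lemma face_inclusion_in_cone:
  assumes iso: "wgraph_iso Y Y' fV fE" and wf: "wf_digraph (fst Y)" "wf_digraph (fst Y')" and x: "x \<in> graph_cone P (fst Y)"
  shows "face_inclusion (arcs (fst Y)) (arcs (fst Y')) fE x \<in> graph_cone P (fst Y')"
proof -
  let ?A = "arcs (fst Y)" and ?A' = "arcs (fst Y')"
  let ?y = "face_inclusion ?A ?A' fE x"
  have bij: "bij_betw fE ?A ?A'" using wgraph_iso_bij[OF iso] .
  have y: "?y e = x (inv_into ?A fE e)" "inv_into ?A fE e \<in> ?A" if "e \<in> ?A'" for e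
    using face_inclusion_bij[OF bij that] bij_betw_apply[OF bij_betw_inv_into[OF bij] that] by auto
  have "{e \<in> ?A'. ?y e = 0} = fE ` {e \<in> ?A. x e = 0}"
  proof (intro Set.set_eqI iffI)
    fix e assume "e \<in> {e \<in> ?A'. ?y e = 0}"
    then show "e \<in> fE ` {e \<in> ?A. x e = 0}"
      using y[of e] bij_betw_inv_into_right[OF bij, of e] by (intro image_eqI[of _ _ "inv_into ?A fE e"]) auto
  next
    fix e assume "e \<in> fE ` {e \<in> ?A. x e = 0}"
    then obtain d where d: "d \<in> ?A" "x d = 0" "e = fE d" by blast
    then have "e \<in> ?A'" using bij_betw_apply[OF bij] by blast
    then show "e \<in> {e \<in> ?A'. ?y e = 0}" using y(1)[of e] d bij_betw_inv_into_left[OF bij d(1)] by simp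
  qed
  then have "P \<longrightarrow> \<not> contains_cycle (fst Y') {e \<in> ?A'. ?y e = 0}"
    using contains_cycle_wgraph_iso[OF iso wf, of "{e \<in> ?A. x e = 0}"] x by (auto simp: graph_cone_iff)
  moreover have "?y \<in> ?A' \<rightarrow>\<^sub>E {0..}"
    using y x by (auto simp: PiE_iff graph_cone_iff) (auto simp: face_inclusion_def)
  ultimately show ?thesis by (simp add: graph_cone_iff)
qed

lemma face_inclusion_cone_bij:
  assumes iso: "wgraph_iso Y Y' fV fE" and wf: "wf_digraph (fst Y)" "wf_digraph (fst Y')"
  shows "bij_betw (face_inclusion (arcs (fst Y)) (arcs (fst Y')) fE) (graph_cone P (fst Y)) (graph_cone P (fst Y'))"
proof (rule bij_betw_byWitness[where f' = "face_inclusion (arcs (fst Y')) (arcs (fst Y)) (inv_into (arcs (fst Y)) fE)"])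
  note bij = wgraph_iso_bij[OF iso]
  show "\<forall>x\<in>graph_cone P (fst Y). face_inclusion (arcs (fst Y')) (arcs (fst Y)) (inv_into (arcs (fst Y)) fE)
      (face_inclusion (arcs (fst Y)) (arcs (fst Y')) fE x) = x"
    using face_inclusion_inverse[OF bij] graph_cone_extensional by blast
  show "\<forall>y\<in>graph_cone P (fst Y'). face_inclusion (arcs (fst Y)) (arcs (fst Y')) fE
      (face_inclusion (arcs (fst Y')) (arcs (fst Y)) (inv_into (arcs (fst Y)) fE) y) = y"
    using face_inclusion_inverse'[OF bij] graph_cone_extensional by blast
  show "face_inclusion (arcs (fst Y)) (arcs (fst Y')) fE ` graph_cone P (fst Y) \<subseteq> graph_cone P (fst Y')"
    using face_inclusion_in_cone[OF iso wf] by blast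
  show "face_inclusion (arcs (fst Y')) (arcs (fst Y)) (inv_into (arcs (fst Y)) fE) ` graph_cone P (fst Y') \<subseteq> graph_cone P (fst Y)"
    using face_inclusion_in_cone[OF wgraph_iso_inverse[OF iso wf(1)] wf(2,1)] by blast
qed

section \<open>Transport of specializations\<close>

text \<open>The marking is pushed forward along a homeomorphism that realizes the
  isomorphism.\<close>

lemma marked_iso_transport:
  assumes X: "well_marked g X" and wf: "wf_digraph (fst Y')" and iso: "wgraph_iso (fst X) Y' fV fE"
  shows "\<exists>h'. well_marked g (Y', h') \<and> marked_iso g X (Y', h') fE"
proof -
  have wfX: "wf_digraph (fst (fst X))" using X by (simp add: well_marked_def)
  obtain \<gamma> where \<gamma>: "virtual_iso (fst X) Y' fE \<gamma>" using wgraph_iso_virtual_iso iso wfX wf by blast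
  obtain \<gamma>' where "homeomorphic_maps (vrealization (fst X)) (vrealization Y') \<gamma> \<gamma>'"
    using virtual_iso_homeomorphic[OF \<gamma>] homeomorphic_map_maps by blast
  then have "homotopy_equivalence (vrealization (fst X)) (vrealization Y') \<gamma>"
    by (rule homotopy_equivalence_homeomorphic)
  then have m: "is_marking g Y' (\<gamma> \<circ> snd X)"
    using X homotopy_equivalence_compose unfolding well_marked_def is_marking_def by blast
  then have W: "well_marked g (Y', \<gamma> \<circ> snd X)" using wf by (simp add: well_marked_def)
  have "loose_equiv g Y' (\<gamma> \<circ> snd X) (\<gamma> \<circ> snd X)"
    using marking_continuous[OF m] by (intro loose_equiv_homotopic) simp
  then have "marked_iso g X (Y', \<gamma> \<circ> snd X) fE" using marked_iso_loose[OF X W] \<gamma> by auto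
  then show ?thesis using W by blast
qed

text \<open>The marking pushed forward from \<open>X\<close> and that of \<open>Z\<close> are two
  markings of one graph and differ by some \<open>\<alpha>\<close>. The edge map remains the
  prescribed \<open>fE\<close>, which is what the lifting of face maps requires.\<close>

lemma marked_action_transitive:
  assumes X: "well_marked g X" and Z: "well_marked g Z" and iso: "wgraph_iso (fst X) (fst Z) fV fE"
  shows "\<exists>\<alpha>\<in>auto (Fg g). marked_iso g (marked_action g X \<alpha>) Z fE"
proof -
  have wf: "wf_digraph (fst (fst Z))" using Z by (simp add: well_marked_def)
  obtain h' where h': "well_marked g (fst Z, h')" "marked_iso g X (fst Z, h') fE"
    using marked_iso_transport[OF X wf iso] by blast
  then obtain \<alpha> where \<alpha>: "\<alpha> \<in> auto (Fg g)"
    "homotopic_with (\<lambda>_. True) (rose_space g) (vrealization (fst Z)) (h' \<circ> rose_map g \<alpha>) (snd Z)"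
    using markings_transitive[of g "fst Z" h' "snd Z"] Z by (auto simp: well_marked_def)
  have r: "homotopy_equivalence (rose_space g) (rose_space g) (rose_map g \<alpha>)" "rose_map g \<alpha> (Vertex ()) = Vertex ()"
    using rose_map_props[OF \<alpha>(1)] by (auto simp: realizes_def)
  have W: "well_marked g (fst Z, h' \<circ> rose_map g \<alpha>)" "well_marked g (fst X, snd X \<circ> rose_map g \<alpha>)"
    using well_marked_precompose[OF h'(1) r(1)] well_marked_precompose[OF X r(1)] by auto
  have "marked_iso g (fst X, snd X \<circ> rose_map g \<alpha>) (fst Z, h' \<circ> rose_map g \<alpha>) fE"
    using marked_iso_precompose[OF X h'(1,2) r] by simp
  from marked_iso_trans[OF W(2,1) _ this marked_iso_homotopic(1)[OF W(1) \<alpha>(2)]]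
  have "marked_iso g (marked_action g X \<alpha>) Z fE" using Z by (simp add: marked_action_def)
  then show ?thesis using \<alpha>(1) by blast
qed

text \<open>A statement on unmarked graphs obtained from the marked one: the marking is pushed
  forward, and the contractions of the two marked graphs correspond.\<close>

lemma wgraph_iso_fold_contract:
  assumes iso: "wgraph_iso Y Y' fV fE" and wf: "wf_digraph (fst Y)" "wf_digraph (fst Y')" and h: "is_marking g Y h"
    and es: "distinct es" "set es \<subseteq> arcs (fst Y)"
  shows "\<exists>fV'. wgraph_iso (fold contract_edge es Y) (fold contract_edge (map fE es) Y') fV' fE"
proof -
  have X: "well_marked g (Y, h)" using h wf by (simp add: well_marked_def)
  obtain h' where h': "well_marked g (Y', h')" "marked_iso g (Y, h) (Y', h') fE"
    using marked_iso_transport[OF X wf(2)] iso by auto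
  have bij: "bij_betw fE (arcs (fst Y)) (arcs (fst Y'))" using wgraph_iso_bij[OF iso] .
  have es': "distinct (map fE es)" "set (map fE es) \<subseteq> arcs (fst Y')"
    using bij es by (auto simp: bij_betw_def distinct_map intro: inj_on_subset)
  have "marked_iso g (fold contract_marked es (Y, h)) (fold contract_marked (map fE es) (Y', h')) fE"
    using marked_iso_fold_contract[OF X h'] es by simp
  from marked_iso_wgraph_iso[OF _ _ this] show ?thesis
    using well_marked_fold_contract[OF X] well_marked_fold_contract[OF h'(1)] es es' by (simp add: fst_fold_contract_marked)
qed

text \<open>The isomorphism carries the list of contracted edges from \<open>Y\<close> to
  \<open>Z\<close>. This moves specializations between graphs and the chosen representatives of
  their classes.\<close>

lemma wgraph_specializes_transport:
  assumes sp: "wgraph_specializes Y Y' \<iota>" and E: "wgraph_iso Y Z fV E" and E': "wgraph_iso Y' Z' fV' E'"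
    and wf: "wf_digraph (fst Y)" "wf_digraph (fst Y')" "wf_digraph (fst Z)" and h: "is_marking g Y h"
  shows "wgraph_specializes Z Z' (E \<circ> \<iota> \<circ> inv_into (arcs (fst Y')) E')"
proof -
  obtain es fW where es: "distinct es" "set es \<subseteq> arcs (fst Y)" "wgraph_iso Y' (fold contract_edge es Y) fW \<iota>"
    using sp unfolding wgraph_specializes_def by blast
  obtain fU where fU: "wgraph_iso (fold contract_edge es Y) (fold contract_edge (map E es) Z) fU E"
    using wgraph_iso_fold_contract[OF E wf(1,3) h es(1,2)] by blast
  have bij: "bij_betw E (arcs (fst Y)) (arcs (fst Z))" using wgraph_iso_bij[OF E] .
  have "distinct (map E es)" "set (map E es) \<subseteq> arcs (fst Z)"
    using bij es by (auto simp: bij_betw_def distinct_map intro: inj_on_subset)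
  with wgraph_iso_compose[OF wgraph_iso_inverse[OF E' wf(2)] wgraph_iso_compose[OF es(3) fU]]
  show ?thesis unfolding wgraph_specializes_def comp_assoc by blast
qed

lemma wgraph_specializes_arcs:
  assumes "wgraph_specializes Y Y' \<iota>"
  shows "inj_on \<iota> (arcs (fst Y'))" "\<iota> ` arcs (fst Y') \<subseteq> arcs (fst Y)"
proof -
  obtain es fV where "wgraph_iso Y' (fold contract_edge es Y) fV \<iota>" using assms unfolding wgraph_specializes_def by blast
  then have "bij_betw \<iota> (arcs (fst Y')) (arcs (fst Y) - set es)"
    using wgraph_iso_bij by (fastforce simp: arcs_fold_contract_edge)
  then show "inj_on \<iota> (arcs (fst Y'))" "\<iota> ` arcs (fst Y') \<subseteq> arcs (fst Y)" by (auto simp: bij_betw_def)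
qed

lemma wgraph_specializes_iso:
  assumes "wgraph_iso Y Y' fV fE"
  shows "wgraph_specializes Y' Y fE"
  unfolding wgraph_specializes_def using assms by (intro exI[of _ "[]"]) auto

text \<open>The flag \<open>P\<close> adds the acyclicity that \<open>pure_teichmueller\<close>
  demands, so that both fans are treated by one argument.\<close>

definition contracts_to :: "bool \<Rightarrow> nat \<Rightarrow> marked \<Rightarrow> marked \<Rightarrow> (nat \<Rightarrow> nat) \<Rightarrow> bool" where
  "contracts_to P g X X' \<iota> \<longleftrightarrow> (\<exists>S. (P \<longrightarrow> \<not> contains_cycle (fst (fst X)) S) \<and> marked_specializes_along g S X X' \<iota>)"

lemma contracts_to_iff:
  "contracts_to P g X X' \<iota> \<longleftrightarrow> (\<exists>es. distinct es \<and> set es \<subseteq> arcs (fst (fst X)) \<and>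
     (P \<longrightarrow> \<not> contains_cycle (fst (fst X)) (set es)) \<and> marked_iso g X' (fold contract_marked es X) \<iota>)"
  unfolding contracts_to_def marked_specializes_along_def by auto

lemma contracts_to_wgraph:
  assumes "contracts_to P g X X' \<iota>" "well_marked g X" "well_marked g X'"
  shows "wgraph_specializes (fst X) (fst X') \<iota>"
proof -
  obtain es where es: "distinct es" "set es \<subseteq> arcs (fst (fst X))" "marked_iso g X' (fold contract_marked es X) \<iota>"
    using assms(1) unfolding contracts_to_iff by blast
  from marked_iso_wgraph_iso[OF assms(3) well_marked_fold_contract[OF assms(2) es(1,2)] es(3)] es(1,2)
  show ?thesis unfolding wgraph_specializes_def fst_fold_contract_marked by blast
qed

lemma contracts_to_transport:
  assumes sp: "contracts_to P g X X' \<iota>" and E: "marked_iso g X Z E" and E': "marked_iso g X' Z' E'"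
    and W: "well_marked g X" "well_marked g X'" "well_marked g Z" "well_marked g Z'"
  shows "contracts_to P g Z Z' (E \<circ> \<iota> \<circ> inv_into (arcs (fst (fst X'))) E')"
proof -
  obtain es where es: "distinct es" "set es \<subseteq> arcs (fst (fst X))" "P \<longrightarrow> \<not> contains_cycle (fst (fst X)) (set es)"
    "marked_iso g X' (fold contract_marked es X) \<iota>"
    using sp unfolding contracts_to_iff by blast
  obtain fV where iso: "wgraph_iso (fst X) (fst Z) fV E" using marked_iso_wgraph_iso[OF W(1,3) E] by blast
  have bij: "bij_betw E (arcs (fst (fst X))) (arcs (fst (fst Z)))" using wgraph_iso_bij[OF iso] .
  have es': "distinct (map E es)" "set (map E es) \<subseteq> arcs (fst (fst Z))"
    using bij es by (auto simp: bij_betw_def distinct_map intro: inj_on_subset)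
  have "marked_iso g (fold contract_marked es X) (fold contract_marked (map E es) Z) E"
    using marked_iso_fold_contract[OF W(1,3) E es(1,2)] .
  note F = well_marked_fold_contract[OF W(1) es(1,2)] well_marked_fold_contract[OF W(3) es']
  have "marked_iso g X' (fold contract_marked (map E es) Z) (E \<circ> \<iota>)"
    by (rule marked_iso_trans[OF W(2) F es(4)]) fact
  from marked_iso_trans[OF W(4,2) F(2) marked_iso_sym[OF W(2,4) E'] this]
  have m: "marked_iso g Z' (fold contract_marked (map E es) Z) (E \<circ> \<iota> \<circ> inv_into (arcs (fst (fst X'))) E')" .
  have "P \<longrightarrow> \<not> contains_cycle (fst (fst Z)) (set (map E es))"
    using contains_cycle_wgraph_iso[OF iso _ _ es(2)] es(3) W by (auto simp: well_marked_def)
  then show ?thesis unfolding contracts_to_iff using es' m by blast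
qed

lemma well_marked_action: "well_marked g X \<Longrightarrow> \<alpha> \<in> auto (Fg g) \<Longrightarrow> well_marked g (marked_action g X \<alpha>)"
  using well_marked_precompose rose_map_props(1) by (simp add: marked_action_def)

lemma fst_marked_action [simp]: "fst (marked_action g X \<alpha>) = fst X"
  by (simp add: marked_action_def)

text \<open>Different members of one outer class may act on the two sides, since their maps of the
  rose are homotopic. This makes the action of \<open>Out\<close> on classes well defined.\<close>

lemma marked_iso_action:
  assumes X: "well_marked g X" "well_marked g X'" and iso: "marked_iso g X X' fE"
    and A: "A \<in> carrier (Out (Fg g))" "\<alpha> \<in> A" "\<beta> \<in> A"
  shows "marked_iso g (marked_action g X \<alpha>) (marked_action g X' \<beta>) fE"
proof -
  have ab: "\<alpha> \<in> auto (Fg g)" "\<beta> \<in> auto (Fg g)" using group.Out_subset_auto[OF group_Fg A(1)] A by auto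
  have r: "homotopy_equivalence (rose_space g) (rose_space g) (rose_map g \<alpha>)" "rose_map g \<alpha> (Vertex ()) = Vertex ()"
    using rose_map_props[OF ab(1)] by (auto simp: realizes_def)
  note W = well_marked_action[OF X(1) ab(1)] well_marked_action[OF X(2) ab(1)] well_marked_action[OF X(2) ab(2)]
  have c: "continuous_map (rose_space g) (vrealization (fst X')) (snd X')" using X(2) marking_continuous by (auto simp: well_marked_def)
  have "homotopic_with (\<lambda>_. True) (rose_space g) (vrealization (fst X')) (snd X' \<circ> rose_map g \<alpha>) (snd X' \<circ> rose_map g \<beta>)"
    using rose_map_Out[OF A] c by (rule homotopic_with_compose_continuous_map_left) simp
  from marked_iso_homotopic(1)[OF W(2)[unfolded marked_action_def] this]
  have "marked_iso g (marked_action g X' \<alpha>) (marked_action g X' \<beta>) id" by (simp add: marked_action_def)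
  moreover have "marked_iso g (marked_action g X \<alpha>) (marked_action g X' \<alpha>) fE"
    using marked_iso_precompose[OF X iso r] by (simp add: marked_action_def)
  ultimately show ?thesis using marked_iso_trans[OF W] by fastforce
qed

text \<open>The same list of edges serves, because contraction commutes with precomposition of the
  marking.\<close>

lemma contracts_to_action:
  assumes sp: "contracts_to P g X X' \<iota>" and W: "well_marked g X" "well_marked g X'"
    and A: "A \<in> carrier (Out (Fg g))" "\<alpha> \<in> A"
  shows "contracts_to P g (marked_action g X \<alpha>) (marked_action g X' \<alpha>) \<iota>"
proof -
  obtain es where es: "distinct es" "set es \<subseteq> arcs (fst (fst X))" "P \<longrightarrow> \<not> contains_cycle (fst (fst X)) (set es)"
    "marked_iso g X' (fold contract_marked es X) \<iota>"
    using sp unfolding contracts_to_iff by blast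
  have "marked_iso g (marked_action g X' \<alpha>) (marked_action g (fold contract_marked es X) \<alpha>) \<iota>"
    using marked_iso_action[OF W(2) well_marked_fold_contract[OF W(1) es(1,2)] es(4) A A(2)] .
  moreover have "marked_action g (fold contract_marked es X) \<alpha> = fold contract_marked es (marked_action g X \<alpha>)"
    using fold_contract_marked_precompose[of es "fst X" "snd X" "rose_map g \<alpha>"] by (simp add: marked_action_def)
  ultimately show ?thesis unfolding contracts_to_iff using es by auto
qed

section \<open>Teichmueller and moduli spaces\<close>

text \<open>The flag \<^term>\<open>P\<close> selects the pure variants.\<close>

definition marked_class :: "bool \<Rightarrow> nat \<Rightarrow> marked set" where
  "marked_class P g = {X \<in> marked_graphs g. P \<longrightarrow> pure_wgraph (fst X)}"

definition wgraph_class :: "bool \<Rightarrow> nat \<Rightarrow> wgraph set" where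
  "wgraph_class P g = {Y \<in> stable_wgraphs g. P \<longrightarrow> pure_wgraph Y}"

definition teich_fan :: "bool \<Rightarrow> nat \<Rightarrow> marked set stacky_fan" where
  "teich_fan P g =
     \<lparr>cells = marked_class P g // marked_rel g,
      coords = (\<lambda>c. arcs (mgraph c)),
      cell_cone = (\<lambda>c. graph_cone P (mgraph c)),
      face_maps = (\<lambda>c d. {face_inclusion (arcs (mgraph c)) (arcs (mgraph d)) \<iota> |\<iota>.
         contracts_to P g (representative d) (representative c) \<iota>})\<rparr>"

definition moduli_fan :: "bool \<Rightarrow> nat \<Rightarrow> wgraph set stacky_fan" where
  "moduli_fan P g =
     \<lparr>cells = wgraph_class P g // wgraph_rel g,
      coords = (\<lambda>C. arcs (wgraph_of C)),
      cell_cone = (\<lambda>C. graph_cone P (wgraph_of C)),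
      face_maps = moduli_face_maps\<rparr>"

lemma teich_fan_simps [simp]:
  "cells (teich_fan P g) = marked_class P g // marked_rel g"
  "coords (teich_fan P g) c = arcs (mgraph c)"
  "cell_cone (teich_fan P g) c = graph_cone P (mgraph c)"
  "face_maps (teich_fan P g) c d = {face_inclusion (arcs (mgraph c)) (arcs (mgraph d)) \<iota> |\<iota>.
         contracts_to P g (representative d) (representative c) \<iota>}"
  by (simp_all add: teich_fan_def)

lemma moduli_fan_simps [simp]:
  "cells (moduli_fan P g) = wgraph_class P g // wgraph_rel g"
  "coords (moduli_fan P g) C = arcs (wgraph_of C)"
  "cell_cone (moduli_fan P g) C = graph_cone P (wgraph_of C)"
  "face_maps (moduli_fan P g) = moduli_face_maps"
  by (simp_all add: moduli_fan_def)

lemma teich_fan_eq: "teich_fan True g = pure_teichmueller g" "teich_fan False g = teichmueller g"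
  unfolding teich_fan_def pure_teichmueller_def teichmueller_def marked_class_def graph_cone_def contracts_to_def
  by (auto simp: fun_eq_iff)

lemma moduli_fan_eq: "moduli_fan True g = pure_moduli g" "moduli_fan False g = moduli g"
  unfolding moduli_fan_def pure_moduli_def moduli_def wgraph_class_def graph_cone_def by simp_all

lemma pure_wgraph_iso:
  assumes iso: "wgraph_iso Y Y' fV fE" and pure: "pure_wgraph Y"
  shows "pure_wgraph Y'"
proof -
  have "verts (fst Y') = fV ` verts (fst Y)" "\<forall>v\<in>verts (fst Y). snd Y' (fV v) = snd Y v"
    using iso by (auto simp: wgraph_iso_def graph_iso_def bij_betw_def)
  then show ?thesis using pure by (simp add: pure_wgraph_def)
qed

lemma stable_wgraphs_wf: "Y \<in> stable_wgraphs g \<Longrightarrow> wf_digraph (fst Y) \<and> finite (arcs (fst Y))"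
  by (auto simp: stable_wgraphs_def fin_digraph.axioms(1) fin_digraph.finite_arcs)

lemma marked_graphs_iff: "X \<in> marked_graphs g \<longleftrightarrow> fst X \<in> stable_wgraphs g \<and> well_marked g X"
  using stable_wgraphs_wf by (cases X) (auto simp: marked_graphs_def well_marked_def)

lemma equiv_wgraph_rel: "equiv (stable_wgraphs g) (wgraph_rel g)"
proof (rule equivI)
  show "refl_on (stable_wgraphs g) (wgraph_rel g)"
    unfolding refl_on_def wgraph_rel_def using wgraph_iso_id by blast
  show "sym (wgraph_rel g)"
    unfolding sym_def wgraph_rel_def using wgraph_iso_inverse stable_wgraphs_wf by blast
  show "trans (wgraph_rel g)"
    unfolding trans_def wgraph_rel_def using wgraph_iso_compose by blast
qed (auto simp: wgraph_rel_def)

lemma equiv_marked_rel: "equiv (marked_graphs g) (marked_rel g)"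
proof (rule equivI)
  show "refl_on (marked_graphs g) (marked_rel g)"
    unfolding refl_on_def marked_rel_def using marked_iso_refl marked_graphs_iff by blast
  show "sym (marked_rel g)"
    unfolding sym_def marked_rel_def using marked_iso_sym marked_graphs_iff by blast
  show "trans (marked_rel g)"
    unfolding trans_def marked_rel_def using marked_iso_trans marked_graphs_iff by blast
qed (auto simp: marked_rel_def)

lemma representative_class:
  assumes eq: "equiv A r" and X: "X \<in> A"
  shows "(X, representative (r `` {X})) \<in> r" "r `` {representative (r `` {X})} = r `` {X}"
proof -
  have "X \<in> r `` {X}" using equiv_class_self[OF eq X] .
  then have "representative (r `` {X}) \<in> r `` {X}" unfolding representative_def by (rule someI)
  then show 1: "(X, representative (r `` {X})) \<in> r" by blast
  show "r `` {representative (r `` {X})} = r `` {X}" using equiv_class_eq[OF eq 1] by simp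
qed

lemma marked_classes:
  assumes X: "X \<in> marked_class P g"
  defines "c \<equiv> marked_rel g `` {X}"
  shows "representative c \<in> marked_class P g" "marked_rel g `` {representative c} = c"
    and "\<exists>fE. marked_iso g X (representative c) fE"
proof -
  have XM: "X \<in> marked_graphs g" using X by (simp add: marked_class_def)
  note r = representative_class[OF equiv_marked_rel XM, folded c_def]
  show "marked_rel g `` {representative c} = c" using r(2) .
  show iso: "\<exists>fE. marked_iso g X (representative c) fE" using r(1) by (auto simp: marked_rel_def)
  have R: "representative c \<in> marked_graphs g" using r(1) by (auto simp: marked_rel_def)
  obtain fV fE where "wgraph_iso (fst X) (fst (representative c)) fV fE"
    using iso marked_iso_wgraph_iso XM R marked_graphs_iff by blast
  then show "representative c \<in> marked_class P g"
    using R X pure_wgraph_iso[of "fst X" "fst (representative c)"] by (auto simp: marked_class_def)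
qed

lemma marked_cell:
  assumes "c \<in> marked_class P g // marked_rel g"
  shows "representative c \<in> marked_class P g" "marked_rel g `` {representative c} = c"
proof -
  obtain X where "X \<in> marked_class P g" "c = marked_rel g `` {X}" using assms by (rule quotientE)
  then show "representative c \<in> marked_class P g" "marked_rel g `` {representative c} = c"
    using marked_classes(1,2) by simp_all
qed

lemma wgraph_classes:
  assumes Y: "Y \<in> wgraph_class P g"
  defines "C \<equiv> wgraph_rel g `` {Y}"
  shows "representative C \<in> wgraph_class P g" "wgraph_rel g `` {representative C} = C"
    and "\<exists>fV fE. wgraph_iso Y (representative C) fV fE"
proof -
  have YM: "Y \<in> stable_wgraphs g" using Y by (simp add: wgraph_class_def)
  note r = representative_class[OF equiv_wgraph_rel YM, folded C_def]
  show "wgraph_rel g `` {representative C} = C" using r(2) .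
  show iso: "\<exists>fV fE. wgraph_iso Y (representative C) fV fE" using r(1) by (auto simp: wgraph_rel_def)
  have R: "representative C \<in> stable_wgraphs g" using r(1) by (auto simp: wgraph_rel_def)
  moreover obtain fV fE where "wgraph_iso Y (representative C) fV fE" using iso by blast
  ultimately show "representative C \<in> wgraph_class P g"
    using Y pure_wgraph_iso[of Y "representative C"] by (auto simp: wgraph_class_def)
qed

lemma wgraph_cell:
  assumes "C \<in> wgraph_class P g // wgraph_rel g"
  shows "representative C \<in> wgraph_class P g" "wgraph_rel g `` {representative C} = C"
proof -
  obtain Y where "Y \<in> wgraph_class P g" "C = wgraph_rel g `` {Y}" using assms by (rule quotientE)
  then show "representative C \<in> wgraph_class P g" "wgraph_rel g `` {representative C} = C"
    using wgraph_classes(1,2) by simp_all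
qed

lemma marked_class_props:
  assumes "X \<in> marked_class P g"
  shows "well_marked g X" "fst X \<in> wgraph_class P g" "wf_digraph (fst (fst X))" "finite (arcs (fst (fst X)))"
    "is_marking g (fst X) (snd X)"
  using assms stable_wgraphs_wf[of "fst X" g] by (auto simp: marked_class_def marked_graphs_iff wgraph_class_def well_marked_def)

lemma wgraph_class_props:
  assumes "Y \<in> wgraph_class P g"
  shows "wf_digraph (fst Y)" "finite (arcs (fst Y))" "\<exists>h. is_marking g Y h"
  using assms stable_wgraphs_wf[of Y g] marking_exists[of Y g] by (auto simp: wgraph_class_def)

lemma marked_class_iso:
  assumes "X \<in> marked_class P g" "X' \<in> marked_class P g" "marked_iso g X X' fE"
  shows "marked_rel g `` {X} = marked_rel g `` {X'}"
  using assms by (intro equiv_class_eq[OF equiv_marked_rel]) (auto simp: marked_rel_def marked_class_def)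

lemma wgraph_class_iso:
  assumes "Y \<in> wgraph_class P g" "Y' \<in> wgraph_class P g" "wgraph_iso Y Y' fV fE"
  shows "wgraph_rel g `` {Y} = wgraph_rel g `` {Y'}"
  using assms by (intro equiv_class_eq[OF equiv_wgraph_rel]) (auto simp: wgraph_rel_def wgraph_class_def)

lemma marked_class_action: "X \<in> marked_class P g \<Longrightarrow> \<alpha> \<in> auto (Fg g) \<Longrightarrow> marked_action g X \<alpha> \<in> marked_class P g"
  using well_marked_action by (simp add: marked_class_def marked_graphs_iff)

section \<open>The action of outer automorphisms on cells and cones\<close>

context
  fixes P :: bool and g :: nat
begin

abbreviation (input) "tcells \<equiv> marked_class P g // marked_rel g"
abbreviation (input) "mcells \<equiv> wgraph_class P g // wgraph_rel g"
abbreviation (input) "rep \<equiv> (representative :: marked set \<Rightarrow> marked)"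
abbreviation (input) "wrep \<equiv> (representative :: wgraph set \<Rightarrow> wgraph)"
abbreviation (input) "OutF \<equiv> Out (Fg g)"

lemmas tcell_props = marked_class_props[OF marked_cell(1)]
lemmas mcell_props = wgraph_class_props[OF wgraph_cell(1)]

lemma glue_step_teich_iff:
  "((c, x), (d, y)) \<in> glue_step (teich_fan P g) \<longleftrightarrow> c \<in> tcells \<and> x \<in> graph_cone P (mgraph c) \<and> d \<in> tcells \<and>
     y \<in> graph_cone P (mgraph d) \<and> (\<exists>\<iota>. contracts_to P g (rep d) (rep c) \<iota> \<and>
       y = face_inclusion (arcs (mgraph c)) (arcs (mgraph d)) \<iota> x)"
  by (auto simp: glue_step_def cone_points_def)

text \<open>The automorphisms listed separately in \<open>moduli_face_maps\<close> are
  specializations with nothing contracted, so one form of generator covers both kinds.\<close>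

lemma glue_step_moduli_iff:
  "((C, x), (D, y)) \<in> glue_step (moduli_fan P g) \<longleftrightarrow> C \<in> mcells \<and> x \<in> graph_cone P (wgraph_of C) \<and> D \<in> mcells \<and>
     y \<in> graph_cone P (wgraph_of D) \<and> (\<exists>\<iota>. wgraph_specializes (wrep D) (wrep C) \<iota> \<and>
       y = face_inclusion (arcs (wgraph_of C)) (arcs (wgraph_of D)) \<iota> x)"
  (is "?L \<longleftrightarrow> ?R")
proof
  assume ?L
  then obtain L where L: "C \<in> mcells" "x \<in> graph_cone P (wgraph_of C)" "D \<in> mcells" "y \<in> graph_cone P (wgraph_of D)"
    "L \<in> moduli_face_maps C D" "y = L x"
    by (auto simp: glue_step_def cone_points_def)
  then show ?R
    using wgraph_specializes_iso[of "wrep C" "wrep C"] unfolding moduli_face_maps_def by blast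
next
  assume ?R
  then show ?L unfolding glue_step_def cone_points_def by (auto simp: moduli_face_maps_def)
qed

text \<open>Two isomorphisms to the representative differ by an automorphism of it, which contracts
  nothing and therefore gives a face map. The ambiguity in the chosen isomorphisms of marked graphs
  is absorbed here.\<close>

lemma glue_marked_iso:
  assumes d: "d \<in> tcells" and Z: "well_marked g Z"
    and F: "marked_iso g Z (rep d) F" and E: "marked_iso g Z (rep d) E" and x: "x \<in> graph_cone P (fst (fst Z))"
  shows "((d, face_inclusion (arcs (fst (fst Z))) (arcs (mgraph d)) F x),
     (d, face_inclusion (arcs (fst (fst Z))) (arcs (mgraph d)) E x)) \<in> glue (teich_fan P g)"
proof -
  let ?A = "arcs (fst (fst Z))" and ?B = "arcs (mgraph d)"
  note D = tcell_props[OF d]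
  obtain fV fV' where iso: "wgraph_iso (fst Z) (fst (rep d)) fV F" "wgraph_iso (fst Z) (fst (rep d)) fV' E"
    using marked_iso_wgraph_iso[OF Z D(1)] F E by blast
  have wf: "wf_digraph (fst (fst Z))" using Z by (simp add: well_marked_def)
  let ?\<iota> = "E \<circ> inv_into ?A F"
  have "marked_iso g (rep d) (rep d) ?\<iota>"
    using marked_iso_trans[OF D(1) Z D(1) marked_iso_sym[OF Z D(1) F] E] .
  \<comment> \<open>The empty set contains no cycle, so this step is allowed in the pure case
    too.\<close>
  then have "contracts_to P g (rep d) (rep d) ?\<iota>"
    unfolding contracts_to_iff by (intro exI[of _ "[]"]) (auto simp: contains_cycle_def)
  moreover have "face_inclusion ?B ?B ?\<iota> (face_inclusion ?A ?B F x) = face_inclusion ?A ?B E x"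
  proof -
    have "face_inclusion ?B ?B (E \<circ> id \<circ> inv_into ?A F) (face_inclusion ?A ?B F x) = face_inclusion ?A ?B E (face_inclusion ?A ?A id x)"
      using wgraph_iso_bij[OF iso(1)] wgraph_iso_bij[OF iso(2)] by (intro face_inclusion_transport) (auto simp: bij_betw_def)
    then show ?thesis using face_inclusion_id[OF graph_cone_extensional[OF x]] by simp
  qed
  ultimately have "((d, face_inclusion ?A ?B F x), (d, face_inclusion ?A ?B E x)) \<in> glue_step (teich_fan P g)"
    unfolding glue_step_teich_iff
    using d face_inclusion_in_cone[OF iso(1) wf D(3) x] face_inclusion_in_cone[OF iso(2) wf D(3) x]
    by (intro conjI exI[of _ ?\<iota>]) simp_all
  then show ?thesis using glue_step_subset by blast
qed

text \<open>The unmarked counterpart, which absorbs the choice in \<open>forget_edges\<close> and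
  the freedom in \<open>forget_marking\<close>.\<close>

lemma glue_wgraph_iso:
  assumes D: "D \<in> mcells" and wf: "wf_digraph (fst Z)"
    and F: "wgraph_iso Z (wrep D) fV F" and E: "wgraph_iso Z (wrep D) fV' E" and x: "x \<in> graph_cone P (fst Z)"
  shows "((D, face_inclusion (arcs (fst Z)) (arcs (wgraph_of D)) F x),
     (D, face_inclusion (arcs (fst Z)) (arcs (wgraph_of D)) E x)) \<in> glue (moduli_fan P g)"
proof -
  let ?A = "arcs (fst Z)" and ?B = "arcs (wgraph_of D)"
  let ?\<iota> = "E \<circ> inv_into ?A F"
  note Dp = mcell_props[OF D]
  have "wgraph_specializes (wrep D) (wrep D) ?\<iota>"
    using wgraph_specializes_iso[OF wgraph_iso_compose[OF wgraph_iso_inverse[OF F wf] E]] .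
  moreover have "face_inclusion ?B ?B ?\<iota> (face_inclusion ?A ?B F x) = face_inclusion ?A ?B E x"
  proof -
    have "face_inclusion ?B ?B (E \<circ> id \<circ> inv_into ?A F) (face_inclusion ?A ?B F x) = face_inclusion ?A ?B E (face_inclusion ?A ?A id x)"
      using wgraph_iso_bij[OF F] wgraph_iso_bij[OF E] by (intro face_inclusion_transport) (auto simp: bij_betw_def)
    then show ?thesis using face_inclusion_id[OF graph_cone_extensional[OF x]] by simp
  qed
  ultimately have "((D, face_inclusion ?A ?B F x), (D, face_inclusion ?A ?B E x)) \<in> glue_step (moduli_fan P g)"
    unfolding glue_step_moduli_iff
    using D face_inclusion_in_cone[OF F wf Dp(1) x] face_inclusion_in_cone[OF E wf Dp(1) x]
    by (intro conjI exI[of _ ?\<iota>]) simp_all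
  then show ?thesis using glue_step_subset by blast
qed

text \<open>Gives a name to the choice made inside \<open>out_map\<close>.\<close>

definition out_edges :: "marked set \<Rightarrow> ((real \<Rightarrow> (unit, nat) gpoint) set \<Rightarrow> (real \<Rightarrow> (unit, nat) gpoint) set) set \<Rightarrow> nat \<Rightarrow> nat" where
  "out_edges c A = (SOME fE. \<exists>\<alpha>\<in>A. marked_iso g (marked_action g (rep c) \<alpha>) (rep (out_cell g c A)) fE)"

text \<open>The union in \<open>out_cell\<close> ranges over all marked graphs in the class and all
  automorphisms in the outer class; its members coincide by
  \<open>marked_iso_action\<close>.\<close>

lemma out_cell:
  assumes c: "c \<in> tcells" and A: "A \<in> carrier OutF" "\<alpha> \<in> A"
  shows "out_cell g c A = marked_rel g `` {marked_action g (rep c) \<alpha>}" "out_cell g c A \<in> tcells"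
proof -
  note R = marked_cell[OF c]
  have auto: "A \<subseteq> auto (Fg g)" using group.Out_subset_auto[OF group_Fg A(1)] .
  have RM: "rep c \<in> marked_graphs g" using R(1) by (simp add: marked_class_def)
  have "marked_rel g `` {marked_action g X \<beta>} = marked_rel g `` {marked_action g (rep c) \<alpha>}" if X: "X \<in> c" "\<beta> \<in> A" for X \<beta>
  proof (rule sym, rule equiv_class_eq[OF equiv_marked_rel])
    have "(rep c, X) \<in> marked_rel g" using X(1) R(2) by blast
    then obtain fE where X': "X \<in> marked_graphs g" "marked_iso g (rep c) X fE" by (auto simp: marked_rel_def)
    then have "marked_iso g (marked_action g (rep c) \<alpha>) (marked_action g X \<beta>) fE"
      using RM by (intro marked_iso_action[OF _ _ _ A X(2)]) (auto simp: marked_graphs_iff)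
    then show "(marked_action g (rep c) \<alpha>, marked_action g X \<beta>) \<in> marked_rel g"
      using X' RM subsetD[OF auto A(2)] subsetD[OF auto X(2)]
      by (auto simp: marked_rel_def marked_graphs_iff intro!: well_marked_action)
  qed
  moreover have "rep c \<in> c" using R RM equiv_class_self[OF equiv_marked_rel RM] by simp
  ultimately show eq: "out_cell g c A = marked_rel g `` {marked_action g (rep c) \<alpha>}"
    unfolding out_cell_def using A(2) by blast
  show "out_cell g c A \<in> tcells" unfolding eq using marked_class_action[OF R(1)] auto A by (intro quotientI) auto
qed

text \<open>The choice provides an edge map for some member of \<open>A\<close>. Any other member
  changes the marking by a homotopy, hence by the identity on edges, so the same edge map works for
  it.\<close>

lemma out_edges:
  assumes c: "c \<in> tcells" and A: "A \<in> carrier OutF" "\<alpha> \<in> A"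
  shows "marked_iso g (marked_action g (rep c) \<alpha>) (rep (out_cell g c A)) (out_edges c A)"
proof -
  have auto: "A \<subseteq> auto (Fg g)" using group.Out_subset_auto[OF group_Fg A(1)] .
  note R = marked_class_action[OF marked_cell(1)[OF c]]
  have "\<exists>fE. marked_iso g (marked_action g (rep c) \<alpha>) (rep (out_cell g c A)) fE"
    unfolding out_cell(1)[OF c A] using marked_classes(3)[OF R] auto A by blast
  then have "\<exists>fE. \<exists>\<alpha>\<in>A. marked_iso g (marked_action g (rep c) \<alpha>) (rep (out_cell g c A)) fE" using A by blast
  from someI_ex[OF this] obtain \<beta> where \<beta>: "\<beta> \<in> A" "marked_iso g (marked_action g (rep c) \<beta>) (rep (out_cell g c A)) (out_edges c A)"
    unfolding out_edges_def[symmetric] by blast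
  note W = tcell_props(1)[OF c]
  have "marked_iso g (marked_action g (rep c) \<alpha>) (marked_action g (rep c) \<beta>) id"
    using marked_iso_action[OF W W marked_iso_refl[OF W] A \<beta>(1)] .
  from marked_iso_trans[OF _ _ _ this \<beta>(2)] show ?thesis
    using well_marked_action[OF W] auto A \<beta>(1) tcell_props(1)[OF out_cell(2)[OF c A]] by (simp add: subset_iff)
qed

lemma out_map_eq: "out_map g c A = face_inclusion (arcs (mgraph c)) (arcs (mgraph (out_cell g c A))) (out_edges c A)"
  by (simp add: out_map_def out_edges_def)

lemma out_edges_wgraph:
  assumes c: "c \<in> tcells" and A: "A \<in> carrier OutF"
  shows "\<exists>fV. wgraph_iso (fst (rep c)) (fst (rep (out_cell g c A))) fV (out_edges c A)"
proof -
  obtain \<alpha> where \<alpha>: "\<alpha> \<in> A" using group.Out_nonempty[OF group_Fg A] by blast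
  then have "\<alpha> \<in> auto (Fg g)" using group.Out_subset_auto[OF group_Fg A] by blast
  from marked_iso_wgraph_iso[OF well_marked_action[OF tcell_props(1)[OF c] this] tcell_props(1)[OF out_cell(2)[OF c A \<alpha>]] out_edges[OF c A \<alpha>]]
  show ?thesis by simp
qed

lemma out_cell_closed: "c \<in> tcells \<Longrightarrow> A \<in> carrier OutF \<Longrightarrow> out_cell g c A \<in> tcells"
  using out_cell(2) group.Out_nonempty[OF group_Fg] by blast

lemma action_one: "well_marked g X \<Longrightarrow> marked_iso g (marked_action g X (\<lambda>x\<in>carrier (Fg g). x)) X id"
proof -
  assume X: "well_marked g X"
  have a: "(\<lambda>x\<in>carrier (Fg g). x) \<in> auto (Fg g)" using group.id_in_auto[OF group_Fg] .
  have c: "continuous_map (rose_space g) (vrealization (fst X)) (snd X)" using X marking_continuous by (auto simp: well_marked_def)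
  have "homotopic_with (\<lambda>_. True) (rose_space g) (vrealization (fst X)) (snd X \<circ> rose_map g (\<lambda>x\<in>carrier (Fg g). x)) (snd X \<circ> id)"
    using rose_map_one c by (rule homotopic_with_compose_continuous_map_left) simp
  from marked_iso_homotopic(1)[OF well_marked_action[OF X a, unfolded marked_action_def] this]
  show ?thesis by (simp add: marked_action_def)
qed

lemma action_mult:
  assumes X: "well_marked g X" and ab: "\<alpha> \<in> auto (Fg g)" "\<beta> \<in> auto (Fg g)"
  shows "marked_iso g (marked_action g (marked_action g X \<alpha>) \<beta>) (marked_action g X (compose (carrier (Fg g)) \<alpha> \<beta>)) id"
proof -
  have c: "continuous_map (rose_space g) (vrealization (fst X)) (snd X)" using X marking_continuous by (auto simp: well_marked_def)
  have "homotopic_with (\<lambda>_. True) (rose_space g) (vrealization (fst X)) (snd X \<circ> (rose_map g \<alpha> \<circ> rose_map g \<beta>))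
      (snd X \<circ> rose_map g (compose (carrier (Fg g)) \<alpha> \<beta>))"
    using rose_map_compose[OF ab] c by (rule homotopic_with_compose_continuous_map_left) simp
  then have "homotopic_with (\<lambda>_. True) (rose_space g) (vrealization (fst X)) (snd X \<circ> rose_map g \<alpha> \<circ> rose_map g \<beta>)
      (snd X \<circ> rose_map g (compose (carrier (Fg g)) \<alpha> \<beta>))"
    by (simp add: comp_assoc)
  from marked_iso_homotopic(1)[OF _ this]
  show ?thesis using well_marked_action[OF well_marked_action[OF X ab(1)] ab(2)] by (simp add: marked_action_def)
qed

lemma out_one: "\<one>\<^bsub>OutF\<^esub> \<in> carrier OutF"
  using group.group_Out[OF group_Fg] by (simp add: group.is_monoid)

lemma out_mult: "A \<in> carrier OutF \<Longrightarrow> B \<in> carrier OutF \<Longrightarrow> A \<otimes>\<^bsub>OutF\<^esub> B \<in> carrier OutF"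
  using group.group_Out[OF group_Fg] by (simp add: group.is_monoid monoid.m_closed)

lemma out_cell_one:
  assumes c: "c \<in> tcells"
  shows "out_cell g c \<one>\<^bsub>OutF\<^esub> = c"
proof -
  note a = group.Out_one[OF group_Fg, of g]
  have "marked_rel g `` {marked_action g (rep c) (\<lambda>x\<in>carrier (Fg g). x)} = marked_rel g `` {rep c}"
    by (rule marked_class_iso[OF marked_class_action[OF marked_cell(1)[OF c] group.id_in_auto[OF group_Fg]] marked_cell(1)[OF c]
          action_one[OF tcell_props(1)[OF c]]])
  then show ?thesis using out_cell(1)[OF c out_one a] marked_cell(2)[OF c] by simp
qed

text \<open>Acting by \<open>\<alpha>\<close> and then by \<open>\<beta>\<close> precomposes with
  \<open>rose_map g \<alpha> \<circ> rose_map g \<beta>\<close>, which realizes the composite of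
  \<open>\<alpha>\<close> after \<open>\<beta>\<close>; hence this is a right action for the product
  of \<open>Out\<close>.\<close>

lemma out_action_mult:
  assumes c: "c \<in> tcells" and A: "A \<in> carrier OutF" "\<alpha> \<in> A" and B: "B \<in> carrier OutF" "\<beta> \<in> B"
  shows "marked_iso g (marked_action g (marked_action g (rep c) \<alpha>) \<beta>) (rep (out_cell g (out_cell g c A) B))
      (out_edges (out_cell g c A) B \<circ> out_edges c A)"
    and "out_cell g (out_cell g c A) B = out_cell g c (A \<otimes>\<^bsub>OutF\<^esub> B)"
proof -
  note c1 = out_cell(2)[OF c A] and c2 = out_cell(2)[OF out_cell(2)[OF c A] B]
  have ab: "\<alpha> \<in> auto (Fg g)" "\<beta> \<in> auto (Fg g)" using group.Out_subset_auto[OF group_Fg] A B by blast+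
  note W = well_marked_action[OF tcell_props(1)[OF c] ab(1)] tcell_props(1)[OF c1] tcell_props(1)[OF c2]
  note W2 = well_marked_action[OF W(1) ab(2)] well_marked_action[OF W(2) ab(2)]
  show iso: "marked_iso g (marked_action g (marked_action g (rep c) \<alpha>) \<beta>) (rep (out_cell g (out_cell g c A) B))
      (out_edges (out_cell g c A) B \<circ> out_edges c A)"
    by (rule marked_iso_trans[OF W2 W(3) marked_iso_action[OF W(1,2) out_edges[OF c A] B B(2)] out_edges[OF c1 B]])
  let ?m = "compose (carrier (Fg g)) \<alpha> \<beta>"
  have m: "?m \<in> A \<otimes>\<^bsub>OutF\<^esub> B" using group.Out_mult[OF group_Fg A(1) B(1) A(2) B(2)] .
  have m': "?m \<in> auto (Fg g)" using compose_auto[OF ab] .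
  note R = marked_cell(1)[OF c]
  have "out_cell g c (A \<otimes>\<^bsub>OutF\<^esub> B) = marked_rel g `` {marked_action g (rep c) ?m}"
    using out_cell(1)[OF c out_mult[OF A(1) B(1)] m] .
  also have "\<dots> = marked_rel g `` {marked_action g (marked_action g (rep c) \<alpha>) \<beta>}"
    by (rule marked_class_iso[where P = P, symmetric, OF _ _ action_mult[OF tcell_props(1)[OF c] ab]]) (intro marked_class_action R ab m')+
  also have "\<dots> = marked_rel g `` {rep (out_cell g (out_cell g c A) B)}"
    by (rule marked_class_iso[where P = P, OF _ _ iso]) (intro marked_class_action R ab marked_cell(1)[OF c2])+
  also have "\<dots> = out_cell g (out_cell g c A) B" using marked_cell(2)[OF c2] .
  finally show "out_cell g (out_cell g c A) B = out_cell g c (A \<otimes>\<^bsub>OutF\<^esub> B)" by simp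
qed

end

section \<open>The projection that forgets the marking\<close>

definition forget_cell :: "nat \<Rightarrow> marked set \<Rightarrow> wgraph set" where
  "forget_cell g c = wgraph_rel g `` {fst (rep c)}"

definition forget_edges :: "nat \<Rightarrow> marked set \<Rightarrow> nat \<Rightarrow> nat" where
  "forget_edges g c = (SOME fE. \<exists>fV. wgraph_iso (fst (rep c)) (wrep (forget_cell g c)) fV fE)"

definition forget_map :: "nat \<Rightarrow> marked set \<Rightarrow> (nat \<Rightarrow> real) \<Rightarrow> nat \<Rightarrow> real" where
  "forget_map g c = face_inclusion (arcs (mgraph c)) (arcs (wgraph_of (forget_cell g c))) (forget_edges g c)"

lemma forget_cell:
  assumes c: "c \<in> tcells P g"
  shows "forget_cell g c \<in> mcells P g" "\<exists>fV. wgraph_iso (fst (rep c)) (wrep (forget_cell g c)) fV (forget_edges g c)"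
proof -
  note Y = tcell_props(2)[OF c]
  show "forget_cell g c \<in> mcells P g" unfolding forget_cell_def using Y by (rule quotientI)
  have "\<exists>fE fV. wgraph_iso (fst (rep c)) (wrep (forget_cell g c)) fV fE"
    using wgraph_classes(3)[OF Y] unfolding forget_cell_def by blast
  then show "\<exists>fV. wgraph_iso (fst (rep c)) (wrep (forget_cell g c)) fV (forget_edges g c)"
    unfolding forget_edges_def by (rule someI_ex)
qed

lemma forget_cell_eqI:
  assumes c: "c \<in> tcells P g" and d: "d \<in> tcells P g" and iso: "wgraph_iso (fst (rep c)) (fst (rep d)) fV fE"
  shows "forget_cell g c = forget_cell g d"
  unfolding forget_cell_def using wgraph_class_iso[OF tcell_props(2)[OF c] tcell_props(2)[OF d] iso] .

lemma forget_cell_out: "c \<in> tcells P g \<Longrightarrow> A \<in> carrier (OutF g) \<Longrightarrow> forget_cell g (out_cell g c A) = forget_cell g c"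
  using forget_cell_eqI[OF _ out_cell_closed] out_edges_wgraph by metis

text \<open>Every stable weighted graph carries a marking, and the class of the graph so marked lies
  above \<open>C\<close>.\<close>

lemma forget_cell_surj:
  assumes C: "C \<in> mcells P g"
  shows "\<exists>c\<in>tcells P g. forget_cell g c = C"
proof -
  note R = wgraph_cell[OF C]
  obtain h where h: "is_marking g (wrep C) h" using wgraph_class_props(3)[OF R(1)] by blast
  have X: "(wrep C, h) \<in> marked_class P g"
    using R(1) h by (auto simp: marked_class_def wgraph_class_def marked_graphs_def)
  let ?c = "marked_rel g `` {(wrep C, h)}"
  have c: "?c \<in> tcells P g" using X by (rule quotientI)
  obtain fE where "marked_iso g (wrep C, h) (rep ?c) fE" using marked_classes(3)[OF X] by blast
  from marked_iso_wgraph_iso[OF marked_class_props(1)[OF X] tcell_props(1)[OF c] this]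
  obtain fV where "wgraph_iso (wrep C) (fst (rep ?c)) fV fE" by auto
  from wgraph_class_iso[OF R(1) tcell_props(2)[OF c] this] have "forget_cell g ?c = C"
    using R(2) by (simp add: forget_cell_def)
  then show ?thesis using c by blast
qed

lemma Out_coset:
  assumes "\<alpha> \<in> auto (Fg g)"
  shows "\<exists>A\<in>carrier (OutF g). \<alpha> \<in> A"
  using group.auto_in_coset_Inn[OF group_Fg assms] assms unfolding group.carrier_Out[OF group_Fg] by blast

text \<open>Equal images mean isomorphic underlying graphs, and then some automorphism of the free
  group carries one marking to the other.\<close>

lemma forget_cell_orbit:
  assumes c: "c \<in> tcells P g" and d: "d \<in> tcells P g" and eq: "forget_cell g c = forget_cell g d"
  shows "d \<in> out_cell g c ` carrier (OutF g)"
proof -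
  obtain fV fV' where f: "wgraph_iso (fst (rep c)) (wrep (forget_cell g c)) fV (forget_edges g c)"
    "wgraph_iso (fst (rep d)) (wrep (forget_cell g c)) fV' (forget_edges g d)"
    using forget_cell(2)[OF c] forget_cell(2)[OF d] eq by auto
  obtain \<alpha> where \<alpha>: "\<alpha> \<in> auto (Fg g)"
    "marked_iso g (marked_action g (rep c) \<alpha>) (rep d) (inv_into (arcs (mgraph d)) (forget_edges g d) \<circ> forget_edges g c)"
    using marked_action_transitive[OF tcell_props(1)[OF c] tcell_props(1)[OF d]
        wgraph_iso_compose[OF f(1) wgraph_iso_inverse[OF f(2) tcell_props(3)[OF d]]]] by blast
  obtain A where A: "A \<in> carrier (OutF g)" "\<alpha> \<in> A" using Out_coset[OF \<alpha>(1)] by blast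
  have "out_cell g c A = marked_rel g `` {marked_action g (rep c) \<alpha>}" using out_cell(1)[OF c A] .
  also have "\<dots> = marked_rel g `` {rep d}"
    by (rule marked_class_iso[OF marked_class_action[OF marked_cell(1)[OF c] \<alpha>(1)] marked_cell(1)[OF d] \<alpha>(2)])
  also have "\<dots> = d" using marked_cell(2)[OF d] .
  finally show ?thesis using A(1) by blast
qed

text \<open>The action commutes with contraction, and passing to the chosen representatives
  conjugates the inclusion of edges; the result is again a generating step.\<close>

lemma out_map_step:
  assumes A: "A \<in> carrier (OutF g)" and st: "((c, x), (d, y)) \<in> glue_step (teich_fan P g)"
  shows "((out_cell g c A, out_map g c A x), (out_cell g d A, out_map g d A y)) \<in> glue (teich_fan P g)"
proof -
  obtain \<iota> where \<iota>: "c \<in> tcells P g" "x \<in> graph_cone P (mgraph c)" "d \<in> tcells P g" "y \<in> graph_cone P (mgraph d)"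
    "contracts_to P g (rep d) (rep c) \<iota>" "y = face_inclusion (arcs (mgraph c)) (arcs (mgraph d)) \<iota> x"
    using st unfolding glue_step_teich_iff by blast
  obtain \<alpha> where \<alpha>: "\<alpha> \<in> A" using group.Out_nonempty[OF group_Fg A] by blast
  then have a: "\<alpha> \<in> auto (Fg g)" using group.Out_subset_auto[OF group_Fg A] by blast
  note c = tcell_props[OF \<iota>(1)] and d = tcell_props[OF \<iota>(3)]
  note c' = out_cell(2)[OF \<iota>(1) A \<alpha>] and d' = out_cell(2)[OF \<iota>(3) A \<alpha>]
  let ?Ec = "out_edges g c A" and ?Ed = "out_edges g d A"
  have "contracts_to P g (rep (out_cell g d A)) (rep (out_cell g c A)) (?Ed \<circ> \<iota> \<circ> inv_into (arcs (mgraph c)) ?Ec)"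
    using contracts_to_transport[OF contracts_to_action[OF \<iota>(5) d(1) c(1) A \<alpha>] out_edges[OF \<iota>(3) A \<alpha>] out_edges[OF \<iota>(1) A \<alpha>]
        well_marked_action[OF d(1) a] well_marked_action[OF c(1) a] tcell_props(1)[OF d'] tcell_props(1)[OF c']] by simp
  moreover obtain fV fV' where iso: "wgraph_iso (fst (rep c)) (fst (rep (out_cell g c A))) fV ?Ec"
    "wgraph_iso (fst (rep d)) (fst (rep (out_cell g d A))) fV' ?Ed"
    using out_edges_wgraph[OF \<iota>(1) A] out_edges_wgraph[OF \<iota>(3) A] by blast
  moreover have "out_map g d A y = face_inclusion (arcs (mgraph (out_cell g c A))) (arcs (mgraph (out_cell g d A)))
      (?Ed \<circ> \<iota> \<circ> inv_into (arcs (mgraph c)) ?Ec) (out_map g c A x)"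
    unfolding out_map_eq \<iota>(6)
    using wgraph_iso_bij[OF iso(1)] wgraph_iso_bij[OF iso(2)] wgraph_specializes_arcs[OF contracts_to_wgraph[OF \<iota>(5) d(1) c(1)]]
    by (intro face_inclusion_transport[symmetric]) (auto simp: bij_betw_def)
  ultimately have "((out_cell g c A, out_map g c A x), (out_cell g d A, out_map g d A y)) \<in> glue_step (teich_fan P g)"
    unfolding glue_step_teich_iff
    using c' d' face_inclusion_in_cone[OF iso(1) c(3) tcell_props(3)[OF c'] \<iota>(2)]
      face_inclusion_in_cone[OF iso(2) d(3) tcell_props(3)[OF d'] \<iota>(4)]
    by (auto simp: out_map_eq)
  then show ?thesis using glue_step_subset by blast
qed

text \<open>\<open>out_map\<close> by the neutral element relabels by some automorphism of the
  representative, which may differ from the identity.\<close>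

lemma out_map_one:
  assumes c: "c \<in> tcells P g" and x: "x \<in> graph_cone P (mgraph c)"
  shows "((c, out_map g c \<one>\<^bsub>OutF g\<^esub> x), (c, x)) \<in> glue (teich_fan P g)"
proof -
  let ?e = "\<lambda>x\<in>carrier (Fg g). x"
  note W = tcell_props(1)[OF c]
  have a: "?e \<in> auto (Fg g)" using group.id_in_auto[OF group_Fg] .
  note W' = well_marked_action[OF W a]
  have "marked_iso g (marked_action g (rep c) ?e) (rep c) (out_edges g c \<one>\<^bsub>OutF g\<^esub>)"
    using out_edges[OF c out_one group.Out_one[OF group_Fg]] out_cell_one[OF c] by simp
  from glue_marked_iso[OF c W' this action_one[OF W]] x
  have "((c, face_inclusion (arcs (mgraph c)) (arcs (mgraph c)) (out_edges g c \<one>\<^bsub>OutF g\<^esub>) x),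
      (c, face_inclusion (arcs (mgraph c)) (arcs (mgraph c)) id x)) \<in> glue (teich_fan P g)"
    by simp
  then show ?thesis
    using out_cell_one[OF c] face_inclusion_id[OF graph_cone_extensional[OF x]] by (simp add: out_map_eq)
qed

text \<open>Both edge maps belong to isomorphisms from one marked graph, acted on by
  \<open>\<alpha>\<close> and \<open>\<beta>\<close>, to one representative, so
  \<open>glue_marked_iso\<close> applies.\<close>

lemma out_map_mult:
  assumes c: "c \<in> tcells P g" and x: "x \<in> graph_cone P (mgraph c)" and A: "A \<in> carrier (OutF g)" and B: "B \<in> carrier (OutF g)"
  shows "((out_cell g c (A \<otimes>\<^bsub>OutF g\<^esub> B), out_map g (out_cell g c A) B (out_map g c A x)),
     (out_cell g c (A \<otimes>\<^bsub>OutF g\<^esub> B), out_map g c (A \<otimes>\<^bsub>OutF g\<^esub> B) x)) \<in> glue (teich_fan P g)"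
proof -
  obtain \<alpha> \<beta> where ab: "\<alpha> \<in> A" "\<beta> \<in> B" using group.Out_nonempty[OF group_Fg] A B by metis
  have auto: "\<alpha> \<in> auto (Fg g)" "\<beta> \<in> auto (Fg g)" using group.Out_subset_auto[OF group_Fg] A B ab by blast+
  let ?AB = "A \<otimes>\<^bsub>OutF g\<^esub> B" and ?m = "compose (carrier (Fg g)) \<alpha> \<beta>"
  have m: "?m \<in> ?AB" using group.Out_mult[OF group_Fg A B ab] .
  have AB: "?AB \<in> carrier (OutF g)" using out_mult[OF A B] .
  note c1 = out_cell(2)[OF c A ab(1)] and c2 = out_cell(2)[OF c AB m]
  note M = out_action_mult[OF c A ab(1) B ab(2)]
  note W = tcell_props(1)[OF c]
  note W' = well_marked_action[OF W compose_auto[OF auto]] and W'' = well_marked_action[OF well_marked_action[OF W auto(1)] auto(2)]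
  let ?F = "out_edges g (out_cell g c A) B \<circ> out_edges g c A" and ?E = "out_edges g c ?AB"
  have "marked_iso g (marked_action g (marked_action g (rep c) \<alpha>) \<beta>) (rep (out_cell g c ?AB)) (?E \<circ> id)"
    by (rule marked_iso_trans[OF W'' W' tcell_props(1)[OF c2] action_mult[OF W auto] out_edges[OF c AB m]])
  then have E: "marked_iso g (marked_action g (marked_action g (rep c) \<alpha>) \<beta>) (rep (out_cell g c ?AB)) ?E" by simp
  have F: "marked_iso g (marked_action g (marked_action g (rep c) \<alpha>) \<beta>) (rep (out_cell g c ?AB)) ?F"
    using M by simp
  have "((out_cell g c ?AB, face_inclusion (arcs (mgraph c)) (arcs (mgraph (out_cell g c ?AB))) ?F x),
      (out_cell g c ?AB, face_inclusion (arcs (mgraph c)) (arcs (mgraph (out_cell g c ?AB))) ?E x)) \<in> glue (teich_fan P g)"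
    using glue_marked_iso[OF c2 W'' F E] x by simp
  moreover have "out_map g (out_cell g c A) B (out_map g c A x) = face_inclusion (arcs (mgraph c)) (arcs (mgraph (out_cell g c ?AB))) ?F x"
  proof -
    obtain fV fV' where iso: "wgraph_iso (fst (rep c)) (fst (rep (out_cell g c A))) fV (out_edges g c A)"
      "wgraph_iso (fst (rep (out_cell g c A))) (fst (rep (out_cell g (out_cell g c A) B))) fV' (out_edges g (out_cell g c A) B)"
      using out_edges_wgraph[OF c A] out_edges_wgraph[OF c1 B] by blast
    then show ?thesis
      unfolding out_map_eq M(2)[symmetric] using wgraph_iso_bij[OF iso(1)] wgraph_iso_bij[OF iso(2)]
      by (intro face_inclusion_compose) (auto simp: bij_betw_def)
  qed
  ultimately show ?thesis unfolding out_map_eq by simp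
qed

lemma forget_map_step:
  assumes st: "((c, x), (d, y)) \<in> glue_step (teich_fan P g)"
  shows "((forget_cell g c, forget_map g c x), (forget_cell g d, forget_map g d y)) \<in> glue (moduli_fan P g)"
proof -
  obtain \<iota> where \<iota>: "c \<in> tcells P g" "x \<in> graph_cone P (mgraph c)" "d \<in> tcells P g" "y \<in> graph_cone P (mgraph d)"
    "contracts_to P g (rep d) (rep c) \<iota>" "y = face_inclusion (arcs (mgraph c)) (arcs (mgraph d)) \<iota> x"
    using st unfolding glue_step_teich_iff by blast
  note c = tcell_props[OF \<iota>(1)] and d = tcell_props[OF \<iota>(3)]
  note C = forget_cell(1)[OF \<iota>(1)] and D = forget_cell(1)[OF \<iota>(3)]
  obtain fV fV' where iso: "wgraph_iso (fst (rep c)) (wrep (forget_cell g c)) fV (forget_edges g c)"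
    "wgraph_iso (fst (rep d)) (wrep (forget_cell g d)) fV' (forget_edges g d)"
    using forget_cell(2)[OF \<iota>(1)] forget_cell(2)[OF \<iota>(3)] by blast
  let ?\<iota> = "forget_edges g d \<circ> \<iota> \<circ> inv_into (arcs (mgraph c)) (forget_edges g c)"
  note sp = contracts_to_wgraph[OF \<iota>(5) d(1) c(1)]
  have "wgraph_specializes (wrep (forget_cell g d)) (wrep (forget_cell g c)) ?\<iota>"
    using wgraph_specializes_transport[OF sp iso(2,1) d(3) c(3) mcell_props(1)[OF D] d(5)] .
  moreover have "forget_map g d y = face_inclusion (arcs (wgraph_of (forget_cell g c))) (arcs (wgraph_of (forget_cell g d)))
      ?\<iota> (forget_map g c x)"
    unfolding forget_map_def \<iota>(6)
    using wgraph_iso_bij[OF iso(1)] wgraph_iso_bij[OF iso(2)] wgraph_specializes_arcs[OF sp]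
    by (intro face_inclusion_transport[symmetric]) (auto simp: bij_betw_def)
  ultimately have "((forget_cell g c, forget_map g c x), (forget_cell g d, forget_map g d y)) \<in> glue_step (moduli_fan P g)"
    unfolding glue_step_moduli_iff
    using C D face_inclusion_in_cone[OF iso(1) c(3) mcell_props(1)[OF C] \<iota>(2)]
      face_inclusion_in_cone[OF iso(2) d(3) mcell_props(1)[OF D] \<iota>(4)]
    by (auto simp: forget_map_def)
  then show ?thesis using glue_step_subset by blast
qed

text \<open>The two ways down to the representative of the unmarked class differ by an automorphism
  of that weighted graph.\<close>

lemma forget_map_out:
  assumes c: "c \<in> tcells P g" and x: "x \<in> graph_cone P (mgraph c)" and A: "A \<in> carrier (OutF g)"
  shows "((forget_cell g c, forget_map g c x), (forget_cell g c, forget_map g (out_cell g c A) (out_map g c A x))) \<in> glue (moduli_fan P g)"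
proof -
  note c' = out_cell_closed[OF c A]
  note eq = forget_cell_out[OF c A]
  obtain fV fV' fV'' where iso: "wgraph_iso (fst (rep c)) (wrep (forget_cell g c)) fV (forget_edges g c)"
    "wgraph_iso (fst (rep c)) (fst (rep (out_cell g c A))) fV' (out_edges g c A)"
    "wgraph_iso (fst (rep (out_cell g c A))) (wrep (forget_cell g c)) fV'' (forget_edges g (out_cell g c A))"
    using forget_cell(2)[OF c] forget_cell(2)[OF c'] out_edges_wgraph[OF c A] eq by auto
  have "forget_map g (out_cell g c A) (out_map g c A x) =
      face_inclusion (arcs (mgraph c)) (arcs (wgraph_of (forget_cell g c))) (forget_edges g (out_cell g c A) \<circ> out_edges g c A) x"
    unfolding forget_map_def out_map_eq eq using wgraph_iso_bij[OF iso(2)] wgraph_iso_bij[OF iso(3)]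
    by (intro face_inclusion_compose) (auto simp: bij_betw_def)
  then show ?thesis
    using glue_wgraph_iso[OF forget_cell(1)[OF c] tcell_props(3)[OF c] iso(1) wgraph_iso_compose[OF iso(2,3)] x]
    by (simp add: forget_map_def)
qed

text \<open>The representative of \<open>d\<close>, contracted along the edges of the unmarked
  specialization, and the representative of \<open>c\<close> have isomorphic underlying graphs. So
  some outer automorphism matches their markings, and it does so over the prescribed inclusion of
  edges.\<close>

lemma moduli_step_lift:
  assumes c: "c \<in> tcells P g" and x: "x \<in> graph_cone P (mgraph c)" and d: "d \<in> tcells P g" and y: "y \<in> graph_cone P (mgraph d)"
    and st: "((forget_cell g c, forget_map g c x), (forget_cell g d, forget_map g d y)) \<in> glue_step (moduli_fan P g)"
  shows "\<exists>A\<in>carrier (OutF g). \<exists>L\<in>face_maps (teich_fan P g) (out_cell g c A) d. y = L (out_map g c A x)"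
proof -
  let ?C = "forget_cell g c" and ?D = "forget_cell g d"
  let ?Fc = "forget_edges g c" and ?Fd = "forget_edges g d"
  let ?Ac = "arcs (mgraph c)" and ?Ad = "arcs (mgraph d)"
  note cp = tcell_props[OF c] and dp = tcell_props[OF d]
  note C = mcell_props[OF forget_cell(1)[OF c]] and D = mcell_props[OF forget_cell(1)[OF d]]
  obtain \<iota> where \<iota>: "wgraph_specializes (wrep ?D) (wrep ?C) \<iota>"
    "forget_map g d y = face_inclusion (arcs (wgraph_of ?C)) (arcs (wgraph_of ?D)) \<iota> (forget_map g c x)"
    using st unfolding glue_step_moduli_iff by blast
  obtain fV fV' where iso: "wgraph_iso (fst (rep c)) (wrep ?C) fV ?Fc" "wgraph_iso (fst (rep d)) (wrep ?D) fV' ?Fd"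
    using forget_cell(2)[OF c] forget_cell(2)[OF d] by blast
  note bij = wgraph_iso_bij[OF iso(1)] wgraph_iso_bij[OF iso(2)]
  note inv = wgraph_iso_inverse[OF iso(1) cp(3)] wgraph_iso_inverse[OF iso(2) dp(3)]
  note bij' = wgraph_iso_bij[OF inv(1)] wgraph_iso_bij[OF inv(2)]
  \<comment> \<open>The inclusion \<open>\<iota>\<close> between the unmarked representatives,
    carried over to the graphs underlying the marked ones.\<close>
  let ?\<kappa> = "inv_into ?Ad ?Fd \<circ> \<iota> \<circ> inv_into (arcs (wgraph_of ?C)) (inv_into ?Ac ?Fc)"
  obtain h where h: "is_marking g (wrep ?D) h" using D(3) by blast
  have sp: "wgraph_specializes (fst (rep d)) (fst (rep c)) ?\<kappa>"
    using wgraph_specializes_transport[OF \<iota>(1) inv(2,1) D(1) C(1) dp(3) h] .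
  have "face_inclusion ?Ac ?Ad ?\<kappa> (face_inclusion (arcs (wgraph_of ?C)) ?Ac (inv_into ?Ac ?Fc) (forget_map g c x)) =
      face_inclusion (arcs (wgraph_of ?D)) ?Ad (inv_into ?Ad ?Fd)
        (face_inclusion (arcs (wgraph_of ?C)) (arcs (wgraph_of ?D)) \<iota> (forget_map g c x))"
    using bij' wgraph_specializes_arcs[OF \<iota>(1)] by (intro face_inclusion_transport) (auto simp: bij_betw_def)
  then have y\<kappa>: "y = face_inclusion ?Ac ?Ad ?\<kappa> x"
    unfolding \<iota>(2)[symmetric] unfolding forget_map_def
    using face_inclusion_inverse[OF bij(1) graph_cone_extensional[OF x]] face_inclusion_inverse[OF bij(2) graph_cone_extensional[OF y]]
    by simp
  obtain es fW where es: "distinct es" "set es \<subseteq> ?Ad" "wgraph_iso (fst (rep c)) (fold contract_edge es (fst (rep d))) fW ?\<kappa>"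
    using sp unfolding wgraph_specializes_def by blast
  let ?Z = "fold contract_marked es (rep d)"
  have Z: "well_marked g ?Z" using well_marked_fold_contract[OF dp(1) es(1,2)] .
  obtain \<alpha> where \<alpha>: "\<alpha> \<in> auto (Fg g)" "marked_iso g (marked_action g (rep c) \<alpha>) ?Z ?\<kappa>"
    using marked_action_transitive[OF cp(1) Z] es(3) unfolding fst_fold_contract_marked by blast
  obtain A where A: "A \<in> carrier (OutF g)" "\<alpha> \<in> A" using Out_coset[OF \<alpha>(1)] by blast
  note c' = out_cell(2)[OF c A]
  note W = well_marked_action[OF cp(1) \<alpha>(1)] tcell_props(1)[OF c']
  let ?E = "out_edges g c A"
  have "marked_iso g (rep (out_cell g c A)) ?Z (?\<kappa> \<circ> inv_into ?Ac ?E)"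
    using marked_iso_trans[OF W(2,1) Z marked_iso_sym[OF W out_edges[OF c A]] \<alpha>(2)] by simp
  \<comment> \<open>Unmarked specializations record no acyclicity; here it follows since the result
    of the contraction has weight zero.\<close>
  moreover have "\<not> contains_cycle (mgraph d) (set es)" if P
  proof (rule pure_contract_acyclic[OF dp(3) es(1,2)])
    have "pure_wgraph (fst (rep c))" using marked_cell(1)[OF c] that by (simp add: marked_class_def)
    then show "pure_wgraph (fold contract_edge es (fst (rep d)))" using pure_wgraph_iso[OF es(3)] by simp
  qed
  ultimately have "contracts_to P g (rep d) (rep (out_cell g c A)) (?\<kappa> \<circ> inv_into ?Ac ?E)"
    unfolding contracts_to_iff using es by blast
  then have L: "face_inclusion (arcs (mgraph (out_cell g c A))) ?Ad (?\<kappa> \<circ> inv_into ?Ac ?E) \<in> face_maps (teich_fan P g) (out_cell g c A) d"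
    by auto
  obtain fU where "wgraph_iso (fst (rep c)) (fst (rep (out_cell g c A))) fU ?E" using out_edges_wgraph[OF c A(1)] by blast
  note bE = wgraph_iso_bij[OF this]
  have "face_inclusion (arcs (mgraph (out_cell g c A))) ?Ad (id \<circ> ?\<kappa> \<circ> inv_into ?Ac ?E) (out_map g c A x) = face_inclusion ?Ad ?Ad id (face_inclusion ?Ac ?Ad ?\<kappa> x)"
    unfolding out_map_eq using bE wgraph_specializes_arcs[OF sp] by (intro face_inclusion_transport) auto
  also have "\<dots> = y" unfolding y\<kappa>[symmetric] using face_inclusion_id[OF graph_cone_extensional[OF y]] .
  finally have "y = face_inclusion (arcs (mgraph (out_cell g c A))) ?Ad (?\<kappa> \<circ> inv_into ?Ac ?E) (out_map g c A x)" by simp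
  then show ?thesis using A(1) L by blast
qed

lemma graph_cone_subset: "graph_cone P G \<subseteq> arcs G \<rightarrow>\<^sub>E UNIV"
  by (auto simp: graph_cone_iff PiE_def)

theorem teich_fan_projection:
  "fan_projection (teich_fan P g) (OutF g) (out_cell g) (out_map g) (moduli_fan P g) (forget_cell g) (forget_map g)"
proof (intro fan_projection.intro fan_action.intro fan_projection_axioms.intro)
  show "finite_fan (teich_fan P g)" "finite_fan (moduli_fan P g)"
    using tcell_props(4) mcell_props(2) graph_cone_subset by (auto simp: finite_fan_def)
  fix c and A assume c: "c \<in> cells (teich_fan P g)"
  then have c: "c \<in> tcells P g" by simp
  note cp = tcell_props[OF c]
  note C = forget_cell(1)[OF c]
  obtain fW where f: "wgraph_iso (fst (rep c)) (wrep (forget_cell g c)) fW (forget_edges g c)" using forget_cell(2)[OF c] by blast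
  show "out_cell g c \<one>\<^bsub>OutF g\<^esub> = c" using out_cell_one[OF c] .
  show "forget_cell g c \<in> cells (moduli_fan P g)" using C by simp
  show "lattice_iso (coords (teich_fan P g) c) (coords (moduli_fan P g) (forget_cell g c)) (forget_map g c)"
    using lattice_iso_face_inclusion[OF wgraph_iso_bij[OF f] cp(4)] by (simp add: forget_map_def)
  show "bij_betw (forget_map g c) (cell_cone (teich_fan P g) c) (cell_cone (moduli_fan P g) (forget_cell g c))"
    using face_inclusion_cone_bij[OF f cp(3) mcell_props(1)[OF C]] by (simp add: forget_map_def)
  show "((c, out_map g c \<one>\<^bsub>OutF g\<^esub> x), (c, x)) \<in> glue (teich_fan P g)" if "x \<in> cell_cone (teich_fan P g) c" for x
    using out_map_one[OF c] that by simp
  show "d \<in> out_cell g c ` carrier (OutF g)" if "d \<in> cells (teich_fan P g)" "forget_cell g c = forget_cell g d" for d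
    using forget_cell_orbit[OF c _ that(2)] that(1) by simp
  assume A: "A \<in> carrier (OutF g)"
  note c' = out_cell_closed[OF c A]
  obtain fV where e: "wgraph_iso (fst (rep c)) (fst (rep (out_cell g c A))) fV (out_edges g c A)" using out_edges_wgraph[OF c A] by blast
  show "out_cell g c A \<in> cells (teich_fan P g)" using c' by simp
  show "lattice_iso (coords (teich_fan P g) c) (coords (teich_fan P g) (out_cell g c A)) (out_map g c A)"
    using lattice_iso_face_inclusion[OF wgraph_iso_bij[OF e] cp(4)] by (simp add: out_map_eq)
  show "bij_betw (out_map g c A) (cell_cone (teich_fan P g) c) (cell_cone (teich_fan P g) (out_cell g c A))"
    using face_inclusion_cone_bij[OF e cp(3) tcell_props(3)[OF c']] by (simp add: out_map_eq)
  show "forget_cell g (out_cell g c A) = forget_cell g c" using forget_cell_out[OF c A] .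
  show "((forget_cell g c, forget_map g c x), (forget_cell g c, forget_map g (out_cell g c A) (out_map g c A x))) \<in> glue (moduli_fan P g)"
    if "x \<in> cell_cone (teich_fan P g) c" for x
    using forget_map_out[OF c _ A] that by simp
  fix B assume B: "B \<in> carrier (OutF g)"
  obtain \<alpha> \<beta> where "\<alpha> \<in> A" "\<beta> \<in> B" using group.Out_nonempty[OF group_Fg] A B by metis
  then show "out_cell g (out_cell g c A) B = out_cell g c (A \<otimes>\<^bsub>OutF g\<^esub> B)" using out_action_mult(2)[OF c A _ B] by blast
  show "((out_cell g c (A \<otimes>\<^bsub>OutF g\<^esub> B), out_map g (out_cell g c A) B (out_map g c A x)),
     (out_cell g c (A \<otimes>\<^bsub>OutF g\<^esub> B), out_map g c (A \<otimes>\<^bsub>OutF g\<^esub> B) x)) \<in> glue (teich_fan P g)"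
    if "x \<in> cell_cone (teich_fan P g) c" for x
    using out_map_mult[OF c _ A B] that by simp
next
  show "group (OutF g)" using group.group_Out[OF group_Fg] .
  show "\<exists>i\<in>cells (teich_fan P g). forget_cell g i = C" if "C \<in> cells (moduli_fan P g)" for C
    using forget_cell_surj that by simp
  show "(p, p) \<in> glue_step (moduli_fan P g)" if "p \<in> cone_points (moduli_fan P g)" for p
  proof (cases p)
    case (Pair C u)
    then have C: "C \<in> mcells P g" "u \<in> graph_cone P (wgraph_of C)" using that by (auto simp: cone_points_def)
    then show ?thesis
      unfolding Pair glue_step_moduli_iff
      using wgraph_specializes_iso[OF wgraph_iso_id] face_inclusion_id[OF graph_cone_extensional[OF C(2)]]
      by (intro conjI exI[of _ id]) auto
  qed
next
  fix c x d y
  assume "c \<in> cells (teich_fan P g)" "x \<in> cell_cone (teich_fan P g) c" "d \<in> cells (teich_fan P g)" "y \<in> cell_cone (teich_fan P g) d"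
    and st: "((forget_cell g c, forget_map g c x), (forget_cell g d, forget_map g d y)) \<in> glue_step (moduli_fan P g)"
  then show "\<exists>A\<in>carrier (OutF g). \<exists>L\<in>face_maps (teich_fan P g) (out_cell g c A) d. y = L (out_map g c A x)"
    by (intro moduli_step_lift) simp_all
qed (simp_all add: out_map_step forget_map_step)

text \<open>\<open>forget_marking\<close> admits every isomorphism to the representative of the
  unmarked class while \<open>forget_map\<close> uses a chosen one, and the two values are glued by
  an automorphism.\<close>

lemma forget_marking_glue:
  assumes c: "c \<in> tcells P g" and x: "x \<in> graph_cone P (mgraph c)" and q: "forget_marking g (c, x) q"
  shows "((forget_cell g c, forget_map g c x), q) \<in> glue (moduli_fan P g)"
proof -
  have q1: "fst q = forget_cell g c" using q by (simp add: forget_marking_def forget_cell_def)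
  obtain fV fE where E: "wgraph_iso (fst (rep c)) (wrep (forget_cell g c)) fV fE"
    "snd q = face_inclusion (arcs (mgraph c)) (arcs (wgraph_of (forget_cell g c))) fE x"
    using q unfolding forget_marking_def q1 by auto
  obtain fW where f: "wgraph_iso (fst (rep c)) (wrep (forget_cell g c)) fW (forget_edges g c)" using forget_cell(2)[OF c] by blast
  show ?thesis
    using glue_wgraph_iso[OF forget_cell(1)[OF c] tcell_props(3)[OF c] f E(1) x] q1 E(2)
    by (cases q) (simp add: forget_map_def)
qed

theorem teich_fan_quotients:
  "is_stratified_quotient (moduli_fan P g) (teich_fan P g) (Out (Fg g)) (out_cell g) (out_map g) (forget_marking g)"
  "is_global_quotient (moduli_fan P g) (teich_fan P g) (Out (Fg g)) (out_cell g) (out_map g) (forget_marking g)"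
proof -
  have "((forget_cell g i, forget_map g i x), q) \<in> glue (moduli_fan P g)"
    if "i \<in> cells (teich_fan P g)" "x \<in> cell_cone (teich_fan P g) i" "forget_marking g (i, x) q" for i x q
    using forget_marking_glue that by simp
  then show "is_stratified_quotient (moduli_fan P g) (teich_fan P g) (Out (Fg g)) (out_cell g) (out_map g) (forget_marking g)"
    "is_global_quotient (moduli_fan P g) (teich_fan P g) (Out (Fg g)) (out_cell g) (out_map g) (forget_marking g)"
    using fan_projection.stratified[OF teich_fan_projection] fan_projection.global[OF teich_fan_projection] by blast+
qed

theorem proposition4p0p8:
  fixes g :: nat
  shows "is_stratified_quotient (pure_moduli g) (pure_teichmueller g) (Out (Fg g))
           (out_cell g) (out_map g) (forget_marking g)
       \<and> is_global_quotient (pure_moduli g) (pure_teichmueller g) (Out (Fg g))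
           (out_cell g) (out_map g) (forget_marking g)
       \<and> is_stratified_quotient (moduli g) (teichmueller g) (Out (Fg g))
           (out_cell g) (out_map g) (forget_marking g)
       \<and> is_global_quotient (moduli g) (teichmueller g) (Out (Fg g))
           (out_cell g) (out_map g) (forget_marking g)"
  using teich_fan_quotients[of True g] teich_fan_quotients[of False g] unfolding teich_fan_eq moduli_fan_eq by blast

end
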